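(* Let $G$ be an abelian group, and let $\mathcal{D}$ be a real algebra isomorphic to $M_n(\mathbb{R})$ (respectively $M_n(\mathbb{H})$). If there is a division $G$-grading $\Gamma$ on $\mathcal{D}$ with homogeneous components of dimension $2$, then $n=2^m$ for some integer $m\ge1$ (respectively $m\ge0$) and the support of $\Gamma$ is a subgroup $T$ of $G$ isomorphic to $\mathbb{Z}_2^{2m-1}$ (respectively $\mathbb{Z}_2^{2m+1}$). The isomorphism classes of such gradings are in one-to-one correspondence with the triples $(T,K,\nu)$ formed by a subgroup $T$ of $G$ isomorphic to $\mathbb{Z}_2^{2m-1}$ (respectively $\mathbb{Z}_2^{2m+1}$), an index $2$ subgroup $K$ of $T$, and a positive (respectively negative) nice map $\nu$ on $T\setminus K$ of type I. All such gradings belong to one equivalence class, represented by the product grading on $M_2(\mathbb{R})\otimes M_2(\mathbb{R})\otimes\cdots\otimes M_2(\mathbb{R})\cong M_n(\mathbb{R})$ ($m$ factors; grading group $\mathbb{Z}_2\times(\mathbb{Z}_2^2)^{m-1}$) (respectively on $\mathbb{H}\otimes M_2(\mathbb{R})\otimes\cdots\otimes M_2(\mathbb{R})\cong M_n(\mathbb{H})$, with $m$ factors $M_2(\mathbb{R})$; grading group $\mathbb{Z}_2\times(\mathbb{Z}_2^2)^m$), where the first factor carries the $\mathbb{Z}_2$-grading with two-dimensional components and the remaining factors carry the $\mathbb{Z}_2^2$-grading with one-dimensional components described in the context.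
   Context: Algebras are associative; dimensions and tensor products are over $\mathbb{R}$. A $G$-grading on an algebra $\mathcal{D}$ is a decomposition $\mathcal{D}=\bigoplus_{g\in G}\mathcal{D}_g$ into subspaces with $\mathcal{D}_g\mathcal{D}_h\subseteq\mathcal{D}_{gh}$. Its support is $\{g\in G\mid \mathcal{D}_g\ne0\}$. The grading is a division grading if $\mathcal{D}$ is unital and every nonzero homogeneous element is invertible; the support is then a subgroup and all nonzero homogeneous components have the same dimension ("homogeneous components of dimension $d$" refers to the nonzero ones). Two $G$-gradings, on $\mathcal{D}$ and $\mathcal{D}'$, are isomorphic if there is an algebra isomorphism $\varphi:\mathcal{D}\to\mathcal{D}'$ with $\varphi(\mathcal{D}_g)=\mathcal{D}'_g$ for all $g\in G$. A $G$-grading $\Gamma$ on $\mathcal{D}$ and an $H$-grading $\Gamma'$ on $\mathcal{D}'$ are equivalent if there are an algebra isomorphism $\varphi:\mathcal{D}\to\mathcal{D}'$ and a bijection $\alpha:\mathrm{supp}(\Gamma)\to\mathrm{supp}(\Gamma')$ with $\varphi(\mathcal{D}_t)=\mathcal{D}'_{\alpha(t)}$ for all $t\in\mathrm{supp}(\Gamma)$. Product grading: if $\mathcal{D}$ is $G$-graded and $\mathcal{D}'$ is $H$-graded, $\mathcal{D}\otimes\mathcal{D}'$ is $G\times H$-graded by $(\mathcal{D}\otimes\mathcal{D}')_{(g,h)}=\mathcal{D}_g\otimes\mathcal{D}'_h$. Quadratic forms (multiplicative notation, $e$ the neutral element): for an elementary abelian $2$-group $K$, a quadratic form is a map $\mu:K\to\{\pm1\}$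 with $\mu(e)=+1$ such that $\beta(u,v):=\mu(uv)\mu(u)^{-1}\mu(v)^{-1}$ is multiplicative in each variable; $\beta$ is its associated alternating bicharacter. It has type I if $\mathrm{rad}(\beta)=\{t\in K\mid\beta(u,t)=+1\ \forall u\in K\}=\{e\}$. Arf invariant: if $\mu$ has type I on a finite $K$, there is an $\mathbb{F}_2$-basis $\{a_1,b_1,\dots,a_r,b_r\}$ of $K$ with $\beta(a_i,b_i)=\beta(b_i,a_i)=-1$ and all other $\beta$-products of basis elements $+1$. Let $q(+1,+1)=q(+1,-1)=q(-1,+1)=+1$, $q(-1,-1)=-1$. Then $\mathrm{Arf}(\mu)=\prod_{i=1}^r q(\mu(a_i),\mu(b_i))$, independent of the basis (and $+1$ if $K$ is trivial). Nice maps: let $T$ be a finite abelian group, $K$ an index $2$ subgroup that is an elementary abelian $2$-group, and $\nu:T\setminus K\to\{\pm1\}$ a map. For $g\in T\setminus K$ let $\mu_g:K\to\{\pm1\}$, $\mu_g(k):=\nu(gk)\nu(g)^{-1}$. The map $\nu$ is a nice map if the $\mu_g$ are quadratic forms (if one is, all are, with the same associated alternating bicharacter). It has type I if the $\mu_g$ have type I; in that case $\nu(g)\cdot\mathrm{Arf}(\mu_g)$ does not depend on $g\in T\setminus K$, and $\nu$ is called positive or negative if this value is $+1$ or $-1$, respectively. Gradings of the factors. One-dimensional components, group $\mathbb{Z}_2^2$: $$M_2(\mathbb{R})=\mathbb{R}\begin{pmatrix}1&0\\0&1\end{pmatrix}\oplus\mathbb{R}\begin{pmatrix}0&1\\1&0\end{pmatrix}\oplus\mathbb{R}\begin{pmatrix}-1&0\\0&1\end{pmatrix}\oplus\mathbb{R}\begin{pmatrix}0&-1\\1&0\end{pmatrix},$$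 with degrees $(\bar0,\bar0),(\bar1,\bar0),(\bar0,\bar1),(\bar1,\bar1)$ respectively. Two-dimensional components, group $\mathbb{Z}_2$ (degree $\bar0$ bracket first, degree $\bar1$ bracket second): $\mathbb{H}=[\mathbb{R}1\oplus\mathbb{R}i]\oplus[\mathbb{R}j\oplus\mathbb{R}k]$ and $$M_2(\mathbb{R})=\left[\mathbb{R}\begin{pmatrix}1&0\\0&1\end{pmatrix}\oplus\mathbb{R}\begin{pmatrix}0&-1\\1&0\end{pmatrix}\right]\oplus\left[\mathbb{R}\begin{pmatrix}0&1\\1&0\end{pmatrix}\oplus\mathbb{R}\begin{pmatrix}-1&0\\0&1\end{pmatrix}\right].$$ *)

theory Defs
  imports
    "HOL-Analysis.Analysis"
    "HOL-Library.Function_Algebras"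
    "HOL-Algebra.FiniteProduct"
    "HOL-Algebra.Product_Groups"
begin

section \<open>Real algebras\<close>

text \<open>
  A real algebra is a \<open>monoid\<close> record over a type of class \<^class>\<open>real_vector\<close>: addition and
  scaling are those of the type, the carrier is a subspace, and the record supplies the product
  and the unit.  Working with carriers is needed because the dimension of the iterated tensor
  products below varies with a natural number.
\<close>

definition linear_map_on :: "'a::real_vector set \<Rightarrow> ('a \<Rightarrow> 'b::real_vector) \<Rightarrow> bool" where
  "linear_map_on V f \<longleftrightarrow>
     (\<forall>x\<in>V. \<forall>y\<in>V. f (x + y) = f x + f y) \<and> (\<forall>r. \<forall>x\<in>V. f (r *\<^sub>R x) = r *\<^sub>R f x)"

definition is_real_algebra :: "'a::real_vector monoid \<Rightarrow> bool" where
  "is_real_algebra A \<longleftrightarrow> monoid A \<and> subspace (carrier A) \<and>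
     (\<forall>x\<in>carrier A. linear_map_on (carrier A) (\<lambda>y. x \<otimes>\<^bsub>A\<^esub> y) \<and>
                     linear_map_on (carrier A) (\<lambda>y. y \<otimes>\<^bsub>A\<^esub> x))"

definition alg_isos :: "'a::real_vector monoid \<Rightarrow> 'b::real_vector monoid \<Rightarrow> ('a \<Rightarrow> 'b) set" where
  "alg_isos A B = {\<phi> \<in> iso A B. linear_map_on (carrier A) \<phi>}"

definition alg_isomorphic :: "'a::real_vector monoid \<Rightarrow> 'b::real_vector monoid \<Rightarrow> bool" where
  "alg_isomorphic A B \<longleftrightarrow> alg_isos A B \<noteq> {}"

definition matrix_algebra :: "('k::real_algebra_1 ^ 'n ^ 'n) monoid" where
  "matrix_algebra = \<lparr>carrier = UNIV, monoid.mult = (**), one = mat 1\<rparr>"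


section \<open>Quaternions\<close>

datatype quat = Quat (qRe: real) (qI: real) (qJ: real) (qK: real)

instantiation quat :: real_algebra_1
begin

definition "0 = Quat 0 0 0 0"
definition "1 = Quat 1 0 0 0"
definition "x + y = Quat (qRe x + qRe y) (qI x + qI y) (qJ x + qJ y) (qK x + qK y)"
definition "- x = Quat (- qRe x) (- qI x) (- qJ x) (- qK x)"
definition "x - y = Quat (qRe x - qRe y) (qI x - qI y) (qJ x - qJ y) (qK x - qK y)"
definition "r *\<^sub>R x = Quat (r * qRe x) (r * qI x) (r * qJ x) (r * qK x)"
definition "x * y = Quat
  (qRe x * qRe y - qI x * qI y - qJ x * qJ y - qK x * qK y)
  (qRe x * qI y + qI x * qRe y + qJ x * qK y - qK x * qJ y)
  (qRe x * qJ y - qI x * qK y + qJ x * qRe y + qK x * qI y)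
  (qRe x * qK y + qI x * qJ y - qJ x * qI y + qK x * qRe y)"

instance
  by standard
    (simp_all add: zero_quat_def one_quat_def plus_quat_def uminus_quat_def minus_quat_def
      scaleR_quat_def times_quat_def algebra_simps)

end

definition quat_algebra :: "quat monoid" where
  "quat_algebra = \<lparr>carrier = UNIV, monoid.mult = (*), one = 1\<rparr>"


section \<open>Gradings\<close>

text \<open>
  A \<open>G\<close>-grading is given by its family of components; values outside \<^term>\<open>carrier G\<close> are
  irrelevant.  Directness of the sum is the condition that every component meets the span of the
  other ones only in \<open>0\<close>.
\<close>

definition is_grading ::
  "('g, 'e) monoid_scheme \<Rightarrow> 'a::real_vector monoid \<Rightarrow> ('g \<Rightarrow> 'a set) \<Rightarrow> bool" where
  "is_grading G D \<Gamma> \<longleftrightarrow>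
     is_real_algebra D \<and>
     (\<forall>g\<in>carrier G. subspace (\<Gamma> g) \<and> \<Gamma> g \<subseteq> carrier D) \<and>
     carrier D = span (\<Union>g\<in>carrier G. \<Gamma> g) \<and>
     (\<forall>g\<in>carrier G. \<Gamma> g \<inter> span (\<Union>h\<in>carrier G - {g}. \<Gamma> h) = {0}) \<and>
     (\<forall>g\<in>carrier G. \<forall>h\<in>carrier G. \<forall>x\<in>\<Gamma> g. \<forall>y\<in>\<Gamma> h. x \<otimes>\<^bsub>D\<^esub> y \<in> \<Gamma> (g \<otimes>\<^bsub>G\<^esub> h))"

definition grading_support ::
  "('g, 'e) monoid_scheme \<Rightarrow> ('g \<Rightarrow> 'a::real_vector set) \<Rightarrow> 'g set" where
  "grading_support G \<Gamma> = {g \<in> carrier G. \<Gamma> g \<noteq> {0}}"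

definition is_division_grading ::
  "('g, 'e) monoid_scheme \<Rightarrow> 'a::real_vector monoid \<Rightarrow> ('g \<Rightarrow> 'a set) \<Rightarrow> bool" where
  "is_division_grading G D \<Gamma> \<longleftrightarrow>
     is_grading G D \<Gamma> \<and> (\<forall>g\<in>carrier G. \<forall>x\<in>\<Gamma> g. x \<noteq> 0 \<longrightarrow> x \<in> Units D)"

definition dim2_division_gradings ::
  "('g, 'e) monoid_scheme \<Rightarrow> 'a::real_vector monoid \<Rightarrow> ('g \<Rightarrow> 'a set) set" where
  "dim2_division_gradings G D =
     {\<Gamma>. is_division_grading G D \<Gamma> \<and> (\<forall>t\<in>grading_support G \<Gamma>. dim (\<Gamma> t) = 2)}"

definition isomorphic_gradings ::
  "('g, 'e) monoid_scheme \<Rightarrow> 'a::real_vector monoid \<Rightarrow> ('g \<Rightarrow> 'a set) \<Rightarrow>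
   'b::real_vector monoid \<Rightarrow> ('g \<Rightarrow> 'b set) \<Rightarrow> bool" where
  "isomorphic_gradings G D \<Gamma> D' \<Gamma>' \<longleftrightarrow>
     (\<exists>\<phi>\<in>alg_isos D D'. \<forall>g\<in>carrier G. \<phi> ` \<Gamma> g = \<Gamma>' g)"

definition equivalent_gradings ::
  "('g, 'e) monoid_scheme \<Rightarrow> 'a::real_vector monoid \<Rightarrow> ('g \<Rightarrow> 'a set) \<Rightarrow>
   ('h, 'f) monoid_scheme \<Rightarrow> 'b::real_vector monoid \<Rightarrow> ('h \<Rightarrow> 'b set) \<Rightarrow> bool" where
  "equivalent_gradings G D \<Gamma> H D' \<Gamma>' \<longleftrightarrow>
     (\<exists>\<phi>\<in>alg_isos D D'. \<exists>\<alpha>. bij_betw \<alpha> (grading_support G \<Gamma>) (grading_support H \<Gamma>') \<and>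
        (\<forall>t\<in>grading_support G \<Gamma>. \<phi> ` \<Gamma> t = \<Gamma>' (\<alpha> t)))"

definition dim2_iso_rel ::
  "('g, 'e) monoid_scheme \<Rightarrow> 'a::real_vector monoid \<Rightarrow> (('g \<Rightarrow> 'a set) \<times> ('g \<Rightarrow> 'a set)) set" where
  "dim2_iso_rel G D =
     {(\<Gamma>, \<Gamma>'). \<Gamma> \<in> dim2_division_gradings G D \<and> \<Gamma>' \<in> dim2_division_gradings G D \<and>
               isomorphic_gradings G D \<Gamma> D \<Gamma>'}"

definition dim2_iso_classes ::
  "('g, 'e) monoid_scheme \<Rightarrow> 'a::real_vector monoid \<Rightarrow> ('g \<Rightarrow> 'a set) set set" where
  "dim2_iso_classes G D = dim2_division_gradings G D // dim2_iso_rel G D"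


section \<open>Quadratic forms and nice maps\<close>

text \<open>Signs are integers \<open>\<plusminus>1\<close>.  Each sign is its own inverse, so inverses of signs are omitted.\<close>

definition elementary_abelian_2_group :: "('g, 'e) monoid_scheme \<Rightarrow> bool" where
  "elementary_abelian_2_group K \<longleftrightarrow> comm_group K \<and> (\<forall>x\<in>carrier K. x \<otimes>\<^bsub>K\<^esub> x = \<one>\<^bsub>K\<^esub>)"

definition assoc_bichar :: "('g, 'e) monoid_scheme \<Rightarrow> ('g \<Rightarrow> int) \<Rightarrow> 'g \<Rightarrow> 'g \<Rightarrow> int" where
  "assoc_bichar K \<mu> u v = \<mu> (u \<otimes>\<^bsub>K\<^esub> v) * \<mu> u * \<mu> v"

definition quadratic_form :: "('g, 'e) monoid_scheme \<Rightarrow> ('g \<Rightarrow> int) \<Rightarrow> bool" where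
  "quadratic_form K \<mu> \<longleftrightarrow>
     elementary_abelian_2_group K \<and> \<mu> \<in> carrier K \<rightarrow> {1, -1} \<and> \<mu> \<one>\<^bsub>K\<^esub> = 1 \<and>
     (\<forall>u\<in>carrier K. \<forall>v\<in>carrier K. \<forall>w\<in>carrier K.
        assoc_bichar K \<mu> (u \<otimes>\<^bsub>K\<^esub> v) w = assoc_bichar K \<mu> u w * assoc_bichar K \<mu> v w \<and>
        assoc_bichar K \<mu> w (u \<otimes>\<^bsub>K\<^esub> v) = assoc_bichar K \<mu> w u * assoc_bichar K \<mu> w v)"

definition quadratic_form_type_I :: "('g, 'e) monoid_scheme \<Rightarrow> ('g \<Rightarrow> int) \<Rightarrow> bool" where
  "quadratic_form_type_I K \<mu> \<longleftrightarrow> quadratic_form K \<mu> \<and>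
     {t \<in> carrier K. \<forall>u\<in>carrier K. assoc_bichar K \<mu> u t = 1} = {\<one>\<^bsub>K\<^esub>}"

text \<open>
  The first two conditions say that \<open>a 0, b 0, \<dots>, a (r - 1), b (r - 1)\<close> is an
  \<open>\<bbbF>\<^sub>2\<close>-basis: every element of \<open>K\<close> is uniquely a product of a subfamily.
\<close>

definition symplectic_basis ::
  "('g, 'e) monoid_scheme \<Rightarrow> ('g \<Rightarrow> int) \<Rightarrow> nat \<Rightarrow> (nat \<Rightarrow> 'g) \<Rightarrow> (nat \<Rightarrow> 'g) \<Rightarrow> bool" where
  "symplectic_basis K \<mu> r a b \<longleftrightarrow>
     (\<forall>i<r. a i \<in> carrier K \<and> b i \<in> carrier K) \<and>
     bij_betw (\<lambda>(S, S'). finprod K a S \<otimes>\<^bsub>K\<^esub> finprod K b S')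
       (Pow {..<r} \<times> Pow {..<r}) (carrier K) \<and>
     (\<forall>i<r. \<forall>j<r.
        assoc_bichar K \<mu> (a i) (b j) = (if i = j then -1 else 1) \<and>
        assoc_bichar K \<mu> (b i) (a j) = (if i = j then -1 else 1) \<and>
        assoc_bichar K \<mu> (a i) (a j) = 1 \<and> assoc_bichar K \<mu> (b i) (b j) = 1)"

definition arf_q :: "int \<Rightarrow> int \<Rightarrow> int" where
  "arf_q x y = (if x = -1 \<and> y = -1 then -1 else 1)"

definition Arf :: "('g, 'e) monoid_scheme \<Rightarrow> ('g \<Rightarrow> int) \<Rightarrow> int" where
  "Arf K \<mu> = (THE s. \<exists>r a b. symplectic_basis K \<mu> r a b \<and> s = (\<Prod>i<r. arf_q (\<mu> (a i)) (\<mu> (b i))))"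

definition index_2_subgroup :: "'g set \<Rightarrow> ('g, 'e) monoid_scheme \<Rightarrow> bool" where
  "index_2_subgroup K T \<longleftrightarrow> subgroup K T \<and> card (rcosets\<^bsub>T\<^esub> K) = 2"

definition nice_mu :: "('g, 'e) monoid_scheme \<Rightarrow> ('g \<Rightarrow> int) \<Rightarrow> 'g \<Rightarrow> 'g \<Rightarrow> int" where
  "nice_mu T \<nu> g k = \<nu> (g \<otimes>\<^bsub>T\<^esub> k) * \<nu> g"

text \<open>
  The extensional function space makes a map on \<open>T \<setminus> K\<close> determined by its values there.
\<close>

definition nice_map :: "('g, 'e) monoid_scheme \<Rightarrow> 'g set \<Rightarrow> ('g \<Rightarrow> int) \<Rightarrow> bool" where
  "nice_map T K \<nu> \<longleftrightarrow>
     comm_group T \<and> finite (carrier T) \<and> index_2_subgroup K T \<and>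
     elementary_abelian_2_group (T\<lparr>carrier := K\<rparr>) \<and>
     \<nu> \<in> (carrier T - K) \<rightarrow>\<^sub>E {1, -1} \<and>
     (\<forall>g\<in>carrier T - K. quadratic_form (T\<lparr>carrier := K\<rparr>) (nice_mu T \<nu> g))"

definition nice_map_type_I :: "('g, 'e) monoid_scheme \<Rightarrow> 'g set \<Rightarrow> ('g \<Rightarrow> int) \<Rightarrow> bool" where
  "nice_map_type_I T K \<nu> \<longleftrightarrow> nice_map T K \<nu> \<and>
     (\<forall>g\<in>carrier T - K. quadratic_form_type_I (T\<lparr>carrier := K\<rparr>) (nice_mu T \<nu> g))"

definition positive_nice_map :: "('g, 'e) monoid_scheme \<Rightarrow> 'g set \<Rightarrow> ('g \<Rightarrow> int) \<Rightarrow> bool" where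
  "positive_nice_map T K \<nu> \<longleftrightarrow> nice_map_type_I T K \<nu> \<and>
     (\<forall>g\<in>carrier T - K. \<nu> g * Arf (T\<lparr>carrier := K\<rparr>) (nice_mu T \<nu> g) = 1)"

definition negative_nice_map :: "('g, 'e) monoid_scheme \<Rightarrow> 'g set \<Rightarrow> ('g \<Rightarrow> int) \<Rightarrow> bool" where
  "negative_nice_map T K \<nu> \<longleftrightarrow> nice_map_type_I T K \<nu> \<and>
     (\<forall>g\<in>carrier T - K. \<nu> g * Arf (T\<lparr>carrier := K\<rparr>) (nice_mu T \<nu> g) = -1)"


section \<open>The classifying triples\<close>

definition Z2_power :: "nat \<Rightarrow> (nat \<Rightarrow> int) monoid" where
  "Z2_power k = product_group {..<k} (\<lambda>_. integer_mod_group 2)"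

definition positive_triples ::
  "('g, 'e) monoid_scheme \<Rightarrow> nat \<Rightarrow> ('g set \<times> 'g set \<times> ('g \<Rightarrow> int)) set" where
  "positive_triples G k = {(T, K, \<nu>).
     subgroup T G \<and> G\<lparr>carrier := T\<rparr> \<cong> Z2_power k \<and>
     index_2_subgroup K (G\<lparr>carrier := T\<rparr>) \<and> positive_nice_map (G\<lparr>carrier := T\<rparr>) K \<nu>}"

definition negative_triples ::
  "('g, 'e) monoid_scheme \<Rightarrow> nat \<Rightarrow> ('g set \<times> 'g set \<times> ('g \<Rightarrow> int)) set" where
  "negative_triples G k = {(T, K, \<nu>).
     subgroup T G \<and> G\<lparr>carrier := T\<rparr> \<cong> Z2_power k \<and>
     index_2_subgroup K (G\<lparr>carrier := T\<rparr>) \<and> negative_nice_map (G\<lparr>carrier := T\<rparr>) K \<nu>}"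

text \<open>
  How a triple is read off a grading: \<open>T\<close> is the support, \<open>K\<close> is the support of the
  centralizer of the neutral component, and \<open>\<nu> t\<close> is the sign of the squares of the nonzero
  elements of degree \<open>t\<close>, which are real multiples of \<open>1\<close> for \<open>t \<in> T \<setminus> K\<close>.
\<close>

definition triple_of_grading ::
  "('g, 'e) monoid_scheme \<Rightarrow> 'a::real_vector monoid \<Rightarrow> ('g \<Rightarrow> 'a set) \<Rightarrow>
   'g set \<times> 'g set \<times> ('g \<Rightarrow> int) \<Rightarrow> bool" where
  "triple_of_grading G D \<Gamma> = (\<lambda>(T, K, \<nu>).
     T = grading_support G \<Gamma> \<and>
     K = {t \<in> T. \<forall>x\<in>\<Gamma> t. \<forall>y\<in>\<Gamma> \<one>\<^bsub>G\<^esub>. x \<otimes>\<^bsub>D\<^esub> y = y \<otimes>\<^bsub>D\<^esub> x} \<and>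
     (\<forall>t\<in>T - K. \<forall>x\<in>\<Gamma> t. x \<noteq> 0 \<longrightarrow>
        (\<exists>r>0. x \<otimes>\<^bsub>D\<^esub> x = (r * real_of_int (\<nu> t)) *\<^sub>R \<one>\<^bsub>D\<^esub>)))"


section \<open>Tensor products of algebras\<close>

instantiation "fun" :: (type, real_vector) real_vector
begin

definition "r *\<^sub>R f = (\<lambda>x. r *\<^sub>R f x)"

instance
  by standard (simp_all add: fun_eq_iff scaleR_fun_def scaleR_add_right scaleR_add_left)

end

text \<open>
  Over a field, the tensor product of \<open>V\<close> and \<open>W\<close> embeds into the dual of the space of bilinear
  forms on \<open>V \<times> W\<close>, the pure tensor of \<open>v\<close> and \<open>w\<close> being evaluation at \<open>(v, w)\<close>.  Hence it is
  the span of the pure tensors among such functionals (extended by \<open>0\<close> to functions that are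
  not bilinear forms).  In the product of \<open>s = \<Sum>\<^sub>i v\<^sub>i \<otimes> w\<^sub>i\<close> and \<open>t = \<Sum>\<^sub>j v'\<^sub>j \<otimes> w'\<^sub>j\<close>, evaluating
  \<open>t\<close> and then \<open>s\<close> gives \<open>f \<mapsto> \<Sum>\<^sub>i \<Sum>\<^sub>j f (v\<^sub>i v'\<^sub>j) (w\<^sub>i w'\<^sub>j)\<close>.
\<close>

definition bilinear_form_on ::
  "'a::real_vector set \<Rightarrow> 'b::real_vector set \<Rightarrow> ('a \<Rightarrow> 'b \<Rightarrow> real) \<Rightarrow> bool" where
  "bilinear_form_on V W f \<longleftrightarrow>
     (\<forall>v\<in>V. linear_map_on W (\<lambda>w. f v w)) \<and> (\<forall>w\<in>W. linear_map_on V (\<lambda>v. f v w))"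

definition pure_tensor ::
  "'a::real_vector set \<Rightarrow> 'b::real_vector set \<Rightarrow> 'a \<Rightarrow> 'b \<Rightarrow> ('a \<Rightarrow> 'b \<Rightarrow> real) \<Rightarrow> real" where
  "pure_tensor V W v w = (\<lambda>f. if bilinear_form_on V W f then f v w else 0)"

definition tensor_algebra ::
  "'a::real_vector monoid \<Rightarrow> 'b::real_vector monoid \<Rightarrow> (('a \<Rightarrow> 'b \<Rightarrow> real) \<Rightarrow> real) monoid" where
  "tensor_algebra A B =
     \<lparr>carrier = span {pure_tensor (carrier A) (carrier B) v w |v w. v \<in> carrier A \<and> w \<in> carrier B},
      monoid.mult = (\<lambda>s t f. if bilinear_form_on (carrier A) (carrier B) f
         then s (\<lambda>v w. t (\<lambda>v' w'. f (v \<otimes>\<^bsub>A\<^esub> v') (w \<otimes>\<^bsub>B\<^esub> w'))) else 0),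
      one = pure_tensor (carrier A) (carrier B) \<one>\<^bsub>A\<^esub> \<one>\<^bsub>B\<^esub>\<rparr>"

definition product_grading ::
  "'a::real_vector monoid \<Rightarrow> ('g \<Rightarrow> 'a set) \<Rightarrow> 'b::real_vector monoid \<Rightarrow> ('h \<Rightarrow> 'b set) \<Rightarrow>
   'g \<times> 'h \<Rightarrow> (('a \<Rightarrow> 'b \<Rightarrow> real) \<Rightarrow> real) set" where
  "product_grading A \<Gamma> B \<Delta> =
     (\<lambda>(g, h). span {pure_tensor (carrier A) (carrier B) v w |v w. v \<in> \<Gamma> g \<and> w \<in> \<Delta> h})"

text \<open>The same for the tensor product of a finite family of algebras over a common type.\<close>

definition multilinear_form_on ::
  "'i set \<Rightarrow> ('i \<Rightarrow> 'a::real_vector set) \<Rightarrow> (('i \<Rightarrow> 'a) \<Rightarrow> real) \<Rightarrow> bool" where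
  "multilinear_form_on I V f \<longleftrightarrow>
     (\<forall>x\<in>Pi\<^sub>E I V. \<forall>i\<in>I. linear_map_on (V i) (\<lambda>v. f (x(i := v))))"

definition pure_tensor_family ::
  "'i set \<Rightarrow> ('i \<Rightarrow> 'a::real_vector set) \<Rightarrow> ('i \<Rightarrow> 'a) \<Rightarrow> (('i \<Rightarrow> 'a) \<Rightarrow> real) \<Rightarrow> real" where
  "pure_tensor_family I V x = (\<lambda>f. if multilinear_form_on I V f then f x else 0)"

definition tensor_algebra_family ::
  "'i set \<Rightarrow> ('i \<Rightarrow> 'a::real_vector monoid) \<Rightarrow> ((('i \<Rightarrow> 'a) \<Rightarrow> real) \<Rightarrow> real) monoid" where
  "tensor_algebra_family I A =
     \<lparr>carrier = span (pure_tensor_family I (\<lambda>i. carrier (A i)) ` (\<Pi>\<^sub>E i\<in>I. carrier (A i))),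
      monoid.mult = (\<lambda>s t f. if multilinear_form_on I (\<lambda>i. carrier (A i)) f
         then s (\<lambda>x. t (\<lambda>y. f (\<lambda>i\<in>I. x i \<otimes>\<^bsub>A i\<^esub> y i))) else 0),
      one = pure_tensor_family I (\<lambda>i. carrier (A i)) (\<lambda>i\<in>I. \<one>\<^bsub>A i\<^esub>)\<rparr>"

definition product_grading_family ::
  "'i set \<Rightarrow> ('i \<Rightarrow> 'a::real_vector monoid) \<Rightarrow> ('i \<Rightarrow> 'g \<Rightarrow> 'a set) \<Rightarrow>
   ('i \<Rightarrow> 'g) \<Rightarrow> ((('i \<Rightarrow> 'a) \<Rightarrow> real) \<Rightarrow> real) set" where
  "product_grading_family I A \<Gamma> =
     (\<lambda>g. span (pure_tensor_family I (\<lambda>i. carrier (A i)) ` (\<Pi>\<^sub>E i\<in>I. \<Gamma> i (g i))))"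

lemma tensor_algebra_mult_pure:
  assumes "is_real_algebra A" "is_real_algebra B"
    and "v \<in> carrier A" "w \<in> carrier B" "v' \<in> carrier A" "w' \<in> carrier B"
  defines "P \<equiv> pure_tensor (carrier A) (carrier B)"
  shows "P v w \<otimes>\<^bsub>tensor_algebra A B\<^esub> P v' w' = P (v \<otimes>\<^bsub>A\<^esub> v') (w \<otimes>\<^bsub>B\<^esub> w')"
proof -
  have cl: "x \<otimes>\<^bsub>A\<^esub> y \<in> carrier A" if "x \<in> carrier A" "y \<in> carrier A" for x y
    using assms(1) that by (simp add: is_real_algebra_def monoid.m_closed)
  have cl': "x \<otimes>\<^bsub>B\<^esub> y \<in> carrier B" if "x \<in> carrier B" "y \<in> carrier B" for x y
    using assms(2) that by (simp add: is_real_algebra_def monoid.m_closed)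
  have inner: "bilinear_form_on (carrier A) (carrier B) (\<lambda>v' w'. f (x \<otimes>\<^bsub>A\<^esub> v') (y \<otimes>\<^bsub>B\<^esub> w'))"
    and outer: "bilinear_form_on (carrier A) (carrier B) (\<lambda>v w. f (v \<otimes>\<^bsub>A\<^esub> x) (w \<otimes>\<^bsub>B\<^esub> y))"
    if "bilinear_form_on (carrier A) (carrier B) f" "x \<in> carrier A" "y \<in> carrier B" for f x y
    using that assms(1,2) cl cl'
    by (simp_all add: bilinear_form_on_def linear_map_on_def is_real_algebra_def)
  show ?thesis
  proof (rule ext)
    fix f
    show "(P v w \<otimes>\<^bsub>tensor_algebra A B\<^esub> P v' w') f = P (v \<otimes>\<^bsub>A\<^esub> v') (w \<otimes>\<^bsub>B\<^esub> w') f"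
    proof (cases "bilinear_form_on (carrier A) (carrier B) f")
      case True
      let ?h = "\<lambda>x y. P v' w' (\<lambda>v' w'. f (x \<otimes>\<^bsub>A\<^esub> v') (y \<otimes>\<^bsub>B\<^esub> w'))"
      have h: "?h x y = f (x \<otimes>\<^bsub>A\<^esub> v') (y \<otimes>\<^bsub>B\<^esub> w')" if "x \<in> carrier A" "y \<in> carrier B" for x y
        using inner[OF True that] by (simp add: P_def pure_tensor_def)
      have "bilinear_form_on (carrier A) (carrier B) ?h"
        using outer[OF True assms(5,6)] h assms(1,2)
        by (simp add: bilinear_form_on_def linear_map_on_def is_real_algebra_def
            subspace_add subspace_scale)
      then show ?thesis
        using True h assms(3,4) by (simp add: P_def tensor_algebra_def pure_tensor_def)
    qed (simp add: P_def tensor_algebra_def pure_tensor_def)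
  qed
qed


section \<open>The representing product gradings\<close>

definition mat2 :: "real \<Rightarrow> real \<Rightarrow> real \<Rightarrow> real \<Rightarrow> real^2^2" where
  "mat2 a b c d = vector [vector [a, b], vector [c, d]]"

definition M2_grading_dim1 :: "int \<times> int \<Rightarrow> (real^2^2) set" where
  "M2_grading_dim1 g =
     (if g = (0, 0) then span {mat2 1 0 0 1}
      else if g = (1, 0) then span {mat2 0 1 1 0}
      else if g = (0, 1) then span {mat2 (-1) 0 0 1}
      else if g = (1, 1) then span {mat2 0 (-1) 1 0}
      else {0})"

definition M2_grading_dim2 :: "int \<Rightarrow> (real^2^2) set" where
  "M2_grading_dim2 g =
     (if g = 0 then span {mat2 1 0 0 1, mat2 0 (-1) 1 0}
      else if g = 1 then span {mat2 0 1 1 0, mat2 (-1) 0 0 1}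
      else {0})"

definition quat_grading_dim2 :: "int \<Rightarrow> quat set" where
  "quat_grading_dim2 g =
     (if g = 0 then span {Quat 1 0 0 0, Quat 0 1 0 0}
      else if g = 1 then span {Quat 0 0 1 0, Quat 0 0 0 1}
      else {0})"

text \<open>
  In the following, \<open>F\<close> is the first tensor factor, \<open>\<Delta>\<close> its \<open>\<int>\<^sub>2\<close>-grading, and \<open>j\<close> the number of
  further factors \<open>M\<^sub>2(\<real>)\<close>.
\<close>

definition model_group :: "nat \<Rightarrow> (int \<times> (nat \<Rightarrow> int \<times> int)) monoid" where
  "model_group j = integer_mod_group 2 \<times>\<times>
     product_group {..<j} (\<lambda>_. integer_mod_group 2 \<times>\<times> integer_mod_group 2)"

definition M2_tensor_power :: "nat \<Rightarrow> (((nat \<Rightarrow> real^2^2) \<Rightarrow> real) \<Rightarrow> real) monoid" where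
  "M2_tensor_power j = tensor_algebra_family {..<j} (\<lambda>_. matrix_algebra)"

definition model_algebra ::
  "'a::real_vector monoid \<Rightarrow> nat \<Rightarrow>
   (('a \<Rightarrow> (((nat \<Rightarrow> real^2^2) \<Rightarrow> real) \<Rightarrow> real) \<Rightarrow> real) \<Rightarrow> real) monoid" where
  "model_algebra F j = tensor_algebra F (M2_tensor_power j)"

definition model_grading ::
  "'a::real_vector monoid \<Rightarrow> (int \<Rightarrow> 'a set) \<Rightarrow> nat \<Rightarrow> int \<times> (nat \<Rightarrow> int \<times> int) \<Rightarrow>
   (('a \<Rightarrow> (((nat \<Rightarrow> real^2^2) \<Rightarrow> real) \<Rightarrow> real) \<Rightarrow> real) \<Rightarrow> real) set" where
  "model_grading F \<Delta> j = product_grading F \<Delta> (M2_tensor_power j)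
     (product_grading_family {..<j} (\<lambda>_. matrix_algebra) (\<lambda>_. M2_grading_dim1))"

end

theory Submission
  imports Defs
begin

text \<open>
  The neutral component of the grading is a copy of \<open>\<complex>\<close>, with imaginary unit \<open>i\<close>, and \<open>K\<close> consists
  of the degrees whose components commute with it.  Fix \<open>X\<close> of degree \<open>g \<notin> K\<close>.  It anticommutes with
  \<open>i\<close>, and commutation with \<open>X\<close> singles out a real line in each component of degree in \<open>K\<close>.  After
  normalization, representatives of these lines along a symplectic basis of \<open>K\<close>, together with the
  pair \<open>X, i\<close>, are generators that square to \<open>\<plusminus>1\<close>, commute up to sign, and span the algebra.  In a
  central algebra, every such Pauli family is described by its signs alone.  The law of inertia for
  \<open>x \<mapsto> tr (x\<^sup>2)\<close> makes the product of \<open>\<nu> g\<close> and the Arf invariant of \<open>\<mu>\<^sub>g\<close> an invariant of the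
  algebra, equal to \<open>1\<close> for \<open>M\<^sub>n(\<real>)\<close> and to \<open>-1\<close> for \<open>M\<^sub>n(\<H>)\<close>.  Conversely, given this value \<open>s\<close>, one
  can choose \<open>g\<close> with \<open>\<nu> g = s\<close>; then \<open>\<mu>\<^sub>g\<close> is hyperbolic, and in a suitable basis the signs are
  those of a standard family that depends on \<open>s\<close> and the dimension only.  Thus two gradings with the
  same triple are isomorphic, and any two gradings are equivalent.
\<close>

section \<open>Real algebras given by carriers\<close>

text \<open>The value of \<open>nu g\<close> times the Arf invariant is a signature. Anticommuting
  generators a, b with squares \<sigma>, \<rho> give four elements 1, a, b, ab whose squares have
  the signs 1, \<sigma>, \<rho>, -\<sigma>\<rho>. The sum 1 + \<sigma> + \<rho> - \<sigma>\<rho> is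
  twice the local Arf factor, and for the pair \<open>X\<close>, i with \<rho> = -1 it is
  \<open>2 * nu g\<close>. These sums multiply over the pairs, which yields exactly the product in
  question; inertia frees it from the choice of the family. The obstacle is that commutation factors
  are complex numbers at first and \<open>G\<close> is any abelian group, so neither signs nor
  exponent 2 are given. Centrality supplies both. It makes \<open>X\<close> exist, since otherwise i
  would be central; and an element of degree in \<open>K\<close> that commutes with all components
  of degree in \<open>K\<close> becomes a scalar after rescaling. Squares of homogeneous elements
  are of this kind, so the support has exponent 2. Independence of a Pauli family follows from its
  commutation signs alone; counting dimensions then gives spanning in the matrix algebras and in the
  graded components.\<close>

locale real_alg = monoid D for D :: "'a::real_vector monoid" (structure) +
  assumes real_algebra: "is_real_algebra D"
begin

lemma subspace_carrier: "subspace (carrier D)"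
  using real_algebra by (simp add: is_real_algebra_def)

lemma carrier_intros [intro, simp]:
  "0 \<in> carrier D"
  "x \<in> carrier D \<Longrightarrow> y \<in> carrier D \<Longrightarrow> x + y \<in> carrier D"
  "x \<in> carrier D \<Longrightarrow> y \<in> carrier D \<Longrightarrow> x - y \<in> carrier D"
  "x \<in> carrier D \<Longrightarrow> c *\<^sub>R x \<in> carrier D"
  "x \<in> carrier D \<Longrightarrow> - x \<in> carrier D"
  using subspace_carrier by (auto simp: subspace_0 subspace_add subspace_diff subspace_scale subspace_neg)

lemma carrier_sum [intro, simp]: "(\<And>i. i \<in> I \<Longrightarrow> f i \<in> carrier D) \<Longrightarrow> sum f I \<in> carrier D"
  using subspace_carrier by (rule subspace_sum)

lemma mult_add [simp]:
  assumes "x \<in> carrier D" "y \<in> carrier D" "z \<in> carrier D"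
  shows "x \<otimes> (y + z) = x \<otimes> y + x \<otimes> z" "(y + z) \<otimes> x = y \<otimes> x + z \<otimes> x"
  using real_algebra assms by (simp_all add: is_real_algebra_def linear_map_on_def)

lemma mult_scale [simp]:
  assumes "x \<in> carrier D" "y \<in> carrier D"
  shows "x \<otimes> (c *\<^sub>R y) = c *\<^sub>R (x \<otimes> y)" "(c *\<^sub>R y) \<otimes> x = c *\<^sub>R (y \<otimes> x)"
  using real_algebra assms by (simp_all add: is_real_algebra_def linear_map_on_def)

lemma mult_0 [simp]:
  assumes "x \<in> carrier D"
  shows "x \<otimes> 0 = 0" "0 \<otimes> x = 0"
  using mult_scale[OF assms, of 0 0] by simp_all

lemma mult_minus [simp]:
  assumes "x \<in> carrier D" "y \<in> carrier D"
  shows "x \<otimes> (- y) = - (x \<otimes> y)" "(- y) \<otimes> x = - (y \<otimes> x)"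
  using mult_scale[OF assms, of "-1"] by simp_all

lemma mult_diff [simp]:
  assumes "x \<in> carrier D" "y \<in> carrier D" "z \<in> carrier D"
  shows "x \<otimes> (y - z) = x \<otimes> y - x \<otimes> z" "(y - z) \<otimes> x = y \<otimes> x - z \<otimes> x"
  using assms mult_add[of x y "- z"] by simp_all

lemma mult_sum:
  assumes "x \<in> carrier D" "\<And>i. i \<in> I \<Longrightarrow> f i \<in> carrier D"
  shows "x \<otimes> sum f I = (\<Sum>i\<in>I. x \<otimes> f i)" "sum f I \<otimes> x = (\<Sum>i\<in>I. f i \<otimes> x)"
proof -
  have "x \<otimes> sum f I = (\<Sum>i\<in>I. x \<otimes> f i) \<and> sum f I \<otimes> x = (\<Sum>i\<in>I. f i \<otimes> x)"
    using assms(2) by (induction I rule: infinite_finite_induct) (use assms(1) in auto)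
  then show "x \<otimes> sum f I = (\<Sum>i\<in>I. x \<otimes> f i)" "sum f I \<otimes> x = (\<Sum>i\<in>I. f i \<otimes> x)"
    by auto
qed

lemma Units_cancel:
  assumes "u \<in> Units D" "x \<in> carrier D" "y \<in> carrier D"
  shows "u \<otimes> x = u \<otimes> y \<longleftrightarrow> x = y" "x \<otimes> u = y \<otimes> u \<longleftrightarrow> x = y"
proof -
  show "u \<otimes> x = u \<otimes> y \<longleftrightarrow> x = y"
    using assms Units_l_cancel by blast
  have "x = y" if "x \<otimes> u = y \<otimes> u"
  proof -
    have "x \<otimes> u \<otimes> inv u = y \<otimes> u \<otimes> inv u" using that by simp
    then show ?thesis using assms by (simp add: m_assoc Units_closed)
  qed
  then show "x \<otimes> u = y \<otimes> u \<longleftrightarrow> x = y" by blast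
qed

lemma Units_if_square:
  assumes "u \<in> carrier D" "u \<otimes> u = c *\<^sub>R \<one>" "c \<noteq> 0"
  shows "u \<in> Units D"
  unfolding Units_def using assms
  by (intro CollectI conjI bexI[of _ "inverse c *\<^sub>R u"]) auto

end

section \<open>Linear algebra of indexed families, and algebra isomorphisms\<close>

lemma real_algI: "is_real_algebra D \<Longrightarrow> real_alg D"
  by (simp add: real_alg_def real_alg_axioms_def is_real_algebra_def)

text \<open>Membership of \<open>z\<close> in the span is kept in the step, so that the closure
  rules of a carrier that equals this span apply to \<open>z\<close>.\<close>

lemma span_induct_mem [consumes 1, case_names base step]:
  assumes "x \<in> span B" "P 0"
    and "\<And>c b z. b \<in> B \<Longrightarrow> z \<in> span B \<Longrightarrow> P z \<Longrightarrow> P (c *\<^sub>R b + z)"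
  shows "P x"
proof -
  have "x \<in> span B \<and> P x"
    using assms(1)
    by (induction rule: span_induct_alt)
      (use assms(2,3) in \<open>auto intro: span_zero span_add span_scale span_base\<close>)
  then show ?thesis by simp
qed

text \<open>Independence is a property of sets and would not notice a repeated vector; vanishing of
  the indexed coefficients excludes repetitions as well.\<close>

lemma independent_familyI:
  fixes y :: "'i \<Rightarrow> 'a::real_vector"
  assumes "finite I"
    and "\<And>c S. (\<Sum>S\<in>I. c S *\<^sub>R y S) = 0 \<Longrightarrow> S \<in> I \<Longrightarrow> c S = 0"
  shows "inj_on y I" "independent (y ` I)"
proof -
  show inj: "inj_on y I"
  proof (rule inj_onI, rule ccontr)
    fix S S' assume S: "S \<in> I" "S' \<in> I" "y S = y S'" "S \<noteq> S'"
    \<comment> \<open>A difference of two indicator functions: the combination is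
      \<open>y S - y S' = 0\<close>, so the hypothesis would give \<open>1 = 0\<close> at
      \<open>S\<close>.\<close>
    let ?c = "\<lambda>R. (if R = S then 1 else 0) - (if R = S' then 1 else 0) :: real"
    have "(\<Sum>R\<in>I. ?c R *\<^sub>R y R) = (\<Sum>R\<in>I. (if R = S then y S else 0) - (if R = S' then y S' else 0))"
      by (rule sum.cong) (simp_all add: scaleR_left_diff_distrib)
    also have "\<dots> = 0" using S assms(1) by (simp add: sum_subtractf)
    finally show False using assms(2)[of ?c S] S by simp
  qed
  show "independent (y ` I)"
  proof (rule independent_if_scalars_zero)
    fix u v assume u: "(\<Sum>x\<in>y ` I. u x *\<^sub>R x) = 0" and v: "v \<in> y ` I"
    have "(\<Sum>S\<in>I. u (y S) *\<^sub>R y S) = 0" using u inj by (simp add: sum.reindex)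
    from assms(2)[OF this] show "u v = 0" using v by blast
  qed (use assms(1) in simp)
qed

lemma linear_extend_family:
  fixes y :: "'i \<Rightarrow> 'a::real_vector" and h :: "'i \<Rightarrow> 'b::real_vector"
  assumes "independent (y ` I)" "inj_on y I"
  obtains f where "linear f" "\<And>S. S \<in> I \<Longrightarrow> f (y S) = h S"
proof -
  obtain f where f: "linear f" "\<forall>x\<in>y ` I. f x = (h \<circ> inv_into I y) x"
    using linear_independent_extend[OF assms(1), of "h \<circ> inv_into I y"] by blast
  then have "f (y S) = h S" if "S \<in> I" for S using that assms(2) by simp
  then show ?thesis using that f(1) by blast
qed

lemma alg_isomorphicI:
  assumes "is_real_algebra A" "linear f" "linear g" "f \<one>\<^bsub>A\<^esub> = \<one>\<^bsub>B\<^esub>"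
    and "\<And>x. x \<in> carrier A \<Longrightarrow> f x \<in> carrier B" "\<And>x. x \<in> carrier B \<Longrightarrow> g x \<in> carrier A"
    and "\<And>x. x \<in> carrier A \<Longrightarrow> g (f x) = x" "\<And>x. x \<in> carrier B \<Longrightarrow> f (g x) = x"
    and "\<And>x y. x \<in> carrier A \<Longrightarrow> y \<in> carrier A \<Longrightarrow> f (x \<otimes>\<^bsub>A\<^esub> y) = f x \<otimes>\<^bsub>B\<^esub> f y"
  shows "f \<in> alg_isos A B"
  using assms
  by (auto simp: alg_isos_def iso_def hom_def linear_map_on_def linear_add linear_scale
      intro!: bij_betw_byWitness[where f' = g])

text \<open>Members of \<open>alg_isos\<close> are linear on the carrier only. A map that is linear
  on the whole type makes the general facts on images of spans applicable.\<close>

lemma alg_isos_linear_extension: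
  assumes "is_real_algebra A" "\<phi> \<in> alg_isos A B"
  obtains f where "linear f" "\<And>x. x \<in> carrier A \<Longrightarrow> f x = \<phi> x"
proof -
  interpret real_alg A by (rule real_algI) fact
  obtain C where C: "C \<subseteq> carrier A" "independent C" "carrier A \<subseteq> span C"
    by (rule basis_exists)
  obtain f where f: "linear f" "\<forall>x\<in>C. f x = \<phi> x"
    using linear_independent_extend[OF C(2)] by blast
  have "x \<in> carrier A \<and> f x = \<phi> x" if "x \<in> span C" for x
    using that
  proof (induction rule: span_induct_alt)
    case base
    have "\<phi> (0 *\<^sub>R 0) = 0 *\<^sub>R \<phi> 0"
      using assms(2) carrier_intros(1) unfolding alg_isos_def linear_map_on_def by blast
    then show ?case using f(1) by (simp add: linear_0)
  next
    case (step c x y)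
    then show ?case using C(1) assms(2) f
      by (auto simp: alg_isos_def linear_map_on_def linear_add linear_scale)
  qed
  then show ?thesis using that[OF f(1)] C(3) by blast
qed

lemma alg_isosD:
  assumes "\<phi> \<in> alg_isos A B"
  shows "bij_betw \<phi> (carrier A) (carrier B)"
    and "x \<in> carrier A \<Longrightarrow> \<phi> x \<in> carrier B"
    and "x \<in> carrier A \<Longrightarrow> y \<in> carrier A \<Longrightarrow> \<phi> (x \<otimes>\<^bsub>A\<^esub> y) = \<phi> x \<otimes>\<^bsub>B\<^esub> \<phi> y"
    and "x \<in> carrier A \<Longrightarrow> y \<in> carrier A \<Longrightarrow> \<phi> (x + y) = \<phi> x + \<phi> y"
    and "x \<in> carrier A \<Longrightarrow> \<phi> (c *\<^sub>R x) = c *\<^sub>R \<phi> x"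
  using assms by (auto simp: alg_isos_def iso_def hom_def linear_map_on_def bij_betw_def)

text \<open>\<open>iso\<close> demands only bijectivity and multiplicativity, so the unit has to be
  recovered from surjectivity: a preimage of the unit is absorbed by the image of the unit.\<close>

lemma alg_isos_one:
  assumes "is_real_algebra A" "is_real_algebra B" "\<phi> \<in> alg_isos A B"
  shows "\<phi> \<one>\<^bsub>A\<^esub> = \<one>\<^bsub>B\<^esub>"
proof -
  interpret A: real_alg A by (rule real_algI) fact
  interpret B: real_alg B by (rule real_algI) fact
  have "\<one>\<^bsub>B\<^esub> \<in> \<phi> ` carrier A"
    using alg_isosD(1)[OF assms(3)] B.one_closed by (simp add: bij_betw_def)
  then obtain x where x: "x \<in> carrier A" "\<phi> x = \<one>\<^bsub>B\<^esub>" by auto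
  have "\<phi> \<one>\<^bsub>A\<^esub> = \<phi> \<one>\<^bsub>A\<^esub> \<otimes>\<^bsub>B\<^esub> \<phi> x"
    using x alg_isosD(2)[OF assms(3)] by simp
  also have "\<dots> = \<phi> x" using x alg_isosD(3)[OF assms(3), of "\<one>\<^bsub>A\<^esub>" x] by simp
  finally show ?thesis using x by simp
qed

lemma alg_isos_0:
  assumes "is_real_algebra A" "\<phi> \<in> alg_isos A B"
  shows "\<phi> 0 = 0"
proof -
  interpret A: real_alg A by (rule real_algI) fact
  show ?thesis using alg_isosD(5)[OF assms(2), of 0 0] by simp
qed

lemma alg_isos_inv:
  assumes "is_real_algebra A" "\<phi> \<in> alg_isos A B"
  shows "inv_into (carrier A) \<phi> \<in> alg_isos B A"
proof -
  interpret A: real_alg A by (rule real_algI) fact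
  let ?g = "inv_into (carrier A) \<phi>"
  note p = alg_isosD[OF assms(2)]
  have bij: "bij_betw ?g (carrier B) (carrier A)" using p(1) by (rule bij_betw_inv_into)
  have g: "?g x \<in> carrier A" "\<phi> (?g x) = x" if "x \<in> carrier B" for x
    using that p(1) bij by (auto simp: bij_betw_def inv_into_into f_inv_into_f)
  have gp: "?g (\<phi> x) = x" if "x \<in> carrier A" for x
    using that p(1) by (simp add: bij_betw_inv_into_left)
  have "?g (x \<otimes>\<^bsub>B\<^esub> y) = ?g x \<otimes>\<^bsub>A\<^esub> ?g y" if "x \<in> carrier B" "y \<in> carrier B" for x y
    using gp[of "?g x \<otimes>\<^bsub>A\<^esub> ?g y"] p(3) g that by simp
  moreover have "?g (x + y) = ?g x + ?g y" if "x \<in> carrier B" "y \<in> carrier B" for x y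
    using gp[of "?g x + ?g y"] p(4) g that by simp
  moreover have "?g (c *\<^sub>R x) = c *\<^sub>R ?g x" if "x \<in> carrier B" for c x
    using gp[of "c *\<^sub>R ?g x"] p(5) g that by simp
  ultimately show ?thesis using bij g by (auto simp: alg_isos_def iso_def hom_def linear_map_on_def)
qed

section \<open>Pauli families\<close>

text \<open>Exponent vectors over the field with two elements: the first set collects the positions
  of the generators \<open>a k\<close> in a monomial, the second those of \<open>b k\<close>.
  Multiplication of monomials adds exponents, which is symmetric difference
  (\<open>idx_add\<close>).\<close>

definition idx :: "nat \<Rightarrow> (nat set \<times> nat set) set" where
  "idx M = Pow {..<M} \<times> Pow {..<M}"

definition sdiff :: "'i set \<Rightarrow> 'i set \<Rightarrow> 'i set" where
  "sdiff A B = (A - B) \<union> (B - A)"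

definition idx_add :: "nat set \<times> nat set \<Rightarrow> nat set \<times> nat set \<Rightarrow> nat set \<times> nat set" where
  "idx_add S S' = (sdiff (fst S) (fst S'), sdiff (snd S) (snd S'))"

text \<open>The sign that arises when \<open>a^u b^v a^u' b^v'\<close> is brought to normal order,
  for anticommuting \<open>a\<close>, \<open>b\<close> with \<open>a^2 = s\<close> and
  \<open>b^2 = r\<close>: one swap of \<open>b\<close> and \<open>a\<close>, then the two
  squares.\<close>

definition pair_sign :: "real \<Rightarrow> real \<Rightarrow> bool \<Rightarrow> bool \<Rightarrow> bool \<Rightarrow> bool \<Rightarrow> real" where
  "pair_sign s r u v u' v' =
     (if v \<and> u' then -1 else 1) * (if u \<and> u' then s else 1) * (if v \<and> v' then r else 1)"

definition idx_sign ::
  "nat \<Rightarrow> (nat \<Rightarrow> real) \<Rightarrow> (nat \<Rightarrow> real) \<Rightarrow> nat set \<times> nat set \<Rightarrow> nat set \<times> nat set \<Rightarrow> real" where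
  "idx_sign M \<sigma> \<rho> S S' =
     (\<Prod>k<M. pair_sign (\<sigma> k) (\<rho> k) (k \<in> fst S) (k \<in> snd S) (k \<in> fst S') (k \<in> snd S'))"

text \<open>Only the multiplication table is recorded. Linear independence follows from it, and
  spanning is stated separately where it is used.\<close>

definition pauli_family ::
  "'a::real_vector monoid \<Rightarrow> nat \<Rightarrow> (nat \<Rightarrow> real) \<Rightarrow> (nat \<Rightarrow> real) \<Rightarrow> (nat set \<times> nat set \<Rightarrow> 'a) \<Rightarrow> bool"
  where
  "pauli_family D M \<sigma> \<rho> y \<longleftrightarrow>
     is_real_algebra D \<and> \<one>\<^bsub>D\<^esub> \<noteq> 0 \<and> (\<forall>k<M. \<sigma> k \<in> {1, -1} \<and> \<rho> k \<in> {1, -1}) \<and>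
     y ({}, {}) = \<one>\<^bsub>D\<^esub> \<and> y \<in> idx M \<rightarrow> carrier D \<and>
     (\<forall>S\<in>idx M. \<forall>S'\<in>idx M. y S \<otimes>\<^bsub>D\<^esub> y S' = idx_sign M \<sigma> \<rho> S S' *\<^sub>R y (idx_add S S'))"

lemma finite_idx [simp]: "finite (idx M)"
  by (simp add: idx_def)

lemma card_idx: "card (idx M) = 4 ^ M"
  by (simp add: idx_def card_cartesian_product card_Pow power_mult_distrib[symmetric])

lemma idx_add_in [simp]: "S \<in> idx M \<Longrightarrow> S' \<in> idx M \<Longrightarrow> idx_add S S' \<in> idx M"
  by (auto simp: idx_def idx_add_def sdiff_def)

lemma empty_in_idx [simp]: "({}, {}) \<in> idx M"
  by (simp add: idx_def)

lemma mem_idx_add: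
  "k \<in> fst (idx_add S S') \<longleftrightarrow> (k \<in> fst S) \<noteq> (k \<in> fst S')"
  "k \<in> snd (idx_add S S') \<longleftrightarrow> (k \<in> snd S) \<noteq> (k \<in> snd S')"
  by (auto simp: idx_add_def sdiff_def)

lemma idx_add_self [simp]: "idx_add S S = ({}, {})"
  by (simp add: idx_add_def sdiff_def)

lemma idx_add_commute: "idx_add S S' = idx_add S' S"
  by (auto simp: idx_add_def sdiff_def)

lemma idx_add_assoc: "idx_add (idx_add S S') S'' = idx_add S (idx_add S' S'')"
  by (auto simp: idx_add_def sdiff_def)

lemma idx_add_empty [simp]: "idx_add S ({}, {}) = S" "idx_add ({}, {}) S = S"
  by (auto simp: idx_add_def sdiff_def)

lemma idx_add_cancel [simp]: "idx_add S S' = idx_add S S'' \<longleftrightarrow> S' = S''"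
  by (metis idx_add_assoc idx_add_empty(2) idx_add_self)

lemma idx_add_eq_empty: "idx_add S S' = ({}, {}) \<longleftrightarrow> S = S'"
  by (metis idx_add_cancel idx_add_self)

lemma singleton_in_idx: "k < M \<Longrightarrow> ({k}, {}) \<in> idx M" "k < M \<Longrightarrow> ({}, {k}) \<in> idx M"
  by (auto simp: idx_def)

locale pauli = real_alg D for D :: "'a::real_vector monoid" (structure) and M \<sigma> \<rho> y +
  assumes pauli_family: "pauli_family D M \<sigma> \<rho> y"
begin

lemma y_empty: "y ({}, {}) = \<one>"
  and one_neq_0: "\<one> \<noteq> 0"
  and y_closed [intro, simp]: "S \<in> idx M \<Longrightarrow> y S \<in> carrier D"
  and y_mult: "S \<in> idx M \<Longrightarrow> S' \<in> idx M \<Longrightarrow> y S \<otimes> y S' = idx_sign M \<sigma> \<rho> S S' *\<^sub>R y (idx_add S S')"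
  using pauli_family by (auto simp: pauli_family_def)

lemma idx_sign_cases: "idx_sign M \<sigma> \<rho> S S' = 1 \<or> idx_sign M \<sigma> \<rho> S S' = -1"
proof -
  have "idx_sign n \<sigma> \<rho> S S' \<in> {1, -1}" if "n \<le> M" for n
    using that
  proof (induction n)
    case (Suc n)
    have s: "\<sigma> n \<in> {1, -1}" "\<rho> n \<in> {1, -1}"
      using pauli_family Suc.prems by (auto simp: pauli_family_def)
    have "pair_sign (\<sigma> n) (\<rho> n) a b c d \<in> {1, -1}" for a b c d
      using s by (auto simp: pair_sign_def)
    from this[of "n \<in> fst S" "n \<in> snd S" "n \<in> fst S'" "n \<in> snd S'"] show ?case
      using Suc by (auto simp: idx_sign_def)
  qed (simp add: idx_sign_def)
  from this[of M] show ?thesis by auto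
qed

lemma idx_sign_neq_0: "idx_sign M \<sigma> \<rho> S S' \<noteq> 0"
  using idx_sign_cases[of S S'] by auto

lemma y_square: "S \<in> idx M \<Longrightarrow> y S \<otimes> y S = idx_sign M \<sigma> \<rho> S S *\<^sub>R \<one>"
  by (simp add: y_mult y_empty)

lemma y_Units: "S \<in> idx M \<Longrightarrow> y S \<in> Units D"
  using Units_if_square[OF _ y_square idx_sign_neq_0] by simp

lemma y_neq_0: "S \<in> idx M \<Longrightarrow> y S \<noteq> 0"
  using y_square[of S] idx_sign_cases[of S S] one_neq_0 by auto

text \<open>Exchanging the two arguments of \<open>idx_sign\<close> with a singleton changes at most
  the factor at \<open>k\<close>, and there precisely when the partner generator occurs.\<close>

lemma y_singleton_comm:
  assumes "S \<in> idx M" "k < M"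
  shows "y ({k}, {}) \<otimes> y S = (if k \<in> snd S then -1 else 1) *\<^sub>R (y S \<otimes> y ({k}, {}))"
    and "y ({}, {k}) \<otimes> y S = (if k \<in> fst S then -1 else 1) *\<^sub>R (y S \<otimes> y ({}, {k}))"
proof -
  have *: "idx_sign M \<sigma> \<rho> T S = c * idx_sign M \<sigma> \<rho> S T"
    if "\<And>l. l < M \<Longrightarrow> pair_sign (\<sigma> l) (\<rho> l) (l \<in> fst T) (l \<in> snd T) (l \<in> fst S) (l \<in> snd S)
        = (if l = k then c else 1)
        * pair_sign (\<sigma> l) (\<rho> l) (l \<in> fst S) (l \<in> snd S) (l \<in> fst T) (l \<in> snd T)" for c T
  proof -
    have "(\<Prod>l<M. if l = k then c else 1) = c" using assms(2) by simp
    then show ?thesis unfolding idx_sign_def using that by (simp add: prod.distrib)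
  qed
  have "idx_sign M \<sigma> \<rho> ({k}, {}) S = (if k \<in> snd S then -1 else 1) * idx_sign M \<sigma> \<rho> S ({k}, {})"
    by (rule *) (auto simp: pair_sign_def)
  then show "y ({k}, {}) \<otimes> y S = (if k \<in> snd S then -1 else 1) *\<^sub>R (y S \<otimes> y ({k}, {}))"
    using assms by (simp add: y_mult singleton_in_idx idx_add_commute)
  have "idx_sign M \<sigma> \<rho> ({}, {k}) S = (if k \<in> fst S then -1 else 1) * idx_sign M \<sigma> \<rho> S ({}, {k})"
    by (rule *) (auto simp: pair_sign_def)
  then show "y ({}, {k}) \<otimes> y S = (if k \<in> fst S then -1 else 1) *\<^sub>R (y S \<otimes> y ({}, {k}))"
    using assms by (simp add: y_mult singleton_in_idx idx_add_commute)
qed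

text \<open>At a position where the two exponent vectors differ, the partner of the differing
  generator commutes with one of the two elements and anticommutes with the other. The normalization
  at the empty index serves for comparisons with the unit.\<close>

lemma separating_unit:
  assumes "S \<in> idx M" "S' \<in> idx M" "S \<noteq> S'"
  obtains T \<kappa> where "T \<in> idx M" "\<And>R. R \<in> idx M \<Longrightarrow> y T \<otimes> y R = \<kappa> R *\<^sub>R (y R \<otimes> y T)"
    "\<kappa> S \<noteq> \<kappa> S'" "\<kappa> ({}, {}) = (1::real)"
proof -
  have "fst S \<noteq> fst S' \<or> snd S \<noteq> snd S'" using assms(3) by (simp add: prod_eq_iff)
  then consider k where "k \<in> fst S \<longleftrightarrow> k \<notin> fst S'" | k where "k \<in> snd S \<longleftrightarrow> k \<notin> snd S'" by blast
  then show ?thesis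
  proof cases
    case 1
    then have "k < M" using assms(1,2) by (auto simp: idx_def)
    then show ?thesis using 1 y_singleton_comm(2)[OF _ \<open>k < M\<close>]
      by (intro that[of "({}, {k})" "\<lambda>R. if k \<in> fst R then -1 else 1"]) (auto simp: singleton_in_idx)
  next
    case 2
    then have "k < M" using assms(1,2) by (auto simp: idx_def)
    then show ?thesis using 2 y_singleton_comm(1)[OF _ \<open>k < M\<close>]
      by (intro that[of "({k}, {})" "\<lambda>R. if k \<in> snd R then -1 else 1"]) (auto simp: singleton_in_idx)
  qed
qed

text \<open>
  If \<open>y T\<close> has different commutation signs with \<open>y S\<close> and \<open>y S'\<close>, then comparing a relation with
  its conjugate by \<open>y T\<close> removes the term of \<open>S\<close> but keeps that of \<open>S'\<close>.
\<close>

lemma y_coeffs_0: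
  assumes "I \<subseteq> idx M" "(\<Sum>S\<in>I. c S *\<^sub>R y S) = 0" "S \<in> I"
  shows "c S = 0"
proof -
  have "finite I" using assms(1) finite_idx by (rule finite_subset)
  then show ?thesis using assms
  proof (induction I arbitrary: c S)
    case (insert S0 I)
    have idx: "S0 \<in> idx M" "I \<subseteq> idx M" using insert.prems by auto
    have I0: "c S = 0" if "S \<in> I" for S
    proof -
      have S: "S \<in> idx M" "S \<noteq> S0" using that idx insert.hyps by auto
      obtain T \<kappa> where T: "T \<in> idx M" "\<And>R. R \<in> idx M \<Longrightarrow> y T \<otimes> y R = \<kappa> R *\<^sub>R (y R \<otimes> y T)"
        "\<kappa> S \<noteq> \<kappa> S0"
        using separating_unit[OF S(1) idx(1) S(2)] by metis
      have J: "(\<Sum>R\<in>insert S0 I. c R *\<^sub>R y R) = 0" by fact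
      have cl: "\<And>R. R \<in> insert S0 I \<Longrightarrow> c R *\<^sub>R y R \<in> carrier D" using idx by auto
      have 1: "0 = (\<Sum>R\<in>insert S0 I. y T \<otimes> (c R *\<^sub>R y R))"
        using T(1) arg_cong[OF J, of "\<lambda>v. y T \<otimes> v"] mult_sum(1)[of "y T" "insert S0 I" "\<lambda>R. c R *\<^sub>R y R"] cl
        by simp
      have 2: "0 = (\<Sum>R\<in>insert S0 I. (c R *\<^sub>R y R) \<otimes> y T)"
        using T(1) arg_cong[OF J, of "\<lambda>v. v \<otimes> y T"] mult_sum(2)[of "y T" "insert S0 I" "\<lambda>R. c R *\<^sub>R y R"] cl
        by simp
      have "0 = (\<Sum>R\<in>insert S0 I. y T \<otimes> (c R *\<^sub>R y R)) - \<kappa> S0 *\<^sub>R (\<Sum>R\<in>insert S0 I. (c R *\<^sub>R y R) \<otimes> y T)"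
        using 1 2 by simp
      also have "\<dots> = (\<Sum>R\<in>insert S0 I. ((\<kappa> R - \<kappa> S0) * c R) *\<^sub>R (y R \<otimes> y T))"
        unfolding scaleR_sum_right sum_subtractf[symmetric]
      proof (rule sum.cong[OF refl])
        fix R assume "R \<in> insert S0 I"
        then have "R \<in> idx M" using idx by auto
        then show "y T \<otimes> (c R *\<^sub>R y R) - \<kappa> S0 *\<^sub>R ((c R *\<^sub>R y R) \<otimes> y T) = ((\<kappa> R - \<kappa> S0) * c R) *\<^sub>R (y R \<otimes> y T)"
          using T(1) by (simp add: T(2) algebra_simps)
      qed
      also have "\<dots> = (\<Sum>R\<in>I. ((\<kappa> R - \<kappa> S0) * c R) *\<^sub>R y R) \<otimes> y T"
        using insert.hyps T(1) idx
        by (subst mult_sum(2)) (auto intro!: sum.cong)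
      finally have "(\<Sum>R\<in>I. ((\<kappa> R - \<kappa> S0) * c R) *\<^sub>R y R) \<otimes> y T = 0 \<otimes> y T"
        using T(1) by simp
      then have "(\<Sum>R\<in>I. ((\<kappa> R - \<kappa> S0) * c R) *\<^sub>R y R) = 0"
        using Units_cancel(2)[OF y_Units[OF T(1)]] idx by (simp add: subsetD)
      from insert.IH[OF idx(2) this that] show ?thesis using T(3) by simp
    qed
    then have "c S0 *\<^sub>R y S0 = 0" using insert.prems(2) insert.hyps by simp
    then have "c S0 = 0" using y_neq_0[OF idx(1)] by simp
    then show ?case using I0 insert.prems(3) by blast
  qed simp
qed

lemma inj_y: "inj_on y (idx M)"
  and independent_idx: "independent (y ` idx M)"
  using independent_familyI[of "idx M" y] y_coeffs_0[OF order.refl] by simp_all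

lemma independent_y: "I \<subseteq> idx M \<Longrightarrow> independent (y ` I)"
  using independent_idx by (rule independent_mono) auto

lemma card_y: "card (y ` idx M) = 4 ^ M"
  using inj_y card_idx by (simp add: card_image)

text \<open>The family already has \<open>4 ^ M\<close> independent members, so a further vector
  would exceed the size of the spanning set \<open>B\<close>.\<close>

lemma spanning_if_small:
  assumes "finite B" "carrier D \<subseteq> span B" "card B \<le> 4 ^ M"
  shows "carrier D = span (y ` idx M)"
proof
  show "carrier D \<subseteq> span (y ` idx M)"
  proof (rule ccontr)
    assume "\<not> carrier D \<subseteq> span (y ` idx M)"
    then obtain v where v: "v \<in> carrier D" "v \<notin> span (y ` idx M)" by blast
    have ind: "independent (insert v (y ` idx M))"
      using independent_insertI[OF v(2) independent_idx] .
    have sub: "insert v (y ` idx M) \<subseteq> span B"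
      using v(1) assms(2) y_closed by blast
    have "card (insert v (y ` idx M)) \<le> card B"
      using independent_span_bound[OF assms(1) ind sub] by (rule conjunct2)
    moreover have "v \<notin> y ` idx M" using v(2) span_base[of v "y ` idx M"] by (rule contrapos_nn)
    ultimately show False using card_y assms(3) by simp
  qed
  show "span (y ` idx M) \<subseteq> carrier D"
    by (rule span_minimal[OF _ subspace_carrier]) (rule image_subsetI, rule y_closed)
qed

end

lemma pauliI: "pauli_family D M \<sigma> \<rho> y \<Longrightarrow> pauli D M \<sigma> \<rho> y"
  by (simp add: pauli_def pauli_axioms_def real_algI pauli_family_def)

text \<open>The linear map that matches the two bases is multiplicative because the tables agree;
  this is extended by linearity first in the right factor, then in the left one. The signs therefore
  determine the algebra.\<close>

lemma pauli_iso:
  assumes "pauli_family D M \<sigma> \<rho> y" "carrier D = span (y ` idx M)"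
    and "pauli_family D' M \<sigma> \<rho> y'" "carrier D' = span (y' ` idx M)"
  obtains f where "linear f" "f \<in> alg_isos D D'" "\<And>S. S \<in> idx M \<Longrightarrow> f (y S) = y' S"
proof -
  interpret P: pauli D M \<sigma> \<rho> y by (rule pauliI) fact
  interpret P': pauli D' M \<sigma> \<rho> y' by (rule pauliI) fact
  obtain f where f: "linear f" and fy: "\<And>S. S \<in> idx M \<Longrightarrow> f (y S) = y' S"
    using linear_extend_family[OF P.independent_idx P.inj_y, of y'] by blast
  obtain g where g: "linear g" and gy: "\<And>S. S \<in> idx M \<Longrightarrow> g (y' S) = y S"
    using linear_extend_family[OF P'.independent_idx P'.inj_y, of y] by blast
  have fcl: "f x \<in> carrier D'" if "x \<in> carrier D" for x
  proof -
    have "f ` span (y ` idx M) = span (f ` (y ` idx M))" by (rule linear_span_image[OF f, symmetric])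
    also have "\<dots> = span (y' ` idx M)" using fy by (simp add: image_image)
    finally show ?thesis using that assms(2,4) by blast
  qed
  have gcl: "g x \<in> carrier D" if "x \<in> carrier D'" for x
  proof -
    have "g ` span (y' ` idx M) = span (g ` (y' ` idx M))" by (rule linear_span_image[OF g, symmetric])
    also have "\<dots> = span (y ` idx M)" using gy by (simp add: image_image)
    finally show ?thesis using that assms(2,4) by blast
  qed
  have gf: "g (f x) = x" if "x \<in> carrier D" for x
  proof -
    have "(g \<circ> f) x = id x"
      by (rule linear_eq_on[OF linear_compose[OF f g] linear_id, of x "y ` idx M"])
        (use that assms(2) in \<open>auto simp: fy gy\<close>)
    then show ?thesis by simp
  qed
  have fg: "f (g x) = x" if "x \<in> carrier D'" for x
  proof -
    have "(f \<circ> g) x = id x"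
      by (rule linear_eq_on[OF linear_compose[OF g f] linear_id, of x "y' ` idx M"])
        (use that assms(4) in \<open>auto simp: fy gy\<close>)
    then show ?thesis by simp
  qed
  have 1: "f (y S \<otimes>\<^bsub>D\<^esub> x) = y' S \<otimes>\<^bsub>D'\<^esub> f x" if "x \<in> span (y ` idx M)" "S \<in> idx M" for x S
    using that(1)
  proof (induction rule: span_induct_mem)
    case base
    then show ?case using that(2) by (simp add: linear_0[OF f])
  next
    case (step c x z)
    then have z: "z \<in> carrier D" using assms(2) by simp
    from step(1) obtain T where "T \<in> idx M" "x = y T" by blast
    then show ?case using that(2) fcl z step(3)
      by (simp add: P.y_mult P'.y_mult linear_add[OF f] linear_scale[OF f] fy)
  qed
  have 2: "f (x \<otimes>\<^bsub>D\<^esub> z) = f x \<otimes>\<^bsub>D'\<^esub> f z" if "x \<in> span (y ` idx M)" "z \<in> carrier D" for x z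
    using that(1)
  proof (induction rule: span_induct_mem)
    case base
    then show ?case using that(2) fcl by (simp add: linear_0[OF f])
  next
    case (step c x w)
    then have w: "w \<in> carrier D" using assms(2) by simp
    from step(1) obtain T where "T \<in> idx M" "x = y T" by blast
    moreover have "f (y T \<otimes>\<^bsub>D\<^esub> z) = y' T \<otimes>\<^bsub>D'\<^esub> f z" if "T \<in> idx M" for T
      using 1[of z T] \<open>z \<in> carrier D\<close> that assms(2) by simp
    ultimately show ?case using fcl w step(3) \<open>z \<in> carrier D\<close>
      by (simp add: linear_add[OF f] linear_scale[OF f] fy)
  qed
  have "f \<in> alg_isos D D'"
    by (rule alg_isomorphicI[OF P.real_algebra f g])
      (use fcl gcl gf fg 2 assms(2) fy[of "({}, {})"] in \<open>auto simp: P.y_empty P'.y_empty\<close>)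
  then show ?thesis using that f fy by blast
qed

section \<open>Counting signs\<close>

lemma sum_Pow_Suc:
  fixes h :: "nat set \<Rightarrow> 'a::comm_monoid_add"
  shows "(\<Sum>U\<in>Pow {..<Suc n}. h U) = (\<Sum>U\<in>Pow {..<n}. h U + h (insert n U))"
proof -
  have "Pow {..<Suc n} = Pow {..<n} \<union> insert n ` Pow {..<n}"
    by (simp add: lessThan_Suc Pow_insert)
  moreover have "Pow {..<n} \<inter> insert n ` Pow {..<n} = {}" by auto
  moreover have "inj_on (insert n) (Pow {..<n})"
    by (rule inj_onI) (metis PowD insert_ident lessThan_iff less_irrefl subsetD)
  ultimately show ?thesis
    by (simp add: sum.union_disjoint sum.reindex sum.distrib)
qed

lemma sum_idx_Suc:
  fixes h :: "nat set \<times> nat set \<Rightarrow> 'a::comm_monoid_add"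
  shows "(\<Sum>S\<in>idx (Suc n). h S) = (\<Sum>(U, V)\<in>idx n.
    h (U, V) + h (U, insert n V) + h (insert n U, V) + h (insert n U, insert n V))"
  unfolding idx_def sum.cartesian_product'[symmetric]
  by (simp add: sum_Pow_Suc sum.cartesian_product' sum.distrib case_prod_unfold ac_simps)

text \<open>The distributive law: expanding the product on the right picks one of four exponent
  pairs at each position, which amounts to picking an element of \<open>idx n\<close>.\<close>

lemma sum_idx_prod:
  fixes f :: "nat \<Rightarrow> bool \<Rightarrow> bool \<Rightarrow> 'a::comm_ring_1"
  shows "(\<Sum>S\<in>idx n. \<Prod>k<n. f k (k \<in> fst S) (k \<in> snd S))
    = (\<Prod>k<n. f k False False + f k False True + f k True False + f k True True)"
proof (induction n)
  case (Suc n)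
  have "(\<Sum>S\<in>idx (Suc n). \<Prod>k<Suc n. f k (k \<in> fst S) (k \<in> snd S))
    = (\<Sum>S\<in>idx n. (\<Prod>k<n. f k (k \<in> fst S) (k \<in> snd S)) *
        (f n False False + f n False True + f n True False + f n True True))"
    unfolding sum_idx_Suc
  proof (rule sum.cong[OF refl], clarify)
    fix U V assume "(U, V) \<in> idx n"
    then have UV: "U \<subseteq> {..<n}" "V \<subseteq> {..<n}" by (simp_all add: idx_def)
    then have n: "n \<notin> U" "n \<notin> V" by auto
    have *: "(\<Prod>k<Suc n. f k (k \<in> fst (U', V')) (k \<in> snd (U', V')))
        = (\<Prod>k<n. f k (k \<in> U) (k \<in> V)) * f n (n \<in> U') (n \<in> V')"
      if "U' = U \<or> U' = insert n U" "V' = V \<or> V' = insert n V" for U' V'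
    proof -
      have "(\<Prod>k<n. f k (k \<in> U') (k \<in> V')) = (\<Prod>k<n. f k (k \<in> U) (k \<in> V))"
        using that by (intro prod.cong) auto
      then show ?thesis by simp
    qed
    show "(\<Prod>k<Suc n. f k (k \<in> fst (U, V)) (k \<in> snd (U, V))) +
        (\<Prod>k<Suc n. f k (k \<in> fst (U, insert n V)) (k \<in> snd (U, insert n V))) +
        (\<Prod>k<Suc n. f k (k \<in> fst (insert n U, V)) (k \<in> snd (insert n U, V))) +
        (\<Prod>k<Suc n. f k (k \<in> fst (insert n U, insert n V)) (k \<in> snd (insert n U, insert n V))) =
      (\<Prod>k<n. f k (k \<in> fst (U, V)) (k \<in> snd (U, V))) *
        (f n False False + f n False True + f n True False + f n True True)"
      unfolding *[of U V, OF disjI1[OF refl] disjI1[OF refl]]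
        *[of U "insert n V", OF disjI1[OF refl] disjI2[OF refl]]
        *[of "insert n U" V, OF disjI2[OF refl] disjI1[OF refl]]
        *[of "insert n U" "insert n V", OF disjI2[OF refl] disjI2[OF refl]]
      using n by (simp add: algebra_simps)
  qed
  then show ?case using Suc by (simp add: sum_distrib_right[symmetric])
qed (simp add: idx_def)

text \<open>The left side counts positive minus negative squares of the family. In each pair,
  \<open>1\<close>, \<open>a\<close>, \<open>b\<close> and \<open>a b\<close> contribute the squares
  \<open>1\<close>, \<open>\<sigma> k\<close>, \<open>\<rho> k\<close> and
  \<open>- \<sigma> k * \<rho> k\<close>.\<close>

lemma sum_idx_sign:
  "(\<Sum>S\<in>idx M. idx_sign M \<sigma> \<rho> S S) = (\<Prod>k<M. 1 + \<sigma> k + \<rho> k - \<sigma> k * \<rho> k)"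
  using sum_idx_prod[of "\<lambda>k u v. pair_sign (\<sigma> k) (\<rho> k) u v u v" M]
  unfolding idx_sign_def by (simp add: pair_sign_def algebra_simps)

text \<open>Coefficients are indexed by \<open>I\<close> rather than by vectors, which fits
  \<open>trace_square\<close> and allows repetitions in \<open>y\<close>.\<close>

lemma span_familyD:
  assumes "finite I" "v \<in> span (y ` I)"
  shows "\<exists>c. v = (\<Sum>S\<in>I. c S *\<^sub>R y S)"
  using assms(2)
proof (induction rule: span_induct_alt)
  case base
  show ?case by (rule exI[of _ "\<lambda>_. 0"]) simp
next
  case (step c x v)
  then obtain d S where d: "v = (\<Sum>S\<in>I. d S *\<^sub>R y S)" and S: "S \<in> I" "x = y S" by auto
  have "(\<Sum>R\<in>I. (d R + (if R = S then c else 0)) *\<^sub>R y R) = c *\<^sub>R x + v"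
    using S assms(1) d by (simp add: scaleR_left_distrib sum.distrib if_distrib[of "\<lambda>t. t *\<^sub>R _"] cong: if_cong)
  then show ?case by metis
qed

section \<open>Traces and the law of inertia\<close>

definition trace_functional :: "'a::real_vector monoid \<Rightarrow> ('a \<Rightarrow> real) \<Rightarrow> bool" where
  "trace_functional D \<tau> \<longleftrightarrow> linear \<tau> \<and> \<tau> \<one>\<^bsub>D\<^esub> = 1 \<and>
     (\<forall>x\<in>carrier D. \<forall>z\<in>carrier D. \<tau> (x \<otimes>\<^bsub>D\<^esub> z) = \<tau> (z \<otimes>\<^bsub>D\<^esub> x))"

context pauli
begin

text \<open>A trace is invariant under conjugation, while conjugation with a suitable
  \<open>y T\<close> multiplies \<open>y S\<close> by a factor other than \<open>1\<close>. As
  \<open>y T\<close> squares to a nonzero scalar, it takes the place of its inverse up to that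
  scalar.\<close>

lemma trace_y:
  assumes \<tau>: "trace_functional D \<tau>" and S: "S \<in> idx M" "S \<noteq> ({}, {})"
  shows "\<tau> (y S) = 0"
proof -
  have lin: "linear \<tau>" using \<tau> by (simp add: trace_functional_def)
  obtain T \<kappa> where T: "T \<in> idx M" "\<And>R. R \<in> idx M \<Longrightarrow> y T \<otimes> y R = \<kappa> R *\<^sub>R (y R \<otimes> y T)"
    "\<kappa> S \<noteq> \<kappa> ({}, {})" "\<kappa> ({}, {}) = (1::real)"
    using separating_unit[OF S(1) empty_in_idx S(2)] by metis
  let ?c = "idx_sign M \<sigma> \<rho> T T"
  have c: "y T \<otimes> y T = ?c *\<^sub>R \<one>" by (rule y_square[OF T(1)])
  have cl: "y T \<in> carrier D" "y S \<in> carrier D" using S T by auto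
  have "?c * \<tau> (y S) = \<tau> ((y T \<otimes> y T) \<otimes> y S)"
    using S c lin by (simp add: linear_scale)
  also have "\<dots> = \<tau> (y T \<otimes> (y T \<otimes> y S))" using cl by (simp add: m_assoc)
  also have "\<dots> = \<tau> ((y T \<otimes> y S) \<otimes> y T)"
    using \<tau> cl by (simp add: trace_functional_def)
  also have "\<dots> = \<tau> (\<kappa> S *\<^sub>R (y S \<otimes> (y T \<otimes> y T)))" using cl S by (simp add: T(2) m_assoc)
  also have "\<dots> = \<kappa> S * (?c * \<tau> (y S))" using c cl lin by (simp add: linear_scale)
  finally show ?thesis using T(3,4) idx_sign_neq_0[of T T] by auto
qed

text \<open>The coefficient of the unit with respect to the family is a trace: a product of two
  members has such a coefficient only if their indices coincide, and then their order does not
  matter.\<close>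

lemma trace_functional_exists:
  assumes span: "carrier D = span (y ` idx M)"
  shows "\<exists>\<tau>. trace_functional D \<tau>"
proof -
  obtain \<tau> :: "'a \<Rightarrow> real" where \<tau>: "linear \<tau>"
      and \<tau>y: "\<And>S. S \<in> idx M \<Longrightarrow> \<tau> (y S) = of_bool (S = ({}, {}))"
    using linear_extend_family[OF independent_idx inj_y,
          of "\<lambda>S. of_bool (S = ({}, {}))"] by blast
  have 1: "\<tau> (x \<otimes> y S) = \<tau> (y S \<otimes> x)" if "x \<in> span (y ` idx M)" "S \<in> idx M" for x S
    using that(1)
  proof (induction rule: span_induct_mem)
    case base
    then show ?case using that(2) by simp
  next
    case (step c x z)
    then have cl: "z \<in> carrier D" using span by simp
    obtain T where T: "T \<in> idx M" "x = y T" using step by auto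
    have "\<tau> (y T \<otimes> y S) = \<tau> (y S \<otimes> y T)"
      using T(1) that(2) linear_scale[OF \<tau>]
      by (simp add: y_mult linear_scale \<tau>y idx_add_eq_empty idx_add_commute)
    then show ?case using step(3) cl T that(2) by (simp add: linear_add[OF \<tau>] linear_scale[OF \<tau>])
  qed
  have 2: "\<tau> (x \<otimes> z) = \<tau> (z \<otimes> x)" if "x \<in> span (y ` idx M)" "z \<in> carrier D" for x z
    using that(1)
  proof (induction rule: span_induct_mem)
    case base
    then show ?case using that(2) by simp
  next
    case (step c x w)
    then have cl: "w \<in> carrier D" using span by simp
    obtain T where "T \<in> idx M" "x = y T" using step(1) by blast
    moreover have "\<tau> (y T \<otimes> z) = \<tau> (z \<otimes> y T)" if "T \<in> idx M" for T
      using 1[of z T] \<open>z \<in> carrier D\<close> that span by simp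
    ultimately show ?case using cl step(3) \<open>z \<in> carrier D\<close>
      by (simp add: linear_add[OF \<tau>] linear_scale[OF \<tau>])
  qed
  show ?thesis
    using \<tau> \<tau>y[of "({}, {})"] 2 span by (auto simp: trace_functional_def y_empty)
qed

text \<open>Mixed products are multiples of members with nonempty index, on which every trace
  vanishes, so only the squares survive.\<close>

lemma trace_square:
  assumes \<tau>: "trace_functional D \<tau>" and I: "I \<subseteq> idx M"
  defines "v c \<equiv> \<Sum>S\<in>I. c S *\<^sub>R y S"
  shows "\<tau> (v c \<otimes> v c) = (\<Sum>S\<in>I. (c S)\<^sup>2 * idx_sign M \<sigma> \<rho> S S)"
proof -
  have lin: "linear \<tau>" using \<tau> by (simp add: trace_functional_def)
  have fin: "finite I" using I finite_idx by (rule finite_subset)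
  have cS: "c S *\<^sub>R y S \<in> carrier D" if "S \<in> I" for S
    using subsetD[OF I that] by simp
  then have vcl: "v c \<in> carrier D" unfolding v_def by (rule carrier_sum)
  have 1: "\<tau> (y S \<otimes> y R) = (if S = R then idx_sign M \<sigma> \<rho> S S else 0)" if "S \<in> I" "R \<in> I" for S R
  proof -
    have in': "S \<in> idx M" "R \<in> idx M" using that I by auto
    then have "\<tau> (y S \<otimes> y R) = idx_sign M \<sigma> \<rho> S R * \<tau> (y (idx_add S R))"
      by (simp add: y_mult linear_scale[OF lin])
    moreover have "\<tau> (y (idx_add S R)) = (if S = R then 1 else 0)"
      using \<tau> in' trace_y[OF \<tau>, of "idx_add S R"]
      by (auto simp: y_empty trace_functional_def idx_add_eq_empty)
    ultimately show ?thesis by simp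
  qed
  have "\<tau> (v c \<otimes> v c) = \<tau> (\<Sum>S\<in>I. (c S *\<^sub>R y S) \<otimes> v c)"
    using mult_sum(2)[of "v c" I "\<lambda>S. c S *\<^sub>R y S", OF vcl cS] by (simp add: v_def)
  also have "\<dots> = (\<Sum>S\<in>I. \<tau> ((c S *\<^sub>R y S) \<otimes> v c))" by (rule linear_sum[OF lin])
  also have "\<dots> = (\<Sum>S\<in>I. \<Sum>R\<in>I. c S * c R * \<tau> (y S \<otimes> y R))"
  proof (rule sum.cong[OF refl])
    fix S assume S: "S \<in> I"
    then have yS: "y S \<in> carrier D" using subsetD[OF I] by simp
    then have "(c S *\<^sub>R y S) \<otimes> v c = c S *\<^sub>R (\<Sum>R\<in>I. y S \<otimes> (c R *\<^sub>R y R))"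
      using mult_sum(1)[of "y S" I "\<lambda>R. c R *\<^sub>R y R", OF yS cS] vcl by (simp add: v_def)
    also have "(\<Sum>R\<in>I. y S \<otimes> (c R *\<^sub>R y R)) = (\<Sum>R\<in>I. c R *\<^sub>R (y S \<otimes> y R))"
      using yS subsetD[OF I] by (intro sum.cong refl) simp
    finally show "\<tau> ((c S *\<^sub>R y S) \<otimes> v c) = (\<Sum>R\<in>I. c S * c R * \<tau> (y S \<otimes> y R))"
      by (simp add: linear_scale[OF lin] linear_sum[OF lin] sum_distrib_left mult.assoc)
  qed
  also have "\<dots> = (\<Sum>S\<in>I. \<Sum>R\<in>I. if S = R then (c S)\<^sup>2 * idx_sign M \<sigma> \<rho> S S else 0)"
    using 1 by (intro sum.cong) (auto simp: power2_eq_square)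
  also have "\<dots> = (\<Sum>S\<in>I. (c S)\<^sup>2 * idx_sign M \<sigma> \<rho> S S)" using fin by simp
  finally show ?thesis .
qed

end

text \<open>
  The form \<open>v \<mapsto> \<tau> (v\<^sup>2)\<close> is diagonal in every spanning Pauli family, so this is the law of inertia.
\<close>

lemma card_positive_le:
  assumes y: "pauli_family D M \<sigma> \<rho> y" "carrier D = span (y ` idx M)"
    and y': "pauli_family D M' \<sigma>' \<rho>' y'" "carrier D = span (y' ` idx M')"
  shows "card {S \<in> idx M'. idx_sign M' \<sigma>' \<rho>' S S = 1} \<le> card {S \<in> idx M. idx_sign M \<sigma> \<rho> S S = 1}"
    (is "card ?P' \<le> card ?P")
proof -
  interpret Y: pauli D M \<sigma> \<rho> y by (rule pauliI) fact
  interpret Y': pauli D M' \<sigma>' \<rho>' y' by (rule pauliI) fact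
  obtain \<tau> where \<tau>: "trace_functional D \<tau>" using Y.trace_functional_exists[OF y(2)] by blast
  \<comment> \<open>The projection onto the positive part of the first family along its negative
    part.\<close>
  obtain \<pi> :: "'a \<Rightarrow> 'a" where \<pi>: "linear \<pi>"
      and \<pi>y: "\<And>S. S \<in> idx M \<Longrightarrow> \<pi> (y S) = (if S \<in> ?P then y S else 0)"
    using linear_extend_family[OF Y.independent_idx Y.inj_y,
          of "\<lambda>S. if S \<in> ?P then y S else 0"] by blast
  have fin: "finite ?P" "finite ?P'" by auto
  \<comment> \<open>An element of the kernel has only negative coordinates in the first family, so
    its square has trace at most \<open>0\<close>; as a combination of positive members of the
    second family it has a sum of squares as trace. Hence all its coefficients vanish, and the
    projection is injective on the positive part of the second family.\<close>
  have \<pi>0: "x = 0" if x: "x \<in> span (y' ` ?P')" "\<pi> x = 0" for x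
  proof -
    have "span (y' ` ?P') \<subseteq> carrier D" unfolding y'(2) by (rule span_mono) auto
    then have "x \<in> carrier D" using x(1) by blast
    then have "x \<in> span (y ` idx M)" unfolding y(2) .
    from span_familyD[OF finite_idx this] obtain c where c: "x = (\<Sum>S\<in>idx M. c S *\<^sub>R y S)"
      by blast
    from span_familyD[OF fin(2) x(1)] obtain d where d: "x = (\<Sum>S\<in>?P'. d S *\<^sub>R y' S)"
      by blast
    have "\<pi> x = (\<Sum>S\<in>idx M. c S *\<^sub>R (if S \<in> ?P then y S else 0))"
      unfolding c by (simp add: linear_sum[OF \<pi>] linear_scale[OF \<pi>] \<pi>y)
    also have "\<dots> = (\<Sum>S\<in>?P. c S *\<^sub>R y S)" by (rule sum.mono_neutral_cong_right) auto
    finally have "(\<Sum>S\<in>?P. c S *\<^sub>R y S) = 0" using x by simp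
    then have c0: "c S = 0" if "S \<in> ?P" for S
      using Y.y_coeffs_0[of ?P c S] that by auto
    have "\<tau> (x \<otimes>\<^bsub>D\<^esub> x) = (\<Sum>S\<in>idx M. (c S)\<^sup>2 * idx_sign M \<sigma> \<rho> S S)"
      unfolding c by (rule Y.trace_square[OF \<tau> order.refl])
    also have "\<dots> \<le> 0"
    proof (rule sum_nonpos)
      fix S assume "S \<in> idx M"
      then show "(c S)\<^sup>2 * idx_sign M \<sigma> \<rho> S S \<le> 0"
        using c0[of S] Y.idx_sign_cases[of S S] by auto
    qed
    finally have le: "\<tau> (x \<otimes>\<^bsub>D\<^esub> x) \<le> 0" .
    have "\<tau> (x \<otimes>\<^bsub>D\<^esub> x) = (\<Sum>S\<in>?P'. (d S)\<^sup>2 * idx_sign M' \<sigma>' \<rho>' S S)"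
      unfolding d by (rule Y'.trace_square[OF \<tau>]) auto
    also have "\<dots> = (\<Sum>S\<in>?P'. (d S)\<^sup>2)" by (rule sum.cong) auto
    finally have "(\<Sum>S\<in>?P'. (d S)\<^sup>2) = 0" using le sum_nonneg[of ?P' "\<lambda>S. (d S)\<^sup>2"] by auto
    then have "\<forall>S\<in>?P'. d S = 0" using sum_nonneg_eq_0_iff[OF fin(2), of "\<lambda>S. (d S)\<^sup>2"] by auto
    then show ?thesis unfolding d by (intro sum.neutral ballI) (drule (1) bspec, simp only: scaleR_zero_left)
  qed
  have inj: "inj_on \<pi> (span (y' ` ?P'))"
  proof (rule inj_onI)
    fix x z assume xz: "x \<in> span (y' ` ?P')" "z \<in> span (y' ` ?P')" "\<pi> x = \<pi> z"
    have "\<pi> (x - z) = 0" using xz(3) by (simp add: linear_diff[OF \<pi>])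
    then have "x - z = 0" by (rule \<pi>0[OF span_diff[OF xz(1,2)]])
    then show "x = z" by simp
  qed
  have P: "?P' \<subseteq> idx M'" "?P \<subseteq> idx M" by (rule Collect_restrict)+
  have ind: "independent (y' ` ?P')" by (rule Y'.independent_y[OF P(1)])
  then have "independent (\<pi> ` y' ` ?P')"
    using linear_independent_injective_image[OF \<pi> _ inj] by blast
  moreover have "\<pi> ` y' ` ?P' \<subseteq> span (y ` ?P)"
  proof -
    have "\<pi> ` span (y ` idx M) = span (\<pi> ` y ` idx M)" by (rule linear_span_image[OF \<pi>, symmetric])
    also have "\<dots> \<subseteq> span (y ` ?P)"
    proof (intro span_minimal[OF _ subspace_span] subsetI, elim imageE, hypsubst)
      fix S assume "S \<in> idx M"
      then show "\<pi> (y S) \<in> span (y ` ?P)" by (simp add: \<pi>y span_zero span_base)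
    qed
    finally have "\<pi> ` carrier D \<subseteq> span (y ` ?P)" unfolding y(2) .
    moreover have "y' ` ?P' \<subseteq> carrier D" using P(1) Y'.y_closed by blast
    ultimately show ?thesis by blast
  qed
  ultimately have "card (\<pi> ` y' ` ?P') \<le> card (y ` ?P)"
    using independent_span_bound fin(1) by blast
  moreover have "card (\<pi> ` y' ` ?P') = card ?P'"
  proof -
    have "inj_on \<pi> (y' ` ?P')" using inj span_superset by (rule inj_on_subset)
    moreover have "inj_on y' ?P'" using Y'.inj_y P(1) by (rule inj_on_subset)
    ultimately show ?thesis by (simp add: card_image)
  qed
  moreover have "card (y ` ?P) \<le> card ?P" using fin(1) by (rule card_image_le)
  ultimately show ?thesis by simp
qed

text \<open>By \<open>sum_idx_sign\<close> both sides are signatures of the trace form, that is,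
  \<open>2 * p - 4 ^ M\<close> for the number \<open>p\<close> of positive members; inertia in both
  directions makes the two numbers equal.\<close>

lemma pauli_sign_unique:
  assumes y: "pauli_family D M \<sigma> \<rho> y" "carrier D = span (y ` idx M)"
    and y': "pauli_family D M \<sigma>' \<rho>' y'" "carrier D = span (y' ` idx M)"
  shows "(\<Prod>k<M. 1 + \<sigma> k + \<rho> k - \<sigma> k * \<rho> k) = (\<Prod>k<M. 1 + \<sigma>' k + \<rho>' k - \<sigma>' k * \<rho>' k)"
proof -
  have *: "(\<Sum>S\<in>idx M. idx_sign M \<sigma> \<rho> S S) = 2 * real (card {S \<in> idx M. idx_sign M \<sigma> \<rho> S S = 1}) - 4 ^ M"
    if "pauli_family D M \<sigma> \<rho> y" for \<sigma> \<rho> y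
  proof -
    interpret Y: pauli D M \<sigma> \<rho> y by (rule pauliI) fact
    have "(\<Sum>S\<in>idx M. idx_sign M \<sigma> \<rho> S S) = (\<Sum>S\<in>idx M. 2 * of_bool (idx_sign M \<sigma> \<rho> S S = 1) - 1)"
    proof (rule sum.cong[OF refl])
      fix S show "idx_sign M \<sigma> \<rho> S S = 2 * of_bool (idx_sign M \<sigma> \<rho> S S = 1) - 1"
        using Y.idx_sign_cases[of S S] by auto
    qed
    also have "\<dots> = 2 * real (card {S \<in> idx M. idx_sign M \<sigma> \<rho> S S = 1}) - 4 ^ M"
      by (simp add: sum_subtractf sum_distrib_left[symmetric] card_idx Int_def)
    finally show ?thesis .
  qed
  have "card {S \<in> idx M. idx_sign M \<sigma>' \<rho>' S S = 1} = card {S \<in> idx M. idx_sign M \<sigma> \<rho> S S = 1}"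
    using card_positive_le[OF y y'] card_positive_le[OF y' y] by simp
  then show ?thesis using *[OF y(1)] *[OF y'(1)] by (simp add: sum_idx_sign)
qed

section \<open>Pauli families from generators\<close>

text \<open>Stated for arbitrary monoids, because \<open>gen_pair\<close> and
  \<open>monomial\<close> are evaluated in the algebra as well as in the grading group; an element
  and its degree are thus computed by the same recursion.\<close>

definition gen_pair :: "('a, 'm) monoid_scheme \<Rightarrow> 'a \<Rightarrow> 'a \<Rightarrow> bool \<Rightarrow> bool \<Rightarrow> 'a" where
  "gen_pair D x z u v = (if u then x else \<one>\<^bsub>D\<^esub>) \<otimes>\<^bsub>D\<^esub> (if v then z else \<one>\<^bsub>D\<^esub>)"

primrec monomial :: "('a, 'm) monoid_scheme \<Rightarrow> (nat \<Rightarrow> 'a) \<Rightarrow> (nat \<Rightarrow> 'a) \<Rightarrow> nat \<Rightarrow> nat set \<times> nat set \<Rightarrow> 'a" where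
  "monomial D a b 0 S = \<one>\<^bsub>D\<^esub>"
| "monomial D a b (Suc n) S = monomial D a b n S \<otimes>\<^bsub>D\<^esub> gen_pair D (a n) (b n) (n \<in> fst S) (n \<in> snd S)"

lemma gen_pair_update [simp]: "gen_pair (G\<lparr>carrier := H\<rparr>) x z u v = gen_pair G x z u v"
  by (simp add: gen_pair_def)

lemma monomial_update [simp]: "monomial (G\<lparr>carrier := H\<rparr>) a b n S = monomial G a b n S"
  by (induction n) simp_all

lemma monomial_cong:
  assumes "\<And>k. k < n \<Longrightarrow> a k = a' k" "\<And>k. k < n \<Longrightarrow> b k = b' k"
    and "\<And>k. k < n \<Longrightarrow> k \<in> fst S \<longleftrightarrow> k \<in> fst S'" "\<And>k. k < n \<Longrightarrow> k \<in> snd S \<longleftrightarrow> k \<in> snd S'"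
  shows "monomial G a b n S = monomial G a' b' n S'"
  using assms by (induction n) auto

context real_alg
begin

lemma gen_pair_closed [intro, simp]:
  "x \<in> carrier D \<Longrightarrow> z \<in> carrier D \<Longrightarrow> gen_pair D x z u v \<in> carrier D"
  by (simp add: gen_pair_def)

lemma gen_pair_mult:
  assumes cl: "x \<in> carrier D" "z \<in> carrier D"
    and rel: "x \<otimes> x = s *\<^sub>R \<one>" "z \<otimes> z = r *\<^sub>R \<one>" "z \<otimes> x = - (x \<otimes> z)"
  shows "gen_pair D x z u v \<otimes> gen_pair D x z u' v'
    = pair_sign s r u v u' v' *\<^sub>R gen_pair D x z (u \<noteq> u') (v \<noteq> v')"
proof -
  have rel': "x \<otimes> (x \<otimes> w) = s *\<^sub>R w" "z \<otimes> (z \<otimes> w) = r *\<^sub>R w" "z \<otimes> (x \<otimes> w) = - (x \<otimes> (z \<otimes> w))"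
    if "w \<in> carrier D" for w
    using that cl rel by (simp_all add: m_assoc[symmetric])
  show ?thesis
    by (cases u; cases v; cases u'; cases v')
      (use cl in \<open>simp_all add: gen_pair_def pair_sign_def m_assoc rel rel'\<close>)
qed

lemma mult_interchange:
  assumes "p \<in> carrier D" "q \<in> carrier D" "r \<in> carrier D" "s \<in> carrier D" "q \<otimes> r = r \<otimes> q"
  shows "p \<otimes> q \<otimes> (r \<otimes> s) = (p \<otimes> r) \<otimes> (q \<otimes> s)"
proof -
  have "q \<otimes> (r \<otimes> s) = r \<otimes> (q \<otimes> s)"
    using assms by (simp add: m_assoc[symmetric])
  then show ?thesis using assms by (simp add: m_assoc)
qed

lemma gen_pair_commute:
  assumes "x \<in> carrier D" "z \<in> carrier D" "w \<in> carrier D" "w \<otimes> x = x \<otimes> w" "w \<otimes> z = z \<otimes> w"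
  shows "w \<otimes> gen_pair D x z u v = gen_pair D x z u v \<otimes> w"
proof -
  have "w \<otimes> (x \<otimes> z) = x \<otimes> z \<otimes> w"
    using assms by (metis m_assoc)
  then show ?thesis using assms by (simp add: gen_pair_def)
qed

definition pauli_generators ::
  "nat \<Rightarrow> (nat \<Rightarrow> real) \<Rightarrow> (nat \<Rightarrow> real) \<Rightarrow> (nat \<Rightarrow> 'a) \<Rightarrow> (nat \<Rightarrow> 'a) \<Rightarrow> bool" where
  "pauli_generators M \<sigma> \<rho> a b \<longleftrightarrow>
     (\<forall>k<M. \<sigma> k \<in> {1, -1} \<and> \<rho> k \<in> {1, -1} \<and> a k \<in> carrier D \<and> b k \<in> carrier D \<and>
        a k \<otimes> a k = \<sigma> k *\<^sub>R \<one> \<and> b k \<otimes> b k = \<rho> k *\<^sub>R \<one> \<and>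
        (\<forall>l<M. a k \<otimes> a l = a l \<otimes> a k \<and> b k \<otimes> b l = b l \<otimes> b k \<and>
           b k \<otimes> a l = (if k = l then - (a l \<otimes> b k) else a l \<otimes> b k)))"

lemma monomial_closed:
  assumes "pauli_generators M \<sigma> \<rho> a b" "n \<le> M"
  shows "monomial D a b n S \<in> carrier D"
  using assms(2) by (induction n) (use assms(1) in \<open>auto simp: pauli_generators_def\<close>)

lemma monomial_commute:
  assumes "pauli_generators M \<sigma> \<rho> a b" "n \<le> M" "w \<in> carrier D"
    and "\<And>k. k < n \<Longrightarrow> w \<otimes> a k = a k \<otimes> w" "\<And>k. k < n \<Longrightarrow> w \<otimes> b k = b k \<otimes> w"
  shows "w \<otimes> monomial D a b n S = monomial D a b n S \<otimes> w"
  using assms(2,4,5)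
proof (induction n)
  case (Suc n)
  have cl: "monomial D a b n S \<in> carrier D" "a n \<in> carrier D" "b n \<in> carrier D"
    using assms(1) Suc.prems monomial_closed[OF assms(1), of n] by (auto simp: pauli_generators_def)
  let ?g = "gen_pair D (a n) (b n) (n \<in> fst S) (n \<in> snd S)"
  have IH: "w \<otimes> monomial D a b n S = monomial D a b n S \<otimes> w"
    using Suc by simp
  have "w \<otimes> ?g = ?g \<otimes> w"
    using Suc.prems cl assms(3) by (intro gen_pair_commute) auto
  then have "w \<otimes> (monomial D a b n S \<otimes> ?g) = monomial D a b n S \<otimes> (?g \<otimes> w)"
    using IH cl assms(3) by (metis gen_pair_closed m_assoc)
  then show ?case using cl assms(3) by (simp add: m_assoc)
qed (use assms(3) in simp)

text \<open>Generators of different positions commute, so the last pair of the left factor can be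
  moved past the earlier pairs of the right one; the sign then splits off the factor of the last
  position.\<close>

lemma monomial_mult:
  assumes gen: "pauli_generators M \<sigma> \<rho> a b" and "n \<le> M"
  shows "monomial D a b n S \<otimes> monomial D a b n S'
    = idx_sign n \<sigma> \<rho> S S' *\<^sub>R monomial D a b n (idx_add S S')"
  using assms(2)
proof (induction n)
  case (Suc n)
  let ?m = "monomial D a b n" and ?g = "\<lambda>S. gen_pair D (a n) (b n) (n \<in> fst S) (n \<in> snd S)"
  have cl: "?m S \<in> carrier D" "a n \<in> carrier D" "b n \<in> carrier D" for S
    using gen Suc.prems monomial_closed[OF gen, of n] by (auto simp: pauli_generators_def)
  then have gcl: "?g S \<in> carrier D" for S by simp
  have "?g S \<otimes> ?m S' = ?m S' \<otimes> ?g S"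
  proof (rule monomial_commute[OF gen])
    fix k assume k: "k < n"
    have rel: "a n \<otimes> a k = a k \<otimes> a n" "b n \<otimes> b k = b k \<otimes> b n" "b n \<otimes> a k = a k \<otimes> b n"
        "b k \<otimes> a n = a n \<otimes> b k" "a k \<in> carrier D" "b k \<in> carrier D"
      using gen Suc.prems k by (auto simp: pauli_generators_def)
    show "?g S \<otimes> a k = a k \<otimes> ?g S" "?g S \<otimes> b k = b k \<otimes> ?g S"
      using rel cl by (simp_all add: gen_pair_commute)
  qed (use Suc.prems gcl in auto)
  then have "?m S \<otimes> ?g S \<otimes> (?m S' \<otimes> ?g S') = (?m S \<otimes> ?m S') \<otimes> (?g S \<otimes> ?g S')"
    by (rule mult_interchange[OF cl(1) gcl cl(1) gcl])
  also have "?g S \<otimes> ?g S' = pair_sign (\<sigma> n) (\<rho> n) (n \<in> fst S) (n \<in> snd S) (n \<in> fst S') (n \<in> snd S')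
      *\<^sub>R ?g (idx_add S S')"
    unfolding mem_idx_add
    by (rule gen_pair_mult) (use gen Suc.prems in \<open>simp_all add: pauli_generators_def\<close>)
  also have "?m S \<otimes> ?m S' = idx_sign n \<sigma> \<rho> S S' *\<^sub>R ?m (idx_add S S')"
    using Suc by simp
  finally show ?case using cl gcl by (simp add: idx_sign_def mult.commute)
qed (simp add: idx_sign_def)

lemma pauli_family_monomial:
  assumes "pauli_generators M \<sigma> \<rho> a b" "\<one> \<noteq> 0"
  shows "pauli_family D M \<sigma> \<rho> (monomial D a b M)"
proof -
  have "monomial D a b n ({}, {}) = \<one>" for n
    by (induction n) (simp_all add: gen_pair_def)
  then show ?thesis
    using assms monomial_mult[OF assms(1) order.refl] monomial_closed[OF assms(1) order.refl] real_algebra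
    unfolding pauli_family_def by (auto simp: pauli_generators_def)
qed

end

section \<open>The standard Pauli families and matrix algebras\<close>

text \<open>The last of the \<open>r + 1\<close> pairs is special: its squares are
  \<open>\<epsilon>\<close> and \<open>-1\<close>, so it spans a copy of the real 2 by 2 matrices
  for \<open>\<epsilon> = 1\<close> and of the quaternions for \<open>\<epsilon> = -1\<close>. All
  other generators square to \<open>1\<close>. The square \<open>-1\<close> is reserved for the
  imaginary unit of the neutral component.\<close>

definition std_family ::
  "'a::real_vector monoid \<Rightarrow> real \<Rightarrow> nat \<Rightarrow> (nat set \<times> nat set \<Rightarrow> 'a) \<Rightarrow> bool" where
  "std_family D \<epsilon> r y \<longleftrightarrow>
     pauli_family D (Suc r) ((\<lambda>_. 1)(r := \<epsilon>)) ((\<lambda>_. 1)(r := -1)) y \<and>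
     carrier D = span (y ` idx (Suc r))"

lemma pauli_family_transfer:
  assumes y: "pauli_family D M \<sigma> \<rho> y" "carrier D = span (y ` idx M)"
    and D': "is_real_algebra D'" and \<phi>: "\<phi> \<in> alg_isos D D'"
  shows "pauli_family D' M \<sigma> \<rho> (\<phi> \<circ> y) \<and> carrier D' = span ((\<phi> \<circ> y) ` idx M)"
proof -
  interpret P: pauli D M \<sigma> \<rho> y by (rule pauliI) fact
  note p = alg_isosD[OF \<phi>]
  have inj: "inj_on \<phi> (carrier D)" using p(1) by (simp add: bij_betw_def)
  have one: "\<phi> \<one>\<^bsub>D\<^esub> = \<one>\<^bsub>D'\<^esub>" by (rule alg_isos_one[OF P.real_algebra D' \<phi>])
  have "\<one>\<^bsub>D'\<^esub> \<noteq> 0"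
    using inj_onD[OF inj, of "\<one>\<^bsub>D\<^esub>" 0] alg_isos_0[OF P.real_algebra \<phi>] P.one_neq_0 one by auto
  moreover have "(\<phi> \<circ> y) S \<otimes>\<^bsub>D'\<^esub> (\<phi> \<circ> y) S' = idx_sign M \<sigma> \<rho> S S' *\<^sub>R (\<phi> \<circ> y) (idx_add S S')"
    if "S \<in> idx M" "S' \<in> idx M" for S S'
    using that p(3)[of "y S" "y S'"] p(5)[of "y (idx_add S S')"] by (simp add: P.y_mult)
  moreover obtain f where f: "linear f" "\<And>x. x \<in> carrier D \<Longrightarrow> f x = \<phi> x"
    using alg_isos_linear_extension[OF P.real_algebra \<phi>] by blast
  have "carrier D' = f ` span (y ` idx M)"
    using p(1) f(2) y(2) by (metis bij_betw_imp_surj_on image_cong)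
  then have "carrier D' = span (f ` y ` idx M)"
    by (simp add: linear_span_image[OF f(1)])
  moreover have "f ` y ` idx M = (\<phi> \<circ> y) ` idx M"
    unfolding image_image by (rule image_cong[OF refl]) (simp add: f(2))
  ultimately show ?thesis
    using y(1) D' one p(2) unfolding pauli_family_def by (simp add: Pi_iff)
qed

lemma std_family_transfer:
  assumes "std_family D \<epsilon> r y" "is_real_algebra D'" "\<phi> \<in> alg_isos D D'"
  shows "std_family D' \<epsilon> r (\<phi> \<circ> y)"
  using assms pauli_family_transfer unfolding std_family_def by blast

lemma std_family_iso:
  assumes "std_family D \<epsilon> r y" "std_family D' \<epsilon> r y'"
  obtains f where "linear f" "f \<in> alg_isos D D'" "\<And>S. S \<in> idx (Suc r) \<Longrightarrow> f (y S) = y' S"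
  using assms pauli_iso unfolding std_family_def by metis

text \<open>Each ordinary pair contributes \<open>1 + 1 + 1 - 1 = 2\<close>, and the last one
  \<open>1 + \<epsilon> - 1 + \<epsilon> = 2 * \<epsilon>\<close>.\<close>

lemma std_sign_prod: "(\<Prod>k<Suc r. 1 + ((\<lambda>_. 1)(r := \<epsilon>)) k + ((\<lambda>_. 1)(r := -1)) k
    - ((\<lambda>_. 1)(r := \<epsilon>)) k * ((\<lambda>_. 1)(r := -1)) k) = 2 ^ Suc r * (\<epsilon>::real)"
proof -
  have "(\<Prod>k<r. 1 + ((\<lambda>_. 1)(r := \<epsilon>)) k + ((\<lambda>_. 1)(r := -1)) k
    - ((\<lambda>_. 1)(r := \<epsilon>)) k * ((\<lambda>_. 1)(r := -1)) k) = (\<Prod>k<r. 2::real)"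
    by (rule prod.cong) auto
  then show ?thesis by simp
qed

section \<open>Centers and bases of matrix algebras\<close>

definition central_algebra :: "'a::real_vector monoid \<Rightarrow> bool" where
  "central_algebra D \<longleftrightarrow>
     (\<forall>z\<in>carrier D. (\<forall>x\<in>carrier D. z \<otimes>\<^bsub>D\<^esub> x = x \<otimes>\<^bsub>D\<^esub> z) \<longrightarrow> (\<exists>t. z = t *\<^sub>R \<one>\<^bsub>D\<^esub>))"

lemma central_algebra_transfer:
  assumes "central_algebra D'" "is_real_algebra D" "is_real_algebra D'" "\<phi> \<in> alg_isos D D'"
  shows "central_algebra D"
  unfolding central_algebra_def
proof (intro ballI impI)
  interpret D: real_alg D by (rule real_algI) fact
  fix z assume z: "z \<in> carrier D" "\<forall>x\<in>carrier D. z \<otimes>\<^bsub>D\<^esub> x = x \<otimes>\<^bsub>D\<^esub> z"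
  note p = alg_isosD[OF assms(4)]
  have "\<phi> z \<otimes>\<^bsub>D'\<^esub> x = x \<otimes>\<^bsub>D'\<^esub> \<phi> z" if x: "x \<in> carrier D'" for x
  proof -
    obtain w where "w \<in> carrier D" "x = \<phi> w"
      using p(1) x unfolding bij_betw_def by blast
    then show ?thesis using p(3)[of z w] p(3)[of w z] z by simp
  qed
  then obtain t where "\<phi> z = t *\<^sub>R \<one>\<^bsub>D'\<^esub>"
    using assms(1) p(2)[OF z(1)] unfolding central_algebra_def by blast
  also have "\<dots> = \<phi> (t *\<^sub>R \<one>\<^bsub>D\<^esub>)"
    using p(5)[of "\<one>\<^bsub>D\<^esub>" t] alg_isos_one[OF assms(2,3,4)] by simp
  finally have "z = t *\<^sub>R \<one>\<^bsub>D\<^esub>"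
    using p(1) z(1) by (auto simp: bij_betw_def dest: inj_onD)
  then show "\<exists>t. z = t *\<^sub>R \<one>\<^bsub>D\<^esub>" by blast
qed

lemma matrix_real_algebra: "is_real_algebra (matrix_algebra :: ('k::real_algebra_1 ^ 'n ^ 'n) monoid)"
proof -
  have "A ** (B + C) = A ** B + A ** C" "(B + C) ** A = B ** A + C ** A"
      "A ** (c *\<^sub>R B) = c *\<^sub>R (A ** B)" "(c *\<^sub>R B) ** A = c *\<^sub>R (B ** A)"
    for A B C :: "'k ^ 'n ^ 'n" and c
    by (simp_all add: matrix_matrix_mult_def vec_eq_iff distrib_left distrib_right sum.distrib
        scaleR_sum_right)
  moreover have "monoid (matrix_algebra :: ('k ^ 'n ^ 'n) monoid)"
    by (rule monoidI) (simp_all add: matrix_algebra_def matrix_mul_assoc)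
  ultimately show ?thesis
    by (simp add: is_real_algebra_def linear_map_on_def matrix_algebra_def)
qed

lemma quat_real_algebra: "is_real_algebra quat_algebra"
proof -
  have "monoid quat_algebra"
    by (rule monoidI) (simp_all add: quat_algebra_def mult.assoc)
  then show ?thesis
    by (simp add: is_real_algebra_def linear_map_on_def quat_algebra_def distrib_left distrib_right)
qed

definition matrix_unit :: "'n \<Rightarrow> 'n \<Rightarrow> 'k \<Rightarrow> 'k::real_algebra_1 ^ 'n ^ 'n" where
  "matrix_unit p q c = (\<chi> i j. if i = p \<and> j = q then c else 0)"

text \<open>The basis consists of the matrices with a single nonzero entry taken from
  \<open>B\<close>. It serves to compare the dimension with powers of \<open>4\<close>.\<close>

lemma matrix_basis:
  fixes B :: "'k::real_algebra_1 set"
  assumes "finite B" "independent B" "span B = UNIV"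
  obtains C :: "('k ^ 'n ^ 'n) set" where "finite C" "independent C" "span C = UNIV"
    "card C = card B * CARD('n) * CARD('n)"
proof -
  define E :: "'n \<times> 'n \<times> 'k \<Rightarrow> 'k ^ 'n ^ 'n" where "E = (\<lambda>(p, q, c). matrix_unit p q c)"
  define I :: "('n \<times> 'n \<times> 'k) set" where "I = UNIV \<times> UNIV \<times> B"
  have fin: "finite I" using assms(1) by (simp add: I_def)
  have "c S = 0" if c: "(\<Sum>S\<in>I. c S *\<^sub>R E S) = 0" and S: "S \<in> I" for c S
  proof -
    obtain p q b where pqb: "S = (p, q, b)" "b \<in> B" using S by (auto simp: I_def)
    have "0 = (\<Sum>S\<in>I. c S *\<^sub>R E S) $ p $ q" using c by simp
    also have "\<dots> = (\<Sum>S\<in>I. c S *\<^sub>R (E S $ p $ q))" by simp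
    also have "\<dots> = (\<Sum>i\<in>UNIV. \<Sum>j\<in>UNIV. \<Sum>x\<in>B. c (i, j, x) *\<^sub>R (if p = i \<and> q = j then x else 0))"
      unfolding I_def E_def matrix_unit_def by (simp add: sum.cartesian_product' del: scaleR_eq_0_iff)
    also have "\<dots> = (\<Sum>i\<in>UNIV. \<Sum>j\<in>UNIV. if p = i then if q = j then \<Sum>x\<in>B. c (i, j, x) *\<^sub>R x else 0 else 0)"
      by (intro sum.cong refl) simp
    also have "\<dots> = (\<Sum>i\<in>UNIV. if p = i then \<Sum>j\<in>UNIV. if q = j then \<Sum>x\<in>B. c (i, j, x) *\<^sub>R x else 0 else 0)"
      by (intro sum.cong refl) simp
    also have "\<dots> = (\<Sum>x\<in>B. c (p, q, x) *\<^sub>R x)" by simp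
    finally have "(\<Sum>x\<in>B. c (p, q, x) *\<^sub>R x) = 0" by simp
    from independentD[OF assms(2,1) order.refl this pqb(2)] show ?thesis using pqb by simp
  qed
  then have inj: "inj_on E I" and ind: "independent (E ` I)"
    using independent_familyI[OF fin, of E] by blast+
  have E: "matrix_unit p q c \<in> span (E ` I)" for p q c
  proof -
    have lin: "linear (matrix_unit p q :: 'k \<Rightarrow> 'k ^ 'n ^ 'n)"
      by (rule linearI) (simp_all add: matrix_unit_def vec_eq_iff)
    have "matrix_unit p q c \<in> matrix_unit p q ` span B" using assms(3) by simp
    also have "\<dots> = span (matrix_unit p q ` B)" by (rule linear_span_image[OF lin, symmetric])
    also have "\<dots> \<subseteq> span (E ` I)"
      by (rule span_mono) (force simp: E_def I_def)
    finally show ?thesis .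
  qed
  have "A \<in> span (E ` I)" for A :: "'k ^ 'n ^ 'n"
  proof -
    have "A = (\<Sum>p\<in>UNIV. \<Sum>q\<in>UNIV. matrix_unit p q (A $ p $ q))"
    proof (subst vec_eq_iff, subst vec_eq_iff, intro allI)
      fix i j
      have "(\<Sum>p\<in>UNIV. \<Sum>q\<in>UNIV. matrix_unit p q (A $ p $ q)) $ i $ j
        = (\<Sum>p\<in>UNIV. \<Sum>q\<in>UNIV. if i = p then if j = q then A $ p $ q else 0 else 0)"
        unfolding matrix_unit_def by (auto simp: intro!: sum.cong)
      also have "\<dots> = (\<Sum>p\<in>UNIV. if i = p then \<Sum>q\<in>UNIV. if j = q then A $ p $ q else 0 else 0)"
        by (intro sum.cong refl) simp
      finally show "A $ i $ j = (\<Sum>p\<in>UNIV. \<Sum>q\<in>UNIV. matrix_unit p q (A $ p $ q)) $ i $ j"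
        by simp
    qed
    also have "\<dots> \<in> span (E ` I)" by (intro span_sum E)
    finally show ?thesis .
  qed
  then have "span (E ` I) = UNIV" by auto
  moreover have "card (E ` I) = card B * CARD('n) * CARD('n)"
    using inj by (simp add: card_image I_def card_cartesian_product)
  ultimately show ?thesis using that[of "E ` I"] fin ind by simp
qed

text \<open>Comparing entries of \<open>z E\<close> and \<open>E z\<close>, where \<open>E\<close>
  has the single entry \<open>c\<close> at \<open>(p, q)\<close>: off-diagonal entries of
  \<open>z\<close> vanish, the diagonal ones coincide, and they commute with every scalar.\<close>

lemma central_matrix_algebra:
  assumes center: "\<And>c :: 'k::real_algebra_1. (\<And>x. c * x = x * c) \<Longrightarrow> \<exists>t. c = t *\<^sub>R 1"
  shows "central_algebra (matrix_algebra :: ('k ^ 'n ^ 'n) monoid)"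
  unfolding central_algebra_def matrix_algebra_def
proof (simp, intro allI impI)
  fix z :: "'k ^ 'n ^ 'n" assume z: "\<forall>x. z ** x = x ** z"
  have entry: "z $ i $ p * c = (if i = p then c * z $ q $ q else 0)" for i p q c
  proof -
    have "(z ** matrix_unit p q c) $ i $ q = (\<Sum>k\<in>UNIV. if k = p then z $ i $ k * c else 0)"
      unfolding matrix_matrix_mult_def matrix_unit_def vec_lambda_beta by (intro sum.cong refl) auto
    moreover have "(matrix_unit p q c ** z) $ i $ q = (\<Sum>k\<in>UNIV. if k = q then if i = p then c * z $ k $ q else 0 else 0)"
      unfolding matrix_matrix_mult_def matrix_unit_def vec_lambda_beta by (intro sum.cong refl) auto
    ultimately show ?thesis using z by simp
  qed
  fix p :: 'n
  have "z $ p $ p * x = x * z $ p $ p" for x using entry[of p p x p] by simp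
  then obtain t where t: "z $ p $ p = t *\<^sub>R 1" using center by blast
  have "z $ i $ j = t *\<^sub>R (mat 1 :: 'k ^ 'n ^ 'n) $ i $ j" for i j
    using entry[of i j 1 p] t by (simp add: mat_def)
  then show "\<exists>t. z = t *\<^sub>R mat 1" by (auto simp: vec_eq_iff)
qed

lemma quat_center:
  fixes c :: quat
  assumes "\<And>x. c * x = x * c"
  shows "\<exists>t. c = t *\<^sub>R 1"
proof -
  have "c = qRe c *\<^sub>R 1"
    using assms[of "Quat 0 1 0 0"] assms[of "Quat 0 0 1 0"]
    by (cases c) (simp add: times_quat_def one_quat_def scaleR_quat_def)
  then show ?thesis by blast
qed

lemma central_real_matrix: "central_algebra (matrix_algebra :: (real ^ 'n ^ 'n) monoid)"
  by (rule central_matrix_algebra) simp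

lemma central_quat_matrix: "central_algebra (matrix_algebra :: (quat ^ 'n ^ 'n) monoid)"
  by (rule central_matrix_algebra) (rule quat_center)

lemma real_basis: "finite {1::real}" "independent {1::real}" "span {1::real} = UNIV"
  by (auto simp: span_singleton)

lemma quat_sel_0: "qRe 0 = 0" "qI 0 = 0" "qJ 0 = 0" "qK 0 = 0"
  by (simp_all add: zero_quat_def)

lemma quat_basis:
  defines "B \<equiv> {Quat 1 0 0 0, Quat 0 1 0 0, Quat 0 0 1 0, Quat 0 0 0 1}"
  shows "finite B" "card B = 4" "independent B" "span B = UNIV"
proof -
  show fin: "finite B" and "card B = 4" by (simp_all add: B_def)
  have sum: "(\<Sum>x\<in>B. f x *\<^sub>R x) = Quat (f (Quat 1 0 0 0)) (f (Quat 0 1 0 0)) (f (Quat 0 0 1 0)) (f (Quat 0 0 0 1))" for f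
    by (simp add: B_def scaleR_quat_def plus_quat_def quat_sel_0)
  show "independent B"
    by (rule independent_if_scalars_zero[OF fin], subst (asm) sum, subst (asm) zero_quat_def)
      (auto simp: B_def)
  have "q \<in> span B" for q
  proof -
    have "q = (\<Sum>x\<in>B. (if x = Quat 1 0 0 0 then qRe q else if x = Quat 0 1 0 0 then qI q
        else if x = Quat 0 0 1 0 then qJ q else qK q) *\<^sub>R x)"
      by (subst sum) simp
    also have "\<dots> \<in> span B" by (intro span_sum span_scale span_base)
    finally show ?thesis .
  qed
  then show "span B = UNIV" by auto
qed

text \<open>
  Row and column indices of \<open>2 ^ m \<times> 2 ^ m\<close> matrices are read as bit strings of length \<open>m\<close>;
  \<open>shift_matrix\<close> flips one bit and \<open>phase_matrix\<close> is the sign of one bit.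
\<close>

definition shift_matrix :: "('n \<Rightarrow> 'n) \<Rightarrow> 'k::real_algebra_1 ^ 'n ^ 'n" where
  "shift_matrix f = (\<chi> p q. if q = f p then 1 else 0)"

definition phase_matrix :: "('n \<Rightarrow> bool) \<Rightarrow> 'k::real_algebra_1 ^ 'n ^ 'n" where
  "phase_matrix b = (\<chi> p q. if q = p then if b p then -1 else 1 else 0)"

lemma shift_matrix_mult: "(shift_matrix f ** A) $ p $ q = A $ f p $ q"
proof -
  have "(shift_matrix f ** A) $ p $ q = (\<Sum>k\<in>UNIV. if k = f p then A $ k $ q else 0)"
    unfolding matrix_matrix_mult_def shift_matrix_def vec_lambda_beta by (intro sum.cong refl) auto
  then show ?thesis by simp
qed

lemma phase_matrix_mult: "(phase_matrix b ** A) $ p $ q = (if b p then - A $ p $ q else A $ p $ q)"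
proof -
  have "(phase_matrix b ** A) $ p $ q = (\<Sum>k\<in>UNIV. if k = p then if b p then - A $ k $ q else A $ k $ q else 0)"
    unfolding matrix_matrix_mult_def phase_matrix_def vec_lambda_beta by (intro sum.cong refl) auto
  then show ?thesis by simp
qed

lemma mat_mult: "(mat c ** A) $ p $ q = c * A $ p $ q"
proof -
  have "(mat c ** A) $ p $ q = (\<Sum>k\<in>UNIV. if k = p then c * A $ k $ q else 0)"
    unfolding matrix_matrix_mult_def mat_def vec_lambda_beta by (intro sum.cong refl) auto
  then show ?thesis by simp
qed

lemma bit_flips_exist:
  assumes "CARD('n) = 2 ^ m"
  obtains flip :: "nat \<Rightarrow> 'n \<Rightarrow> 'n" and bit :: "nat \<Rightarrow> 'n \<Rightarrow> bool" where
    "\<And>k p. k < m \<Longrightarrow> flip k (flip k p) = p"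
    "\<And>k l p. k < m \<Longrightarrow> l < m \<Longrightarrow> flip k (flip l p) = flip l (flip k p)"
    "\<And>k l p. k < m \<Longrightarrow> l < m \<Longrightarrow> bit k (flip l p) \<longleftrightarrow> bit k p \<noteq> (k = l)"
proof -
  have "finite (UNIV :: 'n set)"
    using assms by (metis card.infinite power_eq_0_iff zero_neq_numeral)
  moreover have "card (UNIV :: 'n set) = card (Pow {..<m})" using assms by (simp add: card_Pow)
  ultimately obtain \<phi> :: "'n \<Rightarrow> nat set" where \<phi>: "bij_betw \<phi> UNIV (Pow {..<m})"
    using finite_same_card_bij[of UNIV "Pow {..<m}"] by auto
  define flip where "flip k p = inv_into UNIV \<phi> (sdiff (\<phi> p) {k})" for k p
  have P: "\<phi> p \<subseteq> {..<m}" for p using \<phi> by (auto simp: bij_betw_def)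
  have \<phi>flip: "\<phi> (flip k p) = sdiff (\<phi> p) {k}" if "k < m" for k p
  proof -
    have "sdiff (\<phi> p) {k} \<in> Pow {..<m}" using P[of p] that by (auto simp: sdiff_def)
    then have "sdiff (\<phi> p) {k} \<in> range \<phi>" using \<phi> by (simp add: bij_betw_def)
    then show ?thesis by (simp add: flip_def f_inv_into_f)
  qed
  have inj: "\<phi> p = \<phi> q \<Longrightarrow> p = q" for p q using \<phi> by (auto simp: bij_betw_def dest: injD)
  show ?thesis
  proof (rule that[of flip "\<lambda>k p. k \<in> \<phi> p"])
    fix k l p assume k: "k < m"
    show "flip k (flip k p) = p" by (rule inj) (auto simp: \<phi>flip k sdiff_def)
    assume l: "l < m"
    show "flip k (flip l p) = flip l (flip k p)" by (rule inj) (auto simp: \<phi>flip k l sdiff_def)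
    show "k \<in> \<phi> (flip l p) \<longleftrightarrow> (k \<in> \<phi> p) \<noteq> (k = l)" by (auto simp: \<phi>flip l sdiff_def)
  qed
qed

lemma std_family_real_matrix:
  assumes "CARD('n) = 2 ^ Suc r"
  shows "\<exists>y. std_family (matrix_algebra :: (real ^ 'n ^ 'n) monoid) 1 r y"
proof -
  let ?D = "matrix_algebra :: (real ^ 'n ^ 'n) monoid"
  interpret D: real_alg ?D by (rule real_algI[OF matrix_real_algebra])
  obtain flip :: "nat \<Rightarrow> 'n \<Rightarrow> 'n" and bit where
    f: "\<And>k p. k < Suc r \<Longrightarrow> flip k (flip k p) = p"
      "\<And>k l p. k < Suc r \<Longrightarrow> l < Suc r \<Longrightarrow> flip k (flip l p) = flip l (flip k p)"
    and b: "\<And>k l p. k < Suc r \<Longrightarrow> l < Suc r \<Longrightarrow> bit k (flip l p) \<longleftrightarrow> bit k p \<noteq> (k = l)"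
    using bit_flips_exist[OF assms] by blast
  let ?X = "\<lambda>k. shift_matrix (flip k) :: real ^ 'n ^ 'n"
  \<comment> \<open>Shift and phase of the same bit anticommute and square to \<open>1\<close>;
    their product still anticommutes with the shift but squares to \<open>-1\<close>, as the last
    pair of a standard family demands.\<close>
  let ?Z = "\<lambda>k. (if k = r then shift_matrix (flip k) ** phase_matrix (bit k) else phase_matrix (bit k)) :: real ^ 'n ^ 'n"
  have sh: "shift_matrix (flip k) $ p $ q = (if q = flip k p then 1 else 0::real)" for k p q
    by (simp add: shift_matrix_def)
  have ph: "phase_matrix (bit k) $ p $ q = (if q = p then if bit k p then -1 else 1 else 0::real)" for k p q
    by (simp add: phase_matrix_def)
  have one: "\<one>\<^bsub>?D\<^esub> = mat 1" and mult: "A \<otimes>\<^bsub>?D\<^esub> B = A ** B" and car: "carrier ?D = UNIV" for A B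
    by (simp_all add: matrix_algebra_def)
  have gen: "D.pauli_generators (Suc r) ((\<lambda>_. 1)(r := 1)) ((\<lambda>_. 1)(r := -1)) ?X ?Z"
    unfolding D.pauli_generators_def one mult car
    by (auto simp: vec_eq_iff matrix_mul_assoc[symmetric] shift_matrix_mult phase_matrix_mult
        sh ph mat_def f b)
  have "\<one>\<^bsub>?D\<^esub> \<noteq> 0" unfolding one by (simp add: vec_eq_iff mat_def)
  then have "pauli_family ?D (Suc r) ((\<lambda>_. 1)(r := 1)) ((\<lambda>_. 1)(r := -1)) (monomial ?D ?X ?Z (Suc r))"
    by (rule D.pauli_family_monomial[OF gen])
  moreover from this interpret P: pauli ?D "Suc r" "(\<lambda>_. 1)(r := 1)" "(\<lambda>_. 1)(r := -1)" "monomial ?D ?X ?Z (Suc r)"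
    by (rule pauliI)
  obtain C :: "(real ^ 'n ^ 'n) set" where "finite C" "span C = UNIV" "card C = CARD('n) * CARD('n)"
    by (rule matrix_basis[OF real_basis]) simp
  then have "carrier ?D = span (monomial ?D ?X ?Z (Suc r) ` idx (Suc r))"
    using assms by (intro P.spanning_if_small[of C]) (auto simp: power_mult_distrib[symmetric])
  ultimately show ?thesis unfolding std_family_def by blast
qed

lemma std_family_quat_matrix:
  assumes "CARD('n) = 2 ^ r"
  shows "\<exists>y. std_family (matrix_algebra :: (quat ^ 'n ^ 'n) monoid) (-1) r y"
proof -
  let ?D = "matrix_algebra :: (quat ^ 'n ^ 'n) monoid"
  interpret D: real_alg ?D by (rule real_algI[OF matrix_real_algebra])
  obtain flip :: "nat \<Rightarrow> 'n \<Rightarrow> 'n" and bit where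
    f: "\<And>k p. k < r \<Longrightarrow> flip k (flip k p) = p"
      "\<And>k l p. k < r \<Longrightarrow> l < r \<Longrightarrow> flip k (flip l p) = flip l (flip k p)"
    and b: "\<And>k l p. k < r \<Longrightarrow> l < r \<Longrightarrow> bit k (flip l p) \<longleftrightarrow> bit k p \<noteq> (k = l)"
    using bit_flips_exist[OF assms] by blast
  \<comment> \<open>The last pair consists of the quaternions j and i as scalar matrices, which
    commute with the real shift and phase matrices. It accounts for the factor \<open>4\<close> in
    the dimension, so only \<open>r\<close> bits are needed for \<open>r + 1\<close> pairs.\<close>
  let ?X = "\<lambda>k. (if k = r then mat (Quat 0 0 1 0) else shift_matrix (flip k)) :: quat ^ 'n ^ 'n"
  let ?Z = "\<lambda>k. (if k = r then mat (Quat 0 1 0 0) else phase_matrix (bit k)) :: quat ^ 'n ^ 'n"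
  have sh: "shift_matrix (flip k) $ p $ q = (if q = flip k p then 1 else 0::quat)" for k p q
    by (simp add: shift_matrix_def)
  have ph: "phase_matrix (bit k) $ p $ q = (if q = p then if bit k p then -1 else 1 else 0::quat)" for k p q
    by (simp add: phase_matrix_def)
  have one: "\<one>\<^bsub>?D\<^esub> = mat 1" and mult: "A \<otimes>\<^bsub>?D\<^esub> B = A ** B" and car: "carrier ?D = UNIV" for A B
    by (simp_all add: matrix_algebra_def)
  have mt: "mat c $ p $ q = (if p = q then c else 0::quat)" for c p q
    by (simp add: mat_def)
  have q: "Quat 0 0 1 0 * Quat 0 0 1 0 = -1" "Quat 0 1 0 0 * Quat 0 1 0 0 = -1"
      "Quat 0 1 0 0 * Quat 0 0 1 0 = - (Quat 0 0 1 0 * Quat 0 1 0 0)"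
    by (simp_all add: times_quat_def one_quat_def uminus_quat_def)
  have gen: "D.pauli_generators (Suc r) ((\<lambda>_. 1)(r := -1)) ((\<lambda>_. 1)(r := -1)) ?X ?Z"
    unfolding D.pauli_generators_def one mult car
    by (auto simp: vec_eq_iff matrix_mul_assoc[symmetric] shift_matrix_mult phase_matrix_mult mat_mult
        sh ph mt f b q)
  have "\<one>\<^bsub>?D\<^esub> \<noteq> 0" unfolding one by (simp add: vec_eq_iff mat_def)
  then have "pauli_family ?D (Suc r) ((\<lambda>_. 1)(r := -1)) ((\<lambda>_. 1)(r := -1)) (monomial ?D ?X ?Z (Suc r))"
    by (rule D.pauli_family_monomial[OF gen])
  moreover from this interpret P: pauli ?D "Suc r" "(\<lambda>_. 1)(r := -1)" "(\<lambda>_. 1)(r := -1)" "monomial ?D ?X ?Z (Suc r)"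
    by (rule pauliI)
  obtain C :: "(quat ^ 'n ^ 'n) set" where "finite C" "span C = UNIV" "card C = 4 * CARD('n) * CARD('n)"
    by (rule matrix_basis[OF quat_basis(1,3,4)]) (simp add: quat_basis(2))
  then have "carrier ?D = span (monomial ?D ?X ?Z (Suc r) ` idx (Suc r))"
    using assms by (intro P.spanning_if_small[of C]) (auto simp: power_mult_distrib[symmetric])
  ultimately show ?thesis unfolding std_family_def by blast
qed

section \<open>Elementary abelian 2-groups\<close>

definition idx_restrict :: "nat \<Rightarrow> nat set \<times> nat set \<Rightarrow> nat set \<times> nat set" where
  "idx_restrict n S = (fst S - {n}, snd S - {n})"

lemma idx_restrict_in: "S \<in> idx (Suc n) \<Longrightarrow> idx_restrict n S \<in> idx n"
  by (auto simp: idx_def idx_restrict_def)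

locale elem2 = comm_group K for K (structure) +
  assumes square [simp]: "x \<in> carrier K \<Longrightarrow> x \<otimes> x = \<one>"
begin

lemma square_assoc [simp]:
  "x \<in> carrier K \<Longrightarrow> y \<in> carrier K \<Longrightarrow> x \<otimes> (x \<otimes> y) = y"
  "x \<in> carrier K \<Longrightarrow> y \<in> carrier K \<Longrightarrow> x \<otimes> (y \<otimes> x) = y"
  by (simp add: m_assoc[symmetric]) (metis m_comm m_assoc square r_one)

lemma inv_self [simp]: "x \<in> carrier K \<Longrightarrow> inv x = x"
  by (rule inv_equality) simp_all

text \<open>The factors over \<open>U \<inter> V\<close> occur twice and cancel.\<close>

lemma finprod_sdiff:
  assumes "finite U" "finite V" "c \<in> U \<union> V \<rightarrow> carrier K"
  shows "finprod K c (sdiff U V) = finprod K c U \<otimes> finprod K c V"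
proof -
  have c: "finprod K c (U \<inter> V) \<in> carrier K" "finprod K c (U - V) \<in> carrier K" "finprod K c (V - U) \<in> carrier K"
    using assms(3) by (auto intro!: finprod_closed)
  have "finprod K c ((U - V) \<union> (U \<inter> V)) = finprod K c (U - V) \<otimes> finprod K c (U \<inter> V)"
    using assms by (intro finprod_Un_disjoint) auto
  moreover have "(U - V) \<union> (U \<inter> V) = U" by blast
  moreover have "finprod K c ((U \<inter> V) \<union> (V - U)) = finprod K c (U \<inter> V) \<otimes> finprod K c (V - U)"
    using assms by (intro finprod_Un_disjoint) auto
  moreover have "(U \<inter> V) \<union> (V - U) = V" by blast
  moreover have "finprod K c (sdiff U V) = finprod K c (U - V) \<otimes> finprod K c (V - U)"
    unfolding sdiff_def using assms by (intro finprod_Un_disjoint) auto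
  ultimately show ?thesis using c by (simp add: m_assoc)
qed

lemma finprod_fun_upd:
  assumes "U \<subseteq> {..<Suc k}" "c \<in> {..<k} \<rightarrow> carrier K" "t \<in> carrier K"
  shows "finprod K (c(k := t)) U = finprod K c (U - {k}) \<otimes> (if k \<in> U then t else \<one>)"
proof -
  have sub: "U - {k} \<subseteq> {..<k}" using assms(1) by auto
  then have fin: "finite (U - {k})" by (rule finite_subset) simp
  have c: "c \<in> U - {k} \<rightarrow> carrier K" using sub assms(2) by auto
  have eq: "finprod K (c(k := t)) (U - {k}) = finprod K c (U - {k})"
    using c by (intro finprod_cong') auto
  show ?thesis
  proof (cases "k \<in> U")
    case True
    have "finprod K (c(k := t)) (insert k (U - {k})) = t \<otimes> finprod K (c(k := t)) (U - {k})"
      using fin c assms(3) by (subst finprod_insert) auto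
    then show ?thesis using True c assms(3) eq by (simp add: insert_absorb m_comm)
  next
    case False
    then show ?thesis using c eq by simp
  qed
qed

text \<open>A longest tuple with distinct subset products exists because \<open>2 ^ k\<close> is
  bounded by the order of the group. It generates, since an element that is not a subset product
  could be appended.\<close>

lemma elem2_basis:
  assumes "finite (carrier K)"
  obtains k :: nat and c where "c \<in> {..<k} \<rightarrow> carrier K" "bij_betw (finprod K c) (Pow {..<k}) (carrier K)"
proof -
  define Q where "Q k \<longleftrightarrow> (\<exists>c. c \<in> {..<k} \<rightarrow> carrier K \<and> inj_on (finprod K c) (Pow {..<k}))" for k :: nat
  have "Q 0" by (simp add: Q_def)
  moreover have "k \<le> card (carrier K)" if Qk: "Q k" for k
  proof -
    obtain c where c: "c \<in> {..<k} \<rightarrow> carrier K" "inj_on (finprod K c) (Pow {..<k})"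
      using Qk by (auto simp: Q_def)
    have "finprod K c ` Pow {..<k} \<subseteq> carrier K" using c(1) by (auto intro!: finprod_closed)
    then have "card (Pow {..<k}) \<le> card (carrier K)" using card_inj_on_le[OF c(2) _ assms] by simp
    then have "2 ^ k \<le> card (carrier K)" by (simp add: card_Pow)
    with less_exp[of k] show ?thesis by linarith
  qed
  ultimately obtain k where k: "Q k" "\<And>j. Q j \<Longrightarrow> j \<le> k"
    using GreatestI_nat[of Q 0] Greatest_le_nat[of Q] by metis
  then obtain c where c: "c \<in> {..<k} \<rightarrow> carrier K" "inj_on (finprod K c) (Pow {..<k})"
    by (auto simp: Q_def)
  have sub: "finprod K c U \<in> carrier K" if "U \<subseteq> {..<k}" for U
    using c(1) that by (auto intro!: finprod_closed)
  have "carrier K \<subseteq> finprod K c ` Pow {..<k}"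
  proof (rule subsetI, rule ccontr)
    fix t assume t: "t \<in> carrier K" "t \<notin> finprod K c ` Pow {..<k}"
    have "inj_on (finprod K (c(k := t))) (Pow {..<Suc k})"
    proof (rule inj_onI)
      fix U V assume "U \<in> Pow {..<Suc k}" "V \<in> Pow {..<Suc k}"
      then have UV: "U \<subseteq> {..<Suc k}" "V \<subseteq> {..<Suc k}" by auto
      then have UV': "U - {k} \<subseteq> {..<k}" "V - {k} \<subseteq> {..<k}" by auto
      assume "finprod K (c(k := t)) U = finprod K (c(k := t)) V"
      then have eq: "finprod K c (U - {k}) \<otimes> (if k \<in> U then t else \<one>)
          = finprod K c (V - {k}) \<otimes> (if k \<in> V then t else \<one>)"
        using UV c(1) t(1) by (simp only: finprod_fun_upd)
      have sd: "sdiff (U - {k}) (V - {k}) \<in> Pow {..<k}" using UV' by (auto simp: sdiff_def)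
      have sdeq: "finprod K c (sdiff (U - {k}) (V - {k})) = finprod K c (U - {k}) \<otimes> finprod K c (V - {k})"
        using UV' c(1) finite_subset[OF UV'(1)] finite_subset[OF UV'(2)] by (intro finprod_sdiff) auto
      have t_eq: "t = p \<otimes> q" if "p \<in> carrier K" "q \<in> carrier K" "p \<otimes> t = q" for p q
        using that t(1) by auto
      \<comment> \<open>If only one of \<open>U\<close>, \<open>V\<close> contained
        \<open>k\<close>, then solving for \<open>t\<close> would present it as a subset product of
        the old tuple.\<close>
      have kk: "k \<in> U \<longleftrightarrow> k \<in> V"
      proof (rule ccontr)
        assume "\<not> (k \<in> U \<longleftrightarrow> k \<in> V)"
        then have "t = finprod K c (U - {k}) \<otimes> finprod K c (V - {k})"
          using eq sub[OF UV'(1)] sub[OF UV'(2)] t(1)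
            t_eq[of "finprod K c (U - {k})" "finprod K c (V - {k})"]
            t_eq[of "finprod K c (V - {k})" "finprod K c (U - {k})"]
          by (cases "k \<in> U"; cases "k \<in> V") (simp_all add: m_comm)
        then have "t \<in> finprod K c ` Pow {..<k}" using sd sdeq by (intro image_eqI[OF _ sd]) simp
        then show False using t(2) by contradiction
      qed
      then have "finprod K c (U - {k}) = finprod K c (V - {k})"
        using eq sub[OF UV'(1)] sub[OF UV'(2)] t(1) by (auto split: if_splits)
      then have "U - {k} = V - {k}" using inj_onD[OF c(2)] UV' by blast
      then show "U = V" using kk by blast
    qed
    moreover have "c(k := t) \<in> {..<Suc k} \<rightarrow> carrier K" using c(1) t(1) by (auto simp: less_Suc_eq)
    ultimately have "Q (Suc k)" unfolding Q_def by blast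
    then show False using k(2) by fastforce
  qed
  then have "bij_betw (finprod K c) (Pow {..<k}) (carrier K)"
    using c(2) sub by (auto simp: bij_betw_def)
  then show ?thesis using that c(1) by blast
qed

text \<open>The arrangement of factors used in \<open>symplectic_basis\<close>, all \<open>a\<close>
  before all \<open>b\<close>; \<open>monomial\<close> interleaves them, which makes no difference
  in an abelian group.\<close>

definition idx_prod :: "(nat \<Rightarrow> 'a) \<Rightarrow> (nat \<Rightarrow> 'a) \<Rightarrow> nat set \<times> nat set \<Rightarrow> 'a" where
  "idx_prod a b S = finprod K a (fst S) \<otimes> finprod K b (snd S)"

lemma gen_pair_closed [intro, simp]: "a \<in> carrier K \<Longrightarrow> b \<in> carrier K \<Longrightarrow> gen_pair K a b u v \<in> carrier K"
  by (simp add: gen_pair_def)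

lemma idx_prod_closed:
  assumes "\<And>i. i < n \<Longrightarrow> a i \<in> carrier K" "\<And>i. i < n \<Longrightarrow> b i \<in> carrier K" "S \<in> idx n"
  shows "idx_prod a b S \<in> carrier K"
  unfolding idx_prod_def using assms by (intro m_closed finprod_closed) (auto simp: idx_def)

lemma idx_prod_Suc:
  assumes "\<And>i. i < n \<Longrightarrow> a i \<in> carrier K" "\<And>i. i < n \<Longrightarrow> b i \<in> carrier K"
    and "x \<in> carrier K" "y \<in> carrier K" "S \<in> idx (Suc n)"
  shows "idx_prod (a(n := x)) (b(n := y)) S
    = idx_prod a b (idx_restrict n S) \<otimes> gen_pair K x y (n \<in> fst S) (n \<in> snd S)"
proof -
  have S: "fst S \<subseteq> {..<Suc n}" "snd S \<subseteq> {..<Suc n}" using assms(5) by (auto simp: idx_def)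
  have "fst S - {n} \<subseteq> {..<n}" "snd S - {n} \<subseteq> {..<n}" using S by auto
  then have "finprod K a (fst S - {n}) \<in> carrier K" "finprod K b (snd S - {n}) \<in> carrier K"
    using assms(1,2) by (auto intro!: finprod_closed)
  then show ?thesis
    using S assms unfolding idx_prod_def idx_restrict_def gen_pair_def
    by (subst (1 2) finprod_fun_upd) (auto simp: m_ac)
qed

lemma monomial_idx_prod:
  assumes "\<And>i. i < n \<Longrightarrow> a i \<in> carrier K" "\<And>i. i < n \<Longrightarrow> b i \<in> carrier K" "S \<in> idx n"
  shows "monomial K a b n S = idx_prod a b S"
  using assms
proof (induction n arbitrary: S)
  case 0
  then show ?case by (simp add: idx_def idx_prod_def)
next
  case (Suc n)
  have "monomial K a b n S = monomial K a b n (idx_restrict n S)"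
    by (rule monomial_cong) (auto simp: idx_restrict_def)
  also have "\<dots> = idx_prod a b (idx_restrict n S)"
    using Suc idx_restrict_in by simp
  also have "\<dots> \<otimes> gen_pair K (a n) (b n) (n \<in> fst S) (n \<in> snd S) = idx_prod (a(n := a n)) (b(n := b n)) S"
    using Suc.prems by (intro idx_prod_Suc[symmetric]) simp_all
  finally show ?case by simp
qed

end

lemma elem2_iff: "elem2 K \<longleftrightarrow> elementary_abelian_2_group K"
  by (auto simp: elem2_def elem2_axioms_def elementary_abelian_2_group_def)

section \<open>Powers of the group of order two, with subsets as coordinates\<close>

lemma carrier_Z2: "carrier (integer_mod_group 2) = {0, 1}"
  by (auto simp: carrier_integer_mod_group)

lemma carrier_Z2_power: "carrier (Z2_power k) = {..<k} \<rightarrow>\<^sub>E {0, 1}"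
  by (simp add: Z2_power_def carrier_Z2)

lemma Z2_power_mult:
  assumes "f \<in> carrier (Z2_power k)" "g \<in> carrier (Z2_power k)"
  shows "{i. i < k \<and> (f \<otimes>\<^bsub>Z2_power k\<^esub> g) i = 1} = sdiff {i. i < k \<and> f i = 1} {i. i < k \<and> g i = 1}"
proof -
  have "(f \<otimes>\<^bsub>Z2_power k\<^esub> g) i = 1 \<longleftrightarrow> (f i = 1) \<noteq> (g i = 1)" if "i < k" for i
  proof -
    have "f i = 0 \<or> f i = 1" "g i = 0 \<or> g i = 1"
      using assms that unfolding carrier_Z2_power by (auto simp: PiE_iff)
    then show ?thesis using that by (auto simp: Z2_power_def)
  qed
  then show ?thesis by (auto simp: sdiff_def)
qed

lemma monoid_Z2_power: "group (Z2_power k)"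
  unfolding Z2_power_def by simp

lemma bij_Z2_power: "bij_betw (\<lambda>f. {i. i < k \<and> f i = (1::int)}) ({..<k} \<rightarrow>\<^sub>E {0, 1}) (Pow {..<k})"
proof (rule bij_betw_byWitness[where f' = "\<lambda>S. \<lambda>i\<in>{..<k}. if i \<in> S then 1 else 0"])
  show "\<forall>f\<in>{..<k} \<rightarrow>\<^sub>E {0, 1}. (\<lambda>i\<in>{..<k}. if i \<in> {i. i < k \<and> f i = (1::int)} then 1 else 0) = f"
    by (auto intro!: ext simp: PiE_iff extensional_def restrict_def)
  show "(\<lambda>S. \<lambda>i\<in>{..<k}. if i \<in> S then 1 else 0) ` Pow {..<k} \<subseteq> {..<k} \<rightarrow>\<^sub>E {0, 1::int}"
    by (intro image_subsetI PiE_I) auto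
qed auto

text \<open>The order fixes the length of a basis, and subset products turn symmetric difference,
  the addition of \<open>Z2_power\<close>, into the group operation.\<close>

lemma elem2_iso_Z2_power:
  assumes "elem2 K" "finite (carrier K)" "card (carrier K) = 2 ^ k"
  shows "K \<cong> Z2_power k"
proof -
  interpret elem2 K by fact
  obtain c and j :: nat where c: "c \<in> {..<j} \<rightarrow> carrier K" "bij_betw (finprod K c) (Pow {..<j}) (carrier K)"
    by (rule elem2_basis[OF assms(2)])
  have "card (Pow {..<j}) = 2 ^ k" using bij_betw_same_card[OF c(2)] assms(3) by simp
  then have "j = k" by (simp add: card_Pow)
  let ?h = "\<lambda>f. finprod K c {i. i < k \<and> f i = (1::int)}"
  have "bij_betw (finprod K c \<circ> (\<lambda>f. {i. i < k \<and> f i = (1::int)})) ({..<k} \<rightarrow>\<^sub>E {0, 1}) (carrier K)"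
    using bij_betw_trans[OF bij_Z2_power c(2)[unfolded \<open>j = k\<close>]] .
  then have bij: "bij_betw ?h (carrier (Z2_power k)) (carrier K)"
    by (simp add: comp_def carrier_Z2_power)
  have "?h (f \<otimes>\<^bsub>Z2_power k\<^esub> g) = ?h f \<otimes>\<^bsub>K\<^esub> ?h g"
    if "f \<in> carrier (Z2_power k)" "g \<in> carrier (Z2_power k)" for f g
    unfolding Z2_power_mult[OF that] using c(1) \<open>j = k\<close> by (intro finprod_sdiff) auto
  then have "?h \<in> iso (Z2_power k) K"
    using bij by (auto simp: iso_def hom_def bij_betw_def)
  then have "Z2_power k \<cong> K" by (auto simp: is_iso_def)
  then show ?thesis by (rule group.iso_sym[OF monoid_Z2_power])
qed

lemma iso_Z2_powerD:
  assumes "comm_group K" "K \<cong> Z2_power k"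
  shows "elem2 K" "finite (carrier K)" "card (carrier K) = 2 ^ k"
proof -
  interpret comm_group K by fact
  obtain h where h: "h \<in> iso K (Z2_power k)" using assms(2) by (auto simp: is_iso_def)
  then have bij: "bij_betw h (carrier K) ({..<k} \<rightarrow>\<^sub>E {0, 1})"
    by (simp add: iso_def carrier_Z2_power)
  have "bij_betw ((\<lambda>f. {i. i < k \<and> f i = (1::int)}) \<circ> h) (carrier K) (Pow {..<k})"
    using bij_betw_trans[OF bij bij_Z2_power] .
  from bij_betw_same_card[OF this] bij_betw_finite[OF this]
  show "finite (carrier K)" "card (carrier K) = 2 ^ k" by (simp_all add: card_Pow)
  have hom: "h (x \<otimes>\<^bsub>K\<^esub> y) = h x \<otimes>\<^bsub>Z2_power k\<^esub> h y" if "x \<in> carrier K" "y \<in> carrier K" for x y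
    using h that by (auto simp: iso_def hom_def)
  have sq: "h x \<otimes>\<^bsub>Z2_power k\<^esub> h x = \<one>\<^bsub>Z2_power k\<^esub>" if "x \<in> carrier K" for x
  proof -
    have "h x \<in> {..<k} \<rightarrow>\<^sub>E {0, 1}" using bij that by (auto simp: bij_betw_def)
    then have "\<forall>i<k. h x i = 0 \<or> h x i = 1" by (auto simp: PiE_iff)
    then show ?thesis by (auto simp: Z2_power_def restrict_def)
  qed
  have "x \<otimes>\<^bsub>K\<^esub> x = \<one>\<^bsub>K\<^esub>" if "x \<in> carrier K" for x
  proof -
    have "h (x \<otimes>\<^bsub>K\<^esub> x) = h \<one>\<^bsub>K\<^esub>"
      using hom[OF that that] hom[OF one_closed one_closed] sq[OF that] sq[OF one_closed] by simp
    then show ?thesis using bij that by (auto simp: bij_betw_def dest: inj_onD)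
  qed
  then show "elem2 K" by unfold_locales
qed

section \<open>Quadratic forms\<close>

locale quad_form = elem2 K for K :: "('g, 'e) monoid_scheme" (structure) +
  fixes \<mu> :: "'g \<Rightarrow> int"
  assumes form: "quadratic_form K \<mu>"
begin

abbreviation \<beta> :: "'g \<Rightarrow> 'g \<Rightarrow> int" where "\<beta> \<equiv> assoc_bichar K \<mu>"

lemma mu_cases: "x \<in> carrier K \<Longrightarrow> \<mu> x = 1 \<or> \<mu> x = -1"
  using form by (auto simp: quadratic_form_def)

lemma mu_one [simp]: "\<mu> \<one> = 1"
  using form by (simp add: quadratic_form_def)

lemma mu_square: "x \<in> carrier K \<Longrightarrow> \<mu> x * \<mu> x = 1"
  using mu_cases by fastforce

lemma beta_cases: "x \<in> carrier K \<Longrightarrow> y \<in> carrier K \<Longrightarrow> \<beta> x y = 1 \<or> \<beta> x y = -1"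
  using mu_cases[of x] mu_cases[of y] mu_cases[of "x \<otimes> y"] by (auto simp: assoc_bichar_def)

lemma beta_sym: "x \<in> carrier K \<Longrightarrow> y \<in> carrier K \<Longrightarrow> \<beta> x y = \<beta> y x"
  by (simp add: assoc_bichar_def m_comm mult.commute mult.left_commute)

lemma beta_mult:
  "x \<in> carrier K \<Longrightarrow> y \<in> carrier K \<Longrightarrow> z \<in> carrier K \<Longrightarrow> \<beta> (x \<otimes> y) z = \<beta> x z * \<beta> y z"
  "x \<in> carrier K \<Longrightarrow> y \<in> carrier K \<Longrightarrow> z \<in> carrier K \<Longrightarrow> \<beta> z (x \<otimes> y) = \<beta> z x * \<beta> z y"
  using form by (simp_all add: quadratic_form_def)

lemma beta_self [simp]: "x \<in> carrier K \<Longrightarrow> \<beta> x x = 1"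
  using mu_square by (simp add: assoc_bichar_def)

lemma beta_one [simp]: "x \<in> carrier K \<Longrightarrow> \<beta> \<one> x = 1" "x \<in> carrier K \<Longrightarrow> \<beta> x \<one> = 1"
  using mu_square by (simp_all add: assoc_bichar_def)

lemma mu_mult:
  assumes "x \<in> carrier K" "y \<in> carrier K"
  shows "\<mu> (x \<otimes> y) = \<beta> x y * \<mu> x * \<mu> y"
  using mu_cases[OF assms(1)] mu_cases[OF assms(2)] by (auto simp: assoc_bichar_def)

text \<open>The commutation part of a symplectic basis, relative to a subset \<open>H\<close>, so
  that an induction can pass to orthogonal complements inside the same group.\<close>

definition orth_pairs :: "'g set \<Rightarrow> nat \<Rightarrow> (nat \<Rightarrow> 'g) \<Rightarrow> (nat \<Rightarrow> 'g) \<Rightarrow> bool" where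
  "orth_pairs H r a b \<longleftrightarrow> (\<forall>i<r. a i \<in> H \<and> b i \<in> H) \<and>
     (\<forall>i<r. \<forall>j<r. \<beta> (a i) (b j) = (if i = j then -1 else 1) \<and> \<beta> (b i) (a j) = (if i = j then -1 else 1) \<and>
        \<beta> (a i) (a j) = 1 \<and> \<beta> (b i) (b j) = 1)"

lemma symplectic_basis_iff:
  "symplectic_basis K \<mu> r a b \<longleftrightarrow> orth_pairs (carrier K) r a b \<and> bij_betw (idx_prod a b) (idx r) (carrier K)"
proof -
  have "(\<lambda>(S, S'). finprod K a S \<otimes> finprod K b S') = idx_prod a b"
    by (auto simp: idx_prod_def)
  then show ?thesis unfolding symplectic_basis_def orth_pairs_def idx_def by auto
qed

lemma beta_gen_pair:
  assumes "h \<in> carrier K" "a \<in> carrier K" "b \<in> carrier K" "\<beta> h a = 1" "\<beta> h b = 1"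
  shows "\<beta> h (gen_pair K a b u v) = 1"
  using assms by (simp add: gen_pair_def beta_mult)

lemma beta_idx_prod:
  assumes "\<And>i. i < n \<Longrightarrow> a i \<in> carrier K \<and> b i \<in> carrier K \<and> \<beta> (a i) w = 1 \<and> \<beta> (b i) w = 1"
    and "w \<in> carrier K" "S \<in> idx n"
  shows "\<beta> (idx_prod a b S) w = 1"
proof -
  have "finprod K c U \<in> carrier K \<and> \<beta> (finprod K c U) w = 1"
    if "U \<subseteq> {..<n}" "\<And>i. i < n \<Longrightarrow> c i \<in> carrier K \<and> \<beta> (c i) w = 1" for c U
  proof -
    have "finite U" using that(1) finite_subset by blast
    then show ?thesis using that(1)
    proof (induction U)
      case (insert i U)
      then have i: "c i \<in> carrier K" "\<beta> (c i) w = 1" "c \<in> U \<rightarrow> carrier K" using that(2) by auto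
      then show ?case using insert assms(2) by (simp add: beta_mult)
    qed (use assms(2) in simp)
  qed
  from this[of "fst S" a] this[of "snd S" b] show ?thesis
    using assms unfolding idx_prod_def by (auto simp: beta_mult idx_def)
qed

text \<open>A quadratic form is multiplicative on orthogonal elements; within one pair,
  \<open>\<beta> (a k) (b k) = -1\<close> contributes the additional sign.\<close>

lemma mu_idx_prod:
  assumes "orth_pairs (carrier K) r a b" "n \<le> r" "S \<in> idx n"
  shows "\<mu> (idx_prod a b S) = (\<Prod>k<n. (if k \<in> fst S then \<mu> (a k) else 1)
    * (if k \<in> snd S then \<mu> (b k) else 1) * (if k \<in> fst S \<and> k \<in> snd S then -1 else 1))"
  using assms(2,3)
proof (induction n arbitrary: S)
  case 0
  then show ?case by (simp add: idx_def idx_prod_def)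
next
  case (Suc n)
  note ab = assms(1)[unfolded orth_pairs_def]
  have n: "a n \<in> carrier K" "b n \<in> carrier K" using ab Suc.prems by auto
  let ?R = "idx_restrict n S"
  have R: "?R \<in> idx n" using Suc.prems idx_restrict_in by simp
  have Rcl: "idx_prod a b ?R \<in> carrier K"
    by (rule idx_prod_closed[OF _ _ R]) (use ab Suc.prems in auto)
  have "idx_prod (a(n := a n)) (b(n := b n)) S = idx_prod a b ?R \<otimes> gen_pair K (a n) (b n) (n \<in> fst S) (n \<in> snd S)"
    by (rule idx_prod_Suc) (use ab Suc.prems in auto)
  then have S: "idx_prod a b S = idx_prod a b ?R \<otimes> gen_pair K (a n) (b n) (n \<in> fst S) (n \<in> snd S)"
    by simp
  have "\<beta> (idx_prod a b ?R) (a n) = 1" "\<beta> (idx_prod a b ?R) (b n) = 1"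
    by (rule beta_idx_prod[OF _ _ R]; use ab Suc.prems in force)+
  then have "\<mu> (idx_prod a b S) = \<mu> (idx_prod a b ?R) * \<mu> (gen_pair K (a n) (b n) (n \<in> fst S) (n \<in> snd S))"
    unfolding S using Rcl n by (subst mu_mult) (simp_all add: beta_gen_pair)
  also have "\<mu> (gen_pair K (a n) (b n) (n \<in> fst S) (n \<in> snd S)) = (if n \<in> fst S then \<mu> (a n) else 1)
    * (if n \<in> snd S then \<mu> (b n) else 1) * (if n \<in> fst S \<and> n \<in> snd S then -1 else 1)"
    using n ab Suc.prems by (simp add: gen_pair_def mu_mult)
  also have "\<mu> (idx_prod a b ?R) = (\<Prod>k<n. (if k \<in> fst S then \<mu> (a k) else 1)
    * (if k \<in> snd S then \<mu> (b k) else 1) * (if k \<in> fst S \<and> k \<in> snd S then -1 else 1))"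
    using Suc.IH[OF _ R] Suc.prems by (auto simp: idx_restrict_def intro!: prod.cong)
  finally show ?case by simp
qed

text \<open>This Gauss sum expresses the Arf product without reference to the basis. Each hyperbolic
  pair contributes \<open>1 + \<mu> a + \<mu> b - \<mu> a * \<mu> b\<close>, which is twice its
  local factor.\<close>

lemma sum_mu_symplectic:
  assumes "symplectic_basis K \<mu> r a b"
  shows "(\<Sum>u\<in>carrier K. \<mu> u) = 2 ^ r * (\<Prod>i<r. arf_q (\<mu> (a i)) (\<mu> (b i)))"
    and "card (carrier K) = 4 ^ r"
proof -
  have ab: "orth_pairs (carrier K) r a b" and bij: "bij_betw (idx_prod a b) (idx r) (carrier K)"
    using assms by (simp_all add: symplectic_basis_iff)
  show "card (carrier K) = 4 ^ r" using bij_betw_same_card[OF bij] card_idx by simp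
  have "(\<Sum>u\<in>carrier K. \<mu> u) = (\<Sum>S\<in>idx r. \<mu> (idx_prod a b S))"
    using sum.reindex_bij_betw[OF bij, of \<mu>] by simp
  also have "\<dots> = (\<Sum>S\<in>idx r. \<Prod>k<r. (if k \<in> fst S then \<mu> (a k) else 1)
    * (if k \<in> snd S then \<mu> (b k) else 1) * (if k \<in> fst S \<and> k \<in> snd S then -1 else 1))"
    by (rule sum.cong[OF refl]) (rule mu_idx_prod[OF ab order.refl])
  also have "\<dots> = (\<Prod>k<r. 1 + \<mu> (b k) + \<mu> (a k) - \<mu> (a k) * \<mu> (b k))"
    by (subst sum_idx_prod[of "\<lambda>k u v. (if u then \<mu> (a k) else 1)
      * (if v then \<mu> (b k) else 1) * (if u \<and> v then -1 else 1)"]) simp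
  also have "\<dots> = (\<Prod>k<r. 2 * arf_q (\<mu> (a k)) (\<mu> (b k)))"
  proof (rule prod.cong[OF refl])
    fix k assume "k \<in> {..<r}"
    then have "a k \<in> carrier K" "b k \<in> carrier K" using ab by (auto simp: orth_pairs_def)
    then show "1 + \<mu> (b k) + \<mu> (a k) - \<mu> (a k) * \<mu> (b k) = 2 * arf_q (\<mu> (a k)) (\<mu> (b k))"
      using mu_cases[of "a k"] mu_cases[of "b k"] by (auto simp: arf_q_def)
  qed
  finally show "(\<Sum>u\<in>carrier K. \<mu> u) = 2 ^ r * (\<Prod>i<r. arf_q (\<mu> (a i)) (\<mu> (b i)))"
    by (simp add: prod.distrib)
qed

lemma bij_idx_Suc:
  "bij_betw (\<lambda>S. (idx_restrict n S, n \<in> fst S, n \<in> snd S)) (idx (Suc n)) (idx n \<times> UNIV)"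
  by (rule bij_betw_byWitness[where f' = "\<lambda>(S, u, v). ((if u then insert n (fst S) else fst S),
      (if v then insert n (snd S) else snd S))"])
    (auto simp: idx_restrict_def idx_def less_Suc_eq split: if_splits)

text \<open>
  One hyperbolic plane \<open>{a, b}\<close> is split off at a time.  If \<open>\<mu>\<close> has positive sum, then some
  \<open>a \<noteq> 1\<close> has \<open>\<mu> a = 1\<close>, one of \<open>b\<close>, \<open>a b\<close> has value \<open>1\<close>, and the orthogonal complement again has
  positive sum.
\<close>

lemma orth_pairs_exist:
  assumes "subgroup H K" "finite H" "\<And>t. t \<in> H \<Longrightarrow> \<forall>u\<in>H. \<beta> u t = 1 \<Longrightarrow> t = \<one>"
  shows "\<exists>r a b. orth_pairs H r a b \<and> bij_betw (idx_prod a b) (idx r) H \<and>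
    (0 < (\<Sum>u\<in>H. \<mu> u) \<longrightarrow> (\<forall>i<r. \<mu> (a i) = 1 \<and> \<mu> (b i) = 1))"
  using assms
proof (induction "card H" arbitrary: H rule: less_induct)
  case less
  interpret H: subgroup H K by fact
  have Hc: "x \<in> carrier K" if "x \<in> H" for x using that by simp
  note nondeg = less.prems(3)
  show ?case
  proof (cases "H = {\<one>}")
    case True
    have "orth_pairs H 0 a b" for a b by (simp add: orth_pairs_def)
    moreover have "bij_betw (idx_prod a b) (idx 0) H" for a b
      by (simp add: True idx_def idx_prod_def bij_betw_def)
    ultimately show ?thesis by (intro exI[of _ 0]) auto
  next
    case False
    have "\<exists>a\<in>H. a \<noteq> \<one> \<and> (0 < (\<Sum>u\<in>H. \<mu> u) \<longrightarrow> \<mu> a = 1)"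
    proof (rule ccontr)
      \<comment> \<open>If all nontrivial elements had value \<open>-1\<close>, the sum would be
        \<open>1 - (card H - 1)\<close>, which is not positive as \<open>H\<close> is
        nontrivial.\<close>
      assume "\<not> ?thesis"
      then have neg: "0 < (\<Sum>u\<in>H. \<mu> u)" "\<And>a. a \<in> H \<Longrightarrow> a \<noteq> \<one> \<Longrightarrow> \<mu> a = -1"
        using False H.one_closed mu_cases[OF Hc] by blast+
      have "(\<Sum>u\<in>H. \<mu> u) = \<mu> \<one> + (\<Sum>u\<in>H - {\<one>}. \<mu> u)"
        using less.prems(2) by (rule sum.remove) simp
      also have "(\<Sum>u\<in>H - {\<one>}. \<mu> u) = (\<Sum>u\<in>H - {\<one>}. -1)"
        using neg(2) by (intro sum.cong) auto
      finally have "(\<Sum>u\<in>H. \<mu> u) = 1 - int (card (H - {\<one>}))" by simp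
      moreover have "H - {\<one>} \<noteq> {}" using False H.one_closed by blast
      then have "card (H - {\<one>}) > 0" using less.prems(2) by (metis card_gt_0_iff finite_Diff)
      ultimately show False using neg(1) by simp
    qed
    then obtain a where a: "a \<in> H" "a \<noteq> \<one>" "0 < (\<Sum>u\<in>H. \<mu> u) \<Longrightarrow> \<mu> a = 1" by blast
    obtain b' where b': "b' \<in> H" "\<beta> b' a = -1"
      using nondeg[OF a(1)] a(2) beta_cases Hc a(1) by blast
    have "\<exists>b\<in>H. \<beta> b a = -1 \<and> (0 < (\<Sum>u\<in>H. \<mu> u) \<longrightarrow> \<mu> b = 1)"
    proof (cases "\<mu> b' = 1")
      case True
      then show ?thesis using b' by blast
    next
      case False
      then have "\<mu> b' = -1" using mu_cases Hc b' by blast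
      \<comment> \<open>The signs \<open>\<beta> a b' = -1\<close> and \<open>\<mu> b' = -1\<close>
        cancel, so the value at \<open>a b'\<close> is that at \<open>a\<close>; the pairing with
        \<open>a\<close> is unchanged.\<close>
      then have "\<mu> (a \<otimes> b') = \<mu> a" "\<beta> (a \<otimes> b') a = -1"
        using Hc a(1) b' by (simp_all add: mu_mult beta_mult beta_sym[of a b'])
      then show ?thesis using H.m_closed[OF a(1) b'(1)] a(3)
        by (intro bexI[of _ "a \<otimes> b'"]) simp_all
    qed
    then obtain b where b: "b \<in> H" "\<beta> b a = -1" "0 < (\<Sum>u\<in>H. \<mu> u) \<Longrightarrow> \<mu> b = 1" by blast
    have ab: "a \<in> carrier K" "b \<in> carrier K" "\<beta> a b = -1"
      using a b Hc beta_sym by simp_all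
    let ?e = "gen_pair K a b"
    have e: "?e u v \<in> H" for u v using a b by (simp add: gen_pair_def)
    then have ecl: "?e u v \<in> carrier K" for u v using Hc by blast
    have \<beta>e: "\<beta> (?e u v) a = (if v then -1 else 1)" "\<beta> (?e u v) b = (if u then -1 else 1)" for u v
      using ab b(2) by (simp_all add: gen_pair_def beta_mult)
    have esq: "h \<otimes> ?e u v \<otimes> ?e u v = h" if "h \<in> carrier K" for h u v
      using that ecl[of u v] by (simp add: m_assoc)
    define H' where "H' = {h \<in> H. \<beta> h a = 1 \<and> \<beta> h b = 1}"
    have H'c: "h \<in> H" "h \<in> carrier K" "\<beta> h a = 1" "\<beta> h b = 1" if "h \<in> H'" for h
      using that Hc by (auto simp: H'_def)
    have sub: "subgroup H' K"
      by (rule subgroupI) (auto simp: H'_def beta_mult ab Hc H.one_closed intro!: exI[of _ \<one>])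
    have fin: "finite H'" using less.prems(2) by (simp add: H'_def)
    have "a \<notin> H'" using ab by (simp add: H'_def)
    then have "H' \<subset> H" using a(1) by (auto simp: H'_def)
    then have card: "card H' < card H" using less.prems(2) by (rule psubset_card_mono[rotated])
    \<comment> \<open>Orthogonal splitting: the exponent of \<open>a\<close> is read off from the
      pairing with \<open>b\<close>, that of \<open>b\<close> from the pairing with
      \<open>a\<close>, and dividing out this part leaves an element of the complement.\<close>
    have bijH: "bij_betw (\<lambda>(h, u, v). h \<otimes> ?e u v) (H' \<times> UNIV) H"
    proof (rule bij_betw_byWitness[where f' = "\<lambda>h. (h \<otimes> ?e (\<beta> h b = -1) (\<beta> h a = -1), \<beta> h b = -1, \<beta> h a = -1)"])
      show "\<forall>x\<in>H' \<times> UNIV. (\<lambda>h. (h \<otimes> ?e (\<beta> h b = -1) (\<beta> h a = -1), \<beta> h b = -1, \<beta> h a = -1))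
          ((\<lambda>(h, u, v). h \<otimes> ?e u v) x) = x"
      proof
        fix x assume "x \<in> H' \<times> (UNIV :: (bool \<times> bool) set)"
        then obtain h u v where x: "x = (h, u, v)" "h \<in> H'" by (cases x) auto
        note h = H'c[OF x(2)]
        have "\<beta> (h \<otimes> ?e u v) b = (if u then -1 else 1)" "\<beta> (h \<otimes> ?e u v) a = (if v then -1 else 1)"
          using h ecl ab by (simp_all add: beta_mult \<beta>e)
        then have "(\<beta> (h \<otimes> ?e u v) b = -1) = u" "(\<beta> (h \<otimes> ?e u v) a = -1) = v" by simp_all
        then show "(\<lambda>h. (h \<otimes> ?e (\<beta> h b = -1) (\<beta> h a = -1), \<beta> h b = -1, \<beta> h a = -1))
          ((\<lambda>(h, u, v). h \<otimes> ?e u v) x) = x"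
          using esq[OF h(2)] by (simp add: x)
      qed
      show "\<forall>h\<in>H. (\<lambda>(h, u, v). h \<otimes> ?e u v)
          (h \<otimes> ?e (\<beta> h b = -1) (\<beta> h a = -1), \<beta> h b = -1, \<beta> h a = -1) = h"
        using esq Hc by simp
      show "(\<lambda>(h, u, v). h \<otimes> ?e u v) ` (H' \<times> UNIV) \<subseteq> H" using e H'c(1) by auto
      have "h \<otimes> ?e (\<beta> h b = -1) (\<beta> h a = -1) \<in> H'" if h: "h \<in> H" for h
        using h e ecl ab Hc[OF h] beta_cases[OF Hc[OF h] ab(1)] beta_cases[OF Hc[OF h] ab(2)]
        by (auto simp: H'_def beta_mult \<beta>e)
      then show "(\<lambda>h. (h \<otimes> ?e (\<beta> h b = -1) (\<beta> h a = -1), \<beta> h b = -1, \<beta> h a = -1)) ` H \<subseteq> H' \<times> UNIV"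
        by auto
    qed
    have decomp: "\<exists>h u v. h \<in> H' \<and> x = h \<otimes> ?e u v" if "x \<in> H" for x
      using bijH that by (auto simp: bij_betw_def)
    have nondeg': "t = \<one>" if t: "t \<in> H'" "\<forall>u\<in>H'. \<beta> u t = 1" for t
    proof (rule nondeg)
      show "t \<in> H" using H'c t by blast
      show "\<forall>u\<in>H. \<beta> u t = 1"
      proof
        fix x assume "x \<in> H"
        then obtain h u v where x: "h \<in> H'" "x = h \<otimes> ?e u v" using decomp by blast
        have "\<beta> t (?e u v) = 1" by (rule beta_gen_pair) (use H'c[OF t(1)] ab in auto)
        then have "\<beta> (?e u v) t = 1" using beta_sym[of t "?e u v"] H'c[OF t(1)] ecl by simp
        then show "\<beta> x t = 1" using x t H'c[OF t(1)] H'c[OF x(1)] ecl by (simp add: beta_mult)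
      qed
    qed
    \<comment> \<open>If the sum over \<open>H\<close> is positive, then
      \<open>\<mu> a = \<mu> b = 1\<close> and the first factor is \<open>2\<close>, so positivity
      passes to the complement.\<close>
    have sumH: "(\<Sum>u\<in>H. \<mu> u) = (1 + \<mu> a + \<mu> b - \<mu> a * \<mu> b) * (\<Sum>u\<in>H'. \<mu> u)"
    proof -
      have "(\<Sum>u\<in>H. \<mu> u) = (\<Sum>(h, u, v)\<in>H' \<times> UNIV. \<mu> (h \<otimes> ?e u v))"
        using sum.reindex_bij_betw[OF bijH, of \<mu>] by (simp add: case_prod_unfold)
      also have "\<dots> = (\<Sum>(h, u, v)\<in>H' \<times> UNIV. \<mu> h * \<mu> (?e u v))"
      proof (rule sum.cong[OF refl], clarify)
        fix h u v assume "h \<in> H'"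
        then show "\<mu> (h \<otimes> ?e u v) = \<mu> h * \<mu> (?e u v)"
          using H'c[of h] ecl ab by (simp add: mu_mult beta_gen_pair)
      qed
      also have "\<dots> = (\<Sum>h\<in>H'. \<Sum>(u, v)\<in>UNIV. \<mu> h * \<mu> (?e u v))"
        by (simp add: sum.cartesian_product' case_prod_unfold)
      also have "\<dots> = (\<Sum>h\<in>H'. \<mu> h * (\<Sum>(u, v)\<in>UNIV. \<mu> (?e u v)))"
        by (simp add: sum_distrib_left case_prod_unfold)
      also have "(\<Sum>(u, v)\<in>UNIV. \<mu> (?e u v)) = 1 + \<mu> a + \<mu> b - \<mu> a * \<mu> b"
        using ab by (simp add: UNIV_Times_UNIV[symmetric] sum.cartesian_product'[symmetric] UNIV_bool
            gen_pair_def mu_mult del: UNIV_Times_UNIV)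
      finally show ?thesis by (simp add: sum_distrib_right mult.commute)
    qed
    obtain r as bs where IH: "orth_pairs H' r as bs" "bij_betw (idx_prod as bs) (idx r) H'"
      "0 < (\<Sum>u\<in>H'. \<mu> u) \<Longrightarrow> \<forall>i<r. \<mu> (as i) = 1 \<and> \<mu> (bs i) = 1"
      using less.hyps[OF card sub fin nondeg'] by blast
    note IH1 = IH(1)[unfolded orth_pairs_def]
    have asc: "as i \<in> H'" "bs i \<in> H'" if "i < r" for i using IH1 that by auto
    have "orth_pairs H (Suc r) (as(r := a)) (bs(r := b))"
    proof -
      have x: "as i \<in> H" "bs i \<in> H" "\<beta> (as i) a = 1" "\<beta> (as i) b = 1" "\<beta> (bs i) a = 1" "\<beta> (bs i) b = 1"
          "\<beta> a (as i) = 1" "\<beta> b (as i) = 1" "\<beta> a (bs i) = 1" "\<beta> b (bs i) = 1" if "i < r" for i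
        using H'c[OF asc(1)[OF that]] H'c[OF asc(2)[OF that]] ab
          beta_sym[of a "as i"] beta_sym[of b "as i"] beta_sym[of a "bs i"] beta_sym[of b "bs i"]
        by simp_all
      show ?thesis
        unfolding orth_pairs_def All_less_Suc using IH1 a(1) b(1) ab b(2) by (simp add: x)
    qed
    moreover have "bij_betw (idx_prod (as(r := a)) (bs(r := b))) (idx (Suc r)) H"
    proof -
      have "bij_betw (\<lambda>(S, uv). (idx_prod as bs S, uv)) (idx r \<times> UNIV) (H' \<times> (UNIV :: (bool \<times> bool) set))"
        using bij_betw_map_prod[OF IH(2) bij_betw_id[of UNIV]] by (simp add: map_prod_def)
      from bij_betw_trans[OF bij_betw_trans[OF bij_idx_Suc this] bijH]
      have "bij_betw (\<lambda>S. idx_prod as bs (idx_restrict r S) \<otimes> ?e (r \<in> fst S) (r \<in> snd S)) (idx (Suc r)) H"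
        by (simp add: comp_def)
      moreover have "idx_prod (as(r := a)) (bs(r := b)) S
          = idx_prod as bs (idx_restrict r S) \<otimes> ?e (r \<in> fst S) (r \<in> snd S)" if "S \<in> idx (Suc r)" for S
        using asc H'c(2) ab that by (intro idx_prod_Suc) simp_all
      ultimately show ?thesis by (simp cong: bij_betw_cong)
    qed
    moreover have "\<forall>i<Suc r. \<mu> ((as(r := a)) i) = 1 \<and> \<mu> ((bs(r := b)) i) = 1"
      if pos: "0 < (\<Sum>u\<in>H. \<mu> u)"
    proof -
      have "\<mu> a = 1" "\<mu> b = 1" using a(3)[OF pos] b(3)[OF pos] .
      moreover from this have "0 < (\<Sum>u\<in>H'. \<mu> u)" using sumH pos by simp
      ultimately show ?thesis using IH(3) by (simp add: All_less_Suc)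
    qed
    ultimately show ?thesis by blast
  qed
qed

end

lemma quad_formI: "quadratic_form K \<mu> \<Longrightarrow> quad_form K \<mu>"
  using elem2_iff[of K] by (simp add: quad_form_def quad_form_axioms_def quadratic_form_def)

lemma symplectic_basis_exists:
  assumes "quadratic_form_type_I K \<mu>" "finite (carrier K)"
  shows "\<exists>r a b. symplectic_basis K \<mu> r a b \<and>
    (0 < (\<Sum>u\<in>carrier K. \<mu> u) \<longrightarrow> (\<forall>i<r. \<mu> (a i) = 1 \<and> \<mu> (b i) = 1))"
proof -
  interpret quad_form K \<mu> using assms(1) by (intro quad_formI) (simp add: quadratic_form_type_I_def)
  have "t = \<one>\<^bsub>K\<^esub>" if "t \<in> carrier K" "\<forall>u\<in>carrier K. \<beta> u t = 1" for t
    using assms(1) that by (auto simp: quadratic_form_type_I_def)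
  from orth_pairs_exist[OF subgroup_self assms(2) this] show ?thesis
    by (simp add: symplectic_basis_iff conj_assoc)
qed

text \<open>Every symplectic basis gives the same product, because order and Gauss sum of the group
  determine it; this justifies the definite description in \<open>Arf\<close>.\<close>

lemma Arf_symplectic:
  assumes "quadratic_form K \<mu>" "symplectic_basis K \<mu> r a b"
  shows "Arf K \<mu> = (\<Prod>i<r. arf_q (\<mu> (a i)) (\<mu> (b i)))"
  unfolding Arf_def
proof (rule the_equality)
  interpret quad_form K \<mu> by (rule quad_formI) fact
  show "\<exists>r' a' b'. symplectic_basis K \<mu> r' a' b' \<and>
      (\<Prod>i<r. arf_q (\<mu> (a i)) (\<mu> (b i))) = (\<Prod>i<r'. arf_q (\<mu> (a' i)) (\<mu> (b' i)))"
    using assms(2) by blast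
  fix s assume "\<exists>r' a' b'. symplectic_basis K \<mu> r' a' b' \<and> s = (\<Prod>i<r'. arf_q (\<mu> (a' i)) (\<mu> (b' i)))"
  then obtain r' a' b' where *: "symplectic_basis K \<mu> r' a' b'" "s = (\<Prod>i<r'. arf_q (\<mu> (a' i)) (\<mu> (b' i)))"
    by blast
  have "(4::nat) ^ r = 4 ^ r'"
    using sum_mu_symplectic(2)[OF assms(2)] sum_mu_symplectic(2)[OF *(1)] by simp
  then have "r = r'" by simp
  then show "s = (\<Prod>i<r. arf_q (\<mu> (a i)) (\<mu> (b i)))"
    using sum_mu_symplectic(1)[OF assms(2)] sum_mu_symplectic(1)[OF *(1)] *(2) by simp
qed

section \<open>Division gradings with two-dimensional components\<close>

lemma independent_pair:
  fixes z1 z2 :: "'a::real_vector"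
  assumes "\<And>p q. p *\<^sub>R z1 + q *\<^sub>R z2 = 0 \<Longrightarrow> p = 0 \<and> q = 0"
  shows "independent {z1, z2}" "z1 \<noteq> z2"
proof -
  define y where "y b = (if b then z1 else z2)" for b
  have "c b = 0" if "(\<Sum>b\<in>UNIV. c b *\<^sub>R y b) = 0" for c b
    using assms[of "c True" "c False"] that by (cases b) (simp_all add: y_def UNIV_bool add.commute)
  then have "inj_on y UNIV" "independent (y ` UNIV)"
    using independent_familyI[of UNIV y] by simp_all
  moreover have "y ` UNIV = {z1, z2}" by (auto simp: y_def UNIV_bool)
  ultimately show "independent {z1, z2}" "z1 \<noteq> z2"
    using inj_onD[of y UNIV True False] by (auto simp: y_def)
qed

lemma dim2_span:
  fixes V :: "'a::real_vector set"
  assumes "dim V = 2" "z1 \<in> V" "z2 \<in> V" "v \<in> V"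
    and z: "\<And>p q. p *\<^sub>R z1 + q *\<^sub>R z2 = 0 \<Longrightarrow> p = 0 \<and> q = 0"
  shows "\<exists>p q. v = p *\<^sub>R z1 + q *\<^sub>R z2"
proof -
  obtain B where B: "B \<subseteq> V" "independent B" "V \<subseteq> span B" "card B = dim V"
    by (rule basis_exists)
  have "finite B" using B(4) assms(1) card.infinite by fastforce
  have ind: "independent {z1, z2}" and ne: "z1 \<noteq> z2"
    by (rule independent_pair[of z1 z2, OF z], assumption)+
  have "v \<in> span {z1, z2}"
  proof (rule ccontr)
    assume v: "v \<notin> span {z1, z2}"
    have "independent (insert v {z1, z2})" by (rule independent_insertI[OF v ind])
    moreover have "insert v {z1, z2} \<subseteq> span B" using assms(2,3,4) B(3) by blast
    ultimately have "card (insert v {z1, z2}) \<le> card B"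
      using independent_span_bound[OF \<open>finite B\<close>] by blast
    moreover have "v \<notin> {z1, z2}" using v span_superset[of "{z1, z2}"] by blast
    ultimately show False using ne B(4) assms(1) by simp
  qed
  then obtain p where "v - p *\<^sub>R z1 \<in> span {z2}" by (auto simp: span_breakdown_eq)
  then obtain q where "v - p *\<^sub>R z1 = q *\<^sub>R z2" by (auto simp: span_singleton)
  then have "v = p *\<^sub>R z1 + q *\<^sub>R z2" by (simp add: diff_eq_eq add.commute)
  then show ?thesis by blast
qed

lemma dim2_pair:
  fixes V :: "'a::real_vector set"
  assumes "dim V = 2"
  obtains z1 z2 where "z1 \<in> V" "z2 \<in> V" "\<And>p q. p *\<^sub>R z1 + q *\<^sub>R z2 = 0 \<Longrightarrow> p = 0 \<and> q = 0"
proof -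
  obtain B where B: "B \<subseteq> V" "independent B" "V \<subseteq> span B" "card B = dim V"
    by (rule basis_exists)
  obtain z1 z2 where z: "B = {z1, z2}" "z1 \<noteq> z2" using B(4) assms by (metis card_2_iff)
  have "p = 0 \<and> q = 0" if "p *\<^sub>R z1 + q *\<^sub>R z2 = 0" for p q
  proof -
    have "(\<Sum>x\<in>B. (if x = z1 then p else q) *\<^sub>R x) = 0" using z that by simp
    then have "\<forall>x\<in>B. (if x = z1 then p else q) = 0"
      using independentD[OF B(2), of B "\<lambda>x. if x = z1 then p else q"] z(1) by blast
    then show ?thesis using z by auto
  qed
  then show ?thesis using that z(1) B(1) by blast
qed

lemma subgroup_comm_group:
  assumes "comm_group G" "subgroup H G"
  shows "comm_group (G\<lparr>carrier := H\<rparr>)"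
proof -
  interpret comm_group G by fact
  show ?thesis
    by (rule group.group_comm_groupI[OF subgroup_imp_group[OF assms(2)]])
      (use subgroup.mem_carrier[OF assms(2)] m_comm in auto)
qed

text \<open>The common setting of the real and the quaternionic case: the structure of a grading is
  derived for any nonzero central finite-dimensional algebra.\<close>

locale dim2_grading = real_alg D for D :: "'a::real_vector monoid" (structure) +
  fixes G :: "('g, 'e) monoid_scheme" and \<Gamma> :: "'g \<Rightarrow> 'a set"
  assumes comm_group: "comm_group G"
    and dim2: "\<Gamma> \<in> dim2_division_gradings G D"
    and central: "central_algebra D"
    and one_neq_0: "\<one> \<noteq> 0"
    and finite_dim: "\<exists>B. finite B \<and> carrier D \<subseteq> span B"
begin

sublocale G: comm_group G by (rule comm_group)

definition T :: "'g set" where "T = grading_support G \<Gamma>"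

lemma grading: "is_grading G D \<Gamma>"
  using dim2 by (simp add: dim2_division_gradings_def is_division_grading_def)

lemma T_carrier: "t \<in> T \<Longrightarrow> t \<in> carrier G"
  by (simp add: T_def grading_support_def)

lemma comp_subspace: "t \<in> carrier G \<Longrightarrow> subspace (\<Gamma> t)"
  and comp_carrier: "t \<in> carrier G \<Longrightarrow> x \<in> \<Gamma> t \<Longrightarrow> x \<in> carrier D"
  and comp_mult: "s \<in> carrier G \<Longrightarrow> t \<in> carrier G \<Longrightarrow> x \<in> \<Gamma> s \<Longrightarrow> y \<in> \<Gamma> t \<Longrightarrow> x \<otimes> y \<in> \<Gamma> (s \<otimes>\<^bsub>G\<^esub> t)"
  and carrier_span: "carrier D = span (\<Union>g\<in>carrier G. \<Gamma> g)"
  and comp_direct: "t \<in> carrier G \<Longrightarrow> \<Gamma> t \<inter> span (\<Union>h\<in>carrier G - {t}. \<Gamma> h) = {0}"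
  using grading by (auto simp: is_grading_def)

lemma comp_scale: "t \<in> carrier G \<Longrightarrow> x \<in> \<Gamma> t \<Longrightarrow> c *\<^sub>R x \<in> \<Gamma> t"
  and comp_add: "t \<in> carrier G \<Longrightarrow> x \<in> \<Gamma> t \<Longrightarrow> y \<in> \<Gamma> t \<Longrightarrow> x + y \<in> \<Gamma> t"
  using comp_subspace by (simp_all add: subspace_scale subspace_add)

lemma comp_Units: "t \<in> carrier G \<Longrightarrow> x \<in> \<Gamma> t \<Longrightarrow> x \<noteq> 0 \<Longrightarrow> x \<in> Units D"
  using dim2 by (auto simp: dim2_division_gradings_def is_division_grading_def)

lemma comp_dim: "t \<in> T \<Longrightarrow> dim (\<Gamma> t) = 2"
  using dim2 by (simp add: dim2_division_gradings_def T_def)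

lemma comp_unique:
  assumes "s \<in> carrier G" "t \<in> carrier G" "x \<in> \<Gamma> s" "x \<in> \<Gamma> t" "x \<noteq> 0"
  shows "s = t"
proof (rule ccontr)
  assume "s \<noteq> t"
  then have "x \<in> span (\<Union>h\<in>carrier G - {t}. \<Gamma> h)" using assms by (intro span_base) auto
  then show False using comp_direct[OF assms(2)] assms(4,5) by blast
qed

lemma Units_neq_0: "x \<in> Units D \<Longrightarrow> x \<noteq> 0"
  using one_neq_0 by (metis Units_inv_closed Units_l_inv mult_0(1))

lemma T_comp_carrier: "t \<in> T \<Longrightarrow> x \<in> \<Gamma> t \<Longrightarrow> x \<in> carrier D"
  and T_comp_Units: "t \<in> T \<Longrightarrow> x \<in> \<Gamma> t \<Longrightarrow> x \<noteq> 0 \<Longrightarrow> x \<in> Units D"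
  using comp_carrier[OF T_carrier] comp_Units[OF T_carrier] by blast+

lemma mult_neq_0: "x \<in> Units D \<Longrightarrow> y \<in> Units D \<Longrightarrow> x \<otimes> y \<noteq> 0"
  by (simp add: Units_neq_0)

lemma T_nonzero:
  assumes "t \<in> T" obtains x where "x \<in> \<Gamma> t" "x \<noteq> 0"
  using assms comp_subspace[OF T_carrier[OF assms]] subspace_0
  by (auto simp: T_def grading_support_def)

lemma T_I: "t \<in> carrier G \<Longrightarrow> x \<in> \<Gamma> t \<Longrightarrow> x \<noteq> 0 \<Longrightarrow> t \<in> T"
  by (auto simp: T_def grading_support_def)

lemma T_mult: assumes "s \<in> T" "t \<in> T" shows "s \<otimes>\<^bsub>G\<^esub> t \<in> T"
proof -
  obtain x y where xy: "x \<in> \<Gamma> s" "x \<noteq> 0" "y \<in> \<Gamma> t" "y \<noteq> 0" using assms T_nonzero by metis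
  then have "x \<otimes> y \<noteq> 0" using mult_neq_0 T_comp_Units assms by blast
  then show ?thesis
    using T_I[OF G.m_closed comp_mult] xy(1,3) T_carrier[OF assms(1)] T_carrier[OF assms(2)] by blast
qed

text \<open>Nonzero vectors from distinct components are independent, so a spanning set bounds the
  size of the support.\<close>

lemma finite_T: "finite T"
proof (rule ccontr)
  assume inf: "infinite T"
  obtain B where B: "finite B" "carrier D \<subseteq> span B" using finite_dim by blast
  obtain F where F: "finite F" "card F = Suc (card B)" "F \<subseteq> T"
    using infinite_arbitrarily_large[OF inf, of "Suc (card B)"] by blast
  define x where "x t = (SOME v. v \<in> \<Gamma> t \<and> v \<noteq> 0)" for t
  have x: "x t \<in> \<Gamma> t" "x t \<noteq> 0" if "t \<in> T" for t
    using someI_ex[of "\<lambda>v. v \<in> \<Gamma> t \<and> v \<noteq> 0"] T_nonzero[OF that] unfolding x_def by metis+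
  have "c t = 0" if c: "(\<Sum>t\<in>F. c t *\<^sub>R x t) = 0" and t: "t \<in> F" for c t
  proof -
    have tG: "t \<in> carrier G" "t \<in> T" using t F(3) T_carrier by auto
    have "c t *\<^sub>R x t = - (\<Sum>s\<in>F - {t}. c s *\<^sub>R x s)"
      using c sum.remove[OF F(1) t, of "\<lambda>t. c t *\<^sub>R x t"] by (simp add: eq_neg_iff_add_eq_0)
    also have "\<dots> \<in> span (\<Union>h\<in>carrier G - {t}. \<Gamma> h)"
    proof (intro span_neg span_sum span_scale span_base)
      fix s assume "s \<in> F - {t}"
      then show "x s \<in> (\<Union>h\<in>carrier G - {t}. \<Gamma> h)" using x(1) F(3) T_carrier by blast
    qed
    finally have "c t *\<^sub>R x t = 0"
      using comp_direct[OF tG(1)] comp_scale[OF tG(1) x(1)[OF tG(2)]] by blast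
    then show ?thesis using x(2)[OF tG(2)] by simp
  qed
  then have "inj_on x F" "independent (x ` F)" using independent_familyI[OF F(1)] by blast+
  moreover have "x ` F \<subseteq> span B"
    using x(1) F(3) comp_carrier T_carrier B(2) by blast
  ultimately have "card F \<le> card B"
    using independent_span_bound[OF B(1)] by (metis card_image)
  then show False using F(2) by simp
qed

lemma T_nonempty: "T \<noteq> {}"
proof
  assume "T = {}"
  then have "(\<Union>g\<in>carrier G. \<Gamma> g) \<subseteq> {0}" by (auto simp: T_def grading_support_def)
  then have "span (\<Union>g\<in>carrier G. \<Gamma> g) \<subseteq> span {0}" by (rule span_mono)
  then show False using one_closed one_neq_0 carrier_span by auto
qed

text \<open>An injective self-map of a finite set is onto. This yields the neutral element and
  inverses in the support, which is known only to be closed under products at this point.\<close>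

lemma translate_T:
  assumes "s \<in> T" shows "(\<lambda>t. s \<otimes>\<^bsub>G\<^esub> t) ` T = T"
proof (rule endo_inj_surj[OF finite_T])
  show "(\<lambda>t. s \<otimes>\<^bsub>G\<^esub> t) ` T \<subseteq> T" using T_mult assms by blast
  show "inj_on (\<lambda>t. s \<otimes>\<^bsub>G\<^esub> t) T"
    using assms T_carrier by (intro inj_onI) simp
qed

lemma one_in_T: "\<one>\<^bsub>G\<^esub> \<in> T"
proof -
  obtain s where s: "s \<in> T" using T_nonempty by blast
  then obtain t where t: "t \<in> T" "s = s \<otimes>\<^bsub>G\<^esub> t" using translate_T by blast
  have "t = \<one>\<^bsub>G\<^esub>" using G.l_cancel_one[OF T_carrier[OF s] T_carrier[OF t(1)]] t(2) by simp
  then show ?thesis using t(1) by simp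
qed

lemma subgroup_T: "subgroup T G"
proof (rule G.subgroupI)
  fix s assume s: "s \<in> T"
  then obtain t where t: "t \<in> T" "s \<otimes>\<^bsub>G\<^esub> t = \<one>\<^bsub>G\<^esub>" using translate_T[OF s] one_in_T by (metis imageE)
  then have "t = inv\<^bsub>G\<^esub> s" using s T_carrier by (metis G.inv_equality G.m_comm)
  then show "inv\<^bsub>G\<^esub> s \<in> T" using t by simp
qed (use T_carrier T_nonempty T_mult in auto)

text \<open>Multiplication by the unit \<open>x\<close> maps a basis of one component to two
  independent vectors of another one, which is also two-dimensional.\<close>

lemma comp_mult_surj:
  assumes "s \<in> T" "t \<in> T" "x \<in> \<Gamma> s" "x \<noteq> 0"
  shows "w \<in> \<Gamma> (s \<otimes>\<^bsub>G\<^esub> t) \<Longrightarrow> \<exists>y\<in>\<Gamma> t. w = x \<otimes> y" "w \<in> \<Gamma> (t \<otimes>\<^bsub>G\<^esub> s) \<Longrightarrow> \<exists>y\<in>\<Gamma> t. w = y \<otimes> x"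
proof -
  have G: "s \<in> carrier G" "t \<in> carrier G" using assms T_carrier by auto
  have x: "x \<in> Units D" "x \<in> carrier D" using comp_Units comp_carrier assms G by auto
  obtain y1 y2 where y: "y1 \<in> \<Gamma> t" "y2 \<in> \<Gamma> t"
    and ind: "\<And>p q. p *\<^sub>R y1 + q *\<^sub>R y2 = 0 \<Longrightarrow> p = 0 \<and> q = 0"
    using dim2_pair[OF comp_dim[OF assms(2)]] by metis
  have yc: "y1 \<in> carrier D" "y2 \<in> carrier D" using y comp_carrier G by auto
  have yt: "p *\<^sub>R y1 + q *\<^sub>R y2 \<in> \<Gamma> t" for p q using y comp_add comp_scale G by simp
  {
    assume w: "w \<in> \<Gamma> (s \<otimes>\<^bsub>G\<^esub> t)"
    have "p = 0 \<and> q = 0" if "p *\<^sub>R (x \<otimes> y1) + q *\<^sub>R (x \<otimes> y2) = 0" for p q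
    proof (rule ind)
      have "x \<otimes> (p *\<^sub>R y1 + q *\<^sub>R y2) = x \<otimes> 0" using that x yc by simp
      then show "p *\<^sub>R y1 + q *\<^sub>R y2 = 0" using Units_cancel(1)[OF x(1)] yc by simp
    qed
    then obtain p q where "w = p *\<^sub>R (x \<otimes> y1) + q *\<^sub>R (x \<otimes> y2)"
      using dim2_span[OF comp_dim[OF T_mult[OF assms(1,2)]] _ _ w]
        comp_mult[OF G assms(3) y(1)] comp_mult[OF G assms(3) y(2)] by metis
    then have "w = x \<otimes> (p *\<^sub>R y1 + q *\<^sub>R y2)" using x yc by simp
    then show "\<exists>y\<in>\<Gamma> t. w = x \<otimes> y" using yt by blast
  next
    assume w: "w \<in> \<Gamma> (t \<otimes>\<^bsub>G\<^esub> s)"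
    have "p = 0 \<and> q = 0" if "p *\<^sub>R (y1 \<otimes> x) + q *\<^sub>R (y2 \<otimes> x) = 0" for p q
    proof (rule ind)
      have "(p *\<^sub>R y1 + q *\<^sub>R y2) \<otimes> x = 0 \<otimes> x" using that x yc by simp
      then show "p *\<^sub>R y1 + q *\<^sub>R y2 = 0" using Units_cancel(2)[OF x(1)] yc by simp
    qed
    then obtain p q where "w = p *\<^sub>R (y1 \<otimes> x) + q *\<^sub>R (y2 \<otimes> x)"
      using dim2_span[OF comp_dim[OF T_mult[OF assms(2,1)]] _ _ w]
        comp_mult[OF G(2,1) y(1) assms(3)] comp_mult[OF G(2,1) y(2) assms(3)] by metis
    then have "w = (p *\<^sub>R y1 + q *\<^sub>R y2) \<otimes> x" using x yc by simp
    then show "\<exists>y\<in>\<Gamma> t. w = y \<otimes> x" using yt by blast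
  }
qed

text \<open>Surjectivity gives \<open>x = x \<otimes> y\<close> with \<open>y\<close> in the neutral
  component, and cancelling \<open>x\<close> identifies \<open>y\<close> with the unit.\<close>

lemma one_in_comp: "\<one> \<in> \<Gamma> \<one>\<^bsub>G\<^esub>"
proof -
  obtain x where x: "x \<in> \<Gamma> \<one>\<^bsub>G\<^esub>" "x \<noteq> 0" using one_in_T T_nonzero by blast
  have xc: "x \<in> carrier D" "x \<in> Units D"
    using comp_carrier[OF G.one_closed x(1)] comp_Units[OF G.one_closed x] .
  have "x \<in> \<Gamma> (\<one>\<^bsub>G\<^esub> \<otimes>\<^bsub>G\<^esub> \<one>\<^bsub>G\<^esub>)" using x by simp
  from comp_mult_surj(1)[OF one_in_T one_in_T x this] obtain y where y: "y \<in> \<Gamma> \<one>\<^bsub>G\<^esub>" "x = x \<otimes> y"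
    by blast
  have yc: "y \<in> carrier D" using comp_carrier[OF G.one_closed y(1)] .
  have "x \<otimes> y = x \<otimes> \<one>" using y(2) xc by simp
  then have "y = \<one>" using Units_cancel(1)[OF xc(2) yc one_closed] by simp
  then show ?thesis using y by simp
qed

text \<open>The neutral component is a two-dimensional real division algebra. An element outside the
  real line satisfies a quadratic equation, which is reduced to \<open>w^2 = r\<close> and cannot
  have real roots.\<close>

lemma exists_imaginary_unit: "\<exists>i\<in>\<Gamma> \<one>\<^bsub>G\<^esub>. i \<otimes> i = - \<one> \<and> (\<forall>x\<in>\<Gamma> \<one>\<^bsub>G\<^esub>. \<exists>p q. x = p *\<^sub>R \<one> + q *\<^sub>R i)"
proof -
  let ?E = "\<Gamma> \<one>\<^bsub>G\<^esub>"
  have dimE: "dim ?E = 2" using comp_dim one_in_T by simp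
  have "\<exists>z\<in>?E. \<forall>p. z \<noteq> p *\<^sub>R \<one>"
  proof (rule ccontr)
    assume "\<not> ?thesis"
    then have "?E \<subseteq> span {\<one>}" by (auto simp: span_singleton)
    then have "dim ?E \<le> card {\<one>}" by (rule dim_le_card) simp
    then show False using dimE by simp
  qed
  then obtain z where z: "z \<in> ?E" "\<And>p. z \<noteq> p *\<^sub>R \<one>" by blast
  have ind: "p = 0 \<and> q = 0" if "p *\<^sub>R \<one> + q *\<^sub>R z = 0" for p q
  proof -
    have "q = 0"
    proof (rule ccontr)
      assume "q \<noteq> 0"
      then have "z = (1 / q) *\<^sub>R (q *\<^sub>R z)" by simp
      also have "q *\<^sub>R z = (- p) *\<^sub>R \<one>" using that by (simp add: eq_neg_iff_add_eq_0 add.commute)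
      finally have "z = (- p / q) *\<^sub>R \<one>" by simp
      then show False using z(2) by blast
    qed
    then show ?thesis using that one_neq_0 by simp
  qed
  have zc: "z \<in> carrier D" using comp_carrier[OF G.one_closed z(1)] .
  have EE: "x \<otimes> y \<in> ?E" if "x \<in> ?E" "y \<in> ?E" for x y
    using comp_mult[OF G.one_closed G.one_closed that] by simp
  obtain p q where pq: "z \<otimes> z = p *\<^sub>R \<one> + q *\<^sub>R z"
    using dim2_span[OF dimE one_in_comp z(1) EE[OF z(1) z(1)] ind] by blast
  \<comment> \<open>Completing the square in \<open>z^2 = p + q z\<close>.\<close>
  define w where "w = z - (q / 2) *\<^sub>R \<one>"
  define r where "r = p + q\<^sup>2 / 4"
  have wE: "w + c *\<^sub>R \<one> \<in> ?E" for c
  proof -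
    have "w + c *\<^sub>R \<one> = z + (c - q / 2) *\<^sub>R \<one>" by (simp add: w_def algebra_simps)
    then show ?thesis using z(1) one_in_comp comp_add comp_scale by simp
  qed
  have w0: "w + c *\<^sub>R \<one> \<noteq> 0" for c
  proof
    assume "w + c *\<^sub>R \<one> = 0"
    then have "z = (q / 2 - c) *\<^sub>R \<one>" by (simp add: w_def algebra_simps)
    then show False using z(2) by blast
  qed
  have wc: "w \<in> carrier D" using zc by (simp add: w_def)
  have ww: "w \<otimes> w = r *\<^sub>R \<one>"
  proof -
    have "w \<otimes> w = z \<otimes> z - q *\<^sub>R z + (q\<^sup>2 / 4) *\<^sub>R \<one>"
      using zc by (simp add: w_def algebra_simps power2_eq_square flip: scaleR_add_left)
    then show ?thesis using pq by (simp add: r_def algebra_simps)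
  qed
  \<comment> \<open>For \<open>r \<ge> 0\<close> the equation would factor as
    \<open>(w + sqrt r) (w - sqrt r) = 0\<close>, although both factors are nonzero homogeneous
    elements and hence units.\<close>
  have "r < 0"
  proof (rule ccontr)
    assume "\<not> r < 0"
    then have "(w + sqrt r *\<^sub>R \<one>) \<otimes> (w + (- sqrt r) *\<^sub>R \<one>) = 0"
      using wc ww by (simp add: algebra_simps)
    moreover have "w + sqrt r *\<^sub>R \<one> \<in> Units D" "w + (- sqrt r) *\<^sub>R \<one> \<in> Units D"
      using comp_Units[OF G.one_closed wE w0] by blast+
    ultimately show False using mult_neq_0 by blast
  qed
  define i where "i = (1 / sqrt (- r)) *\<^sub>R w"
  have s: "sqrt (- r) > 0" using \<open>r < 0\<close> by simp
  have iE: "i \<in> ?E" using wE[of 0] comp_scale by (simp add: i_def)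
  have "i \<otimes> i = - \<one>"
  proof -
    have "i \<otimes> i = (1 / sqrt (- r) * (1 / sqrt (- r)) * r) *\<^sub>R \<one>"
      using wc ww by (simp add: i_def)
    moreover have "1 / sqrt (- r) * (1 / sqrt (- r)) * r = -1"
      using \<open>r < 0\<close> by (simp add: field_simps)
    ultimately show ?thesis by simp
  qed
  moreover have "\<exists>p q. x = p *\<^sub>R \<one> + q *\<^sub>R i" if x: "x \<in> ?E" for x
  proof -
    obtain p' q' where x': "x = p' *\<^sub>R \<one> + q' *\<^sub>R z"
      using dim2_span[OF dimE one_in_comp z(1) x ind] by blast
    have "z = sqrt (- r) *\<^sub>R i + (q / 2) *\<^sub>R \<one>" using s by (simp add: i_def w_def)
    then have "x = (p' + q' * q / 2) *\<^sub>R \<one> + (q' * sqrt (- r)) *\<^sub>R i"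
      using x' by (simp add: algebra_simps)
    then show ?thesis by blast
  qed
  ultimately show ?thesis using iE by blast
qed

section \<open>Complex scalars in the neutral component\<close>

definition im :: 'a where
  "im = (SOME i. i \<in> \<Gamma> \<one>\<^bsub>G\<^esub> \<and> i \<otimes> i = - \<one> \<and> (\<forall>x\<in>\<Gamma> \<one>\<^bsub>G\<^esub>. \<exists>p q. x = p *\<^sub>R \<one> + q *\<^sub>R i))"

lemma im_comp: "im \<in> \<Gamma> \<one>\<^bsub>G\<^esub>"
  and im_square: "im \<otimes> im = - \<one>"
  and comp_one_span: "x \<in> \<Gamma> \<one>\<^bsub>G\<^esub> \<Longrightarrow> \<exists>p q. x = p *\<^sub>R \<one> + q *\<^sub>R im"
proof -
  have "\<exists>i. i \<in> \<Gamma> \<one>\<^bsub>G\<^esub> \<and> i \<otimes> i = - \<one> \<and> (\<forall>x\<in>\<Gamma> \<one>\<^bsub>G\<^esub>. \<exists>p q. x = p *\<^sub>R \<one> + q *\<^sub>R i)"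
    using exists_imaginary_unit by blast
  from someI_ex[OF this] show "im \<in> \<Gamma> \<one>\<^bsub>G\<^esub>" "im \<otimes> im = - \<one>"
    "x \<in> \<Gamma> \<one>\<^bsub>G\<^esub> \<Longrightarrow> \<exists>p q. x = p *\<^sub>R \<one> + q *\<^sub>R im"
    unfolding im_def by blast+
qed

lemma im_carrier [simp]: "im \<in> carrier D"
  by (rule comp_carrier[OF G.one_closed im_comp])

definition emb :: "complex \<Rightarrow> 'a" where
  "emb c = Re c *\<^sub>R \<one> + Im c *\<^sub>R im"

lemma emb_carrier [simp]: "emb c \<in> carrier D"
  by (simp add: emb_def)

lemma emb_comp: "emb c \<in> \<Gamma> \<one>\<^bsub>G\<^esub>"
  using one_in_comp im_comp comp_add comp_scale by (simp add: emb_def)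

lemma emb_mult: "emb c \<otimes> emb d = emb (c * d)"
  by (simp add: emb_def im_square algebra_simps)

lemma emb_of_real: "emb (of_real t) = t *\<^sub>R \<one>"
  by (simp add: emb_def)

lemma emb_1: "emb 1 = \<one>"
  by (simp add: emb_def)

lemma emb_Units: "c \<noteq> 0 \<Longrightarrow> emb c \<in> Units D"
  unfolding Units_def
  by (intro CollectI conjI bexI[of _ "emb (inverse c)"]) (simp_all add: emb_mult emb_1)

lemma emb_eq_iff [simp]: "emb c = emb d \<longleftrightarrow> c = d"
proof
  assume "emb c = emb d"
  then have "emb (c - d) = 0" by (simp add: emb_def algebra_simps)
  then show "c = d" using emb_Units[of "c - d"] Units_neq_0 by fastforce
qed simp

lemma emb_surj: assumes "x \<in> \<Gamma> \<one>\<^bsub>G\<^esub>" obtains c where "x = emb c"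
proof -
  obtain p q where "x = p *\<^sub>R \<one> + q *\<^sub>R im" using comp_one_span[OF assms] by blast
  then have "x = emb (Complex p q)" by (simp add: emb_def)
  then show ?thesis using that by blast
qed

lemma emb_0: "emb 0 = 0"
  by (simp add: emb_def)

section \<open>Degrees that commute with the neutral component\<close>

definition K :: "'g set" where
  "K = {t \<in> T. \<forall>x\<in>\<Gamma> t. \<forall>y\<in>\<Gamma> \<one>\<^bsub>G\<^esub>. x \<otimes> y = y \<otimes> x}"

lemma K_T: "t \<in> K \<Longrightarrow> t \<in> T"
  by (simp add: K_def)

lemma comp_right_one:
  assumes "t \<in> T" "x \<in> \<Gamma> t" "x \<noteq> 0" "w \<in> \<Gamma> t"
  obtains c where "w = x \<otimes> emb c"
proof -
  have "w \<in> \<Gamma> (t \<otimes>\<^bsub>G\<^esub> \<one>\<^bsub>G\<^esub>)" using assms T_carrier by simp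
  from comp_mult_surj(1)[OF assms(1) one_in_T assms(2,3) this] obtain y where
    "y \<in> \<Gamma> \<one>\<^bsub>G\<^esub>" "w = x \<otimes> y" by blast
  then show ?thesis using emb_surj that by metis
qed

lemma comp_left_one:
  assumes "t \<in> T" "x \<in> \<Gamma> t" "x \<noteq> 0" "w \<in> \<Gamma> t"
  obtains c where "w = emb c \<otimes> x"
proof -
  have "w \<in> \<Gamma> (\<one>\<^bsub>G\<^esub> \<otimes>\<^bsub>G\<^esub> t)" using assms T_carrier by simp
  from comp_mult_surj(2)[OF assms(1) one_in_T assms(2,3) this] obtain y where
    "y \<in> \<Gamma> \<one>\<^bsub>G\<^esub>" "w = y \<otimes> x" by blast
  then show ?thesis using emb_surj that by metis
qed

text \<open>Conjugation by \<open>x\<close> is a real automorphism of the complex numbers, hence the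
  identity or complex conjugation; here this comes out of \<open>c * c = -1\<close>.\<close>

lemma im_commute_cases:
  assumes "t \<in> T" "x \<in> \<Gamma> t" "x \<noteq> 0"
  shows "im \<otimes> x = x \<otimes> im \<or> im \<otimes> x = - (x \<otimes> im)"
proof -
  have x: "x \<in> carrier D" "x \<in> Units D" using assms T_comp_carrier T_comp_Units by blast+
  have "im \<otimes> x \<in> \<Gamma> t" using comp_mult[OF G.one_closed T_carrier[OF assms(1)] im_comp assms(2)]
    T_carrier[OF assms(1)] by simp
  then obtain c where c: "im \<otimes> x = x \<otimes> emb c" using comp_right_one[OF assms] by metis
  have "x \<otimes> emb (c * c) = (x \<otimes> emb c) \<otimes> emb c" using x by (simp add: m_assoc emb_mult)
  also have "\<dots> = im \<otimes> (x \<otimes> emb c)" using x by (simp add: c[symmetric] m_assoc)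
  also have "\<dots> = (im \<otimes> im) \<otimes> x" using x by (simp add: c[symmetric] m_assoc)
  also have "\<dots> = x \<otimes> emb (-1)" using x by (simp add: im_square emb_def)
  finally have "c * c = -1" using Units_cancel(1)[OF x(2)] by simp
  then have "(c - \<i>) * (c + \<i>) = 0" by (simp add: algebra_simps)
  then have "c = \<i> \<or> c = - \<i>" by (auto simp: eq_neg_iff_add_eq_0)
  then show ?thesis using c x by (auto simp: emb_def)
qed

text \<open>One nonzero element decides for the whole component, since the component is
  \<open>x\<close> times the complex scalars, which commute with each other.\<close>

lemma K_I:
  assumes "t \<in> T" "x \<in> \<Gamma> t" "x \<noteq> 0" "im \<otimes> x = x \<otimes> im"
  shows "t \<in> K"
  unfolding K_def
proof (intro CollectI conjI ballI assms(1))
  have x: "x \<in> carrier D" using assms comp_carrier T_carrier by blast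
  fix w y assume "w \<in> \<Gamma> t" "y \<in> \<Gamma> \<one>\<^bsub>G\<^esub>"
  then obtain c d where cd: "w = x \<otimes> emb c" "y = emb d"
    using comp_right_one[OF assms(1-3)] emb_surj by metis
  have "emb d \<otimes> x = x \<otimes> emb d" using x assms(4) by (simp add: emb_def)
  then have "emb d \<otimes> (x \<otimes> emb c) = x \<otimes> (emb d \<otimes> emb c)"
    using x by (simp add: m_assoc[symmetric])
  then show "w \<otimes> y = y \<otimes> w" using x by (simp add: cd m_assoc emb_mult mult.commute)
qed

lemma K_commute: "t \<in> K \<Longrightarrow> x \<in> \<Gamma> t \<Longrightarrow> x \<otimes> emb c = emb c \<otimes> x"
  using emb_comp by (auto simp: K_def)

lemma not_K_commute:
  assumes "t \<in> T" "t \<notin> K" "x \<in> \<Gamma> t"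
  shows "x \<otimes> emb c = emb (cnj c) \<otimes> x"
proof (cases "x = 0")
  case False
  have x: "x \<in> carrier D" using assms comp_carrier T_carrier by blast
  have "im \<otimes> x = - (x \<otimes> im)" using im_commute_cases[OF assms(1,3) False] K_I[OF assms(1,3) False] assms(2) by blast
  then show ?thesis using x by (simp add: emb_def)
qed simp

lemma K_mult: "s \<in> K \<Longrightarrow> t \<in> K \<Longrightarrow> s \<otimes>\<^bsub>G\<^esub> t \<in> K"
  and not_K_mult: "s \<in> T - K \<Longrightarrow> t \<in> T - K \<Longrightarrow> s \<otimes>\<^bsub>G\<^esub> t \<in> K"
proof -
  \<comment> \<open>Each factor either commutes or anticommutes with \<open>im\<close>. When both do
    the same, the signs cancel, so the two claims share one proof.\<close>
  have *: "s \<otimes>\<^bsub>G\<^esub> t \<in> K" if st: "s \<in> T" "t \<in> T" "s \<in> K \<longleftrightarrow> t \<in> K" for s t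
  proof -
    obtain x y where xy: "x \<in> \<Gamma> s" "x \<noteq> 0" "y \<in> \<Gamma> t" "y \<noteq> 0" using st T_nonzero by metis
    have c: "x \<in> carrier D" "y \<in> carrier D" using xy st T_comp_carrier by blast+
    have "x \<otimes> y \<noteq> 0" using mult_neq_0 T_comp_Units xy st by blast
    have emb: "emb \<i> = im" "emb (- \<i>) = - im" by (simp_all add: emb_def)
    have "im \<otimes> (x \<otimes> y) = x \<otimes> y \<otimes> im"
    proof (cases "s \<in> K")
      case True
      have "im \<otimes> x = x \<otimes> im" "im \<otimes> y = y \<otimes> im"
        using K_commute[OF True xy(1), of \<i>] K_commute[OF _ xy(3), of \<i>] True st(3) by (simp_all add: emb)
      then show ?thesis using c by (metis m_assoc im_carrier)
    next
      case False
      have 1: "im \<otimes> x = - (x \<otimes> im)" "im \<otimes> y = - (y \<otimes> im)"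
        using not_K_commute[OF st(1) False xy(1), of \<i>] not_K_commute[OF st(2) _ xy(3), of \<i>] False st(3) c
        by (simp_all add: emb)
      have "im \<otimes> (x \<otimes> y) = (im \<otimes> x) \<otimes> y" using c by (simp add: m_assoc)
      also have "\<dots> = - (x \<otimes> (im \<otimes> y))" using c by (simp add: 1(1) m_assoc)
      also have "\<dots> = x \<otimes> y \<otimes> im" using c by (simp add: 1(2) m_assoc)
      finally show ?thesis .
    qed
    moreover have "x \<otimes> y \<in> \<Gamma> (s \<otimes>\<^bsub>G\<^esub> t)" using comp_mult xy st T_carrier by blast
    ultimately show ?thesis using K_I T_mult st \<open>x \<otimes> y \<noteq> 0\<close> by blast
  qed
  show "s \<in> K \<Longrightarrow> t \<in> K \<Longrightarrow> s \<otimes>\<^bsub>G\<^esub> t \<in> K" "s \<in> T - K \<Longrightarrow> t \<in> T - K \<Longrightarrow> s \<otimes>\<^bsub>G\<^esub> t \<in> K"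
    using * K_T by blast+
qed

lemma one_in_K: "\<one>\<^bsub>G\<^esub> \<in> K"
  using K_I[OF one_in_T one_in_comp one_neq_0] by simp

lemma central_if:
  assumes "z \<in> carrier D" "\<And>t x. t \<in> T \<Longrightarrow> x \<in> \<Gamma> t \<Longrightarrow> z \<otimes> x = x \<otimes> z"
  obtains c where "z = c *\<^sub>R \<one>"
proof -
  have "z \<otimes> x = x \<otimes> z" if "x \<in> span (\<Union>g\<in>carrier G. \<Gamma> g)" for x
    using that
  proof (induction rule: span_induct_mem)
    case (step c b w)
    obtain g where g: "g \<in> carrier G" "b \<in> \<Gamma> g" using step(1) by blast
    have "z \<otimes> b = b \<otimes> z"
      using assms g T_I[OF g] by (cases "b = 0") auto
    moreover have "w \<in> carrier D" "b \<in> carrier D" using step(2) carrier_span comp_carrier g by auto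
    ultimately show ?case using step(3) assms(1) by simp
  qed (use assms in simp)
  then show ?thesis
    using central assms(1) that unfolding central_algebra_def carrier_span[symmetric] by blast
qed

text \<open>Otherwise \<open>im\<close> would commute with all components and, by centrality, be a
  real multiple of the unit.\<close>

lemma exists_not_K: "T - K \<noteq> {}"
proof
  assume "T - K = {}"
  then have "im \<otimes> x = x \<otimes> im" if "t \<in> T" "x \<in> \<Gamma> t" for t x
    using that K_commute[of t x \<i>] by (auto simp: emb_def)
  then obtain c where "im = c *\<^sub>R \<one>" using central_if[of im] by auto
  then have "emb \<i> = emb (of_real c)" by (simp add: emb_def)
  then have "Im \<i> = Im (of_real c)" by (simp only: emb_eq_iff)
  then show False by simp
qed

lemma exists_not_K_elem:
  obtains g X where "g \<in> T" "g \<notin> K" "X \<in> \<Gamma> g" "X \<noteq> 0"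
proof -
  obtain g where g: "g \<in> T" "g \<notin> K" using exists_not_K by blast
  obtain X where "X \<in> \<Gamma> g" "X \<noteq> 0" by (rule T_nonzero[OF g(1)])
  then show ?thesis using that g by blast
qed

section \<open>Complex commutation factors, and their reduction to signs\<close>

lemma commutation_factor:
  assumes "s \<in> T" "t \<in> T" "x \<in> \<Gamma> s" "y \<in> \<Gamma> t" "x \<noteq> 0" "y \<noteq> 0"
  obtains c where "x \<otimes> y = emb c \<otimes> (y \<otimes> x)" "c \<noteq> 0"
proof -
  have G: "s \<in> carrier G" "t \<in> carrier G" using assms T_carrier by auto
  have U: "x \<in> Units D" "y \<in> Units D" using comp_Units assms G by blast+
  have "x \<otimes> y \<in> \<Gamma> (t \<otimes>\<^bsub>G\<^esub> s)" using comp_mult[OF G assms(3,4)] G by (simp add: G.m_comm)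
  moreover have "y \<otimes> x \<in> \<Gamma> (t \<otimes>\<^bsub>G\<^esub> s)" using comp_mult[OF G(2,1) assms(4,3)] .
  moreover have "y \<otimes> x \<noteq> 0" "x \<otimes> y \<noteq> 0" using mult_neq_0 U by auto
  ultimately obtain c where c: "x \<otimes> y = emb c \<otimes> (y \<otimes> x)"
    using comp_left_one[OF T_mult[OF assms(2,1)]] by metis
  then have "c \<noteq> 0" using \<open>x \<otimes> y \<noteq> 0\<close> U by (auto simp: emb_0 Units_closed)
  then show ?thesis using that c by blast
qed

text \<open>The factor \<open>d\<close> of \<open>y\<close> and \<open>z\<close> has to pass
  \<open>x\<close> on its way to the left, where it turns into \<open>d'\<close>; for
  \<open>x\<close> of degree outside \<open>K\<close> this is the complex conjugate.\<close>

lemma emb_sandwich: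
  assumes "x \<in> carrier D" "y \<in> carrier D" "z \<in> carrier D" "x \<otimes> z = emb c \<otimes> (z \<otimes> x)" "y \<otimes> z = emb d \<otimes> (z \<otimes> y)"
    and "x \<otimes> emb d = emb d' \<otimes> x"
  shows "(x \<otimes> y) \<otimes> z = emb (d' * c) \<otimes> (z \<otimes> (x \<otimes> y))"
proof -
  have "(x \<otimes> y) \<otimes> z = x \<otimes> (emb d \<otimes> (z \<otimes> y))" using assms(1-3) by (simp add: assms(5) m_assoc)
  also have "\<dots> = (x \<otimes> emb d) \<otimes> (z \<otimes> y)" using assms(1-3) by (simp add: m_assoc)
  also have "\<dots> = emb d' \<otimes> ((x \<otimes> z) \<otimes> y)" using assms(1-3) by (simp add: assms(6) m_assoc)
  also have "\<dots> = (emb d' \<otimes> emb c) \<otimes> (z \<otimes> (x \<otimes> y))"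
    using assms(1-3) by (simp only: assms(4)) (simp add: m_assoc)
  finally show ?thesis by (simp add: emb_mult)
qed

text \<open>
  An element of degree in the radical can be rescaled by a square root of its commutation factor
  with an element of degree outside \<open>K\<close>; the result is central.
\<close>

lemma radical_trivial:
  assumes "u \<in> K" "x \<in> \<Gamma> u" "x \<noteq> 0" and comm: "\<And>v y. v \<in> K \<Longrightarrow> y \<in> \<Gamma> v \<Longrightarrow> x \<otimes> y = y \<otimes> x"
  shows "u = \<one>\<^bsub>G\<^esub>"
proof -
  obtain g X where g: "g \<in> T" "g \<notin> K" "X \<in> \<Gamma> g" "X \<noteq> 0" by (rule exists_not_K_elem)
  have u: "u \<in> T" "u \<in> carrier G" "g \<in> carrier G" using assms K_T T_carrier g by auto
  have xc: "x \<in> carrier D" "X \<in> carrier D" "X \<in> Units D" "x \<in> Units D"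
    using T_comp_carrier T_comp_Units assms g u by blast+
  obtain c where c: "X \<otimes> x = emb c \<otimes> (x \<otimes> X)" "c \<noteq> 0"
    using commutation_factor[OF g(1) u(1) g(3) assms(2) g(4) assms(3)] by metis
  have XX: "X \<otimes> X \<in> \<Gamma> (g \<otimes>\<^bsub>G\<^esub> g)" "g \<otimes>\<^bsub>G\<^esub> g \<in> K" using comp_mult g u not_K_mult by auto
  \<comment> \<open>Passing \<open>X\<close> twice multiplies by \<open>|c|^2\<close>. But
    \<open>X \<otimes> X\<close> has degree in \<open>K\<close> and commutes with \<open>x\<close>,
    so \<open>|c| = 1\<close>.\<close>
  have "(X \<otimes> X) \<otimes> x = emb (cnj c * c) \<otimes> (x \<otimes> (X \<otimes> X))"
    by (rule emb_sandwich[OF xc(2,2,1) c(1,1) not_K_commute[OF g(1-3)]])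
  also have "x \<otimes> (X \<otimes> X) = (X \<otimes> X) \<otimes> x" using comm[OF XX(2,1)] .
  finally have "emb 1 \<otimes> ((X \<otimes> X) \<otimes> x) = emb (cnj c * c) \<otimes> ((X \<otimes> X) \<otimes> x)"
    using xc by (simp add: emb_1)
  then have norm: "cnj c * c = 1" using Units_cancel(2)[of "(X \<otimes> X) \<otimes> x"] xc by simp
  \<comment> \<open>The square root also has modulus \<open>1\<close>. With the factor
    \<open>emb d\<close> in front of \<open>x\<close>, moving \<open>X\<close> past it produces
    \<open>cnj d * c = cnj d * d * d = d\<close>, the same factor again, so the product commutes
    with \<open>X\<close>.\<close>
  define d where "d = csqrt c"
  have d2: "d * d = c" using power2_csqrt[of c] by (simp add: d_def power2_eq_square)
  then have d0: "d \<noteq> 0" using c(2) by auto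
  have "cnj d * d * (cnj d * d) = 1" using norm d2 by (metis complex_cnj_mult mult.commute mult.left_commute)
  moreover have sq: "cnj d * d = of_real ((cmod d)\<^sup>2)" by (subst complex_norm_square) (rule mult.commute)
  ultimately have "((cmod d)\<^sup>2)\<^sup>2 = 1" by (metis of_real_eq_1_iff of_real_mult power2_eq_square)
  then have "(cmod d)\<^sup>2 = 1" by (metis power2_eq_1_iff zero_le_power2 neg_0_le_iff_le not_one_le_zero)
  then have nd: "cnj d * d = 1" by (simp only: sq of_real_1)
  define x' where "x' = emb d \<otimes> x"
  have x': "x' \<in> \<Gamma> u" using comp_mult[OF G.one_closed u(2) emb_comp assms(2)] u by (simp add: x'_def)
  have x'c: "x' \<in> carrier D" "x' \<noteq> 0" using xc mult_neq_0 emb_Units d0 by (auto simp: x'_def)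
  have x'K: "x' \<otimes> y = y \<otimes> x'" if "v \<in> K" "y \<in> \<Gamma> v" for v y
  proof -
    have y: "y \<in> carrier D" using that comp_carrier T_carrier K_T by blast
    have "y \<otimes> (emb d \<otimes> x) = emb d \<otimes> (y \<otimes> x)"
      using y xc K_commute[OF that, of d] by (simp add: m_assoc[symmetric])
    then show ?thesis using y xc comm[OF that] by (simp add: x'_def m_assoc)
  qed
  have x'X: "X \<otimes> x' = x' \<otimes> X"
  proof -
    have "X \<otimes> x' = (X \<otimes> emb d) \<otimes> x" using xc by (simp add: x'_def m_assoc)
    also have "\<dots> = emb (cnj d) \<otimes> (X \<otimes> x)" using xc not_K_commute[OF g(1-3)] by (simp add: m_assoc)
    also have "\<dots> = (emb (cnj d) \<otimes> emb c) \<otimes> (x \<otimes> X)" using xc c(1) by (simp add: m_assoc)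
    also have "\<dots> = emb d \<otimes> (x \<otimes> X)" using nd d2 by (simp add: emb_mult) (metis mult.assoc mult_1)
    finally show ?thesis using xc by (simp add: x'_def m_assoc)
  qed
  \<comment> \<open>For a degree \<open>t\<close> outside \<open>K\<close>, the product
    \<open>y \<otimes> X\<close> has degree in \<open>K\<close>; since \<open>x'\<close> commutes
    with it and with the unit \<open>X\<close>, it commutes with \<open>y\<close>.\<close>
  have "x' \<otimes> y = y \<otimes> x'" if y: "t \<in> T" "y \<in> \<Gamma> t" for t y
  proof (cases "t \<in> K")
    case False
    have yc: "y \<in> carrier D" using y comp_carrier T_carrier by blast
    have "y \<otimes> X \<in> \<Gamma> (t \<otimes>\<^bsub>G\<^esub> g)" using comp_mult y T_carrier u g by blast
    then have "x' \<otimes> (y \<otimes> X) = (y \<otimes> X) \<otimes> x'" using x'K not_K_mult False g y by blast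
    also have "\<dots> = y \<otimes> (x' \<otimes> X)" using yc xc x'c x'X by (simp add: m_assoc)
    finally have "(x' \<otimes> y) \<otimes> X = (y \<otimes> x') \<otimes> X" using yc xc x'c by (simp add: m_assoc)
    then show ?thesis using Units_cancel(2)[OF xc(3)] yc x'c by simp
  qed (use x'K y in blast)
  then obtain t where "x' = t *\<^sub>R \<one>" using central_if[OF x'c(1)] by metis
  then have "x' \<in> \<Gamma> \<one>\<^bsub>G\<^esub>" using one_in_comp comp_scale by simp
  then show ?thesis using comp_unique[OF u(2) G.one_closed x'] x'c by blast
qed

text \<open>The commutation factor is a complex number at first. Comparison with an element of
  degree outside \<open>K\<close>, which conjugates scalars, makes it real; finite order of the
  degrees makes it a root of unity. Only \<open>1\<close> and \<open>-1\<close> remain.\<close>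

lemma K_commutation_sign:
  assumes "u \<in> K" "v \<in> K" "x \<in> \<Gamma> u" "y \<in> \<Gamma> v" "x \<noteq> 0" "y \<noteq> 0"
  shows "x \<otimes> y = y \<otimes> x \<or> x \<otimes> y = - (y \<otimes> x)"
proof -
  obtain g X where g: "g \<in> T" "g \<notin> K" "X \<in> \<Gamma> g" "X \<noteq> 0" by (rule exists_not_K_elem)
  have uv: "u \<in> T" "v \<in> T" "u \<in> carrier G" "v \<in> carrier G" "g \<in> carrier G"
    using assms K_T T_carrier g by auto
  have xc: "x \<in> carrier D" "y \<in> carrier D" "X \<in> carrier D" "x \<in> Units D" "y \<in> Units D" "X \<in> Units D"
    using T_comp_carrier T_comp_Units assms g uv by blast+
  obtain b where b: "x \<otimes> y = emb b \<otimes> (y \<otimes> x)" "b \<noteq> 0"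
    using commutation_factor[OF uv(1,2) assms(3-6)] by metis
  obtain c where c: "X \<otimes> x = emb c \<otimes> (x \<otimes> X)" "c \<noteq> 0"
    using commutation_factor[OF g(1) uv(1) g(3) assms(3) g(4) assms(5)] by metis
  obtain d where d: "X \<otimes> y = emb d \<otimes> (y \<otimes> X)" "d \<noteq> 0"
    using commutation_factor[OF g(1) uv(2) g(3) assms(4) g(4) assms(6)] by metis
  have emb_left: "w \<otimes> (emb a \<otimes> z) = emb a \<otimes> (w \<otimes> z)" if "w \<in> \<Gamma> t" "t \<in> K" "z \<in> carrier D" for w a z t
  proof -
    have "w \<in> carrier D" using that comp_carrier T_carrier K_T by blast
    then show ?thesis using K_commute[OF that(2,1), of a] that(3) by (simp add: m_assoc[symmetric])
  qed
  have prod: "X \<otimes> (w \<otimes> z) = emb (k * l) \<otimes> ((w \<otimes> z) \<otimes> X)"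
    if "w \<in> \<Gamma> t" "t \<in> K" "z \<in> carrier D" "X \<otimes> w = emb k \<otimes> (w \<otimes> X)" "X \<otimes> z = emb l \<otimes> (z \<otimes> X)" for w z k l t
  proof -
    have w: "w \<in> carrier D" using that comp_carrier T_carrier K_T by blast
    have "X \<otimes> (w \<otimes> z) = (X \<otimes> w) \<otimes> z" using w xc that(3) by (simp add: m_assoc)
    also have "\<dots> = emb k \<otimes> (w \<otimes> (X \<otimes> z))" using w xc that(3) by (simp add: that(4) m_assoc)
    also have "\<dots> = emb k \<otimes> (emb l \<otimes> (w \<otimes> (z \<otimes> X)))" using w xc that(3) emb_left[OF that(1,2)] by (simp add: that(5))
    also have "\<dots> = (emb k \<otimes> emb l) \<otimes> ((w \<otimes> z) \<otimes> X)" using w xc that(3) by (simp add: m_assoc)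
    finally show ?thesis by (simp add: emb_mult)
  qed
  \<comment> \<open>Moving \<open>X\<close> past \<open>x \<otimes> y\<close> and past
    \<open>y \<otimes> x\<close> gives the same factor \<open>c * d\<close>. So conjugating the
    factor \<open>b\<close> between the two products, the effect of passing it by \<open>X\<close>,
    cannot change it.\<close>
  have "emb (cnj b) \<otimes> (X \<otimes> (y \<otimes> x)) = (X \<otimes> emb b) \<otimes> (y \<otimes> x)"
    using xc not_K_commute[OF g(1-3)] by (simp add: m_assoc)
  also have "\<dots> = X \<otimes> (x \<otimes> y)" using xc b(1) by (simp add: m_assoc)
  also have "\<dots> = emb (c * d) \<otimes> (emb b \<otimes> (y \<otimes> x) \<otimes> X)"
    using prod[OF assms(3,1) xc(2) c(1) d(1)] b(1) by simp
  also have "\<dots> = emb b \<otimes> (emb (d * c) \<otimes> ((y \<otimes> x) \<otimes> X))"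
    using xc by (simp add: m_assoc emb_mult mult.commute mult.left_commute flip: m_assoc[of "emb _" "emb _"])
  also have "emb (d * c) \<otimes> ((y \<otimes> x) \<otimes> X) = X \<otimes> (y \<otimes> x)"
    using prod[OF assms(4,2) xc(1) d(1) c(1)] by simp
  finally have "cnj b = b" using Units_cancel(2)[of "X \<otimes> (y \<otimes> x)"] xc by simp
  then obtain t where t: "b = of_real t" by (metis Reals_cnj_iff Reals_cases)
  have xy: "x \<otimes> y = t *\<^sub>R (y \<otimes> x)" using b(1) xc by (simp add: t emb_of_real)
  \<comment> \<open>Two powers of \<open>u\<close> coincide by finiteness, so some
    \<open>n > 0\<close> has \<open>u^n\<close> neutral. Then \<open>x^n\<close> is a complex scalar
    and commutes with \<open>y\<close>, whence \<open>t ^ n = 1\<close>.\<close>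
  have powT: "u [^]\<^bsub>G\<^esub> k \<in> T" for k :: nat
    by (induction k) (use one_in_T T_mult uv in auto)
  then have "finite (range (\<lambda>k :: nat. u [^]\<^bsub>G\<^esub> k))" using finite_T by (auto intro: finite_subset)
  then have "\<not> inj (\<lambda>k :: nat. u [^]\<^bsub>G\<^esub> k)" using finite_imageD by blast
  then obtain i j :: nat where ij: "u [^]\<^bsub>G\<^esub> i = u [^]\<^bsub>G\<^esub> j" "i < j"
    by (metis injI linorder_neqE_nat)
  define n where "n = j - i"
  have n: "n > 0" "u [^]\<^bsub>G\<^esub> n = \<one>\<^bsub>G\<^esub>"
    using ij G.pow_eq_div2[OF uv(3) ij(1)[symmetric]] by (simp_all add: n_def)
  have pow: "x [^] k \<in> \<Gamma> (u [^]\<^bsub>G\<^esub> k) \<and> x [^] k \<otimes> y = (t ^ k) *\<^sub>R (y \<otimes> x [^] k)" for k :: nat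
  proof (induction k)
    case 0
    then show ?case using one_in_comp xc by simp
  next
    case (Suc k)
    have "x [^] k \<otimes> x \<otimes> y = x [^] k \<otimes> (x \<otimes> y)" using xc by (simp add: m_assoc)
    also have "\<dots> = t *\<^sub>R ((x [^] k \<otimes> y) \<otimes> x)" using xc by (simp add: xy m_assoc)
    also have "\<dots> = (t ^ Suc k) *\<^sub>R (y \<otimes> (x [^] k \<otimes> x))" using xc Suc by (simp add: m_assoc)
    finally show ?case using comp_mult Suc uv assms(3) by simp
  qed
  have "x [^] n \<in> \<Gamma> \<one>\<^bsub>G\<^esub>" using pow[of n] n by simp
  then obtain c where "x [^] n = emb c" using emb_surj by metis
  then have "x [^] n \<otimes> y = y \<otimes> x [^] n" using K_commute[OF assms(2,4)] by simp
  moreover have "x [^] k \<in> Units D" for k :: nat by (induction k) (simp_all add: xc)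
  then have "y \<otimes> x [^] n \<noteq> 0" using xc mult_neq_0 by blast
  moreover have "t ^ n *\<^sub>R (y \<otimes> x [^] n) = x [^] n \<otimes> y" using pow[of n] by simp
  ultimately have "t ^ n *\<^sub>R (y \<otimes> x [^] n) = 1 *\<^sub>R (y \<otimes> x [^] n)" "y \<otimes> x [^] n \<noteq> 0" by simp_all
  then have "t ^ n = 1" by (simp only: scaleR_cancel_right) simp
  then have "\<bar>t\<bar> ^ n = 1" by (metis power_abs abs_one)
  then have "\<bar>t\<bar> = 1" using n(1) by (metis abs_ge_zero power_eq_1_iff abs_abs neq0_conv real_norm_def)
  then have "t = 1 \<or> t = -1" by linarith
  then show ?thesis using xy by auto
qed

text \<open>The square of \<open>x\<close> commutes with every component of degree in
  \<open>K\<close>, because the sign occurs twice; \<open>radical_trivial\<close> then applies to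
  it.\<close>

lemma K_square: assumes "u \<in> K" shows "u \<otimes>\<^bsub>G\<^esub> u = \<one>\<^bsub>G\<^esub>"
proof -
  obtain x where x: "x \<in> \<Gamma> u" "x \<noteq> 0" using assms K_T T_nonzero by blast
  have uG: "u \<in> carrier G" using assms K_T T_carrier by blast
  have xc: "x \<in> carrier D" "x \<in> Units D" using x comp_carrier comp_Units uG by blast+
  show ?thesis
  proof (rule radical_trivial[of _ "x \<otimes> x"])
    show "u \<otimes>\<^bsub>G\<^esub> u \<in> K" using K_mult assms by blast
    show "x \<otimes> x \<in> \<Gamma> (u \<otimes>\<^bsub>G\<^esub> u)" using comp_mult x uG by blast
    show "x \<otimes> x \<noteq> 0" using mult_neq_0 xc by blast
    fix v y assume v: "v \<in> K" "y \<in> \<Gamma> v"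
    have yc: "y \<in> carrier D" using v comp_carrier T_carrier K_T by blast
    show "x \<otimes> x \<otimes> y = y \<otimes> (x \<otimes> x)"
    proof (cases "y = 0")
      case False
      from K_commutation_sign[OF assms v(1) x(1) v(2) x(2) this]
      obtain t where t: "x \<otimes> y = t *\<^sub>R (y \<otimes> x)" "t * t = (1::real)"
        by (metis scaleR_one scaleR_minus1_left mult_1 minus_mult_minus)
      have "x \<otimes> x \<otimes> y = x \<otimes> (x \<otimes> y)" using xc yc by (simp add: m_assoc)
      also have "\<dots> = x \<otimes> (t *\<^sub>R (y \<otimes> x))" by (simp only: t(1))
      also have "\<dots> = t *\<^sub>R ((x \<otimes> y) \<otimes> x)" using xc yc by (simp add: m_assoc)
      also have "(x \<otimes> y) \<otimes> x = t *\<^sub>R (y \<otimes> (x \<otimes> x))" unfolding t(1) using xc yc by (simp add: m_assoc)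
      also have "t *\<^sub>R t *\<^sub>R (y \<otimes> (x \<otimes> x)) = y \<otimes> (x \<otimes> x)" using t(2) by simp
      finally show ?thesis .
    qed (use xc in simp)
  qed
qed

text \<open>Passing \<open>X\<close> twice gives the factor \<open>|c|^2\<close>, but
  \<open>X \<otimes> X\<close> has degree in \<open>K\<close>, so this factor is a sign; being
  nonnegative, it is \<open>1\<close>.\<close>

lemma norm_commutation_factor:
  assumes "g \<in> T - K" "u \<in> K" "X \<in> \<Gamma> g" "x \<in> \<Gamma> u" "X \<noteq> 0" "x \<noteq> 0"
    and c: "X \<otimes> x = emb c \<otimes> (x \<otimes> X)"
  shows "cnj c * c = 1" "(X \<otimes> X) \<otimes> x = x \<otimes> (X \<otimes> X)"
proof -
  have gu: "g \<in> T" "g \<notin> K" "u \<in> T" "u \<in> carrier G" "g \<in> carrier G" using assms K_T T_carrier by auto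
  have xc: "x \<in> carrier D" "X \<in> carrier D" "X \<in> Units D" "x \<in> Units D"
    using T_comp_carrier T_comp_Units assms gu by blast+
  have XX: "X \<otimes> X \<in> \<Gamma> (g \<otimes>\<^bsub>G\<^esub> g)" "g \<otimes>\<^bsub>G\<^esub> g \<in> K" "X \<otimes> X \<noteq> 0"
    using comp_mult assms gu not_K_mult mult_neq_0 xc by auto
  have eq: "(X \<otimes> X) \<otimes> x = emb (cnj c * c) \<otimes> (x \<otimes> (X \<otimes> X))"
    by (rule emb_sandwich[OF xc(2,2,1) c c not_K_commute[OF gu(1,2) assms(3)]])
  have "cnj c * c = 1 \<or> cnj c * c = -1"
    using K_commutation_sign[OF XX(2) assms(2) XX(1) assms(4) XX(3) assms(6)]
  proof
    assume "X \<otimes> X \<otimes> x = x \<otimes> (X \<otimes> X)"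
    then have "emb (cnj c * c) \<otimes> (x \<otimes> (X \<otimes> X)) = emb 1 \<otimes> (x \<otimes> (X \<otimes> X))"
      using eq xc by (simp add: emb_1)
    then show ?thesis using Units_cancel(2)[of "x \<otimes> (X \<otimes> X)"] xc by simp
  next
    assume "X \<otimes> X \<otimes> x = - (x \<otimes> (X \<otimes> X))"
    then have "emb (cnj c * c) \<otimes> (x \<otimes> (X \<otimes> X)) = emb (-1) \<otimes> (x \<otimes> (X \<otimes> X))"
      using eq xc by (simp add: emb_def)
    then show ?thesis using Units_cancel(2)[of "x \<otimes> (X \<otimes> X)"] xc by simp
  qed
  moreover have "cnj c * c \<noteq> -1"
  proof
    assume "cnj c * c = -1"
    then have "Re (cnj c * c) = -1" by simp
    then show False using sum_power2_ge_zero[of "Re c" "Im c"] by (simp add: power2_eq_square)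
  qed
  ultimately show 1: "cnj c * c = 1" by blast
  show "(X \<otimes> X) \<otimes> x = x \<otimes> (X \<otimes> X)" using eq xc by (simp add: 1 emb_1)
qed

text \<open>The square of an element of degree outside \<open>K\<close> has degree in
  \<open>K\<close> and commutes with everything there, so the radical argument applies
  again.\<close>

lemma not_K_square: assumes "g \<in> T - K" shows "g \<otimes>\<^bsub>G\<^esub> g = \<one>\<^bsub>G\<^esub>"
proof -
  obtain X where X: "X \<in> \<Gamma> g" "X \<noteq> 0" using assms T_nonzero by blast
  have gG: "g \<in> carrier G" "g \<in> T" using assms T_carrier by auto
  have Xc: "X \<in> carrier D" "X \<in> Units D" using X comp_carrier comp_Units gG by blast+
  show ?thesis
  proof (rule radical_trivial[of _ "X \<otimes> X"])
    show "g \<otimes>\<^bsub>G\<^esub> g \<in> K" using not_K_mult assms by blast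
    show "X \<otimes> X \<in> \<Gamma> (g \<otimes>\<^bsub>G\<^esub> g)" using comp_mult X gG by blast
    show "X \<otimes> X \<noteq> 0" using mult_neq_0 Xc by blast
    fix v y assume v: "v \<in> K" "y \<in> \<Gamma> v"
    show "X \<otimes> X \<otimes> y = y \<otimes> (X \<otimes> X)"
    proof (cases "y = 0")
      case False
      obtain c where "X \<otimes> y = emb c \<otimes> (y \<otimes> X)"
        using commutation_factor[OF gG(2) K_T[OF v(1)] X(1) v(2) X(2) False] by metis
      then show ?thesis using norm_commutation_factor(2)[OF assms v(1) X(1) v(2) X(2) False] by blast
    qed (use Xc in simp)
  qed
qed

lemma T_square: "t \<in> T \<Longrightarrow> t \<otimes>\<^bsub>G\<^esub> t = \<one>\<^bsub>G\<^esub>"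
  using K_square not_K_square by blast

lemma elem2_T: "elem2 (G\<lparr>carrier := T\<rparr>)"
proof -
  interpret TG: comm_group "G\<lparr>carrier := T\<rparr>"
    by (rule subgroup_comm_group[OF comm_group subgroup_T])
  show ?thesis by unfold_locales (simp add: T_square)
qed

end

section \<open>Subgroups of index two\<close>

context elem2
begin

lemma index_2_subgroupI:
  assumes H: "subgroup H K" and g: "g \<in> carrier K" "g \<notin> H"
    and mult: "\<And>x y. x \<in> carrier K - H \<Longrightarrow> y \<in> carrier K - H \<Longrightarrow> x \<otimes> y \<in> H"
  shows "index_2_subgroup H K"
proof -
  have 1: "H #> h = H" if "h \<in> H" for h
    using that H by (simp add: coset_join2 subgroup.mem_carrier[OF H])
  have 2: "H #> h = H #> g" if "h \<in> carrier K" "h \<notin> H" for h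
  proof -
    have "g = (g \<otimes> h) \<otimes> h" using that g by (simp add: m_assoc)
    then have "g \<in> H #> h" unfolding r_coset_def using mult[of g h] that g by blast
    then show ?thesis using repr_independence that H by blast
  qed
  have 3: "H \<noteq> H #> g" using rcos_self[OF g(1) H] g(2) by blast
  have "rcosets\<^bsub>K\<^esub> H = {H, H #> g}"
    unfolding RCOSETS_def using 1 2 g subgroup.one_closed[OF H] subgroup.subset[OF H] by blast
  then have "card (rcosets\<^bsub>K\<^esub> H) = 2" using 3 by simp
  then show ?thesis using H by (simp add: index_2_subgroup_def)
qed

lemma index_2_subgroupD:
  assumes "index_2_subgroup H K"
  shows "subgroup H K" "carrier K - H \<noteq> {}"
    "\<And>x y. x \<in> carrier K - H \<Longrightarrow> y \<in> carrier K - H \<Longrightarrow> x \<otimes> y \<in> H"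
proof -
  show H: "subgroup H K" using assms by (simp add: index_2_subgroup_def)
  have in': "H #> x \<in> rcosets\<^bsub>K\<^esub> H" if "x \<in> carrier K" for x
    using that unfolding RCOSETS_def by blast
  have H': "H \<in> rcosets\<^bsub>K\<^esub> H" using in'[OF one_closed] H by (simp add: coset_mult_one subgroup.subset)
  obtain A B where AB: "rcosets\<^bsub>K\<^esub> H = {A, B}" "A \<noteq> B"
    using assms by (auto simp: index_2_subgroup_def card_2_iff)
  have neq: "H #> x \<noteq> H" if "x \<in> carrier K - H" for x
    using that rcos_self[OF _ H, of x] by auto
  show "x \<otimes> y \<in> H" if xy: "x \<in> carrier K - H" "y \<in> carrier K - H" for x y
  proof -
    have "H #> x = H #> y" using in'[of x] in'[of y] H' neq[OF xy(1)] neq[OF xy(2)] AB xy by auto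
    then have "x \<in> H #> y" using rcos_self[OF _ H, of x] xy by auto
    then obtain h where "h \<in> H" "x = h \<otimes> y" unfolding r_coset_def by blast
    then show ?thesis using xy subgroup.mem_carrier[OF H] by (simp add: m_assoc)
  qed
  show "carrier K - H \<noteq> {}"
  proof
    assume "carrier K - H = {}"
    then have "H #> x = H" if "x \<in> carrier K" for x
      using that H by (intro coset_join2) auto
    then have "rcosets\<^bsub>K\<^esub> H \<subseteq> {H}" unfolding RCOSETS_def by auto
    then show False using AB by auto
  qed
qed

lemma index_2_card:
  assumes "index_2_subgroup H K" "finite (carrier K)"
  shows "card (carrier K) = 2 * card H"
  using assms(1) lagrange_finite[OF assms(2), of H] by (simp add: index_2_subgroup_def order_def)

lemma mult_not_in:
  assumes "subgroup H K" "x \<in> H" "y \<in> carrier K - H" shows "x \<otimes> y \<in> carrier K - H" "y \<otimes> x \<in> carrier K - H"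
proof -
  have xc: "x \<in> carrier K" by (rule subgroup.mem_carrier[OF assms(1,2)])
  have "x \<otimes> y \<notin> H"
  proof
    assume "x \<otimes> y \<in> H"
    then have "x \<otimes> (x \<otimes> y) \<in> H" using assms(1,2) by (simp add: subgroup.m_closed)
    then show False using assms(3) xc by simp
  qed
  then show "x \<otimes> y \<in> carrier K - H" "y \<otimes> x \<in> carrier K - H" using xc assms(3) by (auto simp: m_comm)
qed

lemma monomial_group_closed:
  assumes "\<And>i. i < n \<Longrightarrow> a i \<in> carrier K \<and> b i \<in> carrier K"
  shows "monomial K a b n S \<in> carrier K"
  using assms by (induction n) auto

lemma gen_pair_group_mult:
  assumes "x \<in> carrier K" "y \<in> carrier K"
  shows "gen_pair K x y (u \<noteq> u') (v \<noteq> v') = gen_pair K x y u v \<otimes> gen_pair K x y u' v'"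
  using assms by (cases u; cases v; cases u'; cases v') (simp_all add: gen_pair_def m_ac)

lemma monomial_idx_add:
  assumes "\<And>i. i < n \<Longrightarrow> a i \<in> carrier K \<and> b i \<in> carrier K"
  shows "monomial K a b n (idx_add S S') = monomial K a b n S \<otimes> monomial K a b n S'"
  using assms
proof (induction n)
  case (Suc n)
  have cl: "monomial K a b n R \<in> carrier K" for R using Suc.prems by (intro monomial_group_closed) simp
  have "a n \<in> carrier K" "b n \<in> carrier K" using Suc.prems by auto
  then have g: "gen_pair K (a n) (b n) u v \<in> carrier K"
    and gm: "gen_pair K (a n) (b n) (u \<noteq> u') (v \<noteq> v') = gen_pair K (a n) (b n) u v \<otimes> gen_pair K (a n) (b n) u' v'"
    for u v u' v' by (simp, rule gen_pair_group_mult)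
  have "monomial K a b n (idx_add S S') = monomial K a b n S \<otimes> monomial K a b n S'"
    using Suc by simp
  then show ?case
    using cl g unfolding monomial.simps mem_idx_add gm by (simp add: m_ac)
qed simp

end

text \<open>
  In the last pair of Pauli generators of a grading, the second one is a square root of \<open>-1\<close> in the
  neutral component; this is why \<open>b r\<close> is the neutral element.
\<close>

definition deg_map ::
  "('g, 'e) monoid_scheme \<Rightarrow> (nat \<Rightarrow> 'g) \<Rightarrow> (nat \<Rightarrow> 'g) \<Rightarrow> 'g \<Rightarrow> nat \<Rightarrow> nat set \<times> nat set \<Rightarrow> 'g" where
  "deg_map K a b g r = monomial K (a(r := g)) (b(r := \<one>\<^bsub>K\<^esub>)) (Suc r)"

lemma deg_map_update [simp]: "deg_map (G\<lparr>carrier := H\<rparr>) a b g r = deg_map G a b g r"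
  by (simp add: deg_map_def fun_eq_iff del: monomial.simps)

text \<open>The letters are shifted here: \<open>K\<close> is the ambient group and \<open>H\<close>
  its subgroup of index two. They are instantiated by the support and by the degrees that commute
  with the neutral component.\<close>

locale degree_map = elem2 K for K (structure) +
  fixes H r a b g
  assumes H: "subgroup H K" and H_mult: "\<And>x y. x \<in> carrier K - H \<Longrightarrow> y \<in> carrier K - H \<Longrightarrow> x \<otimes> y \<in> H"
    and g: "g \<in> carrier K - H" and ab: "\<And>i. i < r \<Longrightarrow> a i \<in> H \<and> b i \<in> H"
    and bij: "bij_betw (monomial K a b r) (idx r) H"
begin

abbreviation d where "d \<equiv> deg_map K a b g r"

lemmas d_def = deg_map_def[of K a b g r]

lemma d_closed: "d S \<in> carrier K"
  unfolding d_def using g ab subgroup.mem_carrier[OF H] by (intro monomial_group_closed) auto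

lemma d_eq: "d S = monomial K a b r (idx_restrict r S) \<otimes> (if r \<in> fst S then g else \<one>)"
proof -
  have "monomial K (a(r := g)) (b(r := \<one>)) r S = monomial K a b r (idx_restrict r S)"
    by (rule monomial_cong) (auto simp: idx_restrict_def)
  then show ?thesis using g by (simp add: d_def gen_pair_def)
qed

lemma d_add: "d (idx_add S S') = d S \<otimes> d S'"
  unfolding d_def using g ab subgroup.mem_carrier[OF H] by (intro monomial_idx_add) auto

lemma mono_H: "S \<in> idx r \<Longrightarrow> monomial K a b r S \<in> H"
  using bij by (auto simp: bij_betw_def)

lemma d_in_H: assumes "S \<in> idx (Suc r)" shows "d S \<in> H \<longleftrightarrow> r \<notin> fst S"
  using mono_H[OF idx_restrict_in[OF assms]] mult_not_in(1)[OF H _ g] subgroup.mem_carrier[OF H]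
  by (auto simp: d_eq)

text \<open>Only the exponent of the last \<open>b\<close> is invisible in the degree, as that
  generator has neutral degree. The fibres thus have two elements, which accounts for components of
  dimension two.\<close>

lemma d_inj:
  assumes "S \<in> idx (Suc r)" "S' \<in> idx (Suc r)"
  shows "d S = d S' \<longleftrightarrow> fst S = fst S' \<and> snd S - {r} = snd S' - {r}"
proof
  assume eq: "d S = d S'"
  then have r: "r \<in> fst S \<longleftrightarrow> r \<in> fst S'" using d_in_H assms by metis
  have c: "monomial K a b r (idx_restrict r S) \<in> carrier K" "monomial K a b r (idx_restrict r S') \<in> carrier K"
    using mono_H idx_restrict_in assms subgroup.mem_carrier[OF H] by blast+
  have "monomial K a b r (idx_restrict r S) = monomial K a b r (idx_restrict r S')"
    using eq c g r by (auto simp: d_eq split: if_splits)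
  then have "idx_restrict r S = idx_restrict r S'"
    using inj_onD[OF bij_betw_imp_inj_on[OF bij]] idx_restrict_in assms by metis
  then show "fst S = fst S' \<and> snd S - {r} = snd S' - {r}"
    using r by (auto simp: idx_restrict_def)
next
  assume "fst S = fst S' \<and> snd S - {r} = snd S' - {r}"
  then show "d S = d S'" by (simp add: d_eq idx_restrict_def)
qed

lemma d_surj: "d ` idx (Suc r) = carrier K"
proof
  show "d ` idx (Suc r) \<subseteq> carrier K" using d_closed by blast
  show "carrier K \<subseteq> d ` idx (Suc r)"
  proof
    fix t assume t: "t \<in> carrier K"
    have *: "\<exists>S\<in>idx r. h = monomial K a b r S" if "h \<in> H" for h
      using bij that by (auto simp: bij_betw_def)
    show "t \<in> d ` idx (Suc r)"
    proof (cases "t \<in> H")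
      case True
      obtain S where S: "S \<in> idx r" "t = monomial K a b r S" using *[OF True] by blast
      then have "r \<notin> fst S" "idx_restrict r S = S" "S \<in> idx (Suc r)"
        by (auto simp: idx_def idx_restrict_def prod_eq_iff)
      then have "d S = t" using S t by (simp add: d_eq)
      then show ?thesis using \<open>S \<in> idx (Suc r)\<close> by blast
    next
      case False
      then have "t \<otimes> g \<in> H" using H_mult t g by blast
      then obtain S where S: "S \<in> idx r" "t \<otimes> g = monomial K a b r S" using * by blast
      let ?S = "(insert r (fst S), snd S)"
      have "idx_restrict r ?S = S" "?S \<in> idx (Suc r)"
        using S(1) by (auto simp: idx_def idx_restrict_def prod_eq_iff)
      then have "d ?S = t" using S g t by (simp add: d_eq flip: S(2)) (simp add: m_assoc)
      then show ?thesis using \<open>?S \<in> idx (Suc r)\<close> by blast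
    qed
  qed
qed

end

section \<open>The classifying triple of a grading\<close>

context dim2_grading
begin

section \<open>Signs of squares outside \<open>K\<close>\<close>

lemma commute_mult:
  assumes "w \<in> carrier D" "x \<in> carrier D" "y \<in> carrier D" "w \<otimes> x = x \<otimes> w" "w \<otimes> y = y \<otimes> w"
  shows "w \<otimes> (x \<otimes> y) = (x \<otimes> y) \<otimes> w"
proof -
  have "w \<otimes> (x \<otimes> y) = (x \<otimes> w) \<otimes> y" using assms(1-3) by (simp add: m_assoc flip: assms(4))
  also have "\<dots> = x \<otimes> (w \<otimes> y)" using assms(1-3) by (simp add: m_assoc)
  also have "\<dots> = (x \<otimes> y) \<otimes> w" using assms(1-3) by (simp add: assms(5) m_assoc)
  finally show ?thesis .
qed

text \<open>The square is a complex scalar that commutes with \<open>x\<close>, whereas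
  \<open>x\<close> conjugates complex scalars; so it is real.\<close>

lemma not_K_square_scalar:
  assumes "g \<in> T - K" "x \<in> \<Gamma> g"
  obtains c where "x \<otimes> x = c *\<^sub>R \<one>"
proof -
  have gT: "g \<in> T" "g \<notin> K" "g \<in> carrier G" using assms T_carrier by auto
  have xc: "x \<in> carrier D" using T_comp_carrier gT assms by blast
  have "x \<otimes> x \<in> \<Gamma> \<one>\<^bsub>G\<^esub>" using comp_mult[OF gT(3,3) assms(2,2)] T_square gT by simp
  then obtain c where c: "x \<otimes> x = emb c" using emb_surj by metis
  show ?thesis
  proof (cases "x = 0")
    case False
    have "emb (cnj c) \<otimes> x = x \<otimes> (x \<otimes> x)" using not_K_commute[OF gT(1,2) assms(2)] c by simp
    also have "\<dots> = emb c \<otimes> x" using xc by (simp add: m_assoc flip: c)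
    finally have "cnj c = c" using Units_cancel(2)[OF T_comp_Units[OF gT(1) assms(2) False]] by simp
    then obtain t where "c = of_real t" by (metis Reals_cnj_iff Reals_cases)
    then show ?thesis using that[of t] c by (simp add: emb_of_real)
  qed (use that[of 0] in simp)
qed

lemma square_neq_0: "t \<in> T \<Longrightarrow> x \<in> \<Gamma> t \<Longrightarrow> x \<noteq> 0 \<Longrightarrow> x \<otimes> x \<noteq> 0"
  using mult_neq_0 T_comp_Units by blast

text \<open>Another element of the component is \<open>emb d \<otimes> x\<close>, and since
  \<open>x\<close> conjugates scalars, its square is \<open>|d|^2\<close> times that of
  \<open>x\<close>.\<close>

lemma square_sign_unique:
  assumes "g \<in> T - K" "x \<in> \<Gamma> g" "x' \<in> \<Gamma> g" "x \<noteq> 0" "x \<otimes> x = c *\<^sub>R \<one>" "x' \<noteq> 0"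
  shows "\<exists>s>0. x' \<otimes> x' = (s * c) *\<^sub>R \<one>"
proof -
  have gT: "g \<in> T" "g \<notin> K" using assms by auto
  have xc: "x \<in> carrier D" using T_comp_carrier gT assms by blast
  obtain d where d: "x' = emb d \<otimes> x" using comp_left_one[OF gT(1) assms(2,4,3)] by metis
  then have "d \<noteq> 0" using assms(6) xc by (auto simp: emb_0)
  have "x' \<otimes> x' = emb d \<otimes> ((x \<otimes> emb d) \<otimes> x)" using xc by (simp add: d m_assoc)
  also have "\<dots> = (emb d \<otimes> emb (cnj d)) \<otimes> (x \<otimes> x)"
    using xc not_K_commute[OF gT assms(2)] by (simp add: m_assoc)
  also have "\<dots> = (c * (cmod d)\<^sup>2) *\<^sub>R \<one>"
    by (simp add: emb_mult assms(5) complex_norm_square[symmetric] emb_of_real del: of_real_power)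
  finally show ?thesis using \<open>d \<noteq> 0\<close> by (intro exI[of _ "(cmod d)\<^sup>2"]) (simp add: mult.commute)
qed

text \<open>The value \<open>undefined\<close> outside \<open>T - K\<close> puts the map into the
  extensional function space that \<open>nice_map\<close> requires.\<close>

definition nu :: "'g \<Rightarrow> int" where
  "nu t = (if t \<in> T - K then if \<exists>x\<in>\<Gamma> t. \<exists>s>0. x \<otimes> x = s *\<^sub>R \<one> then 1 else -1 else undefined)"

lemma nu_eq_sgn:
  assumes "g \<in> T - K" "x \<in> \<Gamma> g" "x \<noteq> 0" "x \<otimes> x = c *\<^sub>R \<one>"
  shows "real_of_int (nu g) = sgn c"
proof -
  have "c \<noteq> 0" using square_neq_0[of g x] assms by auto
  show ?thesis
  proof (cases "c > 0")
    case False
    have "\<not> (\<exists>x'\<in>\<Gamma> g. \<exists>s>0. x' \<otimes> x' = s *\<^sub>R \<one>)"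
    proof
      assume "\<exists>x'\<in>\<Gamma> g. \<exists>s>0. x' \<otimes> x' = s *\<^sub>R \<one>"
      then obtain x' s where x': "x' \<in> \<Gamma> g" "s > 0" "x' \<otimes> x' = s *\<^sub>R \<one>" by blast
      then have "x' \<noteq> 0" using one_neq_0 by auto
      then obtain s' where s': "s' > 0" "x' \<otimes> x' = (s' * c) *\<^sub>R \<one>"
        using square_sign_unique[OF assms(1,2) x'(1) assms(3,4)] by blast
      have "s *\<^sub>R \<one> = (s' * c) *\<^sub>R \<one>" using x'(3) s'(2) by (rule trans[OF sym])
      then have "s = s' * c" using one_neq_0 by (metis scaleR_cancel_right)
      then show False using x'(2) s'(1) False by (simp add: zero_less_mult_iff)
    qed
    then show ?thesis using assms(1) \<open>c \<noteq> 0\<close> False by (simp add: nu_def)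
  qed (use assms in \<open>auto simp: nu_def\<close>)
qed

lemma nu_square:
  assumes "g \<in> T - K" "x \<in> \<Gamma> g" "x \<noteq> 0"
  shows "\<exists>s>0. x \<otimes> x = (s * real_of_int (nu g)) *\<^sub>R \<one>"
proof -
  obtain c where c: "x \<otimes> x = c *\<^sub>R \<one>" by (rule not_K_square_scalar[OF assms(1,2)])
  have "c \<noteq> 0" using square_neq_0[of g x] assms c by auto
  then show ?thesis using c nu_eq_sgn[OF assms c]
    by (intro exI[of _ "\<bar>c\<bar>"]) (simp add: abs_mult_sgn)
qed

lemma nu_cases: "g \<in> T - K \<Longrightarrow> nu g = 1 \<or> nu g = -1"
  by (simp add: nu_def)

lemma triple: "triple_of_grading G D \<Gamma> (T, K, nu)"
  using nu_square unfolding triple_of_grading_def by (auto simp: T_def K_def)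

definition mu :: "'g \<Rightarrow> 'g \<Rightarrow> int" where
  "mu g = nice_mu (G\<lparr>carrier := T\<rparr>) nu g"

lemma mu_eq: "mu g u = nu (g \<otimes>\<^bsub>G\<^esub> u) * nu g"
  by (simp add: mu_def nice_mu_def)

lemma K_subgroup_T: "subgroup K (G\<lparr>carrier := T\<rparr>)"
proof -
  interpret TT: elem2 "G\<lparr>carrier := T\<rparr>" by (rule elem2_T)
  show ?thesis
    by (rule TT.subgroupI) (use K_T one_in_K K_mult TT.inv_self in auto)
qed

lemma K_subgroup: "subgroup K G"
  by (rule G.incl_subgroup[OF subgroup_T K_subgroup_T])

lemma elem2_K: "elem2 (G\<lparr>carrier := K\<rparr>)"
proof -
  interpret KG: comm_group "G\<lparr>carrier := K\<rparr>"
    by (rule subgroup_comm_group[OF comm_group K_subgroup])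
  show ?thesis by unfold_locales (simp add: K_square)
qed

lemma not_K_mult_K: "g \<in> T - K \<Longrightarrow> u \<in> K \<Longrightarrow> g \<otimes>\<^bsub>G\<^esub> u \<in> T - K"
proof -
  interpret TT: elem2 "G\<lparr>carrier := T\<rparr>" by (rule elem2_T)
  show "g \<in> T - K \<Longrightarrow> u \<in> K \<Longrightarrow> g \<otimes>\<^bsub>G\<^esub> u \<in> T - K"
    using TT.mult_not_in(2)[OF K_subgroup_T, of u g] by simp
qed

lemma index_2_K: "index_2_subgroup K (G\<lparr>carrier := T\<rparr>)"
proof -
  interpret TT: elem2 "G\<lparr>carrier := T\<rparr>" by (rule elem2_T)
  obtain g where "g \<in> T - K" using exists_not_K by blast
  then show ?thesis
    using not_K_mult by (intro TT.index_2_subgroupI[OF K_subgroup_T, of g]) auto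
qed

text \<open>
  Commutation with \<open>X\<close> of degree \<open>g \<notin> K\<close> singles out a real line in every component of degree in \<open>K\<close>.
\<close>

definition real_rep :: "'a \<Rightarrow> 'g \<Rightarrow> 'a \<Rightarrow> bool" where
  "real_rep X u x \<longleftrightarrow> u \<in> K \<and> x \<in> \<Gamma> u \<and> x \<noteq> 0 \<and> X \<otimes> x = x \<otimes> X"

lemma real_repD:
  assumes "real_rep X u x"
  shows "u \<in> K" "x \<in> \<Gamma> u" "x \<noteq> 0" "X \<otimes> x = x \<otimes> X" "x \<in> carrier D" "x \<in> Units D" "u \<in> carrier G" "u \<in> T"
proof -
  show *: "u \<in> K" "x \<in> \<Gamma> u" "x \<noteq> 0" "X \<otimes> x = x \<otimes> X" using assms by (auto simp: real_rep_def)
  show "u \<in> T" using K_T *(1) .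
  then show "x \<in> carrier D" "x \<in> Units D" "u \<in> carrier G" using T_comp_carrier T_comp_Units T_carrier * by blast+
qed

text \<open>The factor between \<open>X\<close> and \<open>x\<close> has modulus \<open>1\<close>,
  and rescaling by its square root absorbs it, as in \<open>radical_trivial\<close>.\<close>

lemma real_rep_exists:
  assumes g: "g \<in> T - K" "X \<in> \<Gamma> g" "X \<noteq> 0" and u: "u \<in> K"
  shows "\<exists>x. real_rep X u x"
proof -
  obtain x where x: "x \<in> \<Gamma> u" "x \<noteq> 0" by (rule T_nonzero[OF K_T[OF u]])
  have gT: "g \<in> T" "g \<notin> K" using g by auto
  have xc: "x \<in> carrier D" "X \<in> carrier D" "x \<in> Units D"
    using T_comp_carrier T_comp_Units x K_T[OF u] g gT by blast+
  obtain c where c: "X \<otimes> x = emb c \<otimes> (x \<otimes> X)" "c \<noteq> 0"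
    using commutation_factor[OF gT(1) K_T[OF u] g(2) x(1) g(3) x(2)] by metis
  have norm: "cnj c * c = 1" by (rule norm_commutation_factor(1)[OF g(1) u g(2) x(1) g(3) x(2) c(1)])
  define d where "d = csqrt c"
  have d2: "d * d = c" using power2_csqrt[of c] by (simp add: d_def power2_eq_square)
  have sq: "cnj d * d = of_real ((cmod d)\<^sup>2)" by (subst complex_norm_square) (rule mult.commute)
  have "cnj d * d * (cnj d * d) = 1" using norm d2 by (metis complex_cnj_mult mult.commute mult.left_commute)
  then have "((cmod d)\<^sup>2)\<^sup>2 = 1" unfolding sq by (metis of_real_eq_1_iff of_real_mult power2_eq_square)
  then have "(cmod d)\<^sup>2 = 1" by (metis power2_eq_1_iff zero_le_power2 neg_0_le_iff_le not_one_le_zero)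
  then have nd: "cnj d * d = 1" by (simp only: sq of_real_1)
  then have d0: "d \<noteq> 0" by auto
  have "X \<otimes> (emb d \<otimes> x) = (X \<otimes> emb d) \<otimes> x" using xc by (simp add: m_assoc)
  also have "\<dots> = emb (cnj d) \<otimes> (X \<otimes> x)" using xc not_K_commute[OF gT g(2)] by (simp add: m_assoc)
  also have "\<dots> = (emb (cnj d) \<otimes> emb c) \<otimes> (x \<otimes> X)" using xc c(1) by (simp add: m_assoc)
  also have "cnj d * c = d" using nd d2 by (metis mult.assoc mult_1)
  then have "emb (cnj d) \<otimes> emb c = emb d" by (simp add: emb_mult)
  finally have "X \<otimes> (emb d \<otimes> x) = (emb d \<otimes> x) \<otimes> X" using xc by (simp add: m_assoc)
  moreover have "emb d \<otimes> x \<in> \<Gamma> u"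
    using comp_mult[OF G.one_closed T_carrier[OF K_T[OF u]] emb_comp x(1)] T_carrier[OF K_T[OF u]] by simp
  moreover have "emb d \<otimes> x \<noteq> 0" using mult_neq_0 emb_Units[OF d0] xc by blast
  ultimately show ?thesis using u unfolding real_rep_def by blast
qed

text \<open>The square of \<open>x\<close> is a complex scalar that commutes with \<open>X\<close>,
  hence real. As \<open>X\<close> and \<open>x\<close> commute, the square of
  \<open>X \<otimes> x\<close> is the product of their squares, so the sign in question is
  \<open>nu (g u) * nu g\<close>.\<close>

lemma real_rep_square:
  assumes g: "g \<in> T - K" "X \<in> \<Gamma> g" "X \<noteq> 0" and x: "real_rep X u x"
  shows "\<exists>s>0. x \<otimes> x = (s * real_of_int (mu g u)) *\<^sub>R \<one>"
proof -
  note x = real_repD[OF x]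
  have gT: "g \<in> T" "g \<notin> K" "g \<in> carrier G" using g T_carrier by auto
  have Xc: "X \<in> carrier D" "X \<in> Units D" using T_comp_carrier T_comp_Units g gT by blast+
  have "x \<otimes> x \<in> \<Gamma> \<one>\<^bsub>G\<^esub>" using comp_mult[OF x(7,7,2,2)] T_square x(8) by simp
  then obtain c where c: "x \<otimes> x = emb c" using emb_surj by metis
  have "X \<otimes> (x \<otimes> x) = (x \<otimes> x) \<otimes> X" by (rule commute_mult[OF Xc(1) x(5,5,4,4)])
  then have "emb (cnj c) \<otimes> X = emb c \<otimes> X" using not_K_commute[OF gT(1,2) g(2)] c by simp
  then have "cnj c = c" using Units_cancel(2)[OF Xc(2)] by simp
  then obtain t where "c = of_real t" by (metis Reals_cnj_iff Reals_cases)
  then have t: "x \<otimes> x = t *\<^sub>R \<one>" using c by (simp add: emb_of_real)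
  then have t0: "t \<noteq> 0" using square_neq_0[OF x(8,2,3)] by auto
  obtain s where s: "X \<otimes> X = s *\<^sub>R \<one>" by (rule not_K_square_scalar[OF g(1,2)])
  have Xx: "X \<otimes> x \<in> \<Gamma> (g \<otimes>\<^bsub>G\<^esub> u)" "X \<otimes> x \<noteq> 0" "g \<otimes>\<^bsub>G\<^esub> u \<in> T - K"
    using comp_mult gT g x mult_neq_0 Xc not_K_mult_K by blast+
  have "(X \<otimes> x) \<otimes> (X \<otimes> x) = X \<otimes> ((x \<otimes> X) \<otimes> x)" using Xc x(5) by (simp add: m_assoc)
  also have "\<dots> = (X \<otimes> X) \<otimes> (x \<otimes> x)" using Xc x(5) by (simp add: x(4)[symmetric] m_assoc)
  also have "\<dots> = (s * t) *\<^sub>R \<one>" by (simp add: s t)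
  finally have "real_of_int (nu (g \<otimes>\<^bsub>G\<^esub> u)) = sgn (s * t)" by (rule nu_eq_sgn[OF Xx(3,1,2)])
  moreover have "real_of_int (nu g) = sgn s" by (rule nu_eq_sgn[OF g s])
  moreover have "s \<noteq> 0" using square_neq_0[OF gT(1) g(2,3)] s by auto
  ultimately have "real_of_int (mu g u) = sgn t"
    by (simp add: mu_eq sgn_mult)
  then show ?thesis using t t0 by (intro exI[of _ "\<bar>t\<bar>"]) (simp add: abs_mult_sgn)
qed

lemma mu_cases: "g \<in> T - K \<Longrightarrow> u \<in> K \<Longrightarrow> mu g u = 1 \<or> mu g u = -1"
  using nu_cases[of g] nu_cases[of "g \<otimes>\<^bsub>G\<^esub> u"] not_K_mult_K by (auto simp: mu_eq)

lemma real_rep_mult: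
  assumes "real_rep X u x" "real_rep X v y" "X \<in> carrier D"
  shows "real_rep X (u \<otimes>\<^bsub>G\<^esub> v) (x \<otimes> y)"
proof -
  note x = real_repD[OF assms(1)] and y = real_repD[OF assms(2)]
  have "X \<otimes> (x \<otimes> y) = (x \<otimes> y) \<otimes> X" by (rule commute_mult[OF assms(3) x(5) y(5) x(4) y(4)])
  then show ?thesis
    using K_mult[OF x(1) y(1)] comp_mult[OF x(7) y(7) x(2) y(2)] mult_neq_0[OF x(6) y(6)]
    unfolding real_rep_def by blast
qed

text \<open>If \<open>x \<otimes> y = t (y \<otimes> x)\<close>, then
  \<open>(x \<otimes> y)^2\<close> is \<open>t\<close> times the product of the two squares.
  Comparing signs gives \<open>t = mu (u v) * mu u * mu v\<close>, the associated
  bicharacter.\<close>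

lemma real_rep_commute:
  assumes g: "g \<in> T - K" "X \<in> \<Gamma> g" "X \<noteq> 0" and xy: "real_rep X u x" "real_rep X v y"
  shows "x \<otimes> y = real_of_int (assoc_bichar (G\<lparr>carrier := K\<rparr>) (mu g) u v) *\<^sub>R (y \<otimes> x)"
proof -
  note x = real_repD[OF xy(1)] and y = real_repD[OF xy(2)]
  have Xc: "X \<in> carrier D" using T_comp_carrier g by blast
  obtain t where t: "x \<otimes> y = t *\<^sub>R (y \<otimes> x)" "t = 1 \<or> t = (-1::real)"
    using K_commutation_sign[OF x(1) y(1) x(2) y(2) x(3) y(3)] by (metis scaleR_one scaleR_minus1_left)
  obtain p where p: "p > 0" "x \<otimes> x = (p * real_of_int (mu g u)) *\<^sub>R \<one>" using real_rep_square[OF g xy(1)] by blast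
  obtain q where q: "q > 0" "y \<otimes> y = (q * real_of_int (mu g v)) *\<^sub>R \<one>" using real_rep_square[OF g xy(2)] by blast
  obtain w where w: "w > 0" "(x \<otimes> y) \<otimes> (x \<otimes> y) = (w * real_of_int (mu g (u \<otimes>\<^bsub>G\<^esub> v))) *\<^sub>R \<one>"
    using real_rep_square[OF g real_rep_mult[OF xy Xc]] by blast
  have tt: "t * t = 1" using t(2) by auto
  have "(x \<otimes> y) \<otimes> (x \<otimes> y) = (t *\<^sub>R (y \<otimes> x)) \<otimes> (x \<otimes> y)" by (simp only: t(1)[symmetric])
  also have "\<dots> = t *\<^sub>R (y \<otimes> ((x \<otimes> x) \<otimes> y))" using x(5) y(5) by (simp add: m_assoc)
  also have "\<dots> = (t * (p * real_of_int (mu g u)) * (q * real_of_int (mu g v))) *\<^sub>R \<one>"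
    using y(5) by (simp add: p q)
  finally have "(w * real_of_int (mu g (u \<otimes>\<^bsub>G\<^esub> v))) *\<^sub>R \<one>
      = (t * (p * real_of_int (mu g u)) * (q * real_of_int (mu g v))) *\<^sub>R \<one>" using w(2) by simp
  then have eq: "w * real_of_int (mu g (u \<otimes>\<^bsub>G\<^esub> v)) = t * (p * real_of_int (mu g u)) * (q * real_of_int (mu g v))"
    using one_neq_0 by (metis scaleR_cancel_right)
  have pos: "w > 0" "p * q > 0" using w p q by auto
  have "real_of_int (mu g (u \<otimes>\<^bsub>G\<^esub> v)) * real_of_int (mu g u) * real_of_int (mu g v) = t"
    using eq pos t(2) mu_cases[OF g(1) x(1)] mu_cases[OF g(1) y(1)] mu_cases[OF g(1) K_mult[OF x(1) y(1)]]
    by auto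
  then show ?thesis using t(1) by (simp add: assoc_bichar_def)
qed

lemma bichar_eqI:
  assumes g: "g \<in> T - K" "X \<in> \<Gamma> g" "X \<noteq> 0" and xy: "real_rep X u x" "real_rep X v y"
    and "x \<otimes> y = real_of_int c *\<^sub>R (y \<otimes> x)"
  shows "assoc_bichar (G\<lparr>carrier := K\<rparr>) (mu g) u v = c"
proof -
  have "y \<otimes> x \<noteq> 0" using mult_neq_0 real_repD(6) xy by blast
  moreover have "real_of_int (assoc_bichar (G\<lparr>carrier := K\<rparr>) (mu g) u v) *\<^sub>R (y \<otimes> x) = real_of_int c *\<^sub>R (y \<otimes> x)"
    using real_rep_commute[OF g xy] assms(6) by (rule trans[OF sym])
  ultimately have "real_of_int (assoc_bichar (G\<lparr>carrier := K\<rparr>) (mu g) u v) = real_of_int c"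
    by (metis scaleR_cancel_right)
  then show ?thesis by simp
qed

text \<open>The bicharacter is the commutation sign of real representatives, and commutation signs
  are multiplicative because real representatives are closed under products.\<close>

lemma quadratic_form_mu:
  assumes gK: "g \<in> T - K"
  shows "quadratic_form (G\<lparr>carrier := K\<rparr>) (mu g)"
proof -
  have gT: "g \<in> T" "g \<in> carrier G" using gK T_carrier by auto
  obtain X where X: "X \<in> \<Gamma> g" "X \<noteq> 0" by (rule T_nonzero[OF gT(1)])
  note g = gK X
  have Xc: "X \<in> carrier D" using T_comp_carrier gT X by blast
  let ?\<beta> = "assoc_bichar (G\<lparr>carrier := K\<rparr>) (mu g)"
  have bi: "?\<beta> (u \<otimes>\<^bsub>G\<^esub> v) w = ?\<beta> u w * ?\<beta> v w \<and> ?\<beta> w (u \<otimes>\<^bsub>G\<^esub> v) = ?\<beta> w u * ?\<beta> w v"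
    if uvw: "u \<in> K" "v \<in> K" "w \<in> K" for u v w
  proof -
    obtain x y z where xyz: "real_rep X u x" "real_rep X v y" "real_rep X w z"
      using real_rep_exists[OF g] uvw by metis
    note c = real_repD(5)[OF xyz(1)] real_repD(5)[OF xyz(2)] real_repD(5)[OF xyz(3)]
    note xy = real_rep_mult[OF xyz(1,2) Xc]
    note com = real_rep_commute[OF g]
    have "(x \<otimes> y) \<otimes> z = x \<otimes> (y \<otimes> z)" using c by (simp add: m_assoc)
    also have "y \<otimes> z = real_of_int (?\<beta> v w) *\<^sub>R (z \<otimes> y)" by (rule com[OF xyz(2,3)])
    also have "x \<otimes> \<dots> = real_of_int (?\<beta> v w) *\<^sub>R ((x \<otimes> z) \<otimes> y)" using c by (simp add: m_assoc)
    also have "x \<otimes> z = real_of_int (?\<beta> u w) *\<^sub>R (z \<otimes> x)" by (rule com[OF xyz(1,3)])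
    finally have "(x \<otimes> y) \<otimes> z = real_of_int (?\<beta> u w * ?\<beta> v w) *\<^sub>R (z \<otimes> (x \<otimes> y))"
      using c by (simp add: m_assoc mult.commute)
    then have 1: "?\<beta> (u \<otimes>\<^bsub>G\<^esub> v) w = ?\<beta> u w * ?\<beta> v w" by (rule bichar_eqI[OF g xy xyz(3)])
    have "z \<otimes> (x \<otimes> y) = (z \<otimes> x) \<otimes> y" using c by (simp add: m_assoc)
    also have "z \<otimes> x = real_of_int (?\<beta> w u) *\<^sub>R (x \<otimes> z)" by (rule com[OF xyz(3,1)])
    also have "\<dots> \<otimes> y = real_of_int (?\<beta> w u) *\<^sub>R (x \<otimes> (z \<otimes> y))" using c by (simp add: m_assoc)
    also have "z \<otimes> y = real_of_int (?\<beta> w v) *\<^sub>R (y \<otimes> z)" by (rule com[OF xyz(3,2)])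
    finally have "z \<otimes> (x \<otimes> y) = real_of_int (?\<beta> w u * ?\<beta> w v) *\<^sub>R ((x \<otimes> y) \<otimes> z)"
      using c by (simp add: m_assoc mult.commute)
    then have 2: "?\<beta> w (u \<otimes>\<^bsub>G\<^esub> v) = ?\<beta> w u * ?\<beta> w v" by (rule bichar_eqI[OF g xyz(3) xy])
    show ?thesis using 1 2 by blast
  qed
  have one: "mu g \<one>\<^bsub>G\<^esub> = 1" using nu_cases[OF gK] gT by (auto simp: mu_eq)
  have vals: "mu g \<in> K \<rightarrow> {1, -1}" using mu_cases[OF gK] by auto
  show ?thesis
    unfolding quadratic_form_def using elem2_K elem2_iff one vals bi by auto
qed

text \<open>A real representative of a degree in the radical commutes with all other real
  representatives, hence with their complex multiples, which fill the components of degree in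
  \<open>K\<close>.\<close>

lemma type_I_mu:
  assumes gK: "g \<in> T - K"
  shows "quadratic_form_type_I (G\<lparr>carrier := K\<rparr>) (mu g)"
proof -
  have gT: "g \<in> T" "g \<in> carrier G" using gK T_carrier by auto
  obtain X where X: "X \<in> \<Gamma> g" "X \<noteq> 0" by (rule T_nonzero[OF gT(1)])
  note g = gK X
  have Xc: "X \<in> carrier D" using T_comp_carrier gT X by blast
  let ?\<beta> = "assoc_bichar (G\<lparr>carrier := K\<rparr>) (mu g)"
  have "t = \<one>\<^bsub>G\<^esub>" if t: "t \<in> K" "\<forall>u\<in>K. ?\<beta> u t = 1" for t
  proof -
    obtain x where x: "real_rep X t x" using real_rep_exists[OF g t(1)] by blast
    note xr = real_repD[OF x]
    have "x \<otimes> w = w \<otimes> x" if v: "v \<in> K" "w \<in> \<Gamma> v" for v w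
    proof -
      obtain y where y: "real_rep X v y" using real_rep_exists[OF g v(1)] by blast
      note yr = real_repD[OF y]
      have yx: "y \<otimes> x = x \<otimes> y" using real_rep_commute[OF g y x] t(2) v(1) by simp
      obtain c where c: "w = emb c \<otimes> y" using comp_left_one[OF yr(8,2,3) v(2)] by metis
      have "x \<otimes> (emb c \<otimes> y) = (x \<otimes> emb c) \<otimes> y" using xr yr by (simp add: m_assoc)
      also have "\<dots> = emb c \<otimes> (x \<otimes> y)" using xr(5) yr(5) by (simp add: K_commute[OF xr(1,2)] m_assoc)
      also have "\<dots> = (emb c \<otimes> y) \<otimes> x" using xr(5) yr(5) by (simp add: yx[symmetric] m_assoc)
      finally show ?thesis by (simp add: c)
    qed
    then show ?thesis by (rule radical_trivial[OF xr(1,2,3)])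
  qed
  moreover interpret Q: quad_form "G\<lparr>carrier := K\<rparr>" "mu g" by (rule quad_formI[OF quadratic_form_mu[OF gK]])
  have "?\<beta> u \<one>\<^bsub>G\<^esub> = 1" if "u \<in> K" for u using Q.beta_one(2)[of u] that by simp
  ultimately have "{t \<in> K. \<forall>u\<in>K. ?\<beta> u t = 1} = {\<one>\<^bsub>G\<^esub>}" using one_in_K by blast
  then show ?thesis
    using quadratic_form_mu[OF gK] by (simp add: quadratic_form_type_I_def)
qed

lemma nice_map_nu: "nice_map_type_I (G\<lparr>carrier := T\<rparr>) K nu"
proof -
  have "comm_group (G\<lparr>carrier := T\<rparr>)" by (rule subgroup_comm_group[OF comm_group subgroup_T])
  moreover have "nu t = undefined" if "t \<notin> T - K" for t using that by (auto simp: nu_def)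
  then have "nu \<in> (T - K) \<rightarrow>\<^sub>E {1, -1}" using nu_cases by (intro PiE_I) simp_all
  ultimately show ?thesis
    using finite_T index_2_K elem2_K elem2_iff type_I_mu
    unfolding nice_map_type_I_def nice_map_def mu_def by (auto simp: quadratic_form_type_I_def)
qed

end

section \<open>Homogeneous Pauli families\<close>

lemma degree_map_symplectic:
  assumes "elem2 E" "index_2_subgroup H E" "g \<in> carrier E - H"
    and q: "quadratic_form (E\<lparr>carrier := H\<rparr>) \<mu>" and sb: "symplectic_basis (E\<lparr>carrier := H\<rparr>) \<mu> r a b"
  shows "degree_map E H r a b g"
proof -
  interpret E: elem2 E by fact
  interpret Q: quad_form "E\<lparr>carrier := H\<rparr>" \<mu> by (rule quad_formI[OF q])
  have orth: "Q.orth_pairs H r a b" and bij: "bij_betw (Q.idx_prod a b) (idx r) H"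
    using sb unfolding Q.symplectic_basis_iff by simp_all
  have ab: "a i \<in> H" "b i \<in> H" if "i < r" for i using orth that by (auto simp: Q.orth_pairs_def)
  have "monomial E a b r S = Q.idx_prod a b S" if "S \<in> idx r" for S
    using Q.monomial_idx_prod[of r a b S] ab that by simp
  then have "bij_betw (monomial E a b r) (idx r) H"
    using bij by (simp cong: bij_betw_cong)
  then show ?thesis
    unfolding degree_map_def degree_map_axioms_def
    using E.index_2_subgroupD[OF assms(2)] assms(1,3) ab by simp
qed

context dim2_grading
begin

lemma real_rep_normalized:
  assumes g: "g \<in> T - K" "X \<in> \<Gamma> g" "X \<noteq> 0" and u: "u \<in> K"
  shows "\<exists>x. real_rep X u x \<and> x \<otimes> x = real_of_int (mu g u) *\<^sub>R \<one>"
proof -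
  obtain x where x: "real_rep X u x" using real_rep_exists[OF g u] by blast
  obtain s where s: "s > 0" "x \<otimes> x = (s * real_of_int (mu g u)) *\<^sub>R \<one>"
    using real_rep_square[OF g x] by blast
  note xr = real_repD[OF x]
  have Xc: "X \<in> carrier D" using T_comp_carrier g by blast
  let ?x = "(1 / sqrt s) *\<^sub>R x"
  have "real_rep X u ?x"
    using xr Xc s(1) comp_scale unfolding real_rep_def by simp
  moreover have "?x \<otimes> ?x = real_of_int (mu g u) *\<^sub>R \<one>"
    using xr(5) s by simp
  ultimately show ?thesis by blast
qed

lemma monomial_comp:
  assumes "\<And>k. k < n \<Longrightarrow> da k \<in> carrier G \<and> db k \<in> carrier G \<and> A k \<in> \<Gamma> (da k) \<and> B k \<in> \<Gamma> (db k)"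
  shows "monomial G da db n S \<in> carrier G \<and> monomial D A B n S \<in> \<Gamma> (monomial G da db n S)"
  using assms
proof (induction n)
  case 0
  then show ?case using one_in_comp by simp
next
  case (Suc n)
  let ?p = "\<lambda>E a b. gen_pair E (a n) (b n) (n \<in> fst S) (n \<in> snd S)"
  have n: "da n \<in> carrier G" "db n \<in> carrier G" "A n \<in> \<Gamma> (da n)" "B n \<in> \<Gamma> (db n)"
    using Suc.prems by blast+
  have "gen_pair G (da n) (db n) (n \<in> fst S) (n \<in> snd S) \<in> carrier G \<and>
      gen_pair D (A n) (B n) (n \<in> fst S) (n \<in> snd S) \<in> \<Gamma> (gen_pair G (da n) (db n) (n \<in> fst S) (n \<in> snd S))"
    unfolding gen_pair_def
    using n one_in_comp comp_mult[OF n(1,2,3,4)] comp_mult[OF n(1) G.one_closed n(3) one_in_comp]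
      comp_mult[OF G.one_closed n(2) one_in_comp n(4)] comp_carrier[OF n(1,3)] comp_carrier[OF n(2,4)]
    by auto
  then show ?case using Suc comp_mult by simp
qed

text \<open>Real representatives commute with \<open>X\<close> and with \<open>im\<close>, and with
  each other according to the symplectic basis, while \<open>X\<close> and \<open>im\<close>
  anticommute; these are the relations of Pauli generators. The last pair has the squares
  \<open>nu g\<close> and \<open>-1\<close>.\<close>

lemma homogeneous_family:
  assumes gK: "g \<in> T - K" and sb: "symplectic_basis (G\<lparr>carrier := K\<rparr>) (mu g) r a b"
  shows "degree_map (G\<lparr>carrier := T\<rparr>) K r a b g"
    and "\<exists>y. pauli_family D (Suc r) ((\<lambda>k. real_of_int (mu g (a k)))(r := real_of_int (nu g)))
        ((\<lambda>k. real_of_int (mu g (b k)))(r := -1)) y \<and>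
      carrier D = span (y ` idx (Suc r)) \<and>
      (\<forall>t\<in>carrier G. \<Gamma> t = span {y S |S. S \<in> idx (Suc r) \<and> deg_map G a b g r S = t})"
proof -
  interpret KK: quad_form "G\<lparr>carrier := K\<rparr>" "mu g" by (rule quad_formI[OF quadratic_form_mu[OF gK]])
  interpret TT: elem2 "G\<lparr>carrier := T\<rparr>" by (rule elem2_T)
  let ?\<beta> = "assoc_bichar (G\<lparr>carrier := K\<rparr>) (mu g)"
  have orth: "KK.orth_pairs K r a b" using sb unfolding KK.symplectic_basis_iff by simp
  note orth' = orth[unfolded KK.orth_pairs_def]
  have ab: "a i \<in> K" "b i \<in> K" if "i < r" for i using orth' that by auto
  show dm: "degree_map (G\<lparr>carrier := T\<rparr>) K r a b g"
    using degree_map_symplectic[OF elem2_T index_2_K, of g "mu g" r a b] gK sb quadratic_form_mu[OF gK] by simp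
  interpret DM: degree_map "G\<lparr>carrier := T\<rparr>" K r a b g by (rule dm)
  have gT: "g \<in> T" "g \<in> carrier G" using gK T_carrier by auto
  obtain X0 where X0: "X0 \<in> \<Gamma> g" "X0 \<noteq> 0" by (rule T_nonzero[OF gT(1)])
  obtain s where s: "s > 0" "X0 \<otimes> X0 = (s * real_of_int (nu g)) *\<^sub>R \<one>" using nu_square[OF gK X0] by blast
  define X where "X = (1 / sqrt s) *\<^sub>R X0"
  have X0c: "X0 \<in> carrier D" using T_comp_carrier gT X0 by blast
  have X: "X \<in> \<Gamma> g" "X \<noteq> 0" "X \<otimes> X = real_of_int (nu g) *\<^sub>R \<one>"
    using X0 X0c s comp_scale[OF gT(2) X0(1)] by (simp_all add: X_def)
  have Xc: "X \<in> carrier D" using T_comp_carrier gT X by blast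
  note g = gK X(1,2)
  have "\<exists>f. \<forall>u\<in>K. real_rep X u (f u) \<and> f u \<otimes> f u = real_of_int (mu g u) *\<^sub>R \<one>"
    using real_rep_normalized[OF g] by (intro bchoice) blast
  then obtain f where f: "\<And>u. u \<in> K \<Longrightarrow> real_rep X u (f u)"
      "\<And>u. u \<in> K \<Longrightarrow> f u \<otimes> f u = real_of_int (mu g u) *\<^sub>R \<one>" by blast
  \<comment> \<open>Normalized real representatives in the first \<open>r\<close> places; the pair
    \<open>X\<close>, \<open>im\<close> is appended at index \<open>r\<close>.\<close>
  define A where "A = (\<lambda>k. f (a k))(r := X)"
  define B where "B = (\<lambda>k. f (b k))(r := im)"
  let ?\<sigma> = "(\<lambda>k. real_of_int (mu g (a k)))(r := real_of_int (nu g))"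
  let ?\<rho> = "(\<lambda>k. real_of_int (mu g (b k)))(r := -1)"
  have fc: "f u \<in> carrier D" "X \<otimes> f u = f u \<otimes> X" "im \<otimes> f u = f u \<otimes> im" if "u \<in> K" for u
    using real_repD[OF f(1)[OF that]] K_commute[OF that, of "f u" \<i>] by (simp_all add: emb_def)
  have iX: "im \<otimes> X = - (X \<otimes> im)"
    using not_K_commute[of g X \<i>] gK X Xc by (simp add: emb_def)
  have ff: "f u \<otimes> f v = real_of_int (?\<beta> u v) *\<^sub>R (f v \<otimes> f u)" if "u \<in> K" "v \<in> K" for u v
    by (rule real_rep_commute[OF g f(1)[OF that(1)] f(1)[OF that(2)]])
  have gens: "pauli_generators (Suc r) ?\<sigma> ?\<rho> A B"
    unfolding pauli_generators_def
  proof (intro allI impI conjI)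
    fix k assume k: "k < Suc r"
    show "?\<sigma> k \<in> {1, -1}" "?\<rho> k \<in> {1, -1}"
      using k nu_cases[OF gK] mu_cases[OF gK ab(1), of k] mu_cases[OF gK ab(2), of k]
      by (auto simp: less_Suc_eq)
    show "A k \<in> carrier D" "B k \<in> carrier D" "A k \<otimes> A k = ?\<sigma> k *\<^sub>R \<one>" "B k \<otimes> B k = ?\<rho> k *\<^sub>R \<one>"
      using k ab X Xc im_square f(2) fc(1) by (auto simp: A_def B_def less_Suc_eq)
    fix l assume l: "l < Suc r"
    show "A k \<otimes> A l = A l \<otimes> A k"
      using k l ab fc(2) ff[of "a k" "a l"] orth' by (auto simp: A_def less_Suc_eq)
    show "B k \<otimes> B l = B l \<otimes> B k"
      using k l ab fc(3) ff[of "b k" "b l"] orth' by (auto simp: B_def less_Suc_eq)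
    show "B k \<otimes> A l = (if k = l then - (A l \<otimes> B k) else A l \<otimes> B k)"
      using k l ab fc(2,3) iX ff[of "b k" "a l"] orth' by (auto simp: A_def B_def less_Suc_eq)
  qed
  let ?y = "monomial D A B (Suc r)"
  have fam: "pauli_family D (Suc r) ?\<sigma> ?\<rho> ?y" by (rule pauli_family_monomial[OF gens one_neq_0])
  interpret P: pauli D "Suc r" ?\<sigma> ?\<rho> ?y by (rule pauliI[OF fam])
  let ?d = "deg_map G a b g r"
  have yd: "?y S \<in> \<Gamma> (?d S)" for S
  proof -
    have "monomial G (a(r := g)) (b(r := \<one>\<^bsub>G\<^esub>)) (Suc r) S \<in> carrier G \<and>
        ?y S \<in> \<Gamma> (monomial G (a(r := g)) (b(r := \<one>\<^bsub>G\<^esub>)) (Suc r) S)"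
    proof (rule monomial_comp)
      fix k assume "k < Suc r"
      then show "(a(r := g)) k \<in> carrier G \<and> (b(r := \<one>\<^bsub>G\<^esub>)) k \<in> carrier G \<and>
          A k \<in> \<Gamma> ((a(r := g)) k) \<and> B k \<in> \<Gamma> ((b(r := \<one>\<^bsub>G\<^esub>)) k)"
        using real_repD(2,7)[OF f(1)[OF ab(1)], of k] real_repD(2,7)[OF f(1)[OF ab(2)], of k] X gT im_comp
        by (auto simp: A_def B_def less_Suc_eq)
    qed
    then show ?thesis by (simp only: deg_map_def)
  qed
  have comp: "\<Gamma> t = span {?y S |S. S \<in> idx (Suc r) \<and> ?d S = t}" (is "_ = span (?Y t)") if t: "t \<in> carrier G" for t
  proof
    show "span (?Y t) \<subseteq> \<Gamma> t"
      by (rule span_minimal[OF _ comp_subspace[OF t]]) (use yd in auto)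
    show "\<Gamma> t \<subseteq> span (?Y t)"
    proof (cases "t \<in> T")
      case False
      then show ?thesis using t by (auto simp: T_def grading_support_def span_zero)
    next
      case True
      then have "t \<in> ?d ` idx (Suc r)" using DM.d_surj by simp
      then obtain S where S: "S \<in> idx (Suc r)" "?d S = t" by blast
      \<comment> \<open>The partner of \<open>S\<close> differs by the factor \<open>im\<close> up
        to sign. It has the same degree, and the two independent members fill the two-dimensional
        component.\<close>
      let ?S = "idx_add S ({}, {r})"
      have S': "?S \<in> idx (Suc r)" using S by (simp add: singleton_in_idx)
      have "fst S = fst ?S \<and> snd S - {r} = snd ?S - {r}" unfolding idx_add_def sdiff_def by auto
      then have dS': "?d ?S = t"
        using DM.d_inj[OF S(1) S'] S(2) by simp
      have neq: "S \<noteq> ?S" using idx_add_cancel[of S "({}, {})" "({}, {r})"] by auto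
      have ind: "p = 0 \<and> q = 0" if "p *\<^sub>R ?y S + q *\<^sub>R ?y ?S = 0" for p q
      proof -
        have "(\<Sum>R\<in>{S, ?S}. (if R = S then p else q) *\<^sub>R ?y R) = 0"
          using that neq by simp
        from P.y_coeffs_0[OF _ this, of S] P.y_coeffs_0[OF _ this, of ?S] show ?thesis
          using S S' neq by auto
      qed
      have mem: "?y S \<in> \<Gamma> t" "?y ?S \<in> \<Gamma> t" using yd[of S] yd[of ?S] S(2) dS' by auto
      show ?thesis
      proof
        fix v assume "v \<in> \<Gamma> t"
        from dim2_span[OF comp_dim[OF True] mem this ind]
        obtain p q where "v = p *\<^sub>R ?y S + q *\<^sub>R ?y ?S" by blast
        moreover have "?y S \<in> ?Y t" "?y ?S \<in> ?Y t" using S S' dS' by blast+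
        ultimately show "v \<in> span (?Y t)" by (simp add: span_add span_scale span_base)
      qed
    qed
  qed
  have "carrier D = span (?y ` idx (Suc r))"
  proof
    have "\<Gamma> t \<subseteq> span (?y ` idx (Suc r))" if "t \<in> carrier G" for t
      unfolding comp[OF that] by (rule span_mono) blast
    then show "carrier D \<subseteq> span (?y ` idx (Suc r))"
      unfolding carrier_span by (intro span_minimal UN_least subspace_span) blast
    show "span (?y ` idx (Suc r)) \<subseteq> carrier D"
      by (rule span_minimal[OF _ subspace_carrier]) (rule image_subsetI, rule P.y_closed)
  qed
  then show "\<exists>y. pauli_family D (Suc r) ?\<sigma> ?\<rho> y \<and> carrier D = span (y ` idx (Suc r)) \<and>
      (\<forall>t\<in>carrier G. \<Gamma> t = span {y S |S. S \<in> idx (Suc r) \<and> deg_map G a b g r S = t})"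
    using fam comp by blast
qed

end

section \<open>The grading defined by a Pauli family and a degree map\<close>

text \<open>Converse direction: the degree map is additive and forgets exactly the exponent of the
  generator \<open>y ({}, {r})\<close>, which squares to \<open>-1\<close>. The components are then
  one-dimensional over the complex numbers generated by it.\<close>

locale family_grading = pauli D "Suc r" \<sigma> \<rho> y
  for D :: "'a::real_vector monoid" (structure) and r \<sigma> \<rho> y +
  fixes G :: "('g, 'e) monoid_scheme" and d :: "nat set \<times> nat set \<Rightarrow> 'g"
  assumes comm_group: "comm_group G"
    and spanning: "carrier D = span (y ` idx (Suc r))"
    and \<rho>_last: "\<rho> r = -1"
    and d_closed: "S \<in> idx (Suc r) \<Longrightarrow> d S \<in> carrier G"
    and d_add: "S \<in> idx (Suc r) \<Longrightarrow> S' \<in> idx (Suc r) \<Longrightarrow> d (idx_add S S') = d S \<otimes>\<^bsub>G\<^esub> d S'"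
    and d_inj: "S \<in> idx (Suc r) \<Longrightarrow> S' \<in> idx (Suc r) \<Longrightarrow>
      d S = d S' \<longleftrightarrow> fst S = fst S' \<and> snd S - {r} = snd S' - {r}"
begin

sublocale G: comm_group G by (rule comm_group)

definition \<Gamma> :: "'g \<Rightarrow> 'a set" where
  "\<Gamma> t = span {y S |S. S \<in> idx (Suc r) \<and> d S = t}"

definition im :: 'a where "im = y ({}, {r})"

lemma last_idx: "({}, {r}) \<in> idx (Suc r)"
  by (simp add: singleton_in_idx)

lemma im_carrier [simp]: "im \<in> carrier D"
  using last_idx by (simp add: im_def)

lemma im_square: "im \<otimes> im = - \<one>"
proof -
  have "idx_sign (Suc r) \<sigma> \<rho> ({}, {r}) ({}, {r}) = (\<Prod>k<Suc r. if k = r then -1 else 1)"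
    unfolding idx_sign_def by (rule prod.cong) (auto simp: pair_sign_def \<rho>_last)
  then show ?thesis using y_square[OF last_idx] by (simp add: im_def)
qed

lemma d_one: "d ({}, {}) = \<one>\<^bsub>G\<^esub>"
proof -
  have "d ({}, {}) \<otimes>\<^bsub>G\<^esub> d ({}, {}) = d ({}, {})" using d_add[of "({}, {})" "({}, {})"] by simp
  then show ?thesis using d_closed[of "({}, {})"] by simp
qed

lemma d_eq_cases:
  assumes "S \<in> idx (Suc r)" "S' \<in> idx (Suc r)" "d S' = d S"
  shows "S' = S \<or> S' = idx_add S ({}, {r})"
proof -
  have "fst S' = fst S" and s: "snd S' - {r} = snd S - {r}" using d_inj[OF assms(2,1)] assms(3) by auto
  moreover have "snd S' = snd S \<or> snd S' = sdiff (snd S) {r}"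
  proof (cases "r \<in> snd S' \<longleftrightarrow> r \<in> snd S")
    case True
    then have "snd S' = snd S" using s by blast
    then show ?thesis by blast
  next
    case False
    then have "snd S' = sdiff (snd S) {r}" using s unfolding sdiff_def by blast
    then show ?thesis by blast
  qed
  ultimately show ?thesis by (auto simp: prod_eq_iff idx_add_def sdiff_def)
qed

lemma y_twist:
  assumes "S \<in> idx (Suc r)"
  shows "idx_add S ({}, {r}) \<in> idx (Suc r)" "d (idx_add S ({}, {r})) = d S" "idx_add S ({}, {r}) \<noteq> S"
    "\<exists>c. y (idx_add S ({}, {r})) = c *\<^sub>R (y S \<otimes> im)" "\<exists>c. y S \<otimes> im = c *\<^sub>R y (idx_add S ({}, {r}))"
proof -
  show S: "idx_add S ({}, {r}) \<in> idx (Suc r)" using assms last_idx by simp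
  show "d (idx_add S ({}, {r})) = d S"
  proof -
    have "fst (idx_add S ({}, {r})) = fst S \<and> snd (idx_add S ({}, {r})) - {r} = snd S - {r}"
      unfolding idx_add_def sdiff_def by auto
    then show ?thesis using d_inj[OF S assms] by simp
  qed
  show "idx_add S ({}, {r}) \<noteq> S" using idx_add_cancel[of S "({}, {r})" "({}, {})"] by auto
  have eq: "y S \<otimes> im = idx_sign (Suc r) \<sigma> \<rho> S ({}, {r}) *\<^sub>R y (idx_add S ({}, {r}))"
    unfolding im_def by (rule y_mult[OF assms last_idx])
  then show "\<exists>c. y S \<otimes> im = c *\<^sub>R y (idx_add S ({}, {r}))" by blast
  have "y (idx_add S ({}, {r})) = inverse (idx_sign (Suc r) \<sigma> \<rho> S ({}, {r})) *\<^sub>R (y S \<otimes> im)"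
    unfolding eq using idx_sign_neq_0 by simp
  then show "\<exists>c. y (idx_add S ({}, {r})) = c *\<^sub>R (y S \<otimes> im)" by blast
qed

lemma degree_fibre:
  assumes "S \<in> idx (Suc r)"
  shows "{y S' |S'. S' \<in> idx (Suc r) \<and> d S' = d S} = y ` {S, idx_add S ({}, {r})}"
  using d_eq_cases[OF assms] y_twist(1,2)[OF assms] assms by blast

lemma comp_dim: "S \<in> idx (Suc r) \<Longrightarrow> dim (\<Gamma> (d S)) = 2"
proof -
  assume S: "S \<in> idx (Suc r)"
  let ?I = "{S, idx_add S ({}, {r})}"
  have I: "?I \<subseteq> idx (Suc r)" using S y_twist(1) by simp
  have "card (y ` ?I) = 2"
    using card_image[OF inj_on_subset[OF inj_y I]] y_twist(3)[OF S] by simp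
  then show ?thesis
    unfolding \<Gamma>_def degree_fibre[OF S] using dim_span_eq_card_independent[OF independent_y[OF I]] by simp
qed

text \<open>A component is a member of the family times the complex scalars; products, inverses and
  squares of homogeneous elements are computed in this form.\<close>

lemma comp_form:
  assumes "S \<in> idx (Suc r)"
  shows "x \<in> \<Gamma> (d S) \<longleftrightarrow> (\<exists>p q. x = y S \<otimes> (p *\<^sub>R \<one> + q *\<^sub>R im))"
proof
  assume "x \<in> \<Gamma> (d S)"
  then have "x \<in> span (y ` {S, idx_add S ({}, {r})})" unfolding \<Gamma>_def degree_fibre[OF assms] .
  then have "x \<in> span {y S, y (idx_add S ({}, {r}))}" by simp
  then obtain p q where "x = p *\<^sub>R y S + q *\<^sub>R y (idx_add S ({}, {r}))"
    by (auto simp: span_breakdown_eq span_singleton algebra_simps)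
  moreover obtain c where "y (idx_add S ({}, {r})) = c *\<^sub>R (y S \<otimes> im)" using y_twist(4)[OF assms] by blast
  ultimately have "x = y S \<otimes> (p *\<^sub>R \<one> + (q * c) *\<^sub>R im)" using assms by simp
  then show "\<exists>p q. x = y S \<otimes> (p *\<^sub>R \<one> + q *\<^sub>R im)" by blast
next
  assume "\<exists>p q. x = y S \<otimes> (p *\<^sub>R \<one> + q *\<^sub>R im)"
  then obtain p q where x: "x = y S \<otimes> (p *\<^sub>R \<one> + q *\<^sub>R im)" by blast
  obtain c where "y S \<otimes> im = c *\<^sub>R y (idx_add S ({}, {r}))" using y_twist(5)[OF assms] by blast
  then have "x = p *\<^sub>R y S + (q * c) *\<^sub>R y (idx_add S ({}, {r}))" using x assms by simp
  then show "x \<in> \<Gamma> (d S)"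
    unfolding \<Gamma>_def degree_fibre[OF assms] by (simp add: span_add span_scale span_base)
qed

lemma mult_interchange4:
  assumes "a \<in> carrier D" "b \<in> carrier D" "b' \<in> carrier D" "c \<in> carrier D" "e \<in> carrier D" "b \<otimes> c = c \<otimes> b'"
  shows "(a \<otimes> b) \<otimes> (c \<otimes> e) = (a \<otimes> c) \<otimes> (b' \<otimes> e)"
proof -
  have "(a \<otimes> b) \<otimes> (c \<otimes> e) = a \<otimes> ((b \<otimes> c) \<otimes> e)" using assms(1-5) by (simp add: m_assoc)
  then show ?thesis using assms(1-5) by (simp add: assms(6) m_assoc)
qed

lemma im_commute:
  assumes "S \<in> idx (Suc r)"
  shows "im \<otimes> y S = (if r \<in> fst S then - (y S \<otimes> im) else y S \<otimes> im)"
  using y_singleton_comm(2)[OF assms, of r] by (simp add: im_def)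

lemma complex_Units:
  assumes "p \<noteq> 0 \<or> q \<noteq> 0"
  shows "p *\<^sub>R \<one> + q *\<^sub>R im \<in> Units D"
proof -
  obtain N where N: "N = p * p + q * q" "N \<noteq> 0" using assms sum_squares_eq_zero_iff by blast
  have 1: "(p *\<^sub>R \<one> + q *\<^sub>R im) \<otimes> (p *\<^sub>R \<one> - q *\<^sub>R im) = N *\<^sub>R \<one>"
      "(p *\<^sub>R \<one> - q *\<^sub>R im) \<otimes> (p *\<^sub>R \<one> + q *\<^sub>R im) = N *\<^sub>R \<one>"
    by (simp_all add: N(1) im_square scaleR_left_distrib scaleR_right_diff_distrib scaleR_add_right mult.commute)
  let ?w = "(1 / N) *\<^sub>R (p *\<^sub>R \<one> - q *\<^sub>R im)"
  have cl: "p *\<^sub>R \<one> + q *\<^sub>R im \<in> carrier D" "p *\<^sub>R \<one> - q *\<^sub>R im \<in> carrier D" by simp_all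
  have "(p *\<^sub>R \<one> + q *\<^sub>R im) \<otimes> ?w = \<one>" "?w \<otimes> (p *\<^sub>R \<one> + q *\<^sub>R im) = \<one>"
    unfolding mult_scale[OF cl] mult_scale(2)[OF cl] 1 using N(2) by simp_all
  moreover have "?w \<in> carrier D" using cl(2) by simp
  ultimately show ?thesis using cl(1) unfolding Units_def by blast
qed

lemma comp_form_Units:
  assumes "S \<in> idx (Suc r)" "x \<in> \<Gamma> (d S)" "x \<noteq> 0"
  obtains p q where "x = y S \<otimes> (p *\<^sub>R \<one> + q *\<^sub>R im)" "p *\<^sub>R \<one> + q *\<^sub>R im \<in> Units D" "p\<^sup>2 + q\<^sup>2 > 0"
proof -
  obtain p q where x: "x = y S \<otimes> (p *\<^sub>R \<one> + q *\<^sub>R im)" using comp_form[OF assms(1)] assms(2) by blast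
  then have pq: "p \<noteq> 0 \<or> q \<noteq> 0" using assms(1,3) by auto
  then show ?thesis using that[OF x complex_Units[OF pq]] by (simp add: sum_power2_gt_zero_iff)
qed

lemma comp_outside: "t \<notin> d ` idx (Suc r) \<Longrightarrow> \<Gamma> t = {0}"
proof -
  assume "t \<notin> d ` idx (Suc r)"
  then have "{y S |S. S \<in> idx (Suc r) \<and> d S = t} = {}" by blast
  then show ?thesis unfolding \<Gamma>_def by (simp only: span_empty)
qed

lemma comp_mult:
  assumes "x \<in> \<Gamma> s" "z \<in> \<Gamma> t"
  shows "x \<otimes> z \<in> \<Gamma> (s \<otimes>\<^bsub>G\<^esub> t)"
proof (cases "s \<in> d ` idx (Suc r) \<and> t \<in> d ` idx (Suc r)")
  case False
  have "span {y S |S. S \<in> idx (Suc r) \<and> d S = u} \<subseteq> carrier D" for u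
    by (rule span_minimal[OF _ subspace_carrier]) auto
  then have "x \<in> carrier D" "z \<in> carrier D" using assms unfolding \<Gamma>_def by blast+
  moreover have "x = 0 \<or> z = 0" using False assms comp_outside by blast
  ultimately have "x \<otimes> z = 0" by auto
  then show ?thesis by (simp add: \<Gamma>_def span_zero)
next
  case True
  then obtain S S' where S: "S \<in> idx (Suc r)" "s = d S" "S' \<in> idx (Suc r)" "t = d S'" by blast
  obtain p q where x: "x = y S \<otimes> (p *\<^sub>R \<one> + q *\<^sub>R im)" using comp_form[OF S(1)] assms(1) S(2) by blast
  obtain p' q' where z: "z = y S' \<otimes> (p' *\<^sub>R \<one> + q' *\<^sub>R im)" using comp_form[OF S(3)] assms(2) S(4) by blast
  \<comment> \<open>The sign with which \<open>im\<close> passes \<open>y S'\<close>, that is,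
    whether complex scalars are conjugated on the way.\<close>
  define e :: real where "e = (if r \<in> fst S' then -1 else 1)"
  have "(p *\<^sub>R \<one> + q *\<^sub>R im) \<otimes> y S' = y S' \<otimes> (p *\<^sub>R \<one> + (e * q) *\<^sub>R im)"
    using S im_commute[OF S(3)] by (simp add: e_def)
  then have eq: "(p *\<^sub>R \<one> + q *\<^sub>R im) \<otimes> y S' = y S' \<otimes> (p *\<^sub>R \<one> + (e * q) *\<^sub>R im)" .
  have "x \<otimes> z = (y S \<otimes> y S') \<otimes> ((p *\<^sub>R \<one> + (e * q) *\<^sub>R im) \<otimes> (p' *\<^sub>R \<one> + q' *\<^sub>R im))"
    unfolding x z by (rule mult_interchange4[OF _ _ _ _ _ eq]) (use S in simp_all)
  also have "(p *\<^sub>R \<one> + (e * q) *\<^sub>R im) \<otimes> (p' *\<^sub>R \<one> + q' *\<^sub>R im)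
      = (p * p' - e * q * q') *\<^sub>R \<one> + (p * q' + e * q * p') *\<^sub>R im"
    by (simp add: im_square algebra_simps)
  also have "y S \<otimes> y S' = idx_sign (Suc r) \<sigma> \<rho> S S' *\<^sub>R y (idx_add S S')" using S y_mult by blast
  finally have "x \<otimes> z = y (idx_add S S') \<otimes>
      ((idx_sign (Suc r) \<sigma> \<rho> S S' * (p * p' - e * q * q')) *\<^sub>R \<one>
      + (idx_sign (Suc r) \<sigma> \<rho> S S' * (p * q' + e * q * p')) *\<^sub>R im)"
    using S by (simp add: scaleR_add_right mult.commute)
  then have "x \<otimes> z \<in> \<Gamma> (d (idx_add S S'))" using comp_form[of "idx_add S S'"] S by auto
  then show ?thesis using d_add S by simp
qed

lemma is_grading: "is_grading G D \<Gamma>"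
  unfolding is_grading_def
proof (intro conjI ballI)
  show "is_real_algebra D" by (rule real_algebra)
  have sub: "\<Gamma> t \<subseteq> carrier D" for t
    unfolding \<Gamma>_def by (rule span_minimal[OF _ subspace_carrier]) auto
  fix t assume t: "t \<in> carrier G"
  show "subspace (\<Gamma> t)" "\<Gamma> t \<subseteq> carrier D" using sub by (simp_all add: \<Gamma>_def)
  show "\<Gamma> t \<inter> span (\<Union>h\<in>carrier G - {t}. \<Gamma> h) = {0}"
  proof -
    \<comment> \<open>A linear map that kills the component of degree \<open>t\<close> and fixes all
      the others; a vector in the intersection is both killed and fixed.\<close>
    obtain f :: "'a \<Rightarrow> 'a" where f: "linear f"
        and fy: "\<And>S. S \<in> idx (Suc r) \<Longrightarrow> f (y S) = (if d S = t then 0 else y S)"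
      using linear_extend_family[OF independent_idx inj_y, of "\<lambda>S. if d S = t then 0 else y S"] by blast
    have 0: "f v = 0" if "v \<in> \<Gamma> t" for v
      using that unfolding \<Gamma>_def
      by (induction rule: span_induct_mem) (auto simp: linear_0[OF f] linear_add[OF f] linear_scale[OF f] fy)
    have 1: "f v = v" if "v \<in> \<Gamma> h" "h \<noteq> t" for v h
      using that(1) unfolding \<Gamma>_def
      by (induction rule: span_induct_mem)
        (use that(2) in \<open>auto simp: linear_0[OF f] linear_add[OF f] linear_scale[OF f] fy\<close>)
    have "f v = v" if "v \<in> span (\<Union>h\<in>carrier G - {t}. \<Gamma> h)" for v
      using that
      by (induction rule: span_induct_mem)
        (use 1 in \<open>auto simp: linear_0[OF f] linear_add[OF f] linear_scale[OF f]\<close>)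
    then have "v = 0" if "v \<in> \<Gamma> t" "v \<in> span (\<Union>h\<in>carrier G - {t}. \<Gamma> h)" for v using 0 that by metis
    moreover have "0 \<in> \<Gamma> t" unfolding \<Gamma>_def by (rule span_zero)
    ultimately show ?thesis using span_zero by blast
  qed
next
  show "carrier D = span (\<Union>g\<in>carrier G. \<Gamma> g)"
  proof
    have "y S \<in> (\<Union>g\<in>carrier G. \<Gamma> g)" if "S \<in> idx (Suc r)" for S
      using that d_closed unfolding \<Gamma>_def by (blast intro: span_base)
    then show "carrier D \<subseteq> span (\<Union>g\<in>carrier G. \<Gamma> g)"
      unfolding spanning by (intro span_mono) blast
    show "span (\<Union>g\<in>carrier G. \<Gamma> g) \<subseteq> carrier D"
      unfolding \<Gamma>_def by (intro span_minimal[OF _ subspace_carrier] UN_least) auto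
  qed
qed (rule comp_mult)

lemma dim2_division: "\<Gamma> \<in> dim2_division_gradings G D"
proof -
  have "x \<in> Units D" if "x \<in> \<Gamma> t" "x \<noteq> 0" for t x
  proof (cases "t \<in> d ` idx (Suc r)")
    case True
    then obtain S where S: "S \<in> idx (Suc r)" "t = d S" by blast
    have "x \<in> \<Gamma> (d S)" using that(1) S(2) by simp
    from comp_form_Units[OF S(1) this that(2)]
    obtain p q where "x = y S \<otimes> (p *\<^sub>R \<one> + q *\<^sub>R im)" "p *\<^sub>R \<one> + q *\<^sub>R im \<in> Units D" .
    then show ?thesis using y_Units[OF S(1)] by (simp only: Units_m_closed)
  qed (use comp_outside that in blast)
  moreover have "dim (\<Gamma> t) = 2" if "t \<in> grading_support G \<Gamma>" for t
  proof -
    have "\<Gamma> t \<noteq> {0}" using that by (simp add: grading_support_def)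
    then have "t \<in> d ` idx (Suc r)" using comp_outside by metis
    then show ?thesis using comp_dim by blast
  qed
  ultimately show ?thesis using is_grading by (simp add: dim2_division_gradings_def is_division_grading_def)
qed

lemma support: "grading_support G \<Gamma> = d ` idx (Suc r)"
proof -
  have "\<Gamma> (d S) \<noteq> {0}" if "S \<in> idx (Suc r)" for S
  proof
    assume "\<Gamma> (d S) = {0}"
    then have "dim (\<Gamma> (d S)) \<le> card ({} :: 'a set)" using dim_le_card[of "\<Gamma> (d S)" "{}"] by simp
    then show False using comp_dim[OF that] by simp
  qed
  then have "d ` idx (Suc r) \<subseteq> grading_support G \<Gamma>"
    using d_closed unfolding grading_support_def by (intro image_subsetI) simp
  moreover have "t \<in> d ` idx (Suc r)" if "t \<in> grading_support G \<Gamma>" for t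
  proof (rule ccontr)
    assume "t \<notin> d ` idx (Suc r)"
    then have "\<Gamma> t = {0}" by (rule comp_outside)
    then show False using that by (simp add: grading_support_def)
  qed
  ultimately show ?thesis by (intro equalityI subsetI) (assumption, rule subsetD)
qed

text \<open>The neutral component is spanned by the unit and \<open>im\<close>, and
  \<open>im\<close> anticommutes with \<open>y S\<close> exactly when its partner, the first
  generator of the last pair, occurs in \<open>S\<close>.\<close>

lemma commutes_iff:
  assumes "S \<in> idx (Suc r)"
  shows "(\<forall>x\<in>\<Gamma> (d S). \<forall>z\<in>\<Gamma> \<one>\<^bsub>G\<^esub>. x \<otimes> z = z \<otimes> x) \<longleftrightarrow> r \<notin> fst S"
proof
  have "im = y ({}, {}) \<otimes> (0 *\<^sub>R \<one> + 1 *\<^sub>R im)" by (simp add: y_empty)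
  then have "im \<in> \<Gamma> (d ({}, {}))" using comp_form[OF empty_in_idx, of im] by blast
  then have e: "im \<in> \<Gamma> \<one>\<^bsub>G\<^esub>" by (simp only: d_one)
  have "y S \<in> \<Gamma> (d S)" unfolding \<Gamma>_def using assms by (intro span_base) blast
  moreover assume "\<forall>x\<in>\<Gamma> (d S). \<forall>z\<in>\<Gamma> \<one>\<^bsub>G\<^esub>. x \<otimes> z = z \<otimes> x"
  ultimately have eq: "y S \<otimes> im = im \<otimes> y S" using e by blast
  show "r \<notin> fst S"
  proof
    assume "r \<in> fst S"
    then have "y S \<otimes> im = - (y S \<otimes> im)" using eq im_commute[OF assms] by simp
    then have "2 *\<^sub>R (y S \<otimes> im) = 0" by (simp add: scaleR_2 eq_neg_iff_add_eq_0)
    then have "y S \<otimes> im = 0" by simp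
    moreover have "y S \<otimes> im \<in> Units D" using y_Units assms last_idx by (simp add: im_def)
    ultimately show False using Units_if_square one_neq_0 Units_l_inv[of 0] Units_inv_closed[of 0] by auto
  qed
next
  assume r: "r \<notin> fst S"
  show "\<forall>x\<in>\<Gamma> (d S). \<forall>z\<in>\<Gamma> \<one>\<^bsub>G\<^esub>. x \<otimes> z = z \<otimes> x"
  proof (intro ballI)
    fix x z assume "x \<in> \<Gamma> (d S)" "z \<in> \<Gamma> \<one>\<^bsub>G\<^esub>"
    then obtain p q p' q' where xz: "x = y S \<otimes> (p *\<^sub>R \<one> + q *\<^sub>R im)" "z = y ({}, {}) \<otimes> (p' *\<^sub>R \<one> + q' *\<^sub>R im)"
      using comp_form[OF assms] comp_form[OF empty_in_idx] d_one by metis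
    have "im \<otimes> (y S \<otimes> im) = - y S" using im_commute[OF assms] assms r im_square
      by (simp add: m_assoc[symmetric]) (simp add: m_assoc im_square)
    then show "x \<otimes> z = z \<otimes> x"
      unfolding xz y_empty using assms r im_commute[OF assms] by (simp add: m_assoc im_square algebra_simps)
  qed
qed

text \<open>Here \<open>y S\<close> conjugates complex scalars, so the scalar factor of
  \<open>x\<close> enters the square only through its positive norm
  \<open>p^2 + q^2\<close>.\<close>

lemma comp_square:
  assumes "S \<in> idx (Suc r)" "r \<in> fst S" "x \<in> \<Gamma> (d S)" "x \<noteq> 0"
  shows "\<exists>s>0. x \<otimes> x = (s * idx_sign (Suc r) \<sigma> \<rho> S S) *\<^sub>R \<one>"
proof -
  obtain p q where x: "x = y S \<otimes> (p *\<^sub>R \<one> + q *\<^sub>R im)" and pq: "p\<^sup>2 + q\<^sup>2 > 0"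
    using comp_form_Units[OF assms(1,3,4)] by metis
  have "(p *\<^sub>R \<one> + q *\<^sub>R im) \<otimes> y S = y S \<otimes> (p *\<^sub>R \<one> - q *\<^sub>R im)"
    using assms(1,2) im_commute[OF assms(1)] by simp
  then have eq: "(p *\<^sub>R \<one> + q *\<^sub>R im) \<otimes> y S = y S \<otimes> (p *\<^sub>R \<one> - q *\<^sub>R im)" .
  have "x \<otimes> x = (y S \<otimes> y S) \<otimes> ((p *\<^sub>R \<one> - q *\<^sub>R im) \<otimes> (p *\<^sub>R \<one> + q *\<^sub>R im))"
    unfolding x by (rule mult_interchange4[OF _ _ _ _ _ eq]) (use assms(1) in simp_all)
  also have "(p *\<^sub>R \<one> - q *\<^sub>R im) \<otimes> (p *\<^sub>R \<one> + q *\<^sub>R im) = (p\<^sup>2 + q\<^sup>2) *\<^sub>R \<one>"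
    by (simp add: im_square algebra_simps power2_eq_square)
  finally have "x \<otimes> x = ((p\<^sup>2 + q\<^sup>2) * idx_sign (Suc r) \<sigma> \<rho> S S) *\<^sub>R \<one>"
    using y_square[OF assms(1)] by simp
  then show ?thesis using pq by blast
qed

end

section \<open>Tensor products\<close>

lemma scaleR_fun_apply: "(c *\<^sub>R f) x = c *\<^sub>R f x"
  by (simp add: scaleR_fun_def)

text \<open>
  Both tensor products of the definitions consist of functionals on a space \<open>F\<close> of forms on a set
  \<open>X\<close> of tuples; the type \<open>'f\<close> of forms is \<open>'x \<Rightarrow> real\<close> up to currying by \<open>ev\<close> and \<open>mk\<close>.
\<close>

locale form_algebra =
  fixes X :: "'x set" and F :: "'f::real_vector set" and ev :: "'f \<Rightarrow> 'x \<Rightarrow> real"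
    and mk :: "('x \<Rightarrow> real) \<Rightarrow> 'f" and m :: "'x \<Rightarrow> 'x \<Rightarrow> 'x" and u :: 'x
  assumes F: "subspace F"
    and ev_linear: "ev (f + g) x = ev f x + ev g x" "ev (c *\<^sub>R f) x = c * ev f x"
    and ev_mk: "ev (mk h) x = h x" and mk_ev: "mk (ev f) = f"
    and F_cong: "f \<in> F \<Longrightarrow> (\<And>x. x \<in> X \<Longrightarrow> ev f x = ev g x) \<Longrightarrow> g \<in> F"
    and m_closed: "x \<in> X \<Longrightarrow> y \<in> X \<Longrightarrow> m x y \<in> X" and u_closed: "u \<in> X"
    and m_assoc: "x \<in> X \<Longrightarrow> y \<in> X \<Longrightarrow> z \<in> X \<Longrightarrow> m (m x y) z = m x (m y z)"
    and u_neutral: "x \<in> X \<Longrightarrow> m u x = x" "x \<in> X \<Longrightarrow> m x u = x"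
    and F_left: "f \<in> F \<Longrightarrow> x \<in> X \<Longrightarrow> mk (\<lambda>y. ev f (m x y)) \<in> F"
    and F_right: "f \<in> F \<Longrightarrow> x \<in> X \<Longrightarrow> mk (\<lambda>y. ev f (m y x)) \<in> F"
begin

declare zero_fun_apply [simp del] plus_fun_apply [simp del]

lemmas fun_space = zero_fun_apply plus_fun_apply scaleR_fun_apply

definition pure :: "'x \<Rightarrow> 'f \<Rightarrow> real" where
  "pure x = (\<lambda>f. if f \<in> F then ev f x else 0)"

definition alg :: "('f \<Rightarrow> real) monoid" where
  "alg = \<lparr>carrier = span (pure ` X),
    monoid.mult = (\<lambda>s t f. if f \<in> F then s (mk (\<lambda>x. t (mk (\<lambda>y. ev f (m x y))))) else 0),
    one = pure u\<rparr>"

abbreviation C where "C \<equiv> span (pure ` X)"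
abbreviation mult where "mult \<equiv> monoid.mult alg"

text \<open>The form left after \<open>t\<close> has been evaluated in the right factor of the
  product; a product of functionals is \<open>s\<close> applied to this form.\<close>

definition inner :: "('f \<Rightarrow> real) \<Rightarrow> 'f \<Rightarrow> 'f" where
  "inner t f = mk (\<lambda>x. t (mk (\<lambda>y. ev f (m x y))))"

lemma mult_eq: "mult s t f = (if f \<in> F then s (inner t f) else 0)"
  by (simp add: alg_def inner_def)

lemma ev_eqI: "(\<And>x. ev f x = ev g x) \<Longrightarrow> f = g"
  by (metis mk_ev ext)

text \<open>Functionals in the span are set to \<open>0\<close> off \<open>F\<close>, so linearity
  can be claimed only for forms.\<close>

lemma C_linear:
  assumes "s \<in> C" "f \<in> F" "g \<in> F"
  shows "s (f + g) = s f + s g" "s (c *\<^sub>R f) = c * s f"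
proof -
  have "s (f + g) = s f + s g \<and> s (c *\<^sub>R f) = c * s f"
    using assms(1)
  proof (induction rule: span_induct_mem)
    case (step d b s)
    obtain x where "b = pure x" using step(1) by blast
    then show ?case
      using step(3) assms(2,3) F by (simp add: pure_def subspace_add subspace_scale ev_linear fun_space algebra_simps)
  qed (simp add: fun_space)
  then show "s (f + g) = s f + s g" "s (c *\<^sub>R f) = c * s f" by auto
qed

lemma inner_pure: "f \<in> F \<Longrightarrow> x \<in> X \<Longrightarrow> ev (inner (pure z) f) x = ev f (m x z)"
  by (simp add: inner_def ev_mk pure_def F_left)

lemma inner_add: "inner (s + t) f = inner s f + inner t f"
  by (rule ev_eqI) (simp add: inner_def ev_mk ev_linear fun_space)

lemma inner_scale: "inner (c *\<^sub>R t) f = c *\<^sub>R inner t f"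
  by (rule ev_eqI) (simp add: inner_def ev_mk ev_linear fun_space)

lemma inner_0: "inner 0 f = 0"
  using inner_scale[of 0 0 f] by simp

text \<open>The inner form agrees with the right translate of \<open>f\<close> on \<open>X\<close>;
  at other points the truncation in \<open>pure\<close> may interfere. The assumption
  \<open>F_cong\<close> says that such points do not affect membership in \<open>F\<close>.\<close>

lemma inner_pure_F: assumes "f \<in> F" "z \<in> X" shows "inner (pure z) f \<in> F"
  by (rule F_cong[OF F_right[OF assms]]) (simp add: ev_mk inner_pure assms(1))

lemma inner_F: "t \<in> C \<Longrightarrow> f \<in> F \<Longrightarrow> inner t f \<in> F"
proof (induction rule: span_induct_mem)
  case base
  show ?case using F by (simp add: inner_0 subspace_0)
next
  case (step c b t)
  then show ?case
    using F inner_pure_F by (auto simp: inner_add inner_scale subspace_add subspace_scale)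
qed

lemma mult_pure: assumes "x \<in> X" "z \<in> X" shows "mult (pure x) (pure z) = pure (m x z)"
proof
  fix f show "mult (pure x) (pure z) f = pure (m x z) f"
  proof (cases "f \<in> F")
    case True
    then have "mult (pure x) (pure z) f = ev (inner (pure z) f) x"
      using inner_pure_F[OF True assms(2)] by (simp only: mult_eq pure_def[of x] if_True)
    then show ?thesis using inner_pure[OF True assms(1)] True by (simp add: pure_def[of "m x z"])
  qed (simp add: mult_eq pure_def)
qed

lemma mult_left_linear:
  "mult (s + s') t = mult s t + mult s' t" "mult (c *\<^sub>R s) t = c *\<^sub>R mult s t"
  by (auto simp: fun_eq_iff mult_eq fun_space)

lemma mult_right_linear:
  assumes "s \<in> C" "t \<in> C" "t' \<in> C"
  shows "mult s (t + t') = mult s t + mult s t'" "mult s (c *\<^sub>R t) = c *\<^sub>R mult s t"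
  using C_linear[OF assms(1)] inner_F assms(2,3)
  by (auto simp: fun_eq_iff mult_eq inner_add inner_scale fun_space)

lemma mult_0_left: "mult 0 t = 0"
  using mult_left_linear(2)[of 0 0 t] by simp

lemma mult_0_right: "s \<in> C \<Longrightarrow> mult s 0 = 0"
  using mult_right_linear(2)[of s 0 0 0] by (simp add: span_zero)

lemma pure_C: "x \<in> X \<Longrightarrow> pure x \<in> C"
  by (rule span_base) simp

lemma mult_C: assumes "s \<in> C" "t \<in> C" shows "mult s t \<in> C"
proof -
  have 1: "mult (pure x) t \<in> C" if "x \<in> X" for x
    using assms(2)
  proof (induction rule: span_induct_mem)
    case base
    show ?case by (simp add: mult_0_right pure_C that span_zero)
  next
    case (step c b t)
    obtain z where z: "b = pure z" "z \<in> X" using step(1) by blast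
    have "mult (pure x) (c *\<^sub>R b + t) = c *\<^sub>R pure (m x z) + mult (pure x) t"
      using z that step(2) by (simp add: mult_right_linear pure_C span_scale mult_pure)
    then show ?case using step(3) z that by (simp add: span_add span_scale pure_C m_closed)
  qed
  show ?thesis
    using assms(1)
    by (induction rule: span_induct_mem)
      (use 1 in \<open>auto simp: mult_left_linear mult_0_left span_zero intro: span_add span_scale\<close>)
qed

text \<open>Associativity is inherited from \<open>m\<close> on pure elements and spread by
  linearity over the third, the second and finally the first factor.\<close>

lemma mult_assoc:
  assumes "s \<in> C" "t \<in> C" "w \<in> C"
  shows "mult (mult s t) w = mult s (mult t w)"
proof -
  have 1: "mult (mult (pure x) (pure z)) w = mult (pure x) (mult (pure z) w)" if xz: "x \<in> X" "z \<in> X" for x z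
    using assms(3)
  proof (induction rule: span_induct_mem)
    case base
    show ?case using xz by (simp add: mult_0_right pure_C mult_C)
  next
    case (step c b w)
    obtain v where v: "b = pure v" "v \<in> X" using step(1) by blast
    have "mult (mult (pure x) (pure z)) b = mult (pure x) (mult (pure z) b)"
      using v xz by (simp add: mult_pure m_closed m_assoc)
    moreover have "b \<in> C" using v pure_C by simp
    ultimately show ?case
      using step(2,3) xz by (simp add: mult_right_linear pure_C mult_C span_scale)
  qed
  have 2: "mult (mult (pure x) t) w = mult (pure x) (mult t w)" if x: "x \<in> X" for x
    using assms(2)
  proof (induction rule: span_induct_mem)
    case base
    show ?case using x by (simp add: mult_0_right mult_0_left pure_C)
  next
    case (step c b t)
    obtain v where v: "b = pure v" "v \<in> X" using step(1) by blast
    then have "b \<in> C" using pure_C by simp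
    then show ?case
      using step(2,3) x v 1[OF x v(2)] assms(3)
      by (simp add: mult_right_linear mult_left_linear pure_C mult_C span_scale)
  qed
  show ?thesis
    using assms(1) by (induction rule: span_induct_mem) (use 2 in \<open>auto simp: mult_left_linear mult_0_left\<close>)
qed

lemma mult_one: assumes "t \<in> C" shows "mult (pure u) t = t" "mult t (pure u) = t"
proof -
  have "mult (pure u) t = t \<and> mult t (pure u) = t"
    using assms
  proof (induction rule: span_induct_mem)
    case (step c b t)
    obtain v where v: "b = pure v" "v \<in> X" using step(1) by blast
    then have "b \<in> C" using pure_C by simp
    then show ?case
      using step(2,3) v by (simp add: mult_right_linear mult_left_linear pure_C u_closed span_scale mult_pure u_neutral)
  qed (simp add: mult_0_left mult_0_right pure_C u_closed)
  then show "mult (pure u) t = t" "mult t (pure u) = t" by auto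
qed

lemma alg_simps: "carrier alg = C" "one alg = pure u"
  by (simp_all add: alg_def)

lemma is_real_algebra_alg: "is_real_algebra alg"
proof -
  have "monoid alg"
    by (rule monoidI) (simp_all add: alg_simps mult_C mult_assoc mult_one pure_C u_closed)
  then show ?thesis
    unfolding is_real_algebra_def linear_map_on_def alg_simps
    by (simp add: mult_left_linear mult_right_linear)
qed

end

section \<open>The two tensor products as algebras of functionals on forms\<close>

lemma form_algebra_binary:
  assumes A: "is_real_algebra A" and B: "is_real_algebra B"
  shows "form_algebra (carrier A \<times> carrier B) {f. bilinear_form_on (carrier A) (carrier B) f}
    (\<lambda>f (v, w). f v w) curry (\<lambda>(v, w) (v', w'). (v \<otimes>\<^bsub>A\<^esub> v', w \<otimes>\<^bsub>B\<^esub> w')) (\<one>\<^bsub>A\<^esub>, \<one>\<^bsub>B\<^esub>)"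
proof -
  interpret A: real_alg A by (rule real_algI) fact
  interpret B: real_alg B by (rule real_algI) fact
  show ?thesis
  proof (unfold_locales, goal_cases)
    case 1
    show ?case
      by (auto simp: subspace_def bilinear_form_on_def linear_map_on_def scaleR_fun_def algebra_simps)
  next
    \<comment> \<open>The obligation \<open>F_cong\<close>: bilinearity is tested on the carriers
      only.\<close>
    case (6 f g)
    then have "f v w = g v w" if "v \<in> carrier A" "w \<in> carrier B" for v w using that by fastforce
    then show ?case using 6(1) by (simp add: bilinear_form_on_def linear_map_on_def)
  qed (auto simp: scaleR_fun_def A.m_assoc B.m_assoc bilinear_form_on_def linear_map_on_def curry_def)
qed

lemma form_algebra_family:
  assumes A: "\<And>i. i \<in> I \<Longrightarrow> is_real_algebra (A i)"
  shows "form_algebra (\<Pi>\<^sub>E i\<in>I. carrier (A i)) {f. multilinear_form_on I (\<lambda>i. carrier (A i)) f}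
    (\<lambda>f. f) (\<lambda>f. f) (\<lambda>x y. \<lambda>i\<in>I. x i \<otimes>\<^bsub>A i\<^esub> y i) (\<lambda>i\<in>I. \<one>\<^bsub>A i\<^esub>)"
proof -
  have R: "real_alg (A i)" if "i \<in> I" for i using A[OF that] by (rule real_algI)
  then have M: "monoid (A i)" if "i \<in> I" for i using that by (simp add: real_alg_def)
  let ?X = "\<Pi>\<^sub>E i\<in>I. carrier (A i)" and ?m = "\<lambda>x y. \<lambda>i\<in>I. x i \<otimes>\<^bsub>A i\<^esub> y i"
  have upd: "x(i := v) \<in> ?X" if "x \<in> ?X" "i \<in> I" "v \<in> carrier (A i)" for x i v
    using that by (auto simp: PiE_iff extensional_def)
  have mX: "?m x y \<in> ?X" if "x \<in> ?X" "y \<in> ?X" for x y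
    using that M by (auto simp: PiE_iff monoid.m_closed)
  \<comment> \<open>Substituting a map that acts on each coordinate by a linear map keeps a form
    multilinear; left and right translations are of this kind.\<close>
  have ml: "multilinear_form_on I (\<lambda>i. carrier (A i)) (\<lambda>y. f (h y))"
    if f: "multilinear_form_on I (\<lambda>i. carrier (A i)) f"
      and h: "\<And>y. y \<in> ?X \<Longrightarrow> h y \<in> ?X"
        "\<And>y j v. y \<in> ?X \<Longrightarrow> j \<in> I \<Longrightarrow> h (y(j := v)) = (h y)(j := k j v)"
      and k: "\<And>j. j \<in> I \<Longrightarrow> linear_map_on (carrier (A j)) (k j)"
        "\<And>j v. j \<in> I \<Longrightarrow> v \<in> carrier (A j) \<Longrightarrow> k j v \<in> carrier (A j)" for f h k
    unfolding multilinear_form_on_def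
  proof (intro ballI)
    fix x j assume x: "x \<in> ?X" "j \<in> I"
    then have "linear_map_on (carrier (A j)) (\<lambda>v. f ((h x)(j := v)))"
      using f h(1) unfolding multilinear_form_on_def by blast
    then show "linear_map_on (carrier (A j)) (\<lambda>v. f (h (x(j := v))))"
      using h(2) k[OF x(2)] x by (simp add: linear_map_on_def)
  qed
  have lin: "linear_map_on (carrier (A j)) (\<lambda>v. a \<otimes>\<^bsub>A j\<^esub> v)" "linear_map_on (carrier (A j)) (\<lambda>v. v \<otimes>\<^bsub>A j\<^esub> a)"
    if "j \<in> I" "a \<in> carrier (A j)" for j a
    using A[OF that(1)] that(2) by (simp_all add: is_real_algebra_def)
  show ?thesis
  proof (unfold_locales, goal_cases)
    case 1
    show ?case
      by (auto simp: subspace_def multilinear_form_on_def linear_map_on_def scaleR_fun_def algebra_simps)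
  next
    case (6 f g)
    have "linear_map_on (carrier (A i)) (\<lambda>v. g (x(i := v)))" if x: "x \<in> ?X" "i \<in> I" for x i
    proof -
      interpret Ai: real_alg "A i" by (rule R[OF x(2)])
      have "f (x(i := v)) = g (x(i := v))" if "v \<in> carrier (A i)" for v
        using 6(2)[OF upd[OF x that]] .
      moreover have "linear_map_on (carrier (A i)) (\<lambda>v. f (x(i := v)))"
        using 6(1) x by (simp add: multilinear_form_on_def)
      ultimately show ?thesis by (simp add: linear_map_on_def)
    qed
    then show ?case by (simp add: multilinear_form_on_def)
  next
    case (7 x y)
    then show ?case by (rule mX)
  next
    case 8
    show ?case using M by (auto simp: monoid.one_closed)
  next
    case (9 x y z)
    then show ?case using M by (auto simp: fun_eq_iff PiE_iff monoid.m_assoc)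
  next
    case (10 x)
    then show ?case using M by (auto simp: fun_eq_iff PiE_iff extensional_def monoid.l_one)
  next
    case (11 x)
    then show ?case using M by (auto simp: fun_eq_iff PiE_iff extensional_def monoid.r_one)
  next
    case (12 f x)
    then show ?case
      using ml[of f "?m x" "\<lambda>j v. x j \<otimes>\<^bsub>A j\<^esub> v"] lin mX M
      by (auto simp: fun_eq_iff PiE_iff monoid.m_closed)
  next
    case (13 f x)
    then show ?case
      using ml[of f "\<lambda>y. ?m y x" "\<lambda>j v. v \<otimes>\<^bsub>A j\<^esub> x j"] lin mX M
      by (auto simp: fun_eq_iff PiE_iff monoid.m_closed)
  qed (simp_all add: scaleR_fun_def)
qed

lemma tensor_algebra_alg:
  assumes "is_real_algebra A" "is_real_algebra B"
  shows "is_real_algebra (tensor_algebra A B)"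
proof -
  interpret form_algebra "carrier A \<times> carrier B" "{f. bilinear_form_on (carrier A) (carrier B) f}"
    "\<lambda>f (v, w). f v w" curry "\<lambda>(v, w) (v', w'). (v \<otimes>\<^bsub>A\<^esub> v', w \<otimes>\<^bsub>B\<^esub> w')" "(\<one>\<^bsub>A\<^esub>, \<one>\<^bsub>B\<^esub>)"
    by (rule form_algebra_binary[OF assms])
  have p: "pure (v, w) = pure_tensor (carrier A) (carrier B) v w" for v w
    by (simp add: pure_def pure_tensor_def fun_eq_iff)
  have "pure ` (carrier A \<times> carrier B)
      = {pure_tensor (carrier A) (carrier B) v w |v w. v \<in> carrier A \<and> w \<in> carrier B}"
    using p by (auto simp: image_iff) (metis SigmaI)
  then have "alg = tensor_algebra A B"
    unfolding alg_def tensor_algebra_def p by (simp add: fun_eq_iff curry_def)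
  then show ?thesis using is_real_algebra_alg by simp
qed

lemma
  assumes "\<And>i. i \<in> I \<Longrightarrow> is_real_algebra (A i)"
  shows tensor_algebra_family_alg: "is_real_algebra (tensor_algebra_family I A)"
    and tensor_algebra_family_mult_pure:
      "x \<in> (\<Pi>\<^sub>E i\<in>I. carrier (A i)) \<Longrightarrow> y \<in> (\<Pi>\<^sub>E i\<in>I. carrier (A i)) \<Longrightarrow>
        pure_tensor_family I (\<lambda>i. carrier (A i)) x \<otimes>\<^bsub>tensor_algebra_family I A\<^esub> pure_tensor_family I (\<lambda>i. carrier (A i)) y
        = pure_tensor_family I (\<lambda>i. carrier (A i)) (\<lambda>i\<in>I. x i \<otimes>\<^bsub>A i\<^esub> y i)"
proof -
  interpret form_algebra "\<Pi>\<^sub>E i\<in>I. carrier (A i)" "{f. multilinear_form_on I (\<lambda>i. carrier (A i)) f}"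
    "\<lambda>f. f" "\<lambda>f. f" "\<lambda>x y. \<lambda>i\<in>I. x i \<otimes>\<^bsub>A i\<^esub> y i" "\<lambda>i\<in>I. \<one>\<^bsub>A i\<^esub>"
    by (rule form_algebra_family[OF assms])
  have p: "pure = pure_tensor_family I (\<lambda>i. carrier (A i))"
    by (simp add: pure_def pure_tensor_family_def fun_eq_iff)
  have eq: "alg = tensor_algebra_family I A"
    unfolding alg_def tensor_algebra_family_def p by (simp add: fun_eq_iff)
  show "is_real_algebra (tensor_algebra_family I A)" using is_real_algebra_alg eq by simp
  show "pure_tensor_family I (\<lambda>i. carrier (A i)) x \<otimes>\<^bsub>tensor_algebra_family I A\<^esub> pure_tensor_family I (\<lambda>i. carrier (A i)) y
      = pure_tensor_family I (\<lambda>i. carrier (A i)) (\<lambda>i\<in>I. x i \<otimes>\<^bsub>A i\<^esub> y i)"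
    if "x \<in> (\<Pi>\<^sub>E i\<in>I. carrier (A i))" "y \<in> (\<Pi>\<^sub>E i\<in>I. carrier (A i))"
    using mult_pure[OF that] by (simp add: p eq)
qed

lemma pure_tensor_linear:
  assumes "v \<in> V" "w \<in> W"
  shows "v' \<in> V \<Longrightarrow> pure_tensor V W (v + v') w = pure_tensor V W v w + pure_tensor V W v' w"
    and "w' \<in> W \<Longrightarrow> pure_tensor V W v (w + w') = pure_tensor V W v w + pure_tensor V W v w'"
    and "pure_tensor V W (c *\<^sub>R v) w = c *\<^sub>R pure_tensor V W v w"
    and "pure_tensor V W v (c *\<^sub>R w) = c *\<^sub>R pure_tensor V W v w"
  using assms
  by (auto simp: fun_eq_iff pure_tensor_def scaleR_fun_def bilinear_form_on_def linear_map_on_def)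

lemma pure_tensor_0:
  assumes "v \<in> V" "w \<in> W"
  shows "pure_tensor V W 0 w = 0" "pure_tensor V W v 0 = 0"
  using pure_tensor_linear(3,4)[OF assms, of 0] by simp_all

lemma pure_tensor_span:
  assumes V: "subspace V" "P \<subseteq> V" and W: "subspace W" "Q \<subseteq> W" and v: "v \<in> span P" and w: "w \<in> span Q"
  shows "pure_tensor V W v w \<in> span {pure_tensor V W p q |p q. p \<in> P \<and> q \<in> Q}" (is "_ \<in> span ?B")
proof -
  have PV: "span P \<subseteq> V" and QW: "span Q \<subseteq> W" using V W by (simp_all add: span_minimal)
  have 1: "pure_tensor V W p w \<in> span ?B" if p: "p \<in> P" for p
    using w
  proof (induction rule: span_induct_mem)
    case base
    have "p \<in> V" using p V(2) by blast
    then show ?case using W(1) pure_tensor_0(2)[of p V 0 W] span_zero by (simp only: subspace_0)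
  next
    case (step c q z)
    have mem: "p \<in> V" "q \<in> W" "z \<in> W" "c *\<^sub>R q \<in> W" using p V W QW step(1,2) by (auto simp: subspace_scale)
    have "pure_tensor V W p (c *\<^sub>R q + z) = c *\<^sub>R pure_tensor V W p q + pure_tensor V W p z"
      using mem by (simp add: pure_tensor_linear)
    moreover have "pure_tensor V W p q \<in> span ?B" using p step(1) by (intro span_base) blast
    ultimately show ?case using step(3) by (simp add: span_add span_scale del: plus_fun_apply)
  qed
  have wW: "w \<in> W" using w QW by blast
  show ?thesis
    using v
  proof (induction rule: span_induct_mem)
    case base
    show ?case using wW V(1) pure_tensor_0(1)[of 0 V w W] span_zero by (simp only: subspace_0)
  next
    case (step c p z)
    have mem: "p \<in> V" "z \<in> V" "c *\<^sub>R p \<in> V" using V PV step(1,2) by (auto simp: subspace_scale)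
    have "pure_tensor V W (c *\<^sub>R p + z) w = c *\<^sub>R pure_tensor V W p w + pure_tensor V W z w"
      using mem wW by (simp add: pure_tensor_linear)
    then show ?case using step(3) 1[OF step(1)] by (simp add: span_add span_scale del: plus_fun_apply)
  qed
qed

abbreviation ptf :: "'i set \<Rightarrow> ('i \<Rightarrow> 'a::real_vector) \<Rightarrow> (('i \<Rightarrow> 'a) \<Rightarrow> real) \<Rightarrow> real" where
  "ptf I \<equiv> pure_tensor_family I (\<lambda>_. UNIV)"

lemma ptf_linear:
  assumes "x \<in> extensional I" "i \<in> I"
  shows "linear (\<lambda>v. ptf I (x(i := v)))"
proof (rule linearI)
  have x: "x \<in> (\<Pi>\<^sub>E i\<in>I. UNIV)" using assms(1) by (simp add: PiE_def)
  show "ptf I (x(i := v + w)) = ptf I (x(i := v)) + ptf I (x(i := w))" for v w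
    using x assms(2) by (auto simp: fun_eq_iff pure_tensor_family_def multilinear_form_on_def linear_map_on_def)
  show "ptf I (x(i := c *\<^sub>R v)) = c *\<^sub>R ptf I (x(i := v))" for c v
    using x assms(2) by (auto simp: fun_eq_iff pure_tensor_family_def multilinear_form_on_def linear_map_on_def
        scaleR_fun_def)
qed

lemma ptf_scale:
  assumes "finite I"
  shows "ptf I (\<lambda>i\<in>I. c i *\<^sub>R x i) = (\<Prod>i\<in>I. c i) *\<^sub>R ptf I (\<lambda>i\<in>I. x i)"
proof -
  \<comment> \<open>The set \<open>J\<close> contains the coordinates whose scalars have been taken
    into account; each step of the induction uses linearity in one coordinate.\<close>
  have "ptf I (\<lambda>i\<in>I. if i \<in> J then c i *\<^sub>R x i else x i) = (\<Prod>i\<in>J. c i) *\<^sub>R ptf I (\<lambda>i\<in>I. x i)"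
    if "J \<subseteq> I" for J
    using finite_subset[OF that assms] that
  proof (induction J)
    case (insert j J)
    let ?z = "\<lambda>i\<in>I. if i \<in> J then c i *\<^sub>R x i else x i"
    have z: "?z \<in> extensional I" "j \<in> I" using insert.prems by auto
    have "(\<lambda>i\<in>I. if i \<in> insert j J then c i *\<^sub>R x i else x i) = ?z(j := c j *\<^sub>R x j)"
      using z(2) insert.hyps by (auto simp: fun_eq_iff)
    then have "ptf I (\<lambda>i\<in>I. if i \<in> insert j J then c i *\<^sub>R x i else x i) = c j *\<^sub>R ptf I (?z(j := x j))"
      using linear_scale[OF ptf_linear[OF z]] by simp
    also have "?z(j := x j) = ?z" using z(2) insert.hyps by (auto simp: fun_eq_iff)
    also have "ptf I ?z = (\<Prod>i\<in>J. c i) *\<^sub>R ptf I (\<lambda>i\<in>I. x i)"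
      using insert.IH insert.prems by blast
    finally show ?case by (simp only: prod.insert[OF insert.hyps(1,2)] scaleR_scaleR)
  qed simp
  from this[OF order.refl] show ?thesis by (simp cong: restrict_cong)
qed

text \<open>Multilinear expansion, one coordinate at a time: in the induction, coordinates in
  \<open>J\<close> range over the span and the others over the generators only.\<close>

lemma ptf_span:
  assumes "finite I" "x \<in> (\<Pi>\<^sub>E i\<in>I. span (B i))"
  shows "ptf I x \<in> span (ptf I ` (\<Pi>\<^sub>E i\<in>I. B i))"
proof -
  have "ptf I x \<in> span (ptf I ` (\<Pi>\<^sub>E i\<in>I. B i))"
    if "J \<subseteq> I" "x \<in> (\<Pi>\<^sub>E i\<in>I. if i \<in> J then span (B i) else B i)" for J x
    using finite_subset[OF that(1) assms(1)] that
  proof (induction J arbitrary: x)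
    case empty
    then show ?case by (simp add: span_base)
  next
    case (insert j J)
    have j: "j \<in> I" "x \<in> extensional I" using insert.prems by (auto simp: PiE_iff)
    have lin: "linear (\<lambda>v. ptf I (x(j := v)))" by (rule ptf_linear[OF j(2,1)])
    have "ptf I (x(j := v)) \<in> span (ptf I ` (\<Pi>\<^sub>E i\<in>I. B i))" if "v \<in> B j" for v
      using insert that by (intro insert.IH) (auto simp: PiE_iff extensional_def)
    then have "(\<lambda>v. ptf I (x(j := v))) ` B j \<subseteq> span (ptf I ` (\<Pi>\<^sub>E i\<in>I. B i))" by blast
    then have "span ((\<lambda>v. ptf I (x(j := v))) ` B j) \<subseteq> span (ptf I ` (\<Pi>\<^sub>E i\<in>I. B i))"
      by (simp add: span_minimal)
    then have "(\<lambda>v. ptf I (x(j := v))) ` span (B j) \<subseteq> span (ptf I ` (\<Pi>\<^sub>E i\<in>I. B i))"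
      by (simp add: linear_span_image[OF lin])
    moreover have "x j \<in> span (B j)" using insert.prems by (auto simp: PiE_iff)
    ultimately have "ptf I (x(j := x j)) \<in> span (ptf I ` (\<Pi>\<^sub>E i\<in>I. B i))" by blast
    then show ?case by simp
  qed
  from this[OF order.refl] show ?thesis using assms(2) by (simp cong: PiE_cong)
qed

lemma linear_functional_exists:
  fixes v :: "'a::real_vector"
  assumes "v \<noteq> 0"
  obtains \<omega> :: "'a \<Rightarrow> real" where "linear \<omega>" "\<omega> v = 1"
  using linear_independent_extend[of "{v}" "\<lambda>_. 1 :: real"] assms by auto

text \<open>A product of linear functionals with value \<open>1\<close> at \<open>v\<close> and at
  \<open>w\<close> is a bilinear form on which the pure tensor does not vanish.\<close>

lemma pure_tensor_neq_0:
  assumes "v \<noteq> 0" "w \<noteq> 0"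
  shows "pure_tensor V W v w \<noteq> 0"
proof
  obtain \<omega> :: "'a \<Rightarrow> real" where \<omega>: "linear \<omega>" "\<omega> v = 1" by (rule linear_functional_exists[OF assms(1)])
  obtain \<omega>' :: "'b \<Rightarrow> real" where \<omega>': "linear \<omega>'" "\<omega>' w = 1" by (rule linear_functional_exists[OF assms(2)])
  have "bilinear_form_on V W (\<lambda>v w. \<omega> v * \<omega>' w)"
    by (simp add: bilinear_form_on_def linear_map_on_def linear_add[OF \<omega>(1)] linear_add[OF \<omega>'(1)]
        linear_scale[OF \<omega>(1)] linear_scale[OF \<omega>'(1)] algebra_simps)
  then have "pure_tensor V W v w (\<lambda>v w. \<omega> v * \<omega>' w) = 1" using \<omega> \<omega>' by (simp add: pure_tensor_def)
  moreover assume "pure_tensor V W v w = 0"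
  ultimately show False by simp
qed

lemma ptf_neq_0:
  fixes v :: "'a::real_vector"
  assumes "finite I" "v \<noteq> 0"
  shows "ptf I (\<lambda>i\<in>I. v) \<noteq> 0"
proof
  obtain \<omega> :: "'a \<Rightarrow> real" where \<omega>: "linear \<omega>" "\<omega> v = 1" by (rule linear_functional_exists[OF assms(2)])
  let ?f = "\<lambda>x. \<Prod>i\<in>I. \<omega> (x i)"
  have "?f (x(i := w)) = \<omega> w * (\<Prod>k\<in>I - {i}. \<omega> (x k))" if "i \<in> I" for x i w
  proof -
    have "?f (x(i := w)) = \<omega> ((x(i := w)) i) * (\<Prod>k\<in>I - {i}. \<omega> ((x(i := w)) k))"
      by (rule prod.remove[OF assms(1) that])
    moreover have "(\<Prod>k\<in>I - {i}. \<omega> ((x(i := w)) k)) = (\<Prod>k\<in>I - {i}. \<omega> (x k))"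
      by (rule prod.cong) auto
    ultimately show ?thesis by simp
  qed
  then have "multilinear_form_on I (\<lambda>_. UNIV) ?f"
    unfolding multilinear_form_on_def linear_map_on_def
    by (simp add: linear_add[OF \<omega>(1)] linear_scale[OF \<omega>(1)] algebra_simps)
  then have "ptf I (\<lambda>i\<in>I. v) ?f = 1" using \<omega> by (simp add: pure_tensor_family_def)
  moreover assume "ptf I (\<lambda>i\<in>I. v) = 0"
  ultimately show False by simp
qed

section \<open>The model gradings\<close>

lemma mat2_entry [simp]:
  "mat2 a b c d $ 1 $ 1 = a" "mat2 a b c d $ 1 $ 2 = b" "mat2 a b c d $ 2 $ 1 = c" "mat2 a b c d $ 2 $ 2 = d"
  by (simp_all add: mat2_def)

lemma mat2_eqI:
  fixes A B :: "real^2^2"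
  assumes "A $ 1 $ 1 = B $ 1 $ 1" "A $ 1 $ 2 = B $ 1 $ 2" "A $ 2 $ 1 = B $ 2 $ 1" "A $ 2 $ 2 = B $ 2 $ 2"
  shows "A = B"
  using assms by (simp add: vec_eq_iff forall_2)

lemma mat2_mult: "mat2 a b c d ** mat2 a' b' c' d' = mat2 (a * a' + b * c') (a * b' + b * d') (c * a' + d * c') (c * b' + d * d')"
  by (rule mat2_eqI) (simp_all add: matrix_matrix_mult_def sum_2)

lemma mat2_one: "mat 1 = mat2 1 0 0 1"
  by (rule mat2_eqI) (simp_all add: mat_def)

lemma mat2_uminus: "- mat2 a b c d = mat2 (- a) (- b) (- c) (- d)"
  by (rule mat2_eqI) simp_all

abbreviation pauli_q :: "bool \<Rightarrow> bool \<Rightarrow> real^2^2" where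
  "pauli_q \<equiv> gen_pair matrix_algebra (mat2 0 1 1 0) (mat2 (-1) 0 0 1)"

lemma matrix_algebra_simps:
  "carrier (matrix_algebra :: ('k::real_algebra_1 ^ 'n ^ 'n) monoid) = UNIV"
  "A \<otimes>\<^bsub>matrix_algebra\<^esub> B = A ** B" "\<one>\<^bsub>matrix_algebra\<^esub> = mat 1"
  by (simp_all add: matrix_algebra_def)

lemma pauli_q_eq:
  "pauli_q False False = mat2 1 0 0 1" "pauli_q False True = mat2 (-1) 0 0 1"
  "pauli_q True False = mat2 0 1 1 0" "pauli_q True True = mat2 0 1 (-1) 0"
  by (simp_all add: gen_pair_def matrix_algebra_simps mat2_one mat2_mult)

lemma pauli_q_mult:
  "pauli_q u v \<otimes>\<^bsub>matrix_algebra\<^esub> pauli_q u' v' = pair_sign 1 1 u v u' v' *\<^sub>R pauli_q (u \<noteq> u') (v \<noteq> v')"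
proof -
  interpret real_alg "matrix_algebra :: (real^2^2) monoid" by (rule real_algI[OF matrix_real_algebra])
  show ?thesis
    by (rule gen_pair_mult) (simp_all add: matrix_algebra_simps mat2_mult mat2_one mat2_uminus)
qed

lemma pauli_q_span: "span {pauli_q u v |u v. True} = UNIV"
proof -
  have "A \<in> span {pauli_q u v |u v. True}" for A
  proof -
    have "A = ((A$1$1 + A$2$2) / 2) *\<^sub>R pauli_q False False + ((A$2$2 - A$1$1) / 2) *\<^sub>R pauli_q False True
      + ((A$1$2 + A$2$1) / 2) *\<^sub>R pauli_q True False + ((A$1$2 - A$2$1) / 2) *\<^sub>R pauli_q True True"
      by (rule mat2_eqI) (simp_all add: pauli_q_eq field_simps)
    also have "\<dots> \<in> span {pauli_q u v |u v. True}"
      by (intro span_add span_scale span_base) auto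
    finally show ?thesis .
  qed
  then show ?thesis by auto
qed

text \<open>In degree \<open>(1, 1)\<close> the product of the two generators is the negative of the
  matrix in the definition, which spans the same line.\<close>

lemma M2_grading_dim1_eq: "M2_grading_dim1 (of_bool u, of_bool v) = span {pauli_q u v}"
proof -
  have "mat2 0 (-1) 1 0 = - mat2 0 1 (-1) 0" by (simp add: mat2_uminus)
  then have "span {mat2 0 (-1) 1 0} = span {mat2 0 1 (-1) 0}"
    using span_image_scale[of "{mat2 0 1 (-1) 0}" "\<lambda>_. -1"] by simp
  then show ?thesis by (cases u; cases v) (simp_all add: M2_grading_dim1_def pauli_q_eq)
qed

text \<open>Covers both possible first tensor factors: real 2 by 2 matrices with
  \<open>\<epsilon> = 1\<close> and quaternions with \<open>\<epsilon> = -1\<close>. The element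
  \<open>xx\<close> has degree \<open>1\<close>, and \<open>ii\<close> is the imaginary unit of
  degree \<open>0\<close>.\<close>

locale model_factor = real_alg Fa for Fa :: "'a::real_vector monoid" (structure) +
  fixes \<Delta> :: "int \<Rightarrow> 'a set" and \<epsilon> :: real and xx ii :: 'a
  assumes sign: "\<epsilon> = 1 \<or> \<epsilon> = -1" and nonzero: "\<one> \<noteq> 0"
    and cl: "xx \<in> carrier Fa" "ii \<in> carrier Fa"
    and rel: "xx \<otimes> xx = \<epsilon> *\<^sub>R \<one>" "ii \<otimes> ii = (-1) *\<^sub>R \<one>" "ii \<otimes> xx = - (xx \<otimes> ii)"
    and \<Delta>: "\<Delta> (of_bool u) = span {gen_pair Fa xx ii u v |v. True}"
    and spanning: "carrier Fa = span {gen_pair Fa xx ii u v |u v. True}"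
begin

abbreviation gF where "gF \<equiv> gen_pair Fa xx ii"

lemma gF_mult: "gF u v \<otimes> gF u' v' = pair_sign \<epsilon> (-1) u v u' v' *\<^sub>R gF (u \<noteq> u') (v \<noteq> v')"
  by (rule gen_pair_mult[OF cl rel])

definition qfam :: "nat \<Rightarrow> nat set \<times> nat set \<Rightarrow> nat \<Rightarrow> real^2^2" where
  "qfam j S = (\<lambda>k\<in>{..<j}. pauli_q (k \<in> fst S) (k \<in> snd S))"

text \<open>The first tensor factor supplies the pair with the last index \<open>j\<close>, because
  the special pair of a standard family comes last; the matrix factors supply the pairs below
  \<open>j\<close>.\<close>

definition y :: "nat \<Rightarrow> nat set \<times> nat set \<Rightarrow> ('a \<Rightarrow> (((nat \<Rightarrow> real^2^2) \<Rightarrow> real) \<Rightarrow> real) \<Rightarrow> real) \<Rightarrow> real" where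
  "y j S = pure_tensor (carrier Fa) (carrier (M2_tensor_power j)) (gF (j \<in> fst S) (j \<in> snd S))
     (ptf {..<j} (qfam j S))"

text \<open>Membership of \<open>j\<close> in \<open>snd S\<close> does not enter, since
  \<open>ii\<close> has degree \<open>0\<close>.\<close>

definition deg :: "nat \<Rightarrow> nat set \<times> nat set \<Rightarrow> int \<times> (nat \<Rightarrow> int \<times> int)" where
  "deg j S = (of_bool (j \<in> fst S), \<lambda>k\<in>{..<j}. (of_bool (k \<in> fst S), of_bool (k \<in> snd S)))"

lemma power_algebra: "is_real_algebra (M2_tensor_power j)"
  unfolding M2_tensor_power_def by (rule tensor_algebra_family_alg) (rule matrix_real_algebra)

lemma power_carrier: "carrier (M2_tensor_power j) = span (ptf {..<j} ` ({..<j} \<rightarrow>\<^sub>E UNIV))"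
  by (simp add: M2_tensor_power_def tensor_algebra_family_def matrix_algebra_simps)

lemma ptf_carrier: "x \<in> {..<j} \<rightarrow>\<^sub>E UNIV \<Longrightarrow> ptf {..<j} x \<in> carrier (M2_tensor_power j)"
  unfolding power_carrier by (rule span_base) simp

lemma qfam_ext: "qfam j S \<in> {..<j} \<rightarrow>\<^sub>E UNIV"
  by (simp add: qfam_def)

lemma power_mult:
  "ptf {..<j} (qfam j S) \<otimes>\<^bsub>M2_tensor_power j\<^esub> ptf {..<j} (qfam j S')
    = (\<Prod>k<j. pair_sign 1 1 (k \<in> fst S) (k \<in> snd S) (k \<in> fst S') (k \<in> snd S')) *\<^sub>R ptf {..<j} (qfam j (idx_add S S'))"
proof -
  have "ptf {..<j} (qfam j S) \<otimes>\<^bsub>M2_tensor_power j\<^esub> ptf {..<j} (qfam j S')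
      = ptf {..<j} (\<lambda>k\<in>{..<j}. qfam j S k \<otimes>\<^bsub>matrix_algebra\<^esub> qfam j S' k)"
    using tensor_algebra_family_mult_pure[of "{..<j}" "\<lambda>_. matrix_algebra :: (real^2^2) monoid" "qfam j S" "qfam j S'"]
      qfam_ext matrix_real_algebra
    by (simp add: M2_tensor_power_def matrix_algebra_simps(1))
  also have "(\<lambda>k\<in>{..<j}. qfam j S k \<otimes>\<^bsub>matrix_algebra\<^esub> qfam j S' k)
      = (\<lambda>k\<in>{..<j}. pair_sign 1 1 (k \<in> fst S) (k \<in> snd S) (k \<in> fst S') (k \<in> snd S') *\<^sub>R
          pauli_q (k \<in> fst (idx_add S S')) (k \<in> snd (idx_add S S')))"
    unfolding mem_idx_add pauli_q_mult[symmetric] by (rule restrict_cong) (simp_all add: qfam_def)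
  also have "ptf {..<j} \<dots> = (\<Prod>k<j. pair_sign 1 1 (k \<in> fst S) (k \<in> snd S) (k \<in> fst S') (k \<in> snd S')) *\<^sub>R
      ptf {..<j} (\<lambda>k\<in>{..<j}. pauli_q (k \<in> fst (idx_add S S')) (k \<in> snd (idx_add S S')))"
    by (rule ptf_scale) simp
  finally show ?thesis by (simp only: qfam_def)
qed

lemma model_real_algebra: "is_real_algebra (model_algebra Fa j)"
  unfolding model_algebra_def by (rule tensor_algebra_alg[OF real_algebra power_algebra])

lemma y_mult:
  "y j S \<otimes>\<^bsub>model_algebra Fa j\<^esub> y j S'
    = idx_sign (Suc j) ((\<lambda>_. 1)(j := \<epsilon>)) ((\<lambda>_. 1)(j := -1)) S S' *\<^sub>R y j (idx_add S S')"
proof -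
  let ?e = "pair_sign \<epsilon> (-1) (j \<in> fst S) (j \<in> snd S) (j \<in> fst S') (j \<in> snd S')"
  let ?c = "\<Prod>k<j. pair_sign 1 1 (k \<in> fst S) (k \<in> snd S) (k \<in> fst S') (k \<in> snd S')"
  let ?T = "pure_tensor (carrier Fa) (carrier (M2_tensor_power j))"
  have g: "gF u v \<in> carrier Fa" for u v using cl by simp
  have p: "ptf {..<j} (qfam j R) \<in> carrier (M2_tensor_power j)" for R by (rule ptf_carrier[OF qfam_ext])
  interpret B: real_alg "M2_tensor_power j" by (rule real_algI[OF power_algebra])
  have "y j S \<otimes>\<^bsub>model_algebra Fa j\<^esub> y j S'
      = ?T (gF (j \<in> fst S) (j \<in> snd S) \<otimes> gF (j \<in> fst S') (j \<in> snd S'))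
          (ptf {..<j} (qfam j S) \<otimes>\<^bsub>M2_tensor_power j\<^esub> ptf {..<j} (qfam j S'))"
    unfolding y_def model_algebra_def by (rule tensor_algebra_mult_pure[OF real_algebra power_algebra g p g p])
  also have "\<dots> = ?T (?e *\<^sub>R gF (j \<in> fst (idx_add S S')) (j \<in> snd (idx_add S S')))
      (?c *\<^sub>R ptf {..<j} (qfam j (idx_add S S')))"
    unfolding gF_mult power_mult mem_idx_add ..
  also have "\<dots> = (?e * ?c) *\<^sub>R y j (idx_add S S')"
    using g p by (simp add: y_def pure_tensor_linear(3,4))
  also have "?e * ?c = idx_sign (Suc j) ((\<lambda>_. 1)(j := \<epsilon>)) ((\<lambda>_. 1)(j := -1)) S S'"
    unfolding idx_sign_def by (simp add: mult.commute)
  finally show ?thesis .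
qed

lemma y_closed: "y j S \<in> carrier (model_algebra Fa j)"
proof -
  have "gF (j \<in> fst S) (j \<in> snd S) \<in> carrier Fa" "ptf {..<j} (qfam j S) \<in> carrier (M2_tensor_power j)"
    using cl ptf_carrier[OF qfam_ext] by simp_all
  then show ?thesis
    unfolding y_def model_algebra_def tensor_algebra_def partial_object.select_convs
    by (intro span_base) blast
qed

text \<open>Pairs from different tensor factors commute, and the squares are \<open>1\<close> in the
  matrix factors and \<open>\<epsilon>\<close>, \<open>-1\<close> in \<open>Fa\<close>. This
  replaces an explicit isomorphism of the iterated tensor product with a matrix algebra.\<close>

lemma model_std_family: "std_family (model_algebra Fa j) \<epsilon> j (y j)"
proof -
  let ?D = "model_algebra Fa j" and ?T = "pure_tensor (carrier Fa) (carrier (M2_tensor_power j))"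
  interpret B: real_alg "M2_tensor_power j" by (rule real_algI[OF power_algebra])
  have one: "y j ({}, {}) = \<one>\<^bsub>?D\<^esub>"
  proof -
    have "qfam j ({}, {}) = (\<lambda>i\<in>{..<j}. mat 1)"
      by (simp add: qfam_def pauli_q_eq mat2_one)
    moreover have "gF False False = \<one>" by (simp add: gen_pair_def)
    ultimately show ?thesis
      by (simp add: y_def model_algebra_def tensor_algebra_def M2_tensor_power_def tensor_algebra_family_def
          matrix_algebra_simps)
  qed
  have "y j ({}, {}) \<noteq> 0"
  proof -
    have "ptf {..<j} (\<lambda>i\<in>{..<j}. mat2 1 0 0 1) \<noteq> 0"
    proof (rule ptf_neq_0)
      show "mat2 1 0 0 1 \<noteq> 0" using mat2_entry(1)[of 1 0 0 1] by (metis zero_index zero_neq_one)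
    qed simp
    moreover have "qfam j ({}, {}) = (\<lambda>i\<in>{..<j}. mat2 1 0 0 1)" by (simp add: qfam_def pauli_q_eq)
    moreover have "gF False False = \<one>" by (simp add: gen_pair_def)
    ultimately show ?thesis
      unfolding y_def using nonzero by (intro pure_tensor_neq_0) simp_all
  qed
  then have fam: "pauli_family ?D (Suc j) ((\<lambda>_. 1)(j := \<epsilon>)) ((\<lambda>_. 1)(j := -1)) (y j)"
    unfolding pauli_family_def using model_real_algebra one sign y_closed y_mult by auto
  have "carrier ?D = span (y j ` idx (Suc j))"
  proof
    show "span (y j ` idx (Suc j)) \<subseteq> carrier ?D"
    proof -
      interpret P: real_alg ?D by (rule real_algI[OF model_real_algebra])
      show ?thesis by (rule span_minimal[OF _ P.subspace_carrier]) (use y_closed in auto)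
    qed
    have pw: "carrier (M2_tensor_power j) = span (ptf {..<j} ` ({..<j} \<rightarrow>\<^sub>E {pauli_q u v |u v. True}))"
    proof
      show "carrier (M2_tensor_power j) \<subseteq> span (ptf {..<j} ` ({..<j} \<rightarrow>\<^sub>E {pauli_q u v |u v. True}))"
        unfolding power_carrier
      proof (rule span_minimal[OF _ subspace_span], rule image_subsetI)
        fix x :: "nat \<Rightarrow> real^2^2" assume "x \<in> {..<j} \<rightarrow>\<^sub>E UNIV"
        then have "x \<in> (\<Pi>\<^sub>E i\<in>{..<j}. span {pauli_q u v |u v. True})" unfolding pauli_q_span .
        then show "ptf {..<j} x \<in> span (ptf {..<j} ` ({..<j} \<rightarrow>\<^sub>E {pauli_q u v |u v. True}))"
          by (rule ptf_span[rotated]) simp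
      qed
      show "span (ptf {..<j} ` ({..<j} \<rightarrow>\<^sub>E {pauli_q u v |u v. True})) \<subseteq> carrier (M2_tensor_power j)"
        unfolding power_carrier by (rule span_mono) (auto simp: PiE_iff)
    qed
    have gen: "?T (gF u v) (ptf {..<j} x) \<in> y j ` idx (Suc j)"
      if x: "x \<in> {..<j} \<rightarrow>\<^sub>E {pauli_q u v |u v. True}" for u v x
    proof -
      have "\<forall>k\<in>{..<j}. \<exists>uv. x k = pauli_q (fst uv) (snd uv)" using x by (auto simp: PiE_iff) 
      then obtain uv where uv: "\<And>k. k < j \<Longrightarrow> x k = pauli_q (fst (uv k)) (snd (uv k))"
        using bchoice[of "{..<j}" "\<lambda>k uv. x k = pauli_q (fst uv) (snd uv)"] by auto
      define S where "S = ({k. k < j \<and> fst (uv k)} \<union> (if u then {j} else {}),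
        {k. k < j \<and> snd (uv k)} \<union> (if v then {j} else {}))"
      have "x = qfam j S"
        using x uv by (auto simp: fun_eq_iff qfam_def S_def PiE_iff extensional_def)
      moreover have "(j \<in> fst S) = u" "(j \<in> snd S) = v" by (simp_all add: S_def)
      moreover have "S \<in> idx (Suc j)" by (auto simp: S_def idx_def)
      ultimately show ?thesis unfolding y_def by (intro image_eqI[of _ _ S]) simp_all
    qed
    show "carrier ?D \<subseteq> span (y j ` idx (Suc j))"
      unfolding model_algebra_def tensor_algebra_def partial_object.select_convs
    proof (rule span_minimal[OF _ subspace_span], rule subsetI)
      fix z assume "z \<in> {?T v w |v w. v \<in> carrier Fa \<and> w \<in> carrier (M2_tensor_power j)}"
      then obtain v w where z: "z = ?T v w" "v \<in> carrier Fa" "w \<in> carrier (M2_tensor_power j)" by blast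
      have "?T v w \<in> span {?T p q |p q. p \<in> {gF u v |u v. True} \<and> q \<in> ptf {..<j} ` ({..<j} \<rightarrow>\<^sub>E {pauli_q u v |u v. True})}"
      proof (rule pure_tensor_span[OF subspace_carrier _ B.subspace_carrier])
        show "{gF u v |u v. True} \<subseteq> carrier Fa" unfolding spanning by (rule span_superset)
        show "v \<in> span {gF u v |u v. True}" using z(2) unfolding spanning .
        show "ptf {..<j} ` ({..<j} \<rightarrow>\<^sub>E {pauli_q u v |u v. True}) \<subseteq> carrier (M2_tensor_power j)"
          unfolding pw by (rule span_superset)
        show "w \<in> span (ptf {..<j} ` ({..<j} \<rightarrow>\<^sub>E {pauli_q u v |u v. True}))"
          using z(3) unfolding pw .
      qed
      also have "\<dots> \<subseteq> span (y j ` idx (Suc j))"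
        using gen by (intro span_mono) blast
      finally show "z \<in> span (y j ` idx (Suc j))" using z(1) by simp
    qed
  qed
  then show ?thesis using fam unfolding std_family_def by blast
qed

lemma Z2_group: "comm_group (model_group j)"
proof -
  let ?P = "product_group {..<j} (\<lambda>_. integer_mod_group 2 \<times>\<times> integer_mod_group 2)"
  have "group ?P" by (simp add: DirProd_group)
  then have "group (integer_mod_group 2 \<times>\<times> ?P)" by (simp add: DirProd_group)
  then show ?thesis
    unfolding model_group_def
    by (rule group.group_comm_groupI) (simp add: DirProd_def case_prod_unfold add.commute)
qed

lemma carrier_model_group: "carrier (model_group j) = {0, 1} \<times> ({..<j} \<rightarrow>\<^sub>E {0, 1} \<times> {0, 1})"
  by (simp add: model_group_def carrier_Z2)

lemma of_bool_neq: "of_bool (a \<noteq> b) = (of_bool a + of_bool b) mod (2::int)"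
  by auto

lemma deg_add: "deg j (idx_add S S') = deg j S \<otimes>\<^bsub>model_group j\<^esub> deg j S'"
  unfolding deg_def mem_idx_add of_bool_neq
  by (simp add: model_group_def fun_eq_iff DirProd_def)

lemma deg_inj:
  assumes "S \<in> idx (Suc j)" "S' \<in> idx (Suc j)"
  shows "deg j S = deg j S' \<longleftrightarrow> fst S = fst S' \<and> snd S - {j} = snd S' - {j}"
proof -
  have sub: "fst S \<subseteq> {..j}" "fst S' \<subseteq> {..j}" "snd S \<subseteq> {..j}" "snd S' \<subseteq> {..j}"
    using assms by (auto simp: idx_def)
  have "deg j S = deg j S' \<longleftrightarrow> (j \<in> fst S \<longleftrightarrow> j \<in> fst S') \<and>
      (\<forall>k<j. (k \<in> fst S \<longleftrightarrow> k \<in> fst S') \<and> (k \<in> snd S \<longleftrightarrow> k \<in> snd S'))"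
    by (auto simp: deg_def fun_eq_iff of_bool_eq_iff)
  also have "\<dots> \<longleftrightarrow> fst S = fst S' \<and> snd S - {j} = snd S' - {j}"
    using sub by (auto simp: set_eq_iff subset_iff le_less)
  finally show ?thesis .
qed

lemma deg_closed: "deg j S \<in> carrier (model_group j)"
  by (auto simp: deg_def carrier_model_group)

text \<open>Each matrix factor contributes a line and \<open>Fa\<close> a plane. Hence on the group
  the model grading is the one that the family \<open>y j\<close> and the degree map
  \<open>deg j\<close> define.\<close>

lemma model_comp:
  assumes "t \<in> carrier (model_group j)"
  shows "model_grading Fa \<Delta> j t = span {y j S |S. S \<in> idx (Suc j) \<and> deg j S = t}"
proof -
  let ?T = "pure_tensor (carrier Fa) (carrier (M2_tensor_power j))"
  interpret B: real_alg "M2_tensor_power j" by (rule real_algI[OF power_algebra])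
  obtain g h where t: "t = (g, h)" "g \<in> {0, 1}" "h \<in> {..<j} \<rightarrow>\<^sub>E {0, 1} \<times> {0, 1}"
    using assms by (auto simp: carrier_model_group)
  obtain u where g: "g = of_bool u" using t(2) by (metis insertE of_bool_eq singletonD)
  define U V where "U k \<longleftrightarrow> fst (h k) = 1" and "V k \<longleftrightarrow> snd (h k) = 1" for k
  have h: "h = (\<lambda>k\<in>{..<j}. (of_bool (U k), of_bool (V k)))"
  proof
    fix k show "h k = (\<lambda>k\<in>{..<j}. (of_bool (U k), of_bool (V k))) k"
    proof (cases "k < j")
      case True
      then have "h k \<in> {0, 1} \<times> {0, 1}" using t(3) by (simp add: PiE_iff)
      then show ?thesis using True by (auto simp: U_def V_def)
    next
      case False
      then show ?thesis using t(3) by (simp add: PiE_iff extensional_def)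
    qed
  qed
  let ?q = "\<lambda>k\<in>{..<j}. pauli_q (U k) (V k)"
  let ?G = "{gF u v |v. True}"
  let ?H = "ptf {..<j} ` (\<Pi>\<^sub>E k\<in>{..<j}. span {pauli_q (U k) (V k)})"
  have fam: "product_grading_family {..<j} (\<lambda>_. matrix_algebra) (\<lambda>_. M2_grading_dim1) h = span ?H"
  proof -
    have "(\<Pi>\<^sub>E k\<in>{..<j}. M2_grading_dim1 (h k)) = (\<Pi>\<^sub>E k\<in>{..<j}. span {pauli_q (U k) (V k)})"
      by (rule PiE_cong) (simp add: h M2_grading_dim1_eq)
    then show ?thesis by (simp add: product_grading_family_def matrix_algebra_simps)
  qed
  have H: "span ?H = span {ptf {..<j} ?q}"
  proof
    show "span ?H \<subseteq> span {ptf {..<j} ?q}"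
    proof (rule span_minimal[OF _ subspace_span], rule image_subsetI)
      fix x assume "x \<in> (\<Pi>\<^sub>E k\<in>{..<j}. span {pauli_q (U k) (V k)})"
      then have "ptf {..<j} x \<in> span (ptf {..<j} ` (\<Pi>\<^sub>E k\<in>{..<j}. {pauli_q (U k) (V k)}))"
        by (rule ptf_span[rotated]) simp
      moreover have "(\<Pi>\<^sub>E k\<in>{..<j}. {pauli_q (U k) (V k)}) = {?q}"
      proof (intro equalityI subsetI)
        fix x assume x: "x \<in> (\<Pi>\<^sub>E k\<in>{..<j}. {pauli_q (U k) (V k)})"
        have "x k = ?q k" for k using x by (cases "k < j") (auto simp: PiE_iff extensional_def)
        then show "x \<in> {?q}" by auto
      qed (auto simp: PiE_iff)
      ultimately show "ptf {..<j} x \<in> span {ptf {..<j} ?q}" by simp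
    qed
    have "?q \<in> (\<Pi>\<^sub>E k\<in>{..<j}. span {pauli_q (U k) (V k)})" by (simp add: span_base)
    then show "span {ptf {..<j} ?q} \<subseteq> span ?H" by (intro span_mono) blast
  qed
  have grad: "model_grading Fa \<Delta> j t = span {?T v w |v w. v \<in> span ?G \<and> w \<in> span {ptf {..<j} ?q}}"
    by (simp add: model_grading_def product_grading_def t(1) fam H g \<Delta>)
  have qc: "ptf {..<j} ?q \<in> carrier (M2_tensor_power j)" by (rule ptf_carrier) simp
  have eq: "{?T p q |p q. p \<in> ?G \<and> q \<in> {ptf {..<j} ?q}} = {y j S |S. S \<in> idx (Suc j) \<and> deg j S = t}"
  proof (intro equalityI subsetI)
    fix z assume "z \<in> {?T p q |p q. p \<in> ?G \<and> q \<in> {ptf {..<j} ?q}}"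
    then obtain v where z: "z = ?T (gF u v) (ptf {..<j} ?q)" by blast
    define S where "S = ({k. k < j \<and> U k} \<union> (if u then {j} else {}), {k. k < j \<and> V k} \<union> (if v then {j} else {}))"
    have "S \<in> idx (Suc j)" by (auto simp: S_def idx_def)
    moreover have "deg j S = t" by (auto simp: deg_def t(1) g h S_def fun_eq_iff)
    moreover have "qfam j S = ?q" "(j \<in> fst S) = u" "(j \<in> snd S) = v" by (auto simp: qfam_def S_def fun_eq_iff)
    then have "z = y j S" by (simp add: z y_def)
    ultimately show "z \<in> {y j S |S. S \<in> idx (Suc j) \<and> deg j S = t}" by blast
  next
    fix z assume "z \<in> {y j S |S. S \<in> idx (Suc j) \<and> deg j S = t}"
    then obtain S where S: "z = y j S" "deg j S = t" by blast
    then have d: "of_bool (j \<in> fst S) = (of_bool u :: int)"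
        "(\<lambda>k\<in>{..<j}. (of_bool (k \<in> fst S), of_bool (k \<in> snd S)))
          = (\<lambda>k\<in>{..<j}. (of_bool (U k), of_bool (V k) :: int) :: int \<times> int)"
      by (simp_all add: deg_def t(1) g h)
    have "(k \<in> fst S) = U k \<and> (k \<in> snd S) = V k" if "k < j" for k
      using fun_cong[OF d(2), of k] that by (simp add: of_bool_eq_iff)
    moreover have "(j \<in> fst S) = u" using d(1) by (simp add: of_bool_eq_iff)
    ultimately have "(j \<in> fst S) = u" "\<And>k. k < j \<Longrightarrow> (k \<in> fst S) = U k \<and> (k \<in> snd S) = V k"
      by blast+
    then have "z = ?T (gF u (j \<in> snd S)) (ptf {..<j} ?q)"
      unfolding S(1) y_def qfam_def by (simp cong: restrict_cong)
    then show "z \<in> {?T p q |p q. p \<in> ?G \<and> q \<in> {ptf {..<j} ?q}}" by blast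
  qed
  show ?thesis
    unfolding grad eq[symmetric]
  proof
    show "span {?T v w |v w. v \<in> span ?G \<and> w \<in> span {ptf {..<j} ?q}} \<subseteq> span {?T p q |p q. p \<in> ?G \<and> q \<in> {ptf {..<j} ?q}}"
    proof (rule span_minimal[OF _ subspace_span], rule subsetI)
      fix z assume "z \<in> {?T v w |v w. v \<in> span ?G \<and> w \<in> span {ptf {..<j} ?q}}"
      then obtain v w where z: "z = ?T v w" "v \<in> span ?G" "w \<in> span {ptf {..<j} ?q}" by blast
      show "z \<in> span {?T p q |p q. p \<in> ?G \<and> q \<in> {ptf {..<j} ?q}}"
        unfolding z(1)
        by (rule pure_tensor_span[OF subspace_carrier _ B.subspace_carrier _ z(2,3)]) (use cl qc in auto)
    qed
    show "span {?T p q |p q. p \<in> ?G \<and> q \<in> {ptf {..<j} ?q}} \<subseteq> span {?T v w |v w. v \<in> span ?G \<and> w \<in> span {ptf {..<j} ?q}}"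
      by (rule span_mono) (blast intro: span_base)
  qed
qed

end

text \<open>The model grading and the grading defined by its family are compared on the carrier of
  the group only, which is all that the notions of grading see.\<close>

lemma dim2_division_gradings_cong:
  assumes "\<Gamma> \<in> dim2_division_gradings G D" "\<And>t. t \<in> carrier G \<Longrightarrow> \<Gamma>' t = \<Gamma> t" "comm_group G"
  shows "\<Gamma>' \<in> dim2_division_gradings G D"
proof -
  interpret comm_group G by fact
  have 1: "(\<Union>g\<in>carrier G. \<Gamma>' g) = (\<Union>g\<in>carrier G. \<Gamma> g)" using assms(2) by simp
  have 2: "(\<Union>h\<in>carrier G - {g}. \<Gamma>' h) = (\<Union>h\<in>carrier G - {g}. \<Gamma> h)" for g using assms(2) by simp
  have 3: "is_grading G D \<Gamma>' \<longleftrightarrow> is_grading G D \<Gamma>"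
    unfolding is_grading_def 1 2 by (simp add: assms(2))
  have 4: "is_division_grading G D \<Gamma>' \<longleftrightarrow> is_division_grading G D \<Gamma>"
    unfolding is_division_grading_def 3 by (simp add: assms(2))
  have 5: "grading_support G \<Gamma>' = grading_support G \<Gamma>" "\<And>t. t \<in> grading_support G \<Gamma> \<Longrightarrow> \<Gamma>' t = \<Gamma> t"
    using assms(2) by (auto simp: grading_support_def)
  show ?thesis using assms(1) by (simp add: dim2_division_gradings_def 4 5)
qed

lemma model_factor_M2:
  "model_factor (matrix_algebra :: (real^2^2) monoid) M2_grading_dim2 1 (mat2 0 1 1 0) (mat2 0 (-1) 1 0)"
proof -
  let ?g = "gen_pair (matrix_algebra :: (real^2^2) monoid) (mat2 0 1 1 0) (mat2 0 (-1) 1 0)"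
  have g: "?g False False = mat2 1 0 0 1" "?g False True = mat2 0 (-1) 1 0" "?g True False = mat2 0 1 1 0"
      "?g True True = mat2 1 0 0 (-1)"
    by (simp_all add: gen_pair_def matrix_algebra_simps mat2_one mat2_mult)
  have set1: "{f v |v. True} = {f False, f True}" for f :: "bool \<Rightarrow> real^2^2"
    by (auto simp: ex_bool_eq)
  have neg: "span {a, - b} = span {a, b}" for a b :: "real^2^2"
    by (intro span_eq[THEN iffD2] conjI insert_subsetI)
      (auto simp: span_base span_neg dest: span_neg intro: span_neg[of "- b" "{a, - b}", simplified])
  have "M2_grading_dim2 (of_bool u) = span {?g u v |v. True}" for u
  proof (cases u)
    case True
    \<comment> \<open>The product of the two generators is the negative of the listed basis matrix;
      the span is the same.\<close>
    have "mat2 1 0 0 (-1) = - mat2 (-1) 0 0 1" by (simp add: mat2_uminus)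
    then show ?thesis unfolding set1 using True by (simp add: M2_grading_dim2_def g neg)
  next
    case False
    then show ?thesis unfolding set1 by (simp add: M2_grading_dim2_def g)
  qed
  moreover have "A \<in> span {?g u v |u v. True}" for A
  proof -
    have "A = ((A$1$1 + A$2$2) / 2) *\<^sub>R ?g False False + ((A$1$1 - A$2$2) / 2) *\<^sub>R ?g True True
      + ((A$1$2 + A$2$1) / 2) *\<^sub>R ?g True False + ((A$2$1 - A$1$2) / 2) *\<^sub>R ?g False True"
      by (rule mat2_eqI) (simp_all add: g field_simps)
    also have "\<dots> \<in> span {?g u v |u v. True}"
      by (intro span_add span_scale span_base) auto
    finally show ?thesis .
  qed
  then have "UNIV = span {?g u v |u v. True}" by auto
  moreover have "mat 1 \<noteq> (0 :: real^2^2)" by (simp add: vec_eq_iff mat_def)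
  moreover have "real_alg (matrix_algebra :: (real^2^2) monoid)"
    by (rule real_algI[OF matrix_real_algebra])
  ultimately show ?thesis
    unfolding model_factor_def model_factor_axioms_def
    by (simp add: matrix_algebra_simps mat2_mult mat2_one mat2_uminus)
qed

lemma model_factor_quat:
  "model_factor quat_algebra quat_grading_dim2 (-1) (Quat 0 0 1 0) (Quat 0 1 0 0)"
proof -
  let ?g = "gen_pair quat_algebra (Quat 0 0 1 0) (Quat 0 1 0 0)"
  have s: "carrier quat_algebra = UNIV" "A \<otimes>\<^bsub>quat_algebra\<^esub> B = A * B" "\<one>\<^bsub>quat_algebra\<^esub> = 1" for A B
    by (simp_all add: quat_algebra_def)
  have g: "?g False False = Quat 1 0 0 0" "?g False True = Quat 0 1 0 0" "?g True False = Quat 0 0 1 0"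
      "?g True True = Quat 0 0 0 (-1)"
    by (simp_all add: gen_pair_def s one_quat_def times_quat_def)
  have set1: "{f v |v. True} = {f False, f True}" for f :: "bool \<Rightarrow> quat"
    by (auto simp: ex_bool_eq)
  have neg: "span {a, - b} = span {a, b}" for a b :: quat
    by (intro span_eq[THEN iffD2] conjI insert_subsetI)
      (auto simp: span_base span_neg dest: span_neg intro: span_neg[of "- b" "{a, - b}", simplified])
  have "quat_grading_dim2 (of_bool u) = span {?g u v |v. True}" for u
  proof (cases u)
    case True
    \<comment> \<open>Since j i = -k, the product of the generators differs from the listed basis
      element by a sign.\<close>
    have "Quat 0 0 0 (-1) = - Quat 0 0 0 1" by (simp add: uminus_quat_def)
    then show ?thesis unfolding set1 using True by (simp add: quat_grading_dim2_def g neg)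
  next
    case False
    then show ?thesis unfolding set1 by (simp add: quat_grading_dim2_def g)
  qed
  moreover have "A \<in> span {?g u v |u v. True}" for A
  proof -
    have "A = qRe A *\<^sub>R ?g False False + qI A *\<^sub>R ?g False True + qJ A *\<^sub>R ?g True False + (- qK A) *\<^sub>R ?g True True"
      by (cases A) (simp add: g scaleR_quat_def plus_quat_def)
    also have "\<dots> \<in> span {?g u v |u v. True}"
      by (intro span_add span_scale span_base) auto
    finally show ?thesis .
  qed
  then have "UNIV = span {?g u v |u v. True}" by auto
  moreover have "Quat 0 0 1 0 * Quat 0 0 1 0 = - 1" "Quat 0 1 0 0 * Quat 0 1 0 0 = - 1"
      "Quat 0 1 0 0 * Quat 0 0 1 0 = - (Quat 0 0 1 0 * Quat 0 1 0 0)"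
    by (simp_all add: times_quat_def one_quat_def uminus_quat_def)
  ultimately show ?thesis
    unfolding model_factor_def model_factor_axioms_def
    using real_algI[OF quat_real_algebra] by (simp add: s)
qed

section \<open>The classification\<close>

text \<open>Positive and negative nice maps in one notion, so that the real and the quaternionic
  case share a single classification with a sign \<open>s\<close>.\<close>

definition signed_nice_map :: "int \<Rightarrow> ('g, 'e) monoid_scheme \<Rightarrow> 'g set \<Rightarrow> ('g \<Rightarrow> int) \<Rightarrow> bool" where
  "signed_nice_map s T K \<nu> \<longleftrightarrow> nice_map_type_I T K \<nu> \<and>
     (\<forall>g\<in>carrier T - K. \<nu> g * Arf (T\<lparr>carrier := K\<rparr>) (nice_mu T \<nu> g) = s)"

definition signed_triples ::
  "int \<Rightarrow> ('g, 'e) monoid_scheme \<Rightarrow> nat \<Rightarrow> ('g set \<times> 'g set \<times> ('g \<Rightarrow> int)) set" where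
  "signed_triples s G k = {(T, K, \<nu>).
     subgroup T G \<and> G\<lparr>carrier := T\<rparr> \<cong> Z2_power k \<and>
     index_2_subgroup K (G\<lparr>carrier := T\<rparr>) \<and> signed_nice_map s (G\<lparr>carrier := T\<rparr>) K \<nu>}"

lemma signed_triples_eq:
  "positive_triples G k = signed_triples 1 G k" "negative_triples G k = signed_triples (-1) G k"
  by (simp_all add: positive_triples_def negative_triples_def signed_triples_def signed_nice_map_def
      positive_nice_map_def negative_nice_map_def)

text \<open>
  Since \<open>\<nu> (g k) = \<nu> g * \<mu>\<^sub>g k\<close>, a constant value \<open>- s\<close> of \<open>\<nu>\<close> would make \<open>\<mu>\<^sub>g\<close> constant \<open>1\<close>
  although its Arf invariant is \<open>- 1\<close>.  So \<open>\<nu> g = s\<close> for some \<open>g\<close>, and then \<open>\<mu>\<^sub>g\<close> is hyperbolic.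
\<close>

lemma nice_map_normal_form:
  assumes E: "elem2 E" and nice: "signed_nice_map s E H \<nu>" and s: "s = 1 \<or> s = -1"
  shows "\<exists>g r a b. g \<in> carrier E - H \<and> \<nu> g = s \<and> card H = 4 ^ r \<and>
    symplectic_basis (E\<lparr>carrier := H\<rparr>) (nice_mu E \<nu> g) r a b \<and>
    (\<forall>i<r. nice_mu E \<nu> g (a i) = 1 \<and> nice_mu E \<nu> g (b i) = 1)"
proof -
  interpret E: elem2 E by fact
  have n: "index_2_subgroup H E" "finite (carrier E)" "\<nu> \<in> (carrier E - H) \<rightarrow>\<^sub>E {1, -1}"
    and tI: "\<And>g. g \<in> carrier E - H \<Longrightarrow> quadratic_form_type_I (E\<lparr>carrier := H\<rparr>) (nice_mu E \<nu> g)"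
    and arf: "\<And>g. g \<in> carrier E - H \<Longrightarrow> \<nu> g * Arf (E\<lparr>carrier := H\<rparr>) (nice_mu E \<nu> g) = s"
    using nice by (auto simp: signed_nice_map_def nice_map_type_I_def nice_map_def)
  have H: "subgroup H E" by (rule E.index_2_subgroupD(1)[OF n(1)])
  have finH: "finite H" using n(2) subgroup.subset[OF H] by (rule finite_subset[rotated])
  have \<nu>: "\<nu> g = 1 \<or> \<nu> g = -1" if "g \<in> carrier E - H" for g using n(3) that by (auto simp: PiE_iff)
  \<comment> \<open>Since \<open>\<nu> g\<close> is a sign, the Arf invariant is
    \<open>s * \<nu> g\<close>. The Gauss sum is therefore positive exactly if
    \<open>\<nu> g = s\<close>, and then a basis with all values \<open>1\<close> is
    available.\<close>
  have basis: "\<exists>r a b. symplectic_basis (E\<lparr>carrier := H\<rparr>) (nice_mu E \<nu> g) r a b \<and> card H = 4 ^ r \<and>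
      (\<Sum>u\<in>H. nice_mu E \<nu> g u) = 2 ^ r * (s * \<nu> g) \<and>
      (0 < s * \<nu> g \<longrightarrow> (\<forall>i<r. nice_mu E \<nu> g (a i) = 1 \<and> nice_mu E \<nu> g (b i) = 1))"
    if g: "g \<in> carrier E - H" for g
  proof -
    have q: "quadratic_form (E\<lparr>carrier := H\<rparr>) (nice_mu E \<nu> g)"
      using tI[OF g] by (simp add: quadratic_form_type_I_def)
    interpret Q: quad_form "E\<lparr>carrier := H\<rparr>" "nice_mu E \<nu> g" by (rule quad_formI[OF q])
    obtain r a b where sb: "symplectic_basis (E\<lparr>carrier := H\<rparr>) (nice_mu E \<nu> g) r a b"
        "0 < (\<Sum>u\<in>H. nice_mu E \<nu> g u) \<longrightarrow> (\<forall>i<r. nice_mu E \<nu> g (a i) = 1 \<and> nice_mu E \<nu> g (b i) = 1)"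
      using symplectic_basis_exists[OF tI[OF g]] finH by auto
    have "Arf (E\<lparr>carrier := H\<rparr>) (nice_mu E \<nu> g) = s * \<nu> g"
      using arf[OF g] \<nu>[OF g] by auto
    then have "(\<Sum>u\<in>H. nice_mu E \<nu> g u) = 2 ^ r * (s * \<nu> g)"
      using Q.sum_mu_symplectic(1)[OF sb(1)] Arf_symplectic[OF q sb(1)] by simp
    moreover have "card H = 4 ^ r" using Q.sum_mu_symplectic(2)[OF sb(1)] by simp
    ultimately show ?thesis using sb by (intro exI[of _ r] exI[of _ a] exI[of _ b]) (auto simp: zero_less_mult_iff)
  qed
  obtain g1 where g1: "g1 \<in> carrier E - H" using E.index_2_subgroupD(2)[OF n(1)] by blast
  have "\<exists>g\<in>carrier E - H. \<nu> g = s"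
  proof (rule ccontr)
    assume "\<not> ?thesis"
    then have neg: "\<nu> g = - s" if "g \<in> carrier E - H" for g using \<nu>[OF that] s that by auto
    have "nice_mu E \<nu> g1 u = 1" if "u \<in> H" for u
      using neg[OF g1] neg[OF E.mult_not_in(2)[OF H that g1]] s by (auto simp: nice_mu_def)
    then have "(\<Sum>u\<in>H. nice_mu E \<nu> g1 u) = int (card H)" by simp
    moreover have "s * \<nu> g1 = -1" using neg[OF g1] s by auto
    ultimately obtain k where "int (card H) = 2 ^ k * (- 1)" using basis[OF g1] by auto
    then have "int (card H) + 2 ^ k = 0" by simp
    moreover have "(0::int) < 2 ^ k" by simp
    ultimately show False by linarith
  qed
  then obtain g where g: "g \<in> carrier E - H" "\<nu> g = s" by blast
  then have "s * \<nu> g = 1" using s by auto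
  then show ?thesis using basis[OF g(1)] g by auto
qed

lemma pauli_family_cong:
  assumes "pauli_family D M \<sigma> \<rho> y" "\<And>k. k < M \<Longrightarrow> \<sigma> k = \<sigma>' k" "\<And>k. k < M \<Longrightarrow> \<rho> k = \<rho>' k"
  shows "pauli_family D M \<sigma>' \<rho>' y"
proof -
  have "idx_sign M \<sigma> \<rho> S S' = idx_sign M \<sigma>' \<rho>' S S'" for S S'
    unfolding idx_sign_def using assms(2,3) by (intro prod.cong) auto
  then show ?thesis using assms unfolding pauli_family_def by simp
qed

text \<open>The dimension is \<open>4 ^ M\<close>, so the algebra determines the number of
  pairs.\<close>

lemma pauli_rank_unique:
  assumes "pauli_family D M \<sigma> \<rho> y" "carrier D = span (y ` idx M)"
    and "finite C" "independent C" "carrier D = span C"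
  shows "card C = 4 ^ M"
proof -
  interpret P: pauli D M \<sigma> \<rho> y by (rule pauliI) fact
  have "card C \<le> card (y ` idx M)"
    using independent_span_bound[OF _ assms(4)] span_superset assms(2,5) by (metis finite_idx finite_imageI)
  moreover have "card (y ` idx M) \<le> card C"
    using independent_span_bound[OF assms(3) P.independent_idx] span_superset assms(2,5) by metis
  ultimately show ?thesis using P.card_y by simp
qed

section \<open>Rank, sign and normal form of a grading\<close>

context dim2_grading
begin

lemma finite_K: "finite K"
  by (rule finite_subset[OF _ finite_T]) (use K_T in blast)

lemma mu_basis:
  assumes "g \<in> T - K"
  shows "\<exists>r a b. symplectic_basis (G\<lparr>carrier := K\<rparr>) (mu g) r a b"
  using symplectic_basis_exists[OF type_I_mu[OF assms]] finite_K by auto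

lemma card_T:
  assumes "g \<in> T - K" "symplectic_basis (G\<lparr>carrier := K\<rparr>) (mu g) r a b"
  shows "card T = 2 ^ (2 * r + 1)"
proof -
  interpret TT: elem2 "G\<lparr>carrier := T\<rparr>" by (rule elem2_T)
  interpret Q: quad_form "G\<lparr>carrier := K\<rparr>" "mu g" by (rule quad_formI[OF quadratic_form_mu[OF assms(1)]])
  have "card K = 4 ^ r" using Q.sum_mu_symplectic(2)[OF assms(2)] by simp
  moreover have "card T = 2 * card K" using TT.index_2_card[OF index_2_K] finite_T by simp
  ultimately show ?thesis by (simp add: power_mult)
qed

lemma T_iso:
  assumes "g \<in> T - K" "symplectic_basis (G\<lparr>carrier := K\<rparr>) (mu g) r a b"
  shows "G\<lparr>carrier := T\<rparr> \<cong> Z2_power (2 * r + 1)"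
  by (rule elem2_iso_Z2_power[OF elem2_T]) (use card_T[OF assms] finite_T in auto)

lemma rank_exists:
  "\<exists>r \<sigma> \<rho> y. pauli_family D (Suc r) \<sigma> \<rho> y \<and> carrier D = span (y ` idx (Suc r)) \<and>
     G\<lparr>carrier := T\<rparr> \<cong> Z2_power (2 * r + 1)"
proof -
  obtain g where g: "g \<in> T - K" using exists_not_K by blast
  obtain r a b where sb: "symplectic_basis (G\<lparr>carrier := K\<rparr>) (mu g) r a b" using mu_basis[OF g] by blast
  show ?thesis using homogeneous_family(2)[OF g sb] T_iso[OF g sb] by blast
qed

text \<open>The standard family and the homogeneous family for \<open>g\<close> span the same
  algebra. Equal dimensions give \<open>r' = r\<close>, and equal signatures give
  \<open>2 ^ r * Arf * (2 * nu g) = 2 ^ Suc r * s\<close>.\<close>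

lemma signed_triple:
  assumes std: "std_family D (real_of_int s) r y0"
  shows "(T, K, nu) \<in> signed_triples s G (2 * r + 1)"
proof -
  have y0: "pauli_family D (Suc r) ((\<lambda>_. 1)(r := real_of_int s)) ((\<lambda>_. 1)(r := -1)) y0"
      "carrier D = span (y0 ` idx (Suc r))"
    using std by (simp_all add: std_family_def)
  interpret Y0: pauli D "Suc r" "(\<lambda>_. 1)(r := real_of_int s)" "(\<lambda>_. 1)(r := -1)" y0 by (rule pauliI[OF y0(1)])
  have main: "nu g * Arf (G\<lparr>carrier := K\<rparr>) (mu g) = s \<and> G\<lparr>carrier := T\<rparr> \<cong> Z2_power (2 * r + 1)"
    if g: "g \<in> T - K" for g
  proof -
    interpret Q: quad_form "G\<lparr>carrier := K\<rparr>" "mu g" by (rule quad_formI[OF quadratic_form_mu[OF g]])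
    obtain r' a b where sb': "symplectic_basis (G\<lparr>carrier := K\<rparr>) (mu g) r' a b" using mu_basis[OF g] by blast
    obtain y' where y': "pauli_family D (Suc r') ((\<lambda>k. real_of_int (mu g (a k)))(r' := real_of_int (nu g)))
        ((\<lambda>k. real_of_int (mu g (b k)))(r' := -1)) y'" "carrier D = span (y' ` idx (Suc r'))"
      using homogeneous_family(2)[OF g sb'] by blast
    have "card (y0 ` idx (Suc r)) = 4 ^ Suc r'"
      by (rule pauli_rank_unique[OF y' _ Y0.independent_idx y0(2)]) simp
    then have "(4::nat) ^ Suc r = 4 ^ Suc r'" using Y0.card_y by simp
    then have r': "r' = r" by simp
    note y = y'[unfolded r'] and sb = sb'[unfolded r']
    let ?\<sigma> = "(\<lambda>k. real_of_int (mu g (a k)))(r := real_of_int (nu g))"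
    let ?\<rho> = "(\<lambda>k. real_of_int (mu g (b k)))(r := -1)"
    have ab: "a i \<in> K" "b i \<in> K" if "i < r" for i
      using sb that by (auto simp: symplectic_basis_def)
    note pauli_sign_unique[OF y0 y]
    also have "(\<Prod>k<Suc r. 1 + ?\<sigma> k + ?\<rho> k - ?\<sigma> k * ?\<rho> k)
        = (\<Prod>k<r. 1 + ?\<sigma> k + ?\<rho> k - ?\<sigma> k * ?\<rho> k) * (2 * real_of_int (nu g))" by simp
    also have "(\<Prod>k<r. 1 + ?\<sigma> k + ?\<rho> k - ?\<sigma> k * ?\<rho> k)
        = (\<Prod>k<r. 2 * real_of_int (arf_q (mu g (a k)) (mu g (b k))))"
    proof (rule prod.cong[OF refl])
      fix k assume "k \<in> {..<r}"
      then show "1 + ?\<sigma> k + ?\<rho> k - ?\<sigma> k * ?\<rho> k = 2 * real_of_int (arf_q (mu g (a k)) (mu g (b k)))"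
        using mu_cases[OF g ab(1), of k] mu_cases[OF g ab(2), of k] by (auto simp: arf_q_def)
    qed
    also have "\<dots> = 2 ^ r * real_of_int (Arf (G\<lparr>carrier := K\<rparr>) (mu g))"
      by (simp add: Arf_symplectic[OF quadratic_form_mu[OF g] sb] prod.distrib)
    finally have "2 ^ r * real_of_int (Arf (G\<lparr>carrier := K\<rparr>) (mu g)) * (2 * real_of_int (nu g))
        = 2 ^ Suc r * real_of_int s"
      unfolding std_sign_prod by (rule sym)
    then have "real_of_int (nu g * Arf (G\<lparr>carrier := K\<rparr>) (mu g)) = real_of_int s" by (simp add: mult.commute)
    then have "nu g * Arf (G\<lparr>carrier := K\<rparr>) (mu g) = s" by (simp only: of_int_eq_iff)
    then show ?thesis using T_iso[OF g sb] by blast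
  qed
  then show ?thesis
    using exists_not_K subgroup_T index_2_K nice_map_nu
    by (auto simp: signed_triples_def signed_nice_map_def mu_def)
qed

text \<open>With all values of \<open>mu g\<close> on the basis equal to \<open>1\<close> and
  \<open>nu g = s\<close>, the signs of the homogeneous family are the standard ones; all
  information on the grading is then in the degree map.\<close>

lemma normal_form:
  assumes g: "g \<in> T - K" "nu g = s" and sb: "symplectic_basis (G\<lparr>carrier := K\<rparr>) (mu g) r a b"
    and ab: "\<forall>i<r. mu g (a i) = 1 \<and> mu g (b i) = 1"
  shows "\<exists>y. std_family D (real_of_int s) r y \<and>
    (\<forall>t\<in>carrier G. \<Gamma> t = span {y S |S. S \<in> idx (Suc r) \<and> deg_map G a b g r S = t})"
proof -
  obtain y where y: "pauli_family D (Suc r) ((\<lambda>k. real_of_int (mu g (a k)))(r := real_of_int (nu g)))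
        ((\<lambda>k. real_of_int (mu g (b k)))(r := -1)) y"
      "carrier D = span (y ` idx (Suc r))"
      "\<forall>t\<in>carrier G. \<Gamma> t = span {y S |S. S \<in> idx (Suc r) \<and> deg_map G a b g r S = t}"
    using homogeneous_family(2)[OF g(1) sb] by blast
  have "pauli_family D (Suc r) ((\<lambda>_. 1)(r := real_of_int s)) ((\<lambda>_. 1)(r := -1)) y"
    by (rule pauli_family_cong[OF y(1)]) (use ab g(2) in auto)
  then show ?thesis using y(2,3) unfolding std_family_def by blast
qed

text \<open>A single nonzero element of a component fixes the sign in its degree, and extensionality
  fixes the values elsewhere.\<close>

lemma triple_unique:
  assumes "triple_of_grading G D \<Gamma> (T', K', \<nu>)" "\<nu> \<in> (T' - K') \<rightarrow>\<^sub>E {1, -1}"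
  shows "(T', K', \<nu>) = (T, K, nu)"
proof -
  have TK: "T' = T" "K' = K" using assms(1) by (auto simp: triple_of_grading_def T_def K_def)
  have "\<nu> t = nu t" for t
  proof (cases "t \<in> T - K")
    case True
    then obtain x where x: "x \<in> \<Gamma> t" "x \<noteq> 0" using T_nonzero by blast
    have "\<forall>t\<in>T' - K'. \<forall>x\<in>\<Gamma> t. x \<noteq> 0 \<longrightarrow> (\<exists>p>0. x \<otimes> x = (p * real_of_int (\<nu> t)) *\<^sub>R \<one>)"
      using assms(1) by (simp add: triple_of_grading_def)
    then obtain p where p: "p > 0" "x \<otimes> x = (p * real_of_int (\<nu> t)) *\<^sub>R \<one>"
      using True x unfolding TK by blast
    have "\<nu> t = 1 \<or> \<nu> t = -1" using assms(2) True by (auto simp: PiE_iff TK)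
    moreover have "real_of_int (nu t) = sgn (p * real_of_int (\<nu> t))" by (rule nu_eq_sgn[OF True x p(2)])
    ultimately have "real_of_int (nu t) = real_of_int (\<nu> t)" using p(1) by (auto simp: sgn_mult)
    then show ?thesis by simp
  next
    case False
    then show ?thesis using PiE_arb[OF assms(2)] by (auto simp: TK nu_def)
  qed
  then show ?thesis using TK by auto
qed

lemma nu_PiE: "nu \<in> (T - K) \<rightarrow>\<^sub>E {1, -1}"
  using nice_map_nu by (simp add: nice_map_type_I_def nice_map_def)

end

lemma span_family_image:
  fixes y :: "'s \<Rightarrow> _"
  assumes "linear f" "\<And>S. S \<in> I \<Longrightarrow> f (y S) = y' S"
  shows "f ` span {y S |S. S \<in> I \<and> P S} = span {y' S |S. S \<in> I \<and> P S}"
proof -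
  have eq: "{h S |S. S \<in> I \<and> P S} = h ` {S \<in> I. P S}" for h :: "'s \<Rightarrow> 'z" by blast
  show ?thesis
    unfolding eq linear_span_image[OF assms(1), symmetric] image_image
    by (rule arg_cong[where f = span], rule image_cong) (simp_all add: assms(2))
qed

text \<open>The element \<open>g\<close> and the basis are chosen from the triple alone and serve
  both gradings. The two standard families then carry the same degree map, and the isomorphism that
  matches them preserves degrees.\<close>

lemma same_triple_isomorphic:
  assumes "dim2_grading D G \<Gamma>" "dim2_grading D G \<Gamma>'"
    and eq: "dim2_grading.T G \<Gamma>' = dim2_grading.T G \<Gamma>" "dim2_grading.K D G \<Gamma>' = dim2_grading.K D G \<Gamma>"
      "dim2_grading.nu D G \<Gamma>' = dim2_grading.nu D G \<Gamma>"
    and std: "std_family D (real_of_int s) r y0" and s: "s = 1 \<or> s = -1"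
  shows "isomorphic_gradings G D \<Gamma> D \<Gamma>'"
proof -
  interpret A: dim2_grading D G \<Gamma> by fact
  interpret B: dim2_grading D G \<Gamma>' by fact
  have mu: "B.mu = A.mu" unfolding A.mu_def B.mu_def fun_eq_iff eq by simp
  have "signed_nice_map s (G\<lparr>carrier := A.T\<rparr>) A.K A.nu"
    using A.signed_triple[OF std] by (simp add: signed_triples_def)
  from nice_map_normal_form[OF A.elem2_T this s] obtain g r' a b where
    g: "g \<in> A.T - A.K" "A.nu g = s" and sb: "symplectic_basis (G\<lparr>carrier := A.K\<rparr>) (A.mu g) r' a b"
    and ab: "\<forall>i<r'. A.mu g (a i) = 1 \<and> A.mu g (b i) = 1"
    by (auto simp: A.mu_def)
  obtain y where y: "std_family D (real_of_int s) r' y"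
      "\<forall>t\<in>carrier G. \<Gamma> t = span {y S |S. S \<in> idx (Suc r') \<and> deg_map G a b g r' S = t}"
    using A.normal_form[OF g sb ab] by blast
  obtain y' where y': "std_family D (real_of_int s) r' y'"
      "\<forall>t\<in>carrier G. \<Gamma>' t = span {y' S |S. S \<in> idx (Suc r') \<and> deg_map G a b g r' S = t}"
    using B.normal_form[of g s r' a b] g sb ab by (auto simp: eq mu)
  obtain f where f: "linear f" "f \<in> alg_isos D D" "\<And>S. S \<in> idx (Suc r') \<Longrightarrow> f (y S) = y' S"
    using std_family_iso[OF y(1) y'(1)] by blast
  have "f ` \<Gamma> t = \<Gamma>' t" if "t \<in> carrier G" for t
    unfolding bspec[OF y(2) that] bspec[OF y'(2) that] by (rule span_family_image[OF f(1,3)])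
  then show ?thesis using f(2) unfolding isomorphic_gradings_def by blast
qed

text \<open>Transport along the isomorphism shows that the triple of the first grading is also read
  off from the second one; uniqueness does the rest.\<close>

lemma isomorphic_same_triple:
  assumes "dim2_grading D G \<Gamma>" "dim2_grading D G \<Gamma>'" and iso: "isomorphic_gradings G D \<Gamma> D \<Gamma>'"
  shows "(dim2_grading.T G \<Gamma>, dim2_grading.K D G \<Gamma>, dim2_grading.nu D G \<Gamma>)
    = (dim2_grading.T G \<Gamma>', dim2_grading.K D G \<Gamma>', dim2_grading.nu D G \<Gamma>')"
proof -
  interpret A: dim2_grading D G \<Gamma> by fact
  interpret B: dim2_grading D G \<Gamma>' by fact
  obtain \<phi> where \<phi>: "\<phi> \<in> alg_isos D D" "\<And>t. t \<in> carrier G \<Longrightarrow> \<phi> ` \<Gamma> t = \<Gamma>' t"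
    using iso by (auto simp: isomorphic_gradings_def)
  note p = alg_isosD[OF \<phi>(1)]
  have inj: "inj_on \<phi> (carrier D)" using p(1) by (simp add: bij_betw_def)
  have \<phi>0: "\<phi> 0 = 0" by (rule alg_isos_0[OF A.real_algebra \<phi>(1)])
  have \<phi>1: "\<phi> \<one>\<^bsub>D\<^esub> = \<one>\<^bsub>D\<^esub>" by (rule alg_isos_one[OF A.real_algebra A.real_algebra \<phi>(1)])
  have img: "\<phi> x \<in> \<Gamma>' t" if "x \<in> \<Gamma> t" "t \<in> carrier G" for x t using \<phi>(2) that by blast
  have nz: "\<phi> x \<noteq> 0" if "x \<in> carrier D" "x \<noteq> 0" for x
    using inj_onD[OF inj _ that(1) A.carrier_intros(1)] \<phi>0 that(2) by auto
  have T: "A.T = B.T"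
  proof -
    have "\<Gamma> t \<noteq> {0} \<longleftrightarrow> \<Gamma>' t \<noteq> {0}" if t: "t \<in> carrier G" for t
    proof
      assume "\<Gamma>' t \<noteq> {0}"
      then show "\<Gamma> t \<noteq> {0}" using \<phi>(2)[OF t] \<phi>0 by auto
    next
      assume "\<Gamma> t \<noteq> {0}"
      then have "t \<in> A.T" using t by (simp add: A.T_def grading_support_def)
      then obtain x where "x \<in> \<Gamma> t" "x \<noteq> 0" by (rule A.T_nonzero)
      then have "\<phi> x \<in> \<Gamma>' t" "\<phi> x \<noteq> 0" using img nz A.comp_carrier t by blast+
      then show "\<Gamma>' t \<noteq> {0}" by blast
    qed
    then show ?thesis unfolding A.T_def B.T_def grading_support_def by (simp cong: conj_cong)
  qed
  have comm: "\<phi> x \<otimes>\<^bsub>D\<^esub> \<phi> z = \<phi> z \<otimes>\<^bsub>D\<^esub> \<phi> x \<longleftrightarrow> x \<otimes>\<^bsub>D\<^esub> z = z \<otimes>\<^bsub>D\<^esub> x" if "x \<in> carrier D" "z \<in> carrier D" for x z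
    unfolding p(3)[OF that, symmetric] p(3)[OF that(2,1), symmetric]
    by (rule inj_on_eq_iff[OF inj A.m_closed[OF that] A.m_closed[OF that(2,1)]])
  have K: "A.K = B.K"
  proof -
    have "(\<forall>x\<in>\<Gamma>' t. \<forall>z\<in>\<Gamma>' \<one>\<^bsub>G\<^esub>. x \<otimes>\<^bsub>D\<^esub> z = z \<otimes>\<^bsub>D\<^esub> x) \<longleftrightarrow> (\<forall>x\<in>\<Gamma> t. \<forall>z\<in>\<Gamma> \<one>\<^bsub>G\<^esub>. x \<otimes>\<^bsub>D\<^esub> z = z \<otimes>\<^bsub>D\<^esub> x)"
      if t: "t \<in> carrier G" for t
    proof -
      have "(\<phi> x \<otimes>\<^bsub>D\<^esub> \<phi> z = \<phi> z \<otimes>\<^bsub>D\<^esub> \<phi> x) = (x \<otimes>\<^bsub>D\<^esub> z = z \<otimes>\<^bsub>D\<^esub> x)" if "x \<in> \<Gamma> t" "z \<in> \<Gamma> \<one>\<^bsub>G\<^esub>" for x z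
        using that by (intro comm A.comp_carrier[OF t] A.comp_carrier[OF A.G.one_closed])
      then show ?thesis
        unfolding \<phi>(2)[OF t, symmetric] \<phi>(2)[OF A.G.one_closed, symmetric] ball_simps by (simp cong: ball_cong)
    qed
    then show ?thesis unfolding A.K_def B.K_def T by (intro Collect_cong conj_cong refl) (simp add: B.T_carrier)
  qed
  have "triple_of_grading G D \<Gamma>' (A.T, A.K, A.nu)"
    unfolding triple_of_grading_def
  proof (clarsimp, intro conjI ballI impI)
    show "A.T = grading_support G \<Gamma>'" using T by (simp add: B.T_def)
    show "A.K = {t \<in> A.T. \<forall>x\<in>\<Gamma>' t. \<forall>y\<in>\<Gamma>' \<one>\<^bsub>G\<^esub>. x \<otimes>\<^bsub>D\<^esub> y = y \<otimes>\<^bsub>D\<^esub> x}" using K T by (simp add: B.K_def)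
    fix t x assume t: "t \<in> A.T - A.K" and x: "x \<in> \<Gamma>' t" "x \<noteq> 0"
    have tG: "t \<in> carrier G" using t A.T_carrier by blast
    obtain w where w: "w \<in> \<Gamma> t" "x = \<phi> w" using \<phi>(2)[OF tG] x(1) by blast
    have wc: "w \<in> carrier D" using A.comp_carrier tG w by blast
    have "w \<noteq> 0" using x(2) w(2) \<phi>0 by auto
    then obtain q where q: "q > 0" "w \<otimes>\<^bsub>D\<^esub> w = (q * real_of_int (A.nu t)) *\<^sub>R \<one>\<^bsub>D\<^esub>"
      using A.nu_square[OF t w(1)] by blast
    have "x \<otimes>\<^bsub>D\<^esub> x = (q * real_of_int (A.nu t)) *\<^sub>R \<one>\<^bsub>D\<^esub>"
      using p(3)[OF wc wc] p(5)[OF A.one_closed, of "q * real_of_int (A.nu t)"] q(2) \<phi>1 w(2) by simp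
    then show "\<exists>q>0. x \<otimes>\<^bsub>D\<^esub> x = (q * real_of_int (A.nu t)) *\<^sub>R \<one>\<^bsub>D\<^esub>" using q(1) by blast
  qed
  then show ?thesis by (rule B.triple_unique[OF _ A.nu_PiE])
qed

text \<open>The standard family of the algebra is kept and only its degrees are chosen:
  \<open>g\<close> and the neutral element for the last pair, a symplectic basis with all values
  \<open>1\<close> for the others.\<close>

lemma grading_of_triple:
  assumes G: "comm_group G" and std: "std_family D (real_of_int s) r y" and s: "s = 1 \<or> s = -1"
    and triple: "(T, K, \<nu>) \<in> signed_triples s G (2 * r + 1)"
  shows "\<exists>\<Gamma>\<in>dim2_division_gradings G D. triple_of_grading G D \<Gamma> (T, K, \<nu>)"
proof -
  let ?E = "G\<lparr>carrier := T\<rparr>"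
  have t: "subgroup T G" "?E \<cong> Z2_power (2 * r + 1)" "index_2_subgroup K ?E" and nice: "signed_nice_map s ?E K \<nu>"
    using triple by (auto simp: signed_triples_def)
  interpret G: comm_group G by fact
  have E: "elem2 ?E" and cardT: "card T = 2 ^ (2 * r + 1)" "finite T"
    using iso_Z2_powerD[OF subgroup_comm_group[OF G t(1)] t(2)] by simp_all
  interpret E: elem2 ?E by (rule E)
  obtain g r' a b where g: "g \<in> T - K" "\<nu> g = s" and card: "card K = 4 ^ r'"
    and sb': "symplectic_basis (G\<lparr>carrier := K\<rparr>) (nice_mu ?E \<nu> g) r' a b"
    and ab': "\<forall>i<r'. nice_mu ?E \<nu> g (a i) = 1 \<and> nice_mu ?E \<nu> g (b i) = 1"
    using nice_map_normal_form[OF E nice s] by auto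
  have "card T = 2 * card K" using E.index_2_card[OF t(3)] cardT(2) by simp
  then have "(4::nat) ^ r = 4 ^ r'" using cardT(1) card by (simp add: power_mult)
  then have r': "r' = r" by simp
  note sb = sb'[unfolded r'] and ab = ab'[unfolded r']
  let ?\<mu> = "nice_mu ?E \<nu> g"
  have q: "quadratic_form (G\<lparr>carrier := K\<rparr>) ?\<mu>"
    using nice g(1) by (auto simp: signed_nice_map_def nice_map_type_I_def nice_map_def)
  interpret Q: quad_form "G\<lparr>carrier := K\<rparr>" ?\<mu> by (rule quad_formI[OF q])
  have dm: "degree_map ?E K r a b g"
    by (rule degree_map_symplectic[OF E t(3), where \<mu> = ?\<mu>]) (use g q sb in auto)
  interpret DM: degree_map ?E K r a b g by (rule dm)
  let ?d = "deg_map G a b g r"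
  let ?\<sigma> = "(\<lambda>_. 1)(r := real_of_int s)" and ?\<rho> = "(\<lambda>_. 1)(r := -1) :: nat \<Rightarrow> real"
  have y: "pauli_family D (Suc r) ?\<sigma> ?\<rho> y" "carrier D = span (y ` idx (Suc r))"
    using std by (simp_all add: std_family_def)
  interpret F: family_grading D r ?\<sigma> ?\<rho> y G ?d
  proof -
    have "?d S \<in> carrier G" for S using DM.d_closed[of S] subgroup.mem_carrier[OF t(1)] by simp
    then show "family_grading D r ?\<sigma> ?\<rho> y G ?d"
      unfolding family_grading_def family_grading_axioms_def
      using pauliI[OF y(1)] G y(2) DM.d_add DM.d_inj by simp
  qed
  have dT: "?d ` idx (Suc r) = T" using DM.d_surj by simp
  \<comment> \<open>Both sides equal \<open>s\<close> times one sign for each position below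
    \<open>r\<close> where both generators occur: on the left from reordering, on the right from the
    quadratic form.\<close>
  have square: "idx_sign (Suc r) ?\<sigma> ?\<rho> S S = real_of_int (\<nu> (?d S))"
    if S: "S \<in> idx (Suc r)" "r \<in> fst S" for S
  proof -
    let ?R = "idx_restrict r S"
    have R: "?R \<in> idx r" by (rule idx_restrict_in[OF S(1)])
    have orth: "Q.orth_pairs K r a b" using sb unfolding Q.symplectic_basis_iff by simp
    have abK: "a i \<in> K" "b i \<in> K" if "i < r" for i using orth that by (auto simp: Q.orth_pairs_def)
    let ?u = "monomial G a b r ?R"
    have u: "?u \<in> K" using DM.mono_H[OF R] by simp
    have "?u = Q.idx_prod a b ?R"
      using Q.monomial_idx_prod[of r a b ?R] abK R by simp
    then have "?\<mu> ?u = (\<Prod>k<r. (if k \<in> fst ?R then ?\<mu> (a k) else 1)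
        * (if k \<in> snd ?R then ?\<mu> (b k) else 1) * (if k \<in> fst ?R \<and> k \<in> snd ?R then -1 else 1))"
      using Q.mu_idx_prod[of r a b r ?R] orth R by simp
    also have "\<dots> = (\<Prod>k<r. if k \<in> fst S \<and> k \<in> snd S then -1 else 1)"
      using ab by (intro prod.cong) (auto simp: idx_restrict_def)
    finally have \<mu>u: "?\<mu> ?u = (\<Prod>k<r. if k \<in> fst S \<and> k \<in> snd S then -1 else 1)" .
    have gu: "?u \<otimes>\<^bsub>G\<^esub> g = g \<otimes>\<^bsub>G\<^esub> ?u"
      using u g subgroup.mem_carrier[OF t(1)] DM.H subgroup.mem_carrier[OF DM.H] by (intro G.m_comm) auto
    have "?d S = ?u \<otimes>\<^bsub>G\<^esub> g" using DM.d_eq[of S] S(2) by simp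
    then have "\<nu> (?d S) = ?\<mu> ?u * s"
      using g(2) s gu by (auto simp: nice_mu_def)
    moreover have "idx_sign (Suc r) ?\<sigma> ?\<rho> S S = (\<Prod>k<r. if k \<in> fst S \<and> k \<in> snd S then -1 else 1) * real_of_int s"
    proof -
      have "(\<Prod>k<r. pair_sign (?\<sigma> k) (?\<rho> k) (k \<in> fst S) (k \<in> snd S) (k \<in> fst S) (k \<in> snd S))
          = (\<Prod>k<r. if k \<in> fst S \<and> k \<in> snd S then -1 else 1)"
        by (rule prod.cong) (auto simp: pair_sign_def)
      \<comment> \<open>If the second generator of the last pair occurs, the reordering sign and its
        square \<open>-1\<close> cancel, so the value is \<open>s\<close> either way.\<close>
      moreover have "pair_sign (?\<sigma> r) (?\<rho> r) (r \<in> fst S) (r \<in> snd S) (r \<in> fst S) (r \<in> snd S) = real_of_int s"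
        using S(2) by (simp add: pair_sign_def)
      ultimately show ?thesis unfolding idx_sign_def prod.lessThan_Suc by (simp only:)
    qed
    moreover have "real_of_int (\<Prod>k<r. if k \<in> fst S \<and> k \<in> snd S then -1 else 1)
        = (\<Prod>k<r. if k \<in> fst S \<and> k \<in> snd S then -1 else 1)"
      by (simp add: of_int_prod if_distrib[of real_of_int] cong: if_cong)
    ultimately show ?thesis using \<mu>u by simp
  qed
  have "triple_of_grading G D F.\<Gamma> (T, K, \<nu>)"
    unfolding triple_of_grading_def
  proof (clarsimp, intro conjI ballI impI)
    show "T = grading_support G F.\<Gamma>" using F.support dT by simp
    have KT: "K \<subseteq> T" using subgroup.subset[OF DM.H] by simp
    show "K = {t \<in> T. \<forall>x\<in>F.\<Gamma> t. \<forall>y\<in>F.\<Gamma> \<one>\<^bsub>G\<^esub>. x \<otimes>\<^bsub>D\<^esub> y = y \<otimes>\<^bsub>D\<^esub> x}"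
    proof -
      have "(\<forall>x\<in>F.\<Gamma> u. \<forall>y\<in>F.\<Gamma> \<one>\<^bsub>G\<^esub>. x \<otimes>\<^bsub>D\<^esub> y = y \<otimes>\<^bsub>D\<^esub> x) \<longleftrightarrow> u \<in> K" if "u \<in> T" for u
      proof -
        have "u \<in> ?d ` idx (Suc r)" using that dT by simp
        then obtain S where S: "S \<in> idx (Suc r)" "u = ?d S" by blast
        show ?thesis unfolding S(2) F.commutes_iff[OF S(1)] using DM.d_in_H[OF S(1)] by simp
      qed
      then show ?thesis using KT by blast
    qed
    fix u x assume u: "u \<in> T - K" and x: "x \<in> F.\<Gamma> u" "x \<noteq> 0"
    have "u \<in> ?d ` idx (Suc r)" using u dT by simp
    then obtain S where S: "S \<in> idx (Suc r)" "u = ?d S" by blast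
    have rS: "r \<in> fst S" using DM.d_in_H[OF S(1)] u S(2) by simp
    show "\<exists>q>0. x \<otimes>\<^bsub>D\<^esub> x = (q * real_of_int (\<nu> u)) *\<^sub>R \<one>\<^bsub>D\<^esub>"
      using F.comp_square[OF S(1) rS, of x] x S(2) square[OF S(1) rS] by simp
  qed
  then show ?thesis using F.dim2_division by blast
qed

text \<open>The relation is the kernel of \<open>f\<close> on \<open>X\<close>, so \<open>f\<close>
  is constant on each class and \<open>the_elem\<close> extracts its value.\<close>

lemma bij_quotient:
  fixes f :: "'x \<Rightarrow> 'y"
  assumes R: "R = {(x, x'). x \<in> X \<and> x' \<in> X \<and> f x = f x'}"
  shows "bij_betw (\<lambda>c. the_elem (f ` c)) (X // R) (f ` X)"
    and "x \<in> X \<Longrightarrow> the_elem (f ` (R `` {x})) = f x"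
proof -
  have 1: "the_elem (f ` (R `` {x})) = f x" if "x \<in> X" for x
  proof -
    have "f ` (R `` {x}) = {f x}" using that by (auto simp: R)
    then show ?thesis by simp
  qed
  then show "x \<in> X \<Longrightarrow> the_elem (f ` (R `` {x})) = f x" .
  show "bij_betw (\<lambda>c. the_elem (f ` c)) (X // R) (f ` X)"
    unfolding bij_betw_def
  proof
    show "inj_on (\<lambda>c. the_elem (f ` c)) (X // R)"
    proof (rule inj_onI)
      fix c c' assume "c \<in> X // R" "c' \<in> X // R" and eq: "the_elem (f ` c) = the_elem (f ` c')"
      then obtain x x' where x: "x \<in> X" "x' \<in> X" "c = R `` {x}" "c' = R `` {x'}"
        by (auto simp: quotient_def)
      then have "f x = f x'" using eq 1 by simp
      then show "c = c'" unfolding x(3,4) by (auto simp: R x(1,2))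
    qed
    have "(\<lambda>c. the_elem (f ` c)) ` (X // R) = (\<lambda>x. the_elem (f ` (R `` {x}))) ` X"
      by (auto simp: quotient_def image_iff)
    also have "\<dots> = f ` X" using 1 by (intro image_cong) auto
    finally show "(\<lambda>c. the_elem (f ` c)) ` (X // R) = f ` X" .
  qed
qed

section \<open>Classification over a fixed central algebra\<close>

locale central_algebra_with_family = real_alg D for D :: "'a::real_vector monoid" (structure) +
  fixes G :: "('g, 'e) monoid_scheme" and s r y0
  assumes comm_group: "comm_group G" and central: "central_algebra D"
    and std: "std_family D (real_of_int s) r y0" and s: "s = 1 \<or> s = -1"
begin

lemma dim2_gradingI: "\<Gamma> \<in> dim2_division_gradings G D \<Longrightarrow> dim2_grading D G \<Gamma>"
proof -
  assume "\<Gamma> \<in> dim2_division_gradings G D"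
  moreover have "\<one> \<noteq> 0" using std by (simp add: std_family_def pauli_family_def)
  moreover have "\<exists>B. finite B \<and> carrier D \<subseteq> span B"
    using std unfolding std_family_def by (intro exI[of _ "y0 ` idx (Suc r)"]) simp
  ultimately show ?thesis
    unfolding dim2_grading_def dim2_grading_axioms_def
    using comm_group central real_algI[OF real_algebra] by blast
qed

definition tr :: "('g \<Rightarrow> 'a set) \<Rightarrow> 'g set \<times> 'g set \<times> ('g \<Rightarrow> int)" where
  "tr \<Gamma> = (dim2_grading.T G \<Gamma>, dim2_grading.K D G \<Gamma>, dim2_grading.nu D G \<Gamma>)"

lemma iso_rel_eq: "dim2_iso_rel G D = {(\<Gamma>, \<Gamma>'). \<Gamma> \<in> dim2_division_gradings G D \<and>
    \<Gamma>' \<in> dim2_division_gradings G D \<and> tr \<Gamma> = tr \<Gamma>'}"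
proof -
  have "isomorphic_gradings G D \<Gamma> D \<Gamma>' \<longleftrightarrow> tr \<Gamma> = tr \<Gamma>'"
    if "\<Gamma> \<in> dim2_division_gradings G D" "\<Gamma>' \<in> dim2_division_gradings G D" for \<Gamma> \<Gamma>'
    using isomorphic_same_triple[OF dim2_gradingI[OF that(1)] dim2_gradingI[OF that(2)]]
      same_triple_isomorphic[OF dim2_gradingI[OF that(1)] dim2_gradingI[OF that(2)] _ _ _ std s]
    unfolding tr_def by auto
  then show ?thesis by (auto simp: dim2_iso_rel_def)
qed

lemma tr_image: "tr ` dim2_division_gradings G D = signed_triples s G (2 * r + 1)"
proof (intro equalityI subsetI)
  fix \<tau> assume "\<tau> \<in> tr ` dim2_division_gradings G D"
  then obtain \<Gamma> where \<Gamma>: "\<Gamma> \<in> dim2_division_gradings G D" "\<tau> = tr \<Gamma>" by blast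
  show "\<tau> \<in> signed_triples s G (2 * r + 1)"
    unfolding \<Gamma>(2) tr_def by (rule dim2_grading.signed_triple[OF dim2_gradingI[OF \<Gamma>(1)] std])
next
  fix \<tau> assume \<tau>: "\<tau> \<in> signed_triples s G (2 * r + 1)"
  obtain T K \<nu> where tkn: "\<tau> = (T, K, \<nu>)" by (cases \<tau>)
  obtain \<Gamma> where \<Gamma>: "\<Gamma> \<in> dim2_division_gradings G D" "triple_of_grading G D \<Gamma> (T, K, \<nu>)"
    using grading_of_triple[OF comm_group std s] \<tau> tkn by blast
  have "\<nu> \<in> (T - K) \<rightarrow>\<^sub>E {1, -1}"
    using \<tau> by (simp add: tkn signed_triples_def signed_nice_map_def nice_map_type_I_def nice_map_def)
  then have "\<tau> = tr \<Gamma>"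
    using dim2_grading.triple_unique[OF dim2_gradingI[OF \<Gamma>(1)] \<Gamma>(2)] by (simp add: tkn tr_def)
  then show "\<tau> \<in> tr ` dim2_division_gradings G D" using \<Gamma>(1) by blast
qed

lemma classification:
  "\<exists>\<Phi>. bij_betw \<Phi> (dim2_iso_classes G D) (signed_triples s G (2 * r + 1)) \<and>
     (\<forall>\<Gamma>\<in>dim2_division_gradings G D. triple_of_grading G D \<Gamma> (\<Phi> (dim2_iso_rel G D `` {\<Gamma>})))"
proof (intro exI conjI ballI)
  show "bij_betw (\<lambda>c. the_elem (tr ` c)) (dim2_iso_classes G D) (signed_triples s G (2 * r + 1))"
    using bij_quotient(1)[OF iso_rel_eq] by (simp add: dim2_iso_classes_def tr_image)
  fix \<Gamma> assume \<Gamma>: "\<Gamma> \<in> dim2_division_gradings G D"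
  show "triple_of_grading G D \<Gamma> (the_elem (tr ` (dim2_iso_rel G D `` {\<Gamma>})))"
    unfolding bij_quotient(2)[OF iso_rel_eq \<Gamma>] tr_def by (rule dim2_grading.triple[OF dim2_gradingI[OF \<Gamma>]])
qed

text \<open>Equivalence asks only for a bijection of supports, so it suffices that both degree maps
  have the same fibres. Matching the families index by index then carries components to
  components.\<close>

lemma equivalent_to_family:
  assumes std': "std_family D' (real_of_int s) r y'"
    and comp': "\<And>t. t \<in> carrier G' \<Longrightarrow> \<Gamma>' t = span {y' S |S. S \<in> idx (Suc r) \<and> d' S = t}"
    and supp': "grading_support G' \<Gamma>' = d' ` idx (Suc r)"
    and d'_closed: "\<And>S. S \<in> idx (Suc r) \<Longrightarrow> d' S \<in> carrier G'"
    and d'_inj: "\<And>S S'. S \<in> idx (Suc r) \<Longrightarrow> S' \<in> idx (Suc r) \<Longrightarrow>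
      d' S = d' S' \<longleftrightarrow> fst S = fst S' \<and> snd S - {r} = snd S' - {r}"
    and \<Gamma>: "\<Gamma> \<in> dim2_division_gradings G D"
  shows "equivalent_gradings G D \<Gamma> G' D' \<Gamma>'"
proof -
  interpret A: dim2_grading D G \<Gamma> by (rule dim2_gradingI[OF \<Gamma>])
  have st: "(A.T, A.K, A.nu) \<in> signed_triples s G (2 * r + 1)" by (rule A.signed_triple[OF std])
  then have "signed_nice_map s (G\<lparr>carrier := A.T\<rparr>) A.K A.nu" by (simp add: signed_triples_def)
  from nice_map_normal_form[OF A.elem2_T this s] obtain g r' a b where
    g: "g \<in> A.T - A.K" "A.nu g = s" and sb': "symplectic_basis (G\<lparr>carrier := A.K\<rparr>) (A.mu g) r' a b"
    and ab': "\<forall>i<r'. A.mu g (a i) = 1 \<and> A.mu g (b i) = 1"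
    by (auto simp: A.mu_def)
  have "card A.T = 2 ^ (2 * r + 1)"
    using st iso_Z2_powerD(3)[OF subgroup_comm_group[OF comm_group A.subgroup_T]] by (auto simp: signed_triples_def)
  then have "(2::nat) ^ (2 * r' + 1) = 2 ^ (2 * r + 1)" using A.card_T[OF g(1) sb'] by simp
  then have r': "r' = r" by simp
  note sb = sb'[unfolded r'] and ab = ab'[unfolded r']
  obtain y where y: "std_family D (real_of_int s) r y"
      "\<forall>t\<in>carrier G. \<Gamma> t = span {y S |S. S \<in> idx (Suc r) \<and> deg_map G a b g r S = t}"
    using A.normal_form[OF g sb ab] by blast
  interpret DM: degree_map "G\<lparr>carrier := A.T\<rparr>" A.K r a b g by (rule A.homogeneous_family(1)[OF g(1) sb])
  let ?d = "deg_map G a b g r"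
  have dT: "?d ` idx (Suc r) = A.T" using DM.d_surj by simp
  have dd': "?d S = ?d S' \<longleftrightarrow> d' S = d' S'" if "S \<in> idx (Suc r)" "S' \<in> idx (Suc r)" for S S'
    using DM.d_inj[OF that] d'_inj[OF that] by simp
  obtain f where f: "linear f" "f \<in> alg_isos D D'" "\<And>S. S \<in> idx (Suc r) \<Longrightarrow> f (y S) = y' S"
    using std_family_iso[OF y(1) std'] by blast
  \<comment> \<open>The choice of an index of degree \<open>t\<close> is immaterial, because indices
    with equal degree on one side have equal degree on the other.\<close>
  define \<alpha> where "\<alpha> t = d' (SOME S. S \<in> idx (Suc r) \<and> ?d S = t)" for t
  have \<alpha>d: "\<alpha> (?d S) = d' S" if S: "S \<in> idx (Suc r)" for S
  proof -
    let ?S = "SOME S'. S' \<in> idx (Suc r) \<and> ?d S' = ?d S"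
    have "?S \<in> idx (Suc r) \<and> ?d ?S = ?d S"
      by (rule someI[of "\<lambda>S'. S' \<in> idx (Suc r) \<and> ?d S' = ?d S" S]) (use S in simp)
    then show ?thesis unfolding \<alpha>_def using dd'[OF _ S] by blast
  qed
  have "bij_betw \<alpha> (grading_support G \<Gamma>) (grading_support G' \<Gamma>')"
    unfolding supp' A.T_def[symmetric] dT[symmetric] bij_betw_def
  proof
    show "inj_on \<alpha> (?d ` idx (Suc r))"
    proof (rule inj_onI)
      fix u v assume "u \<in> ?d ` idx (Suc r)" "v \<in> ?d ` idx (Suc r)" and eq: "\<alpha> u = \<alpha> v"
      then obtain S S' where S: "S \<in> idx (Suc r)" "u = ?d S" "S' \<in> idx (Suc r)" "v = ?d S'" by blast
      then show "u = v" using eq dd'[OF S(1,3)] by (simp only: \<alpha>d)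
    qed
    show "\<alpha> ` ?d ` idx (Suc r) = d' ` idx (Suc r)"
      unfolding image_image by (rule image_cong[OF refl]) (rule \<alpha>d)
  qed
  moreover have "f ` \<Gamma> t = \<Gamma>' (\<alpha> t)" if "t \<in> grading_support G \<Gamma>" for t
  proof -
    have tT: "t \<in> A.T" using that by (simp add: A.T_def)
    then have "t \<in> ?d ` idx (Suc r)" using dT by simp
    then obtain S where S: "S \<in> idx (Suc r)" "t = ?d S" by blast
    have "f ` \<Gamma> t = span {y' R |R. R \<in> idx (Suc r) \<and> ?d R = t}"
      unfolding bspec[OF y(2) A.T_carrier[OF tT]] by (rule span_family_image[OF f(1,3)])
    also have "{y' R |R. R \<in> idx (Suc r) \<and> ?d R = t} = {y' R |R. R \<in> idx (Suc r) \<and> d' R = d' S}"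
      using dd'[OF _ S(1)] unfolding S(2) by blast
    also have "span \<dots> = \<Gamma>' (\<alpha> t)"
      unfolding S(2) \<alpha>d[OF S(1)] by (rule comp'[OF d'_closed[OF S(1)], symmetric])
    finally show ?thesis .
  qed
  ultimately show ?thesis using f(2) unfolding equivalent_gradings_def by blast
qed

end

context model_factor
begin

lemma family_grading_model:
  "family_grading (model_algebra Fa j) j ((\<lambda>_. 1)(j := \<epsilon>)) ((\<lambda>_. 1)(j := -1)) (y j) (model_group j) (deg j)"
  unfolding family_grading_def family_grading_axioms_def
  using model_std_family[of j] Z2_group deg_closed deg_add deg_inj
  by (auto simp: std_family_def intro: pauliI)

lemma model_dim2: "model_grading Fa \<Delta> j \<in> dim2_division_gradings (model_group j) (model_algebra Fa j)"
  and model_support: "grading_support (model_group j) (model_grading Fa \<Delta> j) = deg j ` idx (Suc j)"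
proof -
  interpret F: family_grading "model_algebra Fa j" j "(\<lambda>_. 1)(j := \<epsilon>)" "(\<lambda>_. 1)(j := -1)" "y j" "model_group j" "deg j"
    by (rule family_grading_model)
  have eq: "model_grading Fa \<Delta> j t = F.\<Gamma> t" if "t \<in> carrier (model_group j)" for t
    unfolding model_comp[OF that] F.\<Gamma>_def ..
  show "model_grading Fa \<Delta> j \<in> dim2_division_gradings (model_group j) (model_algebra Fa j)"
    by (rule dim2_division_gradings_cong[OF F.dim2_division eq Z2_group])
  show "grading_support (model_group j) (model_grading Fa \<Delta> j) = deg j ` idx (Suc j)"
    using eq unfolding F.support[symmetric] grading_support_def by auto
qed

end

lemma (in central_algebra_with_family) equivalent_to_model:
  assumes "model_factor Fa \<Delta> (real_of_int s) xx ii" "\<Gamma> \<in> dim2_division_gradings G D"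
  shows "equivalent_gradings G D \<Gamma> (model_group r) (model_algebra Fa r) (model_grading Fa \<Delta> r)"
proof -
  interpret M: model_factor Fa \<Delta> "real_of_int s" xx ii by fact
  show ?thesis
    by (rule equivalent_to_family[OF M.model_std_family M.model_comp M.model_support M.deg_closed M.deg_inj assms(2)])
qed

text \<open>The matrix size is arbitrary here. That it is a power of two results from comparing the
  dimension \<open>card B * n^2\<close> with the size \<open>4 ^ Suc r\<close> of a homogeneous
  family.\<close>

lemma matrix_isomorphic:
  fixes B :: "'k::real_algebra_1 set"
  assumes D: "is_real_algebra D" and iso: "alg_isomorphic D (matrix_algebra :: ('k ^ 'n ^ 'n) monoid)"
    and B: "finite B" "independent B" "span B = UNIV"
    and center: "central_algebra (matrix_algebra :: ('k ^ 'n ^ 'n) monoid)"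
    and G: "comm_group G" and \<Gamma>: "\<Gamma> \<in> dim2_division_gradings G D"
  shows "\<exists>r. card B * CARD('n) * CARD('n) = 4 ^ Suc r \<and> subgroup (grading_support G \<Gamma>) G \<and>
    G\<lparr>carrier := grading_support G \<Gamma>\<rparr> \<cong> Z2_power (2 * r + 1)"
proof -
  let ?M = "matrix_algebra :: ('k ^ 'n ^ 'n) monoid"
  interpret D: real_alg D by (rule real_algI[OF D])
  obtain \<phi> where \<phi>: "\<phi> \<in> alg_isos D ?M" using iso by (auto simp: alg_isomorphic_def)
  obtain C :: "('k ^ 'n ^ 'n) set" where C: "finite C" "independent C" "span C = UNIV"
      "card C = card B * CARD('n) * CARD('n)"
    by (rule matrix_basis[OF B])
  have carM: "carrier ?M = span C" by (simp add: C(3) matrix_algebra_simps)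
  obtain f where f: "linear f" "\<And>x. x \<in> carrier ?M \<Longrightarrow> f x = inv_into (carrier D) \<phi> x"
    using alg_isos_linear_extension[OF matrix_real_algebra alg_isos_inv[OF D \<phi>]] by blast
  have "carrier D = inv_into (carrier D) \<phi> ` carrier ?M"
    using alg_isosD(1)[OF alg_isos_inv[OF D \<phi>]] by (simp add: bij_betw_def)
  also have "\<dots> = f ` carrier ?M" using f(2) by (intro image_cong) auto
  also have "\<dots> = span (f ` C)" unfolding carM by (rule linear_span_image[OF f(1), symmetric])
  finally have fin: "\<exists>B. finite B \<and> carrier D \<subseteq> span B" using C(1) by blast
  have one: "\<one>\<^bsub>D\<^esub> \<noteq> 0"
  proof
    assume "\<one>\<^bsub>D\<^esub> = 0"
    then have "(mat 1 :: 'k ^ 'n ^ 'n) = 0"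
      using alg_isos_one[OF D matrix_real_algebra \<phi>] alg_isos_0[OF D \<phi>] by (simp add: matrix_algebra_simps)
    from arg_cong[OF this, of "\<lambda>A. A $ undefined $ undefined"] show False by (simp add: mat_def)
  qed
  interpret A: dim2_grading D G \<Gamma>
    unfolding dim2_grading_def dim2_grading_axioms_def
    using D.real_alg_axioms G \<Gamma> central_algebra_transfer[OF center D matrix_real_algebra \<phi>] one fin by blast
  obtain r \<sigma> \<rho> y where y: "pauli_family D (Suc r) \<sigma> \<rho> y" "carrier D = span (y ` idx (Suc r))"
      "G\<lparr>carrier := A.T\<rparr> \<cong> Z2_power (2 * r + 1)"
    using A.rank_exists by blast
  have "card C = 4 ^ Suc r"
    using pauli_family_transfer[OF y(1,2) matrix_real_algebra \<phi>] pauli_rank_unique[OF _ _ C(1,2) carM] by blast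
  then show ?thesis using y(3) A.subgroup_T C(4) unfolding A.T_def by auto
qed

lemma power4_square: "(n::nat) * n = 4 ^ k \<Longrightarrow> n = 2 ^ k"
  using power2_eq_imp_eq[of n "2 ^ k"] by (simp add: power2_eq_square power_mult_distrib[symmetric])

lemma central_family_matrix:
  fixes M :: "('k::real_algebra_1 ^ 'n ^ 'n) monoid"
  assumes "is_real_algebra D" "comm_group G" "alg_isomorphic D M" "M = matrix_algebra"
    and "central_algebra M" "\<exists>y. std_family M (real_of_int s) r y" "s = 1 \<or> s = -1"
  shows "\<exists>y. central_algebra_with_family D G s r y"
proof -
  have M: "is_real_algebra M" unfolding assms(4) by (rule matrix_real_algebra)
  obtain \<phi> where \<phi>: "\<phi> \<in> alg_isos D M" using assms(3) by (auto simp: alg_isomorphic_def)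
  obtain y where y: "std_family M (real_of_int s) r y" using assms(6) by blast
  have "std_family D (real_of_int s) r (inv_into (carrier D) \<phi> \<circ> y)"
    by (rule std_family_transfer[OF y assms(1) alg_isos_inv[OF assms(1) \<phi>]])
  then show ?thesis
    unfolding central_algebra_with_family_def central_algebra_with_family_axioms_def
    using real_algI[OF assms(1)] assms(2,7) central_algebra_transfer[OF assms(5,1) M \<phi>] by blast
qed

lemma model_isomorphic:
  assumes "model_factor Fa \<Delta> \<epsilon> xx ii" "\<exists>y. std_family M \<epsilon> r y"
  shows "alg_isomorphic (model_algebra Fa r) M"
proof -
  interpret model_factor Fa \<Delta> \<epsilon> xx ii by fact
  obtain y' where y': "std_family M \<epsilon> r y'" using assms(2) by blast
  obtain f where "f \<in> alg_isos (model_algebra Fa r) M" using std_family_iso[OF model_std_family y'] by blast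
  then show ?thesis by (auto simp: alg_isomorphic_def)
qed

theorem theorem22:
  fixes G :: "('g, 'e) monoid_scheme"
    and D :: "'d::real_vector monoid"
  assumes "comm_group G"
    and "is_real_algebra D"
  shows
    "(alg_isomorphic D (matrix_algebra :: (real^'n^'n) monoid) \<longrightarrow>
       (\<forall>\<Gamma> \<in> dim2_division_gradings G D.
          \<exists>m\<ge>1. CARD('n) = 2 ^ m \<and> subgroup (grading_support G \<Gamma>) G \<and>
            G\<lparr>carrier := grading_support G \<Gamma>\<rparr> \<cong> Z2_power (2 * m - 1)) \<and>
       (\<forall>m\<ge>1. CARD('n) = 2 ^ m \<longrightarrow>
          (\<exists>\<Phi>. bij_betw \<Phi> (dim2_iso_classes G D) (positive_triples G (2 * m - 1)) \<and>
             (\<forall>\<Gamma> \<in> dim2_division_gradings G D.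
                triple_of_grading G D \<Gamma> (\<Phi> (dim2_iso_rel G D `` {\<Gamma>})))) \<and>
          alg_isomorphic (model_algebra (matrix_algebra :: (real^2^2) monoid) (m - 1))
            (matrix_algebra :: (real^'n^'n) monoid) \<and>
          model_grading matrix_algebra M2_grading_dim2 (m - 1)
            \<in> dim2_division_gradings (model_group (m - 1)) (model_algebra matrix_algebra (m - 1)) \<and>
          (\<forall>\<Gamma> \<in> dim2_division_gradings G D.
             equivalent_gradings G D \<Gamma> (model_group (m - 1))
               (model_algebra matrix_algebra (m - 1))
               (model_grading matrix_algebra M2_grading_dim2 (m - 1))))) \<and>
     (alg_isomorphic D (matrix_algebra :: (quat^'n^'n) monoid) \<longrightarrow>
       (\<forall>\<Gamma> \<in> dim2_division_gradings G D.
          \<exists>m. CARD('n) = 2 ^ m \<and> subgroup (grading_support G \<Gamma>) G \<and>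
            G\<lparr>carrier := grading_support G \<Gamma>\<rparr> \<cong> Z2_power (2 * m + 1)) \<and>
       (\<forall>m. CARD('n) = 2 ^ m \<longrightarrow>
          (\<exists>\<Phi>. bij_betw \<Phi> (dim2_iso_classes G D) (negative_triples G (2 * m + 1)) \<and>
             (\<forall>\<Gamma> \<in> dim2_division_gradings G D.
                triple_of_grading G D \<Gamma> (\<Phi> (dim2_iso_rel G D `` {\<Gamma>})))) \<and>
          alg_isomorphic (model_algebra quat_algebra m)
            (matrix_algebra :: (quat^'n^'n) monoid) \<and>
          model_grading quat_algebra quat_grading_dim2 m
            \<in> dim2_division_gradings (model_group m) (model_algebra quat_algebra m) \<and>
          (\<forall>\<Gamma> \<in> dim2_division_gradings G D.
             equivalent_gradings G D \<Gamma> (model_group m)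
               (model_algebra quat_algebra m)
               (model_grading quat_algebra quat_grading_dim2 m))))"
proof (intro conjI impI ballI allI)
  assume iso: "alg_isomorphic D (matrix_algebra :: (real^'n^'n) monoid)"
  {
    fix \<Gamma> assume \<Gamma>: "\<Gamma> \<in> dim2_division_gradings G D"
    obtain r where r: "card {1::real} * CARD('n) * CARD('n) = 4 ^ Suc r" "subgroup (grading_support G \<Gamma>) G"
        "G\<lparr>carrier := grading_support G \<Gamma>\<rparr> \<cong> Z2_power (2 * r + 1)"
      using matrix_isomorphic[OF assms(2) iso real_basis central_real_matrix assms(1) \<Gamma>] by blast
    \<comment> \<open>From \<open>n^2 = 4 ^ Suc r\<close>: in the real case
      \<open>m = r + 1\<close>, so the rank \<open>2 * r + 1\<close> of the support is
      \<open>2 * m - 1\<close>, and \<open>m \<ge> 1\<close>.\<close>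
    have "CARD('n) = 2 ^ Suc r" by (rule power4_square) (use r(1) in simp)
    then show "\<exists>m\<ge>1. CARD('n) = 2 ^ m \<and> subgroup (grading_support G \<Gamma>) G \<and>
        G\<lparr>carrier := grading_support G \<Gamma>\<rparr> \<cong> Z2_power (2 * m - 1)"
      using r(2,3) by (intro exI[of _ "Suc r"]) simp
  }
  fix m :: nat assume m: "1 \<le> m" "CARD('n) = 2 ^ m"
  define r where "r = m - 1"
  have mr: "m = Suc r" using m(1) by (simp add: r_def)
  have std: "\<exists>y. std_family (matrix_algebra :: (real^'n^'n) monoid) (real_of_int 1) r y"
    using std_family_real_matrix[of r] m(2) mr by simp
  obtain y where "central_algebra_with_family D G 1 r y"
    using central_family_matrix[OF assms(2,1) iso refl central_real_matrix std] by auto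
  then interpret A: central_algebra_with_family D G 1 r y .
  note mf = model_factor_M2
  interpret M: model_factor "matrix_algebra :: (real^2^2) monoid" M2_grading_dim2 1 "mat2 0 1 1 0" "mat2 0 (-1) 1 0"
    by (rule mf)
  have "2 * m - 1 = 2 * r + 1" by (simp add: mr)
  then show "\<exists>\<Phi>. bij_betw \<Phi> (dim2_iso_classes G D) (positive_triples G (2 * m - 1)) \<and>
      (\<forall>\<Gamma> \<in> dim2_division_gradings G D. triple_of_grading G D \<Gamma> (\<Phi> (dim2_iso_rel G D `` {\<Gamma>})))"
    using A.classification by (simp only: signed_triples_eq)
  show "alg_isomorphic (model_algebra (matrix_algebra :: (real^2^2) monoid) (m - 1))
      (matrix_algebra :: (real^'n^'n) monoid)"
    unfolding r_def[symmetric] by (rule model_isomorphic[OF mf]) (use std in simp)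
  show "model_grading matrix_algebra M2_grading_dim2 (m - 1)
      \<in> dim2_division_gradings (model_group (m - 1)) (model_algebra matrix_algebra (m - 1))"
    by (rule M.model_dim2)
  show "equivalent_gradings G D \<Gamma> (model_group (m - 1)) (model_algebra matrix_algebra (m - 1))
      (model_grading matrix_algebra M2_grading_dim2 (m - 1))" if "\<Gamma> \<in> dim2_division_gradings G D" for \<Gamma>
    unfolding r_def[symmetric] by (rule A.equivalent_to_model[OF _ that]) (use mf in simp)
next
  assume iso: "alg_isomorphic D (matrix_algebra :: (quat^'n^'n) monoid)"
  {
    fix \<Gamma> assume \<Gamma>: "\<Gamma> \<in> dim2_division_gradings G D"
    obtain r where r: "card {Quat 1 0 0 0, Quat 0 1 0 0, Quat 0 0 1 0, Quat 0 0 0 1} * CARD('n) * CARD('n) = 4 ^ Suc r"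
        "subgroup (grading_support G \<Gamma>) G"
        "G\<lparr>carrier := grading_support G \<Gamma>\<rparr> \<cong> Z2_power (2 * r + 1)"
      using matrix_isomorphic[OF assms(2) iso quat_basis(1,3,4) central_quat_matrix assms(1) \<Gamma>] by blast
    \<comment> \<open>The quaternions contribute a factor \<open>4\<close> to the dimension, so
      \<open>4 * n^2 = 4 ^ Suc r\<close> and \<open>m = r\<close> in this case.\<close>
    have "CARD('n) = 2 ^ r" by (rule power4_square) (use r(1) in \<open>simp add: quat_basis(2)\<close>)
    then show "\<exists>m. CARD('n) = 2 ^ m \<and> subgroup (grading_support G \<Gamma>) G \<and>
        G\<lparr>carrier := grading_support G \<Gamma>\<rparr> \<cong> Z2_power (2 * m + 1)"
      using r(2,3) by (intro exI[of _ r]) simp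
  }
  fix m :: nat assume m: "CARD('n) = 2 ^ m"
  have std: "\<exists>y. std_family (matrix_algebra :: (quat^'n^'n) monoid) (real_of_int (-1)) m y"
    using std_family_quat_matrix[OF m] by simp
  obtain y where "central_algebra_with_family D G (-1) m y"
    using central_family_matrix[OF assms(2,1) iso refl central_quat_matrix std] by auto
  then interpret A: central_algebra_with_family D G "-1" m y .
  note mf = model_factor_quat
  interpret M: model_factor quat_algebra quat_grading_dim2 "-1" "Quat 0 0 1 0" "Quat 0 1 0 0"
    by (rule mf)
  show "\<exists>\<Phi>. bij_betw \<Phi> (dim2_iso_classes G D) (negative_triples G (2 * m + 1)) \<and>
      (\<forall>\<Gamma> \<in> dim2_division_gradings G D. triple_of_grading G D \<Gamma> (\<Phi> (dim2_iso_rel G D `` {\<Gamma>})))"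
    using A.classification by (simp only: signed_triples_eq)
  show "alg_isomorphic (model_algebra quat_algebra m) (matrix_algebra :: (quat^'n^'n) monoid)"
    by (rule model_isomorphic[OF mf]) (use std in simp)
  show "model_grading quat_algebra quat_grading_dim2 m
      \<in> dim2_division_gradings (model_group m) (model_algebra quat_algebra m)"
    by (rule M.model_dim2)
  show "equivalent_gradings G D \<Gamma> (model_group m) (model_algebra quat_algebra m)
      (model_grading quat_algebra quat_grading_dim2 m)" if "\<Gamma> \<in> dim2_division_gradings G D" for \<Gamma>
    by (rule A.equivalent_to_model[OF _ that]) (use mf in simp)
qed

end
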